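(* Let $t\ge 2$ be an integer and let $f_t(x)=x^3-t^2x-1$. Let $\lambda_t$ be any root of $f_t(x)$, let $K_t=\mathbb{Q}(\lambda_t)$ and let $F_t$ be the Galois closure of $K_t$ over $\mathbb{Q}$. Then: (i) $f_t$ is irreducible over $\mathbb{Q}$ and has three distinct real roots; (ii) $F_t$ is a totally real Galois extension of $\mathbb{Q}$ with $\mathrm{Gal}(F_t/\mathbb{Q})\cong S_3$; (iii) $\lambda_t$ and $\lambda_t+t$ are multiplicatively independent units in $\mathbb{Z}[\lambda_t]\subseteq\mathcal{O}_{K_t}$; (iv) $\mathrm{Leo}(K_t,p)$ and $\mathrm{Leo}(F_t,p)$ both hold for all prime numbers $p\ne 3$ with $p\mid t$.
   Context: For a number field $E$ and prime $p$, with $S_p(E)$ the places above $p$ and $U^1_{E_w}$ the principal units of the completion $E_w$, the diagonal embedding of units induces $\lambda_{E,p}:\mathbb{Z}_p\otimes_{\mathbb{Z}}\mathcal{O}_E^\times\to\prod_{w\in S_p(E)}U^1_{E_w}$; $\mathrm{Leo}(E,p)$ holds if $\lambda_{E,p}$ is injective. *)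

theory Defs
  imports
    "HOL-Algebra.Algebra"
    "HOL-Algebra.Algebraic_Closure_Type"
    "HOL-Computational_Algebra.Computational_Algebra"
begin

section \<open>Number fields inside the complex numbers\<close>

text \<open>All number fields are subfields of the complex numbers, given by their carrier sets.\<close>

abbreviation complex_ring :: "complex ring" where
  "complex_ring \<equiv> ring_of_type_algebra"

abbreviation subring_of :: "complex set \<Rightarrow> complex ring" where
  "subring_of A \<equiv> complex_ring\<lparr>carrier := A\<rparr>"

definition number_field :: "complex set \<Rightarrow> bool" where
  "number_field E \<longleftrightarrow> subfield E complex_ring \<and> ring.finite_dimension complex_ring \<rat> E"

definition ring_of_integers :: "complex set \<Rightarrow> complex set" where
  "ring_of_integers E = {x \<in> E. algebraic_int x}"

text \<open>
  Finite Galois extensions of the rationals: finite, normal and separable.  A rational polynomial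
  always splits over the complex numbers, so it splits over \<open>E\<close> iff all its complex roots lie in \<open>E\<close>.
\<close>
definition galois_extension :: "complex set \<Rightarrow> bool" where
  "galois_extension E \<longleftrightarrow> number_field E \<and>
     (\<forall>q :: rat poly. Factorial_Ring.irreducible q \<and> (\<exists>x\<in>E. poly (map_poly of_rat q) x = 0) \<longrightarrow>
        rsquarefree (map_poly of_rat q :: complex poly) \<and>
        {x :: complex. poly (map_poly of_rat q) x = 0} \<subseteq> E)"

definition galois_closure :: "complex set \<Rightarrow> complex set" where
  "galois_closure K = galois_extension hull K"

definition galois_group :: "complex set \<Rightarrow> (complex \<Rightarrow> complex) monoid" where
  "galois_group E = BijGroup E
     \<lparr>carrier := {\<sigma> \<in> Bij E. \<sigma> \<in> ring_iso (subring_of E) (subring_of E) \<and> (\<forall>q\<in>\<rat>. \<sigma> q = q)}\<rparr>"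

definition totally_real :: "complex set \<Rightarrow> bool" where
  "totally_real E \<longleftrightarrow> (\<forall>\<sigma> \<in> ring_hom (subring_of E) complex_ring. \<sigma> ` E \<subseteq> \<real>)"

definition multiplicatively_independent :: "complex list \<Rightarrow> bool" where
  "multiplicatively_independent xs \<longleftrightarrow> 0 \<notin> set xs \<and>
     (\<forall>e :: nat \<Rightarrow> int. (\<Prod>i<length xs. xs ! i powi e i) = 1 \<longrightarrow> (\<forall>i<length xs. e i = 0))"


section \<open>Places and completions\<close>

definition absolute_value :: "complex set \<Rightarrow> (complex \<Rightarrow> real) \<Rightarrow> bool" where
  "absolute_value E w \<longleftrightarrow>
     (\<forall>x\<in>E. 0 \<le> w x \<and> (w x = 0 \<longleftrightarrow> x = 0)) \<and>
     (\<forall>x\<in>E. \<forall>y\<in>E. w (x * y) = w x * w y \<and> w (x + y) \<le> w x + w y)"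

definition padic_abs_rat :: "nat \<Rightarrow> rat \<Rightarrow> real" where
  "padic_abs_rat p q = (if q = 0 then 0 else
     let (a, b) = quotient_of q
     in real p powi (int (multiplicity (int p) b) - int (multiplicity (int p) a)))"

definition padic_abs :: "nat \<Rightarrow> complex \<Rightarrow> real" where
  "padic_abs p = (\<lambda>x\<in>\<rat>. padic_abs_rat p (THE q. of_rat q = x))"

text \<open>
  A place of \<open>E\<close> above \<open>p\<close> is an equivalence class of absolute values whose restriction to the
  rationals is equivalent to the \<open>p\<close>-adic one.  Each class has exactly one member that restricts to
  the \<open>p\<close>-adic absolute value itself; it represents the place.  Representatives are
  extensional so that they are determined by their values on \<open>E\<close>.
\<close>
definition places_above :: "nat \<Rightarrow> complex set \<Rightarrow> (complex \<Rightarrow> real) set" where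
  "places_above p E =
     {w \<in> extensional E. absolute_value E w \<and> (\<forall>x\<in>\<rat>. w x = padic_abs p x)}"

definition cauchy_sequences :: "complex set \<Rightarrow> (complex \<Rightarrow> real) \<Rightarrow> (nat \<Rightarrow> complex) set" where
  "cauchy_sequences E w =
     {s. range s \<subseteq> E \<and> (\<forall>e>0. \<exists>N. \<forall>m\<ge>N. \<forall>n\<ge>N. w (s m - s n) < e)}"

definition cauchy_ring :: "complex set \<Rightarrow> (complex \<Rightarrow> real) \<Rightarrow> (nat \<Rightarrow> complex) ring" where
  "cauchy_ring E w =
     \<lparr>carrier = cauchy_sequences E w,
      monoid.mult = (\<lambda>s t n. s n * t n), monoid.one = (\<lambda>_. 1),
      ring.zero = (\<lambda>_. 0), ring.add = (\<lambda>s t n. s n + t n)\<rparr>"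

definition null_sequences :: "complex set \<Rightarrow> (complex \<Rightarrow> real) \<Rightarrow> (nat \<Rightarrow> complex) set" where
  "null_sequences E w = {s \<in> cauchy_sequences E w. (\<lambda>n. w (s n)) \<longlonglongrightarrow> 0}"

definition completion :: "complex set \<Rightarrow> (complex \<Rightarrow> real) \<Rightarrow> (nat \<Rightarrow> complex) set ring" where
  "completion E w = cauchy_ring E w Quot null_sequences E w"

definition to_completion ::
    "complex set \<Rightarrow> (complex \<Rightarrow> real) \<Rightarrow> complex \<Rightarrow> (nat \<Rightarrow> complex) set" where
  "to_completion E w x = null_sequences E w +>\<^bsub>cauchy_ring E w\<^esub> (\<lambda>_. x)"

definition completion_abs ::
    "complex set \<Rightarrow> (complex \<Rightarrow> real) \<Rightarrow> (nat \<Rightarrow> complex) set \<Rightarrow> real" where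
  "completion_abs E w A = (THE r. \<forall>s\<in>A. (\<lambda>n. w (s n)) \<longlonglongrightarrow> r)"

definition completion_tendsto ::
    "complex set \<Rightarrow> (complex \<Rightarrow> real) \<Rightarrow> (nat \<Rightarrow> (nat \<Rightarrow> complex) set) \<Rightarrow>
     (nat \<Rightarrow> complex) set \<Rightarrow> bool" where
  "completion_tendsto E w x L \<longleftrightarrow>
     (\<lambda>n. completion_abs E w (x n \<ominus>\<^bsub>completion E w\<^esub> L)) \<longlonglongrightarrow> 0"

definition padic_integers :: "nat \<Rightarrow> (nat \<Rightarrow> complex) set ring" where
  "padic_integers p = (completion \<rat> (padic_abs p))
     \<lparr>carrier := {a \<in> carrier (completion \<rat> (padic_abs p)).
                   completion_abs \<rat> (padic_abs p) a \<le> 1}\<rparr>"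

definition principal_units ::
    "complex set \<Rightarrow> (complex \<Rightarrow> real) \<Rightarrow> (nat \<Rightarrow> complex) set monoid" where
  "principal_units E w = (units_of (completion E w))
     \<lparr>carrier := {x \<in> carrier (completion E w).
        completion_abs E w (x \<ominus>\<^bsub>completion E w\<^esub> \<one>\<^bsub>completion E w\<^esub>) < 1}\<rparr>"

text \<open>
  The units of the valuation ring of \<open>E\<^sub>w\<close> are the direct product of the (finite) group of roots of
  unity of order prime to \<open>p\<close> and the group of principal units.  This is the projection to the
  second factor.
\<close>
definition principal_part ::
    "nat \<Rightarrow> complex set \<Rightarrow> (complex \<Rightarrow> real) \<Rightarrow> (nat \<Rightarrow> complex) set \<Rightarrow> (nat \<Rightarrow> complex) set" where
  "principal_part p E w x = (THE y. y \<in> carrier (principal_units E w) \<and>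
     (\<exists>z \<in> carrier (completion E w). \<exists>n::nat. n > 0 \<and> coprime n p \<and>
        z [^]\<^bsub>completion E w\<^esub> n = \<one>\<^bsub>completion E w\<^esub> \<and> x = z \<otimes>\<^bsub>completion E w\<^esub> y))"

text \<open>
  The \<open>p\<close>-adic integer power of a principal unit, extending integer powers by continuity.
\<close>
definition padic_pow ::
    "nat \<Rightarrow> complex set \<Rightarrow> (complex \<Rightarrow> real) \<Rightarrow> (nat \<Rightarrow> complex) set \<Rightarrow> (nat \<Rightarrow> complex) set \<Rightarrow>
     (nat \<Rightarrow> complex) set" where
  "padic_pow p E w y a = (THE z. z \<in> carrier (principal_units E w) \<and>
     (\<forall>k :: nat \<Rightarrow> int.
        completion_tendsto \<rat> (padic_abs p) (\<lambda>n. to_completion \<rat> (padic_abs p) (of_int (k n))) a \<longrightarrow>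
        completion_tendsto E w (\<lambda>n. y [^]\<^bsub>principal_units E w\<^esub> k n) z))"


section \<open>Tensor products of abelian groups\<close>

text \<open>
  Both groups are written multiplicatively; the tensor product is the quotient of the free abelian
  group on pairs by the subgroup generated by the bilinearity relations.
\<close>
definition tensor_relations ::
    "('a, 'm) monoid_scheme \<Rightarrow> ('b, 'n) monoid_scheme \<Rightarrow> ('a \<times> 'b \<Rightarrow>\<^sub>0 int) set" where
  "tensor_relations A B = generate (free_Abelian_group (carrier A \<times> carrier B))
     ({frag_of (a \<otimes>\<^bsub>A\<^esub> a', b) - frag_of (a, b) - frag_of (a', b) | a a' b.
         a \<in> carrier A \<and> a' \<in> carrier A \<and> b \<in> carrier B} \<union>
      {frag_of (a, b \<otimes>\<^bsub>B\<^esub> b') - frag_of (a, b) - frag_of (a, b') | a b b'.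
         a \<in> carrier A \<and> b \<in> carrier B \<and> b' \<in> carrier B})"

definition tensor_product ::
    "('a, 'm) monoid_scheme \<Rightarrow> ('b, 'n) monoid_scheme \<Rightarrow> ('a \<times> 'b \<Rightarrow>\<^sub>0 int) set monoid" where
  "tensor_product A B =
     free_Abelian_group (carrier A \<times> carrier B) Mod tensor_relations A B"

definition pure_tensor ::
    "('a, 'm) monoid_scheme \<Rightarrow> ('b, 'n) monoid_scheme \<Rightarrow> 'a \<Rightarrow> 'b \<Rightarrow> ('a \<times> 'b \<Rightarrow>\<^sub>0 int) set" where
  "pure_tensor A B a b =
     tensor_relations A B #>\<^bsub>free_Abelian_group (carrier A \<times> carrier B)\<^esub> frag_of (a, b)"

text \<open>The homomorphism that a bilinear map \<open>f\<close> induces on the tensor product.\<close>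
definition tensor_lift ::
    "('a, 'm) monoid_scheme \<Rightarrow> ('b, 'n) monoid_scheme \<Rightarrow> ('c, 'k) monoid_scheme \<Rightarrow>
     ('a \<Rightarrow> 'b \<Rightarrow> 'c) \<Rightarrow> ('a \<times> 'b \<Rightarrow>\<^sub>0 int) set \<Rightarrow> 'c" where
  "tensor_lift A B G f = (THE h.
     h \<in> hom (tensor_product A B) G \<and> h \<in> extensional (carrier (tensor_product A B)) \<and>
     (\<forall>a\<in>carrier A. \<forall>b\<in>carrier B. h (pure_tensor A B a b) = f a b))"


section \<open>The Leopoldt condition\<close>

abbreviation unit_group :: "complex set \<Rightarrow> complex monoid" where
  "unit_group E \<equiv> units_of (subring_of (ring_of_integers E))"

definition leopoldt_map ::
    "complex set \<Rightarrow> nat \<Rightarrow> ((nat \<Rightarrow> complex) set \<times> complex \<Rightarrow>\<^sub>0 int) set \<Rightarrow>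
     (complex \<Rightarrow> real) \<Rightarrow> (nat \<Rightarrow> complex) set" where
  "leopoldt_map E p =
     tensor_lift (add_monoid (padic_integers p)) (unit_group E)
       (product_group (places_above p E) (\<lambda>w. principal_units E w))
       (\<lambda>a u. \<lambda>w\<in>places_above p E. padic_pow p E w (principal_part p E w (to_completion E w u)) a)"

definition Leo :: "complex set \<Rightarrow> nat \<Rightarrow> bool" where
  "Leo E p \<longleftrightarrow> inj_on (leopoldt_map E p)
     (carrier (tensor_product (add_monoid (padic_integers p)) (unit_group E)))"


section \<open>The cubic family\<close>

definition cubic :: "int \<Rightarrow> 'a :: comm_ring_1 poly" where
  "cubic t = [:-1, - (of_int t)\<^sup>2, 0, 1:]"

end

theory Submission
  imports Defs "HOL-Number_Theory.Residues"
begin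

text \<open>
  Proof idea. A place \<open>w\<close> of \<open>F\<close> above \<open>p\<close> satisfies \<open>w(l\<^sub>i) = 1\<close> and, as \<open>p\<close> divides \<open>t\<close> but not the
  discriminant \<open>4 t\<^sup>6 - 27\<close>, also \<open>w(l\<^sub>i - l\<^sub>j) = 1\<close> for the roots \<open>l\<^sub>i\<close> of the cubic.  Sixth powers
  of \<open>l\<^sub>i\<close> and \<open>l\<^sub>i + t\<close> lie in the disc where \<open>(1 + x)\<^sup>m - 1\<close> is \<open>m x\<close> up to a smaller error, with linear
  terms proportional to \<open>t\<^sup>2 l\<^sub>i\<close> and \<open>t / l\<^sub>i\<close>; comparing two roots shows that a \<open>p\<close>-adic relation between
  \<open>l\<^sub>i\<close> and \<open>l\<^sub>i + t\<close> is trivial.  A Dirichlet pigeonhole argument bounds the unit rank of \<open>K\<close> by two, so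
  these two units generate a subgroup of finite index, which settles \<open>K\<close>.  For \<open>F\<close>, with \<open>\<rho>\<close> of order three
  and \<open>\<tau>\<close> of order two in the Galois group, the \<open>\<tau>\<close>-fixed elements \<open>\<sigma>(v) \<tau>(\<sigma>(v))\<close> for \<open>\<sigma>\<close> a power of \<open>\<rho>\<close>
  and the norm of \<open>v\<close> to the quadratic subfield, whose unit rank is at most one, determine \<open>v\<^sup>6\<close>.  Places
  above \<open>p\<close> are obtained from a maximal subring not containing \<open>1/p\<close>.
\<close>

section \<open>Subfields of the complex numbers and their absolute values\<close>

text \<open>The exponent six has two sources. A root z satisfies z^3 = 1 + t^2 z, while (z + t)^2 is
  1/z times an element near 1; cubing the latter and using the former makes sixth powers of both
  units products of elements near 1. In F, the product of the fixed elements is x^3 times the norm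
  of x, and squaring removes signs. The prime 3 is excluded since the discriminant is -27 modulo p.
  The prime 2 is allowed and needs extra care: there -1 is a principal unit, so torsion is visible
  p-adically, and the disc in which the linear term dominates has radius 1/4. Neither finite
  generation of the units nor their exact rank enters. A tensor is written with units independent
  over Z, upper bounds on ranks give integer relation matrices, and independence over Z survives
  over Z_p by fraction-free elimination. The decomposition of p is never computed: one place w of F,
  composed with automorphisms and restricted, supplies all the places needed. P-adic integers occur
  as integer sequences, so the arguments are about ordinary powers u^(k n) and limits of their
  values.\<close>

lemma complex_ring_simps [simp]:
  "carrier complex_ring = UNIV" "x \<otimes>\<^bsub>complex_ring\<^esub> y = x * y" "\<one>\<^bsub>complex_ring\<^esub> = 1"
  "\<zero>\<^bsub>complex_ring\<^esub> = 0" "x \<oplus>\<^bsub>complex_ring\<^esub> y = x + y"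
  by (simp_all add: ring_of_type_algebra_def)

lemma field_complex_ring: "field complex_ring"
  by (rule field_from_type_algebra)

lemma complex_ring_minus [simp]: "\<ominus>\<^bsub>complex_ring\<^esub> x = - x"
proof -
  interpret field complex_ring by (rule field_complex_ring)
  show ?thesis by (metis (no_types) UNIV_I add.right_inverse complex_ring_simps(1,4,5) minus_equality add.commute)
qed

lemma complex_ring_inv [simp]: "x \<noteq> 0 \<Longrightarrow> inv\<^bsub>complex_ring\<^esub> x = inverse x"
proof -
  interpret field complex_ring by (rule field_complex_ring)
  assume "x \<noteq> 0"
  then show ?thesis by (intro comm_inv_char) (auto)
qed

text \<open>Since \<open>inverse 0 = 0\<close>, closure under inverses can be demanded of all
  elements, zero included.\<close>

lemma subfield_complex_iff:
  "subfield E complex_ring \<longleftrightarrow>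
     1 \<in> E \<and> (\<forall>x\<in>E. \<forall>y\<in>E. x - y \<in> E \<and> x * y \<in> E) \<and> (\<forall>x\<in>E. inverse x \<in> E)"
proof -
  interpret field complex_ring by (rule field_complex_ring)
  show ?thesis
  proof
    assume s: "subfield E complex_ring"
    note sr = subringE[OF subfieldE(1)[OF s]]
    have "x - y \<in> E" if "x \<in> E" "y \<in> E" for x y
      using sr(7)[OF that(1) sr(5)[OF that(2)]] by simp
    moreover have "inverse x \<in> E" if "x \<in> E" for x
      using subfield_m_inv(1)[OF s, of x] sr(2) that by (cases "x = 0") auto
    ultimately show "1 \<in> E \<and> (\<forall>x\<in>E. \<forall>y\<in>E. x - y \<in> E \<and> x * y \<in> E) \<and> (\<forall>x\<in>E. inverse x \<in> E)"
      using sr by auto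
  next
    assume h: "1 \<in> E \<and> (\<forall>x\<in>E. \<forall>y\<in>E. x - y \<in> E \<and> x * y \<in> E) \<and> (\<forall>x\<in>E. inverse x \<in> E)"
    have z: "0 \<in> E" using h by (metis diff_self)
    have m: "- x \<in> E" if "x \<in> E" for x using h z that by (metis diff_0)
    have a: "x + y \<in> E" if "x \<in> E" "y \<in> E" for x y using h m that by (metis diff_minus_eq_add)
    show "subfield E complex_ring"
      by (rule subfieldI', rule subringI) (use h z m a in auto)
  qed
qed

locale complex_subfield =
  fixes E :: "complex set"
  assumes subfield: "subfield E complex_ring"
begin

lemma one_mem [simp]: "1 \<in> E" and diff_mem: "x \<in> E \<Longrightarrow> y \<in> E \<Longrightarrow> x - y \<in> E"
  and mult_mem: "x \<in> E \<Longrightarrow> y \<in> E \<Longrightarrow> x * y \<in> E" and inverse_mem: "x \<in> E \<Longrightarrow> inverse x \<in> E"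
  using subfield unfolding subfield_complex_iff by auto

lemma zero_mem [simp]: "0 \<in> E" using diff_mem[OF one_mem one_mem] by simp
lemma minus_mem: "x \<in> E \<Longrightarrow> - x \<in> E" using diff_mem[OF zero_mem] by simp
lemma add_mem: "x \<in> E \<Longrightarrow> y \<in> E \<Longrightarrow> x + y \<in> E" using diff_mem[OF _ minus_mem, of x y] by simp
lemma divide_mem: "x \<in> E \<Longrightarrow> y \<in> E \<Longrightarrow> x / y \<in> E"
  by (simp add: divide_inverse mult_mem inverse_mem)
lemma power_mem: "x \<in> E \<Longrightarrow> x ^ n \<in> E" by (induction n) (auto intro: mult_mem)
lemma powi_mem: "x \<in> E \<Longrightarrow> x powi n \<in> E"
  by (auto simp: power_int_def intro: power_mem inverse_mem)
lemma of_nat_mem [simp]: "of_nat n \<in> E" by (induction n) (auto intro: add_mem)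
lemma of_int_mem [simp]: "of_int n \<in> E" by (cases n rule: int_cases2) (auto intro: minus_mem)
lemma numeral_mem [simp]: "numeral n \<in> E" using of_nat_mem[of "numeral n"] by simp
lemma of_rat_mem [simp]: "of_rat q \<in> E"
  by (cases q) (auto simp: of_rat_rat intro!: divide_mem)
lemma Rats_subset: "\<rat> \<subseteq> E" by (auto elim!: Rats_cases)
lemma sum_mem: "(\<And>i. i \<in> I \<Longrightarrow> f i \<in> E) \<Longrightarrow> sum f I \<in> E"
  by (induction I rule: infinite_finite_induct) (auto intro: add_mem)
lemma prod_mem: "(\<And>i. i \<in> I \<Longrightarrow> f i \<in> E) \<Longrightarrow> prod f I \<in> E"
  by (induction I rule: infinite_finite_induct) (auto intro: mult_mem)

lemmas mem_intros = diff_mem mult_mem inverse_mem minus_mem add_mem divide_mem power_mem powi_mem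

end

lemma complex_subfield_Rats: "complex_subfield \<rat>"
  by (rule complex_subfield.intro) (auto simp: subfield_complex_iff)

text \<open>The ultrametric inequality is an assumption here, proved for every place in
  \<open>places_above_valued_field\<close>; \<open>absolute_value\<close> only contains the triangle
  inequality. Normalising the value of p makes integers have the same value at all places above
  p.\<close>

locale valued_field = complex_subfield +
  fixes w :: "complex \<Rightarrow> real" and p :: nat
  assumes abs_value: "absolute_value E w"
    and ultrametric: "x \<in> E \<Longrightarrow> y \<in> E \<Longrightarrow> w (x + y) \<le> max (w x) (w y)"
    and prime_p: "Factorial_Ring.prime p"
    and abs_p: "w (of_nat p) = 1 / real p"
begin

lemma abs_nonneg [simp]: "x \<in> E \<Longrightarrow> 0 \<le> w x"
  and abs_eq_0: "x \<in> E \<Longrightarrow> w x = 0 \<longleftrightarrow> x = 0"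
  and abs_mult: "x \<in> E \<Longrightarrow> y \<in> E \<Longrightarrow> w (x * y) = w x * w y"
  using abs_value unfolding absolute_value_def by auto

lemma abs_0 [simp]: "w 0 = 0" by (simp add: abs_eq_0)
lemma abs_1 [simp]: "w 1 = 1" using abs_mult[of 1 1] abs_eq_0[of 1] by auto
lemma abs_minus: "x \<in> E \<Longrightarrow> w (- x) = w x"
proof -
  assume x: "x \<in> E"
  have "w (-1) * w (-1) = 1" using abs_mult[of "-1" "-1"] minus_mem[OF one_mem] by simp
  then have "w (-1) = 1" using abs_nonneg[OF minus_mem[OF one_mem]]
    by (metis abs_of_nonneg real_sqrt_abs2 real_sqrt_one)
  then show ?thesis using abs_mult[of "-1" x] minus_mem[OF one_mem] x by simp
qed
lemma abs_commute: "x \<in> E \<Longrightarrow> y \<in> E \<Longrightarrow> w (x - y) = w (y - x)"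
  using abs_minus[OF diff_mem, of x y] by simp
lemma abs_diff_le: "x \<in> E \<Longrightarrow> y \<in> E \<Longrightarrow> w (x - y) \<le> max (w x) (w y)"
  using ultrametric[OF _ minus_mem, of x y] abs_minus[of y] by simp
lemma abs_triangle: "x \<in> E \<Longrightarrow> y \<in> E \<Longrightarrow> z \<in> E \<Longrightarrow> w (x - z) \<le> max (w (x - y)) (w (y - z))"
  using ultrametric[OF diff_mem diff_mem, of x y y z] by simp
lemma abs_le_diff: "x \<in> E \<Longrightarrow> y \<in> E \<Longrightarrow> \<bar>w x - w y\<bar> \<le> w (x - y)"
proof -
  assume x: "x \<in> E" "y \<in> E"
  have "w x \<le> w (x - y) + w y"
    using ultrametric[OF diff_mem[OF x] x(2)] abs_nonneg[OF diff_mem[OF x]] abs_nonneg[OF x(2)] by simp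
  moreover have "w y \<le> w (x - y) + w x"
    using ultrametric[OF diff_mem[OF x(2,1)] x(1)] abs_nonneg[OF diff_mem[OF x]] abs_nonneg[OF x(1)]
      abs_commute[OF x] by simp
  ultimately show ?thesis by simp
qed
text \<open>Isosceles principle of ultrametrics: a perturbation smaller than y cannot change the
  size of y. It is the standard way to compute values below.\<close>

lemma abs_eqI: "x \<in> E \<Longrightarrow> y \<in> E \<Longrightarrow> w (x - y) < w y \<Longrightarrow> w x = w y"
  using ultrametric[of "x - y" y] abs_diff_le[of x "x - y"] diff_mem[of x y] abs_commute[of x y]
  by (fastforce simp: max_def split: if_splits)
lemma abs_inverse: "x \<in> E \<Longrightarrow> w (inverse x) = inverse (w x)"
proof (cases "x = 0")
  case False
  assume x: "x \<in> E"
  have "w x * w (inverse x) = 1"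
    using abs_mult[of x "inverse x"] inverse_mem[OF x] x False by simp
  then show ?thesis by (metis inverse_unique)
qed auto
lemma abs_divide: "x \<in> E \<Longrightarrow> y \<in> E \<Longrightarrow> w (x / y) = w x / w y"
  by (simp add: divide_inverse abs_mult abs_inverse inverse_mem)
lemma abs_power: "x \<in> E \<Longrightarrow> w (x ^ n) = w x ^ n"
  by (induction n) (auto simp: abs_mult power_mem)
lemma abs_powi: "x \<in> E \<Longrightarrow> w (x powi n) = w x powi n"
  by (auto simp: power_int_def abs_power power_mem inverse_mem abs_inverse)
lemma abs_prod: "(\<And>i. i \<in> I \<Longrightarrow> f i \<in> E) \<Longrightarrow> w (prod f I) = (\<Prod>i\<in>I. w (f i))"
  by (induction I rule: infinite_finite_induct) (auto simp: abs_mult prod_mem)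
lemma abs_sum_le: "(\<And>i. i \<in> I \<Longrightarrow> f i \<in> E \<and> w (f i) \<le> B) \<Longrightarrow> 0 \<le> B \<Longrightarrow> w (sum f I) \<le> B"
proof (induction I rule: infinite_finite_induct)
  case (insert x A)
  have "w (f x + sum f A) \<le> max (w (f x)) (w (sum f A))"
    by (rule ultrametric) (use insert in \<open>auto intro: sum_mem\<close>)
  also have "\<dots> \<le> B" using insert by auto
  finally show ?case using insert by simp
qed auto

lemma abs_of_nat_le_1: "w (of_nat n) \<le> 1"
proof (induction n)
  case (Suc n)
  have "w (of_nat n + 1) \<le> max (w (of_nat n)) (w 1)" by (rule ultrametric) auto
  with Suc show ?case by (simp add: add.commute)
qed auto
lemma abs_of_int_le_1: "w (of_int n) \<le> 1"
  by (cases n rule: int_cases2) (auto simp: abs_of_nat_le_1 abs_minus)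

lemma p_gt_1: "p > 1" using prime_p prime_gt_1_nat by blast

text \<open>If p did not divide n, a Bezout identity a p + b n = 1 would write 1 as a sum of two
  elements of value below 1.\<close>

lemma abs_of_int_less_1_iff: "w (of_int n) < 1 \<longleftrightarrow> int p dvd n"
proof
  assume "int p dvd n"
  then obtain k where "n = int p * k" by blast
  then have "w (of_int n) = 1 / real p * w (of_int k)" by (simp add: abs_mult abs_p)
  also have "\<dots> \<le> 1 / real p" using abs_of_int_le_1[of k] by (simp add: field_simps divide_right_mono)
  also have "\<dots> < 1" using p_gt_1 by simp
  finally show "w (of_int n) < 1" .
next
  assume l: "w (of_int n) < 1"
  show "int p dvd n"
  proof (rule ccontr)
    assume "\<not> int p dvd n"
    then have "coprime (int p) n"
      using prime_p by (metis prime_imp_coprime prime_nat_int_transfer)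
    then obtain a b where ab: "a * int p + b * n = 1"
      by (metis bezout_int coprime_iff_gcd_eq_1)
    have "w (of_int (a * int p) + of_int (b * n)) \<le> max (w (of_int (a * int p))) (w (of_int (b * n)))"
      by (rule ultrametric) (rule of_int_mem)+
    moreover have "w (of_int (b * n)) < 1"
      using mult_right_mono[OF abs_of_int_le_1[of b], of "w (of_int n)"] l by (simp add: abs_mult)
    moreover have "w (of_int (a * int p)) \<le> 1 / real p"
      using abs_of_int_le_1[of a] p_gt_1 by (simp add: abs_mult abs_p field_simps)
    moreover have "of_int (a * int p) + of_int (b * n) = (1 :: complex)"
      using ab by (metis of_int_1 of_int_add)
    moreover have "1 / real p < 1" using p_gt_1 by simp
    ultimately show False by simp
  qed
qed

lemma abs_of_int_coprime: "coprime n (int p) \<Longrightarrow> w (of_int n) = 1"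
proof -
  assume "coprime n (int p)"
  then have "\<not> int p dvd n"
    using prime_p by (metis coprime_common_divisor dvd_refl not_prime_unit prime_nat_int_transfer)
  then show ?thesis using abs_of_int_less_1_iff abs_of_int_le_1[of n] by force
qed
lemma abs_of_nat_coprime: "coprime n p \<Longrightarrow> w (of_nat n) = 1"
  using abs_of_int_coprime[of "int n"] by simp

end

section \<open>Completions\<close>

text \<open>Integers have value at most 1, so the binomial expansion bounds w(x + y)^n by (n + 1)
  max(w x, w y)^n. A linear factor cannot compensate exponential growth, and the ultrametric
  inequality follows.\<close>

lemma places_above_valued_field:
  assumes p: "Factorial_Ring.prime p" and E: "complex_subfield E" and w: "w \<in> places_above p E"
  shows "valued_field E w p"
proof -
  interpret complex_subfield E by fact
  have av: "absolute_value E w" and wr: "\<And>x. x \<in> \<rat> \<Longrightarrow> w x = padic_abs p x"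
    using w by (auto simp: places_above_def)
  have nn: "\<And>x. x \<in> E \<Longrightarrow> 0 \<le> w x" and mult: "\<And>x y. x \<in> E \<Longrightarrow> y \<in> E \<Longrightarrow> w (x * y) = w x * w y"
    and tri: "\<And>x y. x \<in> E \<Longrightarrow> y \<in> E \<Longrightarrow> w (x + y) \<le> w x + w y"
    and z: "\<And>x. x \<in> E \<Longrightarrow> w x = 0 \<longleftrightarrow> x = 0"
    using av unfolding absolute_value_def by auto
  have the: "(THE q. of_rat q = (of_rat r :: complex)) = r" for r by (rule the_equality) auto
  have w_int: "w (of_int n) = padic_abs_rat p (of_int n)" for n
    using wr[of "of_int n"] the[of "of_int n"] by (simp add: padic_abs_def)
  have w_nat_le: "w (of_nat n) \<le> 1" for n
  proof (cases "n = 0")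
    case False
    have "padic_abs_rat p (of_int (int n)) = real p powi (- int (multiplicity (int p) (int n)))"
      using False by (simp add: padic_abs_rat_def quotient_of_int del: of_int_of_nat_eq)
    also have "\<dots> \<le> 1"
      using prime_gt_1_nat[OF p] by (simp add: power_int_minus inverse_le_1_iff)
    finally show ?thesis using w_int[of "int n"] by simp
  qed (use z[of 0] in simp)
  have w1: "w 1 = 1" using mult[of 1 1] z[of 1] by auto
  have wpow: "w (x ^ n) = w x ^ n" if "x \<in> E" for x n
    by (induction n) (auto simp: w1 mult power_mem that)
  have pow_bound: "w (x + y) ^ n \<le> (real n + 1) * max (w x) (w y) ^ n" if xy: "x \<in> E" "y \<in> E" for x y n
  proof -
    have wsum: "w (sum f I) \<le> (\<Sum>i\<in>I. w (f i))" if "finite I" "\<And>i. i \<in> I \<Longrightarrow> f i \<in> E" for f and I :: "nat set"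
      using that
    proof (induction I rule: finite_induct)
      case (insert i I)
      then show ?case using tri[of "f i" "sum f I"] by (simp add: sum_mem order_trans)
    qed (use z[of 0] in simp)
    have "w ((x + y) ^ n) = w (\<Sum>k\<le>n. of_nat (n choose k) * x ^ k * y ^ (n - k))"
      by (simp add: binomial_ring)
    also have "\<dots> \<le> (\<Sum>k\<le>n. w (of_nat (n choose k) * x ^ k * y ^ (n - k)))"
      by (rule wsum) (auto intro!: mem_intros xy)
    also have "\<dots> \<le> (\<Sum>k\<le>n. max (w x) (w y) ^ n)"
    proof (rule sum_mono)
      fix k assume k: "k \<in> {..n}"
      have "w (of_nat (n choose k) * x ^ k * y ^ (n - k)) = w (of_nat (n choose k)) * (w x ^ k * w y ^ (n - k))"
        by (simp add: mult wpow xy power_mem mult_mem)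
      also have "\<dots> \<le> 1 * (max (w x) (w y) ^ k * max (w x) (w y) ^ (n - k))"
        by (intro mult_mono power_mono w_nat_le) (auto simp: nn xy le_max_iff_disj)
      also have "\<dots> = max (w x) (w y) ^ n" using k by (simp flip: power_add)
      finally show "w (of_nat (n choose k) * x ^ k * y ^ (n - k)) \<le> max (w x) (w y) ^ n" .
    qed
    also have "\<dots> = (real n + 1) * max (w x) (w y) ^ n" by simp
    finally show ?thesis by (simp add: wpow add_mem xy)
  qed
  have ultra: "w (x + y) \<le> max (w x) (w y)" if xy: "x \<in> E" "y \<in> E" for x y
  proof (rule ccontr)
    define m where "m = max (w x) (w y)"
    assume "\<not> w (x + y) \<le> max (w x) (w y)"
    then have less: "m < w (x + y)" unfolding m_def by linarith
    have m0: "m \<ge> 0" using nn xy by (simp add: m_def le_max_iff_disj)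
    show False
    proof (cases "m = 0")
      case True
      then show ?thesis using pow_bound[OF xy, of 1] less by (simp add: m_def)
    next
      case False
      then have mpos: "m > 0" using m0 by simp
      define r where "r = w (x + y) / m"
      have r: "r > 1" using less mpos by (simp add: r_def)
      have b: "r ^ n \<le> real n + 1" for n
        using pow_bound[OF xy, of n] mpos by (simp add: r_def power_divide field_simps m_def)
      define e where "e = r - 1"
      have e: "e > 0" "r = 1 + e" using r by (auto simp: e_def)
      have bern: "1 + real n * e \<le> r ^ n" for n
        using Bernoulli_inequality[of e n] e by simp
      \<comment> \<open>Squaring Bernoulli's bound gives (1 + N e)^2 <= r^(2N) <= 2N + 1, hence N
        e^2 <= 2; an n with n e^2 > 3 contradicts this.\<close>
      obtain n :: nat where n: "real n * e\<^sup>2 > 3" 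
        using reals_Archimedean3[of "e\<^sup>2"] e by auto
      define N where "N = n + 1"
      have "(1 + real N * e)\<^sup>2 \<le> (r ^ N)\<^sup>2"
        by (rule power_mono[OF bern]) (use e in auto)
      also have "\<dots> = r ^ (2 * N)" by (simp add: power_even_eq)
      also have "\<dots> \<le> 2 * real N + 1" using b[of "2 * N"] by simp
      finally have "(real N * e)\<^sup>2 + 2 * (real N * e) \<le> 2 * real N" by (simp add: power2_eq_square algebra_simps)
      moreover have "real N * e \<ge> 0" using e by simp
      ultimately have "(real N * e)\<^sup>2 \<le> 2 * real N" by linarith
      then have "real N * (real N * e\<^sup>2) \<le> real N * 2" by (simp add: power2_eq_square mult_ac)
      then have "real N * e\<^sup>2 \<le> 2" by (subst (asm) mult_le_cancel_left_pos) (simp_all add: N_def)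
      moreover have "real N * e\<^sup>2 \<ge> real n * e\<^sup>2" by (intro mult_right_mono) (auto simp: N_def)
      ultimately show False using n by simp
    qed
  qed
  have "padic_abs_rat p (of_int (int p)) = real p powi (- int (multiplicity (int p) (int p)))"
    using prime_gt_0_nat[OF p] by (simp add: padic_abs_rat_def quotient_of_int del: of_int_of_nat_eq)
  also have "multiplicity (int p) (int p) = 1"
    using prime_gt_1_nat[OF p] by (intro multiplicity_self) auto
  finally have "w (of_nat p) = 1 / real p" using w_int[of "int p"] by (simp add: power_int_minus divide_inverse)
  then show ?thesis using av ultra p by unfold_locales auto
qed

section \<open>Completions as Cauchy sequences modulo null sequences\<close>

context valued_field
begin

abbreviation "Cau \<equiv> cauchy_sequences E w"
abbreviation "Nul \<equiv> null_sequences E w"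
abbreviation "CR \<equiv> cauchy_ring E w"
abbreviation "Ew \<equiv> completion E w"

lemma cauchy_ring_simps [simp]:
  "carrier CR = Cau" "s \<otimes>\<^bsub>CR\<^esub> t = (\<lambda>n. s n * t n)" "\<one>\<^bsub>CR\<^esub> = (\<lambda>_. 1)"
  "\<zero>\<^bsub>CR\<^esub> = (\<lambda>_. 0)" "s \<oplus>\<^bsub>CR\<^esub> t = (\<lambda>n. s n + t n)"
  by (simp_all add: cauchy_ring_def)

lemma Cau_mem: "s \<in> Cau \<Longrightarrow> s n \<in> E" by (auto simp: cauchy_sequences_def)

lemma Cau_const [simp]: "x \<in> E \<Longrightarrow> (\<lambda>_. x) \<in> Cau"
  by (auto simp: cauchy_sequences_def)

lemma Cau_D: "s \<in> Cau \<Longrightarrow> e > 0 \<Longrightarrow> \<exists>N. \<forall>m\<ge>N. \<forall>n\<ge>N. w (s m - s n) < e"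
  by (auto simp: cauchy_sequences_def)

lemma Cau_I: "(\<And>n. s n \<in> E) \<Longrightarrow> (\<And>e. e > 0 \<Longrightarrow> \<exists>N. \<forall>m\<ge>N. \<forall>n\<ge>N. w (s m - s n) < e) \<Longrightarrow> s \<in> Cau"
  by (auto simp: cauchy_sequences_def)

lemma Cau_add: assumes "s \<in> Cau" "t \<in> Cau" shows "(\<lambda>n. s n + t n) \<in> Cau"
proof (rule Cau_I)
  fix e :: real assume e: "e > 0"
  obtain N1 N2 where N: "\<forall>m\<ge>N1. \<forall>n\<ge>N1. w (s m - s n) < e" "\<forall>m\<ge>N2. \<forall>n\<ge>N2. w (t m - t n) < e"
    using Cau_D[OF assms(1) e] Cau_D[OF assms(2) e] by blast
  have "w (s m + t m - (s n + t n)) < e" if "m \<ge> max N1 N2" "n \<ge> max N1 N2" for m n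
  proof -
    have "w ((s m - s n) + (t m - t n)) \<le> max (w (s m - s n)) (w (t m - t n))"
      by (intro ultrametric mem_intros Cau_mem assms)
    also have "\<dots> < e" using N that by auto
    finally show ?thesis by (simp add: algebra_simps)
  qed
  then show "\<exists>N. \<forall>m\<ge>N. \<forall>n\<ge>N. w (s m + t m - (s n + t n)) < e" by blast
qed (intro mem_intros Cau_mem assms)

lemma Cau_minus: assumes "s \<in> Cau" shows "(\<lambda>n. - s n) \<in> Cau"
proof (rule Cau_I)
  fix e :: real assume e: "e > 0"
  have "w (- s m - - s n) = w (s m - s n)" for m n
    using abs_commute[OF Cau_mem Cau_mem, OF assms assms, of m n] by simp
  then show "\<exists>N. \<forall>m\<ge>N. \<forall>n\<ge>N. w (- s m - - s n) < e" using Cau_D[OF assms e] by simp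
qed (intro mem_intros Cau_mem assms)

lemma Cau_diff: "s \<in> Cau \<Longrightarrow> t \<in> Cau \<Longrightarrow> (\<lambda>n. s n - t n) \<in> Cau"
  using Cau_add[OF _ Cau_minus, of s t] by simp

lemma Cau_abs_convergent: assumes "s \<in> Cau" shows "convergent (\<lambda>n. w (s n))"
proof -
  have "Cauchy (\<lambda>n. w (s n))"
  proof (rule metric_CauchyI)
    fix e :: real assume e: "e > 0"
    then obtain N where N: "\<forall>m\<ge>N. \<forall>n\<ge>N. w (s m - s n) < e" using Cau_D[OF assms] by blast
    have "dist (w (s m)) (w (s n)) < e" if "m \<ge> N" "n \<ge> N" for m n
      using N that abs_le_diff[OF Cau_mem Cau_mem, OF assms assms, of m n] by (fastforce simp: dist_real_def)
    then show "\<exists>N. \<forall>m\<ge>N. \<forall>n\<ge>N. dist (w (s m)) (w (s n)) < e" by blast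
  qed
  then show ?thesis by (rule Cauchy_convergent)
qed

lemma Cau_bounded: assumes "s \<in> Cau" obtains B where "B > 0" "\<And>n. w (s n) \<le> B"
proof -
  have "Bseq (\<lambda>n. w (s n))" using Cau_abs_convergent[OF assms] by (rule convergent_imp_Bseq)
  then obtain B where "B > 0" "\<forall>n. norm (w (s n)) \<le> B" by (auto simp: Bseq_def)
  then show ?thesis using that[of B] by (auto simp: abs_le_iff)
qed

lemma Cau_mult: assumes "s \<in> Cau" "t \<in> Cau" shows "(\<lambda>n. s n * t n) \<in> Cau"
proof (rule Cau_I)
  fix e :: real assume e: "e > 0"
  obtain B1 B2 where B: "B1 > 0" "\<And>n. w (s n) \<le> B1" "B2 > 0" "\<And>n. w (t n) \<le> B2"
    using Cau_bounded[OF assms(1)] Cau_bounded[OF assms(2)] by metis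
  obtain N1 N2 where N: "\<forall>m\<ge>N1. \<forall>n\<ge>N1. w (s m - s n) < e / B2" "\<forall>m\<ge>N2. \<forall>n\<ge>N2. w (t m - t n) < e / B1"
    using Cau_D[OF assms(1), of "e / B2"] Cau_D[OF assms(2), of "e / B1"] e B by (metis divide_pos_pos)
  have "w (s m * t m - s n * t n) < e" if mn: "m \<ge> max N1 N2" "n \<ge> max N1 N2" for m n
  proof -
    have "s m * t m - s n * t n = s m * (t m - t n) + t n * (s m - s n)" by (simp add: algebra_simps)
    then have "w (s m * t m - s n * t n) \<le> max (w (s m * (t m - t n))) (w (t n * (s m - s n)))"
      by (metis ultrametric Cau_mem assms diff_mem mult_mem)
    also have "w (s m * (t m - t n)) < e"
    proof -
      have "w (s m * (t m - t n)) \<le> B1 * w (t m - t n)"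
        using B(2)[of m] by (simp add: abs_mult Cau_mem assms diff_mem mult_right_mono)
      also have "\<dots> < B1 * (e / B1)" using N(2) mn B by (intro mult_strict_left_mono) auto
      finally show ?thesis using B by simp
    qed
    moreover have "w (t n * (s m - s n)) < e"
    proof -
      have "w (t n * (s m - s n)) \<le> B2 * w (s m - s n)"
        using B(4)[of n] by (simp add: abs_mult Cau_mem assms diff_mem mult_right_mono)
      also have "\<dots> < B2 * (e / B2)" using N(1) mn B by (intro mult_strict_left_mono) auto
      finally show ?thesis using B by simp
    qed
    ultimately show ?thesis by simp
  qed
  then show "\<exists>N. \<forall>m\<ge>N. \<forall>n\<ge>N. w (s m * t m - s n * t n) < e" by blast
qed (intro mem_intros Cau_mem assms)

text \<open>Tending to zero already forces the Cauchy property, so membership in the ideal can be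
  tested by the limit alone.\<close>

lemma Nul_iff: "s \<in> Nul \<longleftrightarrow> (\<forall>n. s n \<in> E) \<and> (\<lambda>n. w (s n)) \<longlonglongrightarrow> 0"
proof
  assume s: "(\<forall>n. s n \<in> E) \<and> (\<lambda>n. w (s n)) \<longlonglongrightarrow> 0"
  have "s \<in> Cau"
  proof (rule Cau_I)
    fix e :: real assume e: "e > 0"
    then obtain N where N: "\<forall>n\<ge>N. w (s n) < e"
      using order_tendstoD(2)[OF s[THEN conjunct2]] by (auto simp: eventually_sequentially)
    have "w (s m - s n) < e" if "m \<ge> N" "n \<ge> N" for m n
    proof -
      have "w (s m - s n) \<le> max (w (s m)) (w (s n))" using s by (intro abs_diff_le) auto
      also have "\<dots> < e" using N that by simp
      finally show ?thesis .
    qed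
    then show "\<exists>N. \<forall>m\<ge>N. \<forall>n\<ge>N. w (s m - s n) < e" by blast
  qed (use s in auto)
  then show "s \<in> Nul" using s by (simp add: null_sequences_def)
qed (auto simp: null_sequences_def Cau_mem)

lemma Nul_Cau: "s \<in> Nul \<Longrightarrow> s \<in> Cau" by (simp add: null_sequences_def)

lemma tendsto_0_squeeze:
  assumes "\<And>n. 0 \<le> f n" "\<And>n. f n \<le> g n" "g \<longlonglongrightarrow> (0 :: real)" shows "f \<longlonglongrightarrow> 0"
  by (rule real_tendsto_sandwich[OF _ _ tendsto_const assms(3)]) (simp_all add: assms(1,2))

lemma Nul_add: "s \<in> Nul \<Longrightarrow> t \<in> Nul \<Longrightarrow> (\<lambda>n. s n + t n) \<in> Nul"
proof -
  assume s: "s \<in> Nul" "t \<in> Nul"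
  have "(\<lambda>n. max (w (s n)) (w (t n))) \<longlonglongrightarrow> max 0 0"
    using s by (intro tendsto_max) (auto simp: Nul_iff)
  moreover have E: "s n \<in> E" "t n \<in> E" for n using s by (auto simp: Nul_iff)
  ultimately have "(\<lambda>n. max (w (s n)) (w (t n))) \<longlonglongrightarrow> 0" by simp
  then have "(\<lambda>n. w (s n + t n)) \<longlonglongrightarrow> 0"
    by (rule tendsto_0_squeeze[rotated 2]) (simp_all add: E add_mem ultrametric)
  then show ?thesis using E by (simp add: Nul_iff add_mem)
qed

lemma Nul_mult: "s \<in> Nul \<Longrightarrow> t \<in> Cau \<Longrightarrow> (\<lambda>n. s n * t n) \<in> Nul"
proof -
  assume s: "s \<in> Nul" and t: "t \<in> Cau"
  obtain B where B: "B > 0" "\<And>n. w (t n) \<le> B" using Cau_bounded[OF t] by metis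
  have E: "s n \<in> E" "t n \<in> E" for n
    by (use s in \<open>simp add: Nul_iff\<close>) (rule Cau_mem[OF t])
  have s0: "(\<lambda>n. w (s n)) \<longlonglongrightarrow> 0" using s by (simp add: Nul_iff)
  have "(\<lambda>n. w (s n * t n)) \<longlonglongrightarrow> 0"
  proof (rule tendsto_0_squeeze)
    show "w (s n * t n) \<le> w (s n) * B" for n
      unfolding abs_mult[OF E] by (rule mult_left_mono[OF B(2) abs_nonneg[OF E(1)]])
    show "(\<lambda>n. w (s n) * B) \<longlonglongrightarrow> 0" using tendsto_mult_left_zero[OF s0] .
  qed (simp add: E mult_mem)
  then show ?thesis by (simp add: Nul_iff E mult_mem)
qed

lemma Nul_minus: "s \<in> Nul \<Longrightarrow> (\<lambda>n. - s n) \<in> Nul"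
  using Nul_mult[of s "\<lambda>_. -1"] minus_mem[OF one_mem] by simp

lemma cring_CR: "cring CR"
proof (rule cringI)
  show "abelian_group CR"
  proof (rule abelian_groupI)
    fix s assume "s \<in> carrier CR"
    then show "\<exists>t\<in>carrier CR. t \<oplus>\<^bsub>CR\<^esub> s = \<zero>\<^bsub>CR\<^esub>"
      by (intro bexI[of _ "\<lambda>n. - s n"]) (auto intro: Cau_minus)
  qed (auto intro: Cau_add simp: algebra_simps)
  show "Group.comm_monoid CR"
    by (rule comm_monoidI) (auto intro: Cau_mult simp: algebra_simps)
qed (simp add: algebra_simps)

sublocale CR: cring CR by (rule cring_CR)

lemma CR_minus: "s \<in> Cau \<Longrightarrow> \<ominus>\<^bsub>CR\<^esub> s = (\<lambda>n. - s n)"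
  using CR.minus_equality[of "\<lambda>n. - s n" s] by (simp add: Cau_minus)

lemma ideal_Nul: "ideal Nul CR"
proof (rule idealI)
  show "subgroup Nul (add_monoid CR)"
  proof (rule group.subgroupI)
    show "group (add_monoid CR)" by (rule CR.a_group)
    show "Nul \<noteq> {}" using Nul_iff[of "\<lambda>_. 0"] by auto
  next
    fix a assume a: "a \<in> Nul"
    have "inv\<^bsub>add_monoid CR\<^esub> a = (\<lambda>n. - a n)"
      using CR_minus[OF Nul_Cau[OF a]] by (simp add: a_inv_def)
    then show "inv\<^bsub>add_monoid CR\<^esub> a \<in> Nul" using Nul_minus[OF a] by simp
  qed (auto simp: Nul_Cau Nul_add)
next
  fix a x assume a: "a \<in> Nul" "x \<in> carrier CR"
  show "x \<otimes>\<^bsub>CR\<^esub> a \<in> Nul" "a \<otimes>\<^bsub>CR\<^esub> x \<in> Nul"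
    using Nul_mult[of a x] a by (simp_all add: mult.commute)
qed (rule CR.ring_axioms)

sublocale Nul: ideal Nul CR by (rule ideal_Nul)

text \<open>Every element of the completion is such a coset (\<open>completion_carrier\<close>), so
  all computations in the quotient ring are done on representing sequences.\<close>

definition cls :: "(nat \<Rightarrow> complex) \<Rightarrow> (nat \<Rightarrow> complex) set" where
  "cls s = Nul +>\<^bsub>CR\<^esub> s"

lemma cls_altdef: assumes "s \<in> Cau" shows "cls s = {u. (\<lambda>n. u n - s n) \<in> Nul}"
proof (rule Set.set_eqI)
  fix u
  have "(\<exists>v\<in>Nul. u = (\<lambda>n. v n + s n)) \<longleftrightarrow> (\<lambda>n. u n - s n) \<in> Nul"
    by (auto intro!: bexI[of _ "\<lambda>n. u n - s n"])
  then show "u \<in> cls s \<longleftrightarrow> u \<in> {u. (\<lambda>n. u n - s n) \<in> Nul}"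
    by (auto simp: cls_def a_r_coset_def r_coset_def)
qed

lemma cls_eq_iff: assumes "s \<in> Cau" "t \<in> Cau" shows "cls s = cls t \<longleftrightarrow> (\<lambda>n. w (s n - t n)) \<longlonglongrightarrow> 0"
proof -
  have N: "(\<lambda>n. s n - t n) \<in> Nul \<longleftrightarrow> (\<lambda>n. w (s n - t n)) \<longlonglongrightarrow> 0"
    by (simp add: Nul_iff Cau_mem[OF assms(1)] Cau_mem[OF assms(2)] diff_mem)
  show ?thesis
  proof
    assume "cls s = cls t"
    moreover have "s \<in> cls s" using assms by (simp add: cls_altdef Nul_iff)
    ultimately show "(\<lambda>n. w (s n - t n)) \<longlonglongrightarrow> 0" using N assms by (auto simp: cls_altdef)
  next
    assume "(\<lambda>n. w (s n - t n)) \<longlonglongrightarrow> 0"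
    then have n: "(\<lambda>n. s n - t n) \<in> Nul" using N by simp
    have "(\<lambda>n. u n - s n) \<in> Nul \<longleftrightarrow> (\<lambda>n. u n - t n) \<in> Nul" for u
      using Nul_add[OF n, of "\<lambda>n. u n - s n"] Nul_add[OF Nul_minus[OF n], of "\<lambda>n. u n - t n"] by auto
    then show "cls s = cls t" using assms by (auto simp: cls_altdef)
  qed
qed

lemma cls_mem [simp]: "s \<in> Cau \<Longrightarrow> s \<in> cls s" by (simp add: cls_altdef Nul_iff)

lemma completion_carrier: "carrier Ew = cls ` Cau"
  by (auto simp: completion_def FactRing_def A_RCOSETS_def' cls_def)

lemma completionE: assumes "x \<in> carrier Ew" obtains s where "s \<in> Cau" "x = cls s"
  using assms by (auto simp: completion_carrier)

lemma cls_closed [simp]: "s \<in> Cau \<Longrightarrow> cls s \<in> carrier Ew" by (auto simp: completion_carrier)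

lemma completion_mult: "s \<in> Cau \<Longrightarrow> t \<in> Cau \<Longrightarrow> cls s \<otimes>\<^bsub>Ew\<^esub> cls t = cls (\<lambda>n. s n * t n)"
  by (simp add: completion_def FactRing_def cls_def Nul.rcoset_mult_add)

lemma completion_add: "s \<in> Cau \<Longrightarrow> t \<in> Cau \<Longrightarrow> cls s \<oplus>\<^bsub>Ew\<^esub> cls t = cls (\<lambda>n. s n + t n)"
  by (simp add: completion_def FactRing_def cls_def Nul.a_rcos_sum)

lemma completion_one: "\<one>\<^bsub>Ew\<^esub> = cls (\<lambda>_. 1)"
  by (simp add: completion_def FactRing_def cls_def)

lemma completion_zero: "\<zero>\<^bsub>Ew\<^esub> = cls (\<lambda>_. 0)"
  by (simp add: cls_altdef) (simp add: completion_def FactRing_def)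

lemma cring_Ew: "cring Ew"
  unfolding completion_def by (rule Nul.quotient_is_cring) (rule cring_CR)

sublocale Ew: cring Ew by (rule cring_Ew)

lemma completion_uminus: "s \<in> Cau \<Longrightarrow> \<ominus>\<^bsub>Ew\<^esub> cls s = cls (\<lambda>n. - s n)"
  by (rule Ew.minus_equality) (simp_all add: completion_add completion_zero Cau_minus)

lemma completion_minus: "s \<in> Cau \<Longrightarrow> t \<in> Cau \<Longrightarrow> cls s \<ominus>\<^bsub>Ew\<^esub> cls t = cls (\<lambda>n. s n - t n)"
  by (simp add: a_minus_def completion_uminus completion_add Cau_minus)

lemma Cau_power: "s \<in> Cau \<Longrightarrow> (\<lambda>n. s n ^ k) \<in> Cau"
  by (induction k) (auto intro: Cau_mult)

lemma completion_pow: "s \<in> Cau \<Longrightarrow> cls s [^]\<^bsub>Ew\<^esub> (k::nat) = cls (\<lambda>n. s n ^ k)"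
  by (induction k) (auto simp: completion_one completion_mult Cau_power mult.commute)

text \<open>Representatives of one class differ by a null sequence, and the values of two elements
  differ by at most the value of their difference. So the limit is the same for all of them, as the
  definite description in \<open>completion_abs\<close> requires.\<close>

lemma completion_abs_eq: assumes "s \<in> Cau" "(\<lambda>n. w (s n)) \<longlonglongrightarrow> r" shows "completion_abs E w (cls s) = r"
  unfolding completion_abs_def
proof (rule the_equality)
  show "\<forall>u\<in>cls s. (\<lambda>n. w (u n)) \<longlonglongrightarrow> r"
  proof
    fix u assume "u \<in> cls s"
    then have u: "(\<lambda>n. u n - s n) \<in> Nul" using assms(1) by (simp add: cls_altdef)
    have uE: "u n \<in> E" for n
      using add_mem[of "u n - s n" "s n"] u Cau_mem[OF assms(1)] by (auto simp: Nul_iff)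
    have "(\<lambda>n. \<bar>w (u n) - w (s n)\<bar>) \<longlonglongrightarrow> 0"
    proof (rule tendsto_0_squeeze)
      show "\<bar>w (u n) - w (s n)\<bar> \<le> w (u n - s n)" for n
        by (rule abs_le_diff[OF uE Cau_mem[OF assms(1)]])
      show "(\<lambda>n. w (u n - s n)) \<longlonglongrightarrow> 0" using u by (simp add: Nul_iff)
    qed simp
    then have "(\<lambda>n. w (u n) - w (s n)) \<longlonglongrightarrow> 0" by (rule tendsto_rabs_zero_cancel)
    then show "(\<lambda>n. w (u n)) \<longlonglongrightarrow> r" using tendsto_add[OF _ assms(2)] by fastforce
  qed
  fix r' assume "\<forall>u\<in>cls s. (\<lambda>n. w (u n)) \<longlonglongrightarrow> r'"
  then have "(\<lambda>n. w (s n)) \<longlonglongrightarrow> r'" using assms by simp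
  then show "r' = r" using assms(2) LIMSEQ_unique by blast
qed

lemma completion_abs_tendsto: "s \<in> Cau \<Longrightarrow> (\<lambda>n. w (s n)) \<longlonglongrightarrow> completion_abs E w (cls s)"
  using completion_abs_eq Cau_abs_convergent[of s] by (auto simp: convergent_def)

lemma to_completion_eq: "to_completion E w x = cls (\<lambda>_. x)"
  by (simp add: to_completion_def cls_def)

end

section \<open>Powers with p-adic exponents\<close>

text \<open>Convergence to zero in Z_p, phrased by divisibility and thus without any field or place.
  \<open>padic_null_iff\<close> translates it to an arbitrary w above p.\<close>

definition padic_null :: "nat \<Rightarrow> (nat \<Rightarrow> int) \<Rightarrow> bool" where
  "padic_null p c \<longleftrightarrow> (\<forall>m. \<exists>N. \<forall>n\<ge>N. int p ^ m dvd c n)"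

definition padic_cauchy :: "nat \<Rightarrow> (nat \<Rightarrow> int) \<Rightarrow> bool" where
  "padic_cauchy p c \<longleftrightarrow> (\<forall>m. \<exists>N. \<forall>a\<ge>N. \<forall>b\<ge>N. int p ^ m dvd c a - c b)"

text \<open>These integers tend to \<open>1\<close>, while raising to them kills, from some \<open>n\<close> on, every root of unity
  of order prime to \<open>p\<close>: \<open>u\<close> raised to them tends to the principal part of \<open>u\<close>.  The square turns the
  limit \<open>-1\<close> of \<open>p\<^bsup>n!\<^esup> - 1\<close> into \<open>1\<close>.\<close>

definition teich_exp :: "nat \<Rightarrow> nat \<Rightarrow> int" where
  "teich_exp p n = (int p ^ fact n - 1)\<^sup>2"

text \<open>With q = p^(n!), (q - 1)^2 - 1 = q (q - 2), and n! >= n.\<close>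

lemma teich_exp_cong: "padic_null p (\<lambda>n. teich_exp p n - 1)"
  unfolding padic_null_def
proof
  fix m
  have "int p ^ m dvd teich_exp p n - 1" if "n \<ge> m" for n
  proof -
    have "m \<le> fact n" using fact_ge_self[of n] that by linarith
    then have "int p ^ m dvd int p ^ fact n" by (rule le_imp_power_dvd)
    moreover have "teich_exp p n - 1 = int p ^ fact n * (int p ^ fact n - 2)"
      by (simp add: teich_exp_def power2_eq_square algebra_simps)
    ultimately show ?thesis by simp
  qed
  then show "\<exists>N. \<forall>n\<ge>N. int p ^ m dvd teich_exp p n - 1" by blast
qed

text \<open>The factorial in the exponent is there for this: n! is eventually a multiple of
  \<open>totient M\<close>, and Euler's theorem then gives p^(n!) = 1 modulo M.\<close>

lemma teich_exp_dvd:
  assumes "coprime M p" "M > 0"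
  shows "\<exists>N. \<forall>n\<ge>N. int M dvd teich_exp p n"
proof -
  have e: "[p ^ totient M = 1] (mod M)"
    by (rule euler_theorem) (use assms in \<open>simp add: coprime_commute\<close>)
  have "int M dvd teich_exp p n" if n: "n \<ge> totient M" for n
  proof -
    have "totient M > 0" using assms by simp
    then have "totient M dvd fact n" using n by (intro dvd_fact) linarith+
    then obtain k where k: "fact n = totient M * k" by blast
    have "[p ^ fact n = 1 ^ k] (mod M)" unfolding k power_mult by (rule cong_pow[OF e])
    then have "[int p ^ fact n = 1] (mod int M)"
      by (metis cong_int_iff of_nat_1 of_nat_power power_one)
    then have "int M dvd int p ^ fact n - 1" by (simp add: cong_iff_dvd_diff)
    then show ?thesis by (simp add: teich_exp_def power2_eq_square)
  qed
  then show ?thesis by blast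
qed

lemma padic_null_add: "padic_null p c \<Longrightarrow> padic_null p d \<Longrightarrow> padic_null p (\<lambda>n. c n + d n)"
  unfolding padic_null_def by (meson dvd_add le_trans nat_le_linear)

lemma padic_null_mult: "padic_null p c \<Longrightarrow> padic_null p (\<lambda>n. d n * c n)"
  unfolding padic_null_def by (meson dvd_mult)

lemma padic_null_0 [simp]: "padic_null p (\<lambda>_. 0)" by (simp add: padic_null_def)

lemma padic_null_diff: "padic_null p c \<Longrightarrow> padic_null p d \<Longrightarrow> padic_null p (\<lambda>n. c n - d n)"
  unfolding padic_null_def by (meson dvd_diff le_trans nat_le_linear)

lemma padic_null_sum: "(\<And>i. i \<in> I \<Longrightarrow> padic_null p (c i)) \<Longrightarrow> padic_null p (\<lambda>n. \<Sum>i\<in>I. c i n)"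
  by (induction I rule: infinite_finite_induct) (auto intro: padic_null_add)

lemma padic_null_imp_cauchy: "padic_null p c \<Longrightarrow> padic_cauchy p c"
  unfolding padic_null_def padic_cauchy_def by (meson dvd_diff)

lemma padic_cauchy_const [simp]: "padic_cauchy p (\<lambda>_. c)" by (simp add: padic_cauchy_def)

lemma padic_cauchy_diff:
  assumes "padic_cauchy p c" "padic_cauchy p d" shows "padic_cauchy p (\<lambda>n. c n - d n)"
  unfolding padic_cauchy_def
proof
  fix m
  obtain N1 N2 where N: "\<forall>a\<ge>N1. \<forall>b\<ge>N1. int p ^ m dvd c a - c b" "\<forall>a\<ge>N2. \<forall>b\<ge>N2. int p ^ m dvd d a - d b"
    using assms unfolding padic_cauchy_def by blast
  have "int p ^ m dvd (c a - d a) - (c b - d b)" if "a \<ge> max N1 N2" "b \<ge> max N1 N2" for a b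
  proof -
    have "int p ^ m dvd (c a - c b) - (d a - d b)" by (rule dvd_diff) (use N that in auto)
    then show ?thesis by (simp add: algebra_simps)
  qed
  then show "\<exists>N. \<forall>a\<ge>N. \<forall>b\<ge>N. int p ^ m dvd (c a - d a) - (c b - d b)" by blast
qed

lemma padic_cauchy_add:
  "padic_cauchy p c \<Longrightarrow> padic_cauchy p d \<Longrightarrow> padic_cauchy p (\<lambda>n. c n + d n)"
  using padic_cauchy_diff[of p c "\<lambda>n. 0 - d n"] padic_cauchy_diff[of p "\<lambda>_. 0" d] by simp

section \<open>Values of integers and continuity of powers in base and exponent\<close>

context valued_field
begin

lemma p_inv: "0 < 1 / real p" "1 / real p < 1" using p_gt_1 by auto

text \<open>After splitting off the exact power of p the cofactor has value 1, so w restricted to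
  integers is the p-adic absolute value.\<close>

lemma abs_of_int_le_power_iff: "w (of_int c) \<le> (1 / real p) ^ m \<longleftrightarrow> int p ^ m dvd c"
proof
  assume "int p ^ m dvd c"
  then obtain k where "c = int p ^ m * k" by blast
  then have "w (of_int c) = (1 / real p) ^ m * w (of_int k)"
    by (simp add: abs_mult abs_power abs_p power_mem)
  then show "w (of_int c) \<le> (1 / real p) ^ m"
    using mult_left_mono[OF abs_of_int_le_1[of k], of "(1 / real p) ^ m"] p_inv by simp
next
  assume l: "w (of_int c) \<le> (1 / real p) ^ m"
  show "int p ^ m dvd c"
  proof (cases "c = 0")
    case False
    obtain k where k: "c = int p ^ multiplicity (int p) c * k" "\<not> int p dvd k"
      using multiplicity_decompose'[of c "int p"] False p_gt_1 by auto
    have "w (of_int k) = 1"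
      using k(2) abs_of_int_less_1_iff[of k] abs_of_int_le_1[of k] by linarith
    then have "w (of_int c) = (1 / real p) ^ multiplicity (int p) c"
      by (subst k(1)) (simp add: abs_mult abs_power abs_p power_mem)
    then have "multiplicity (int p) c \<ge> m"
      using l p_inv power_decreasing_iff[of "1 / real p"] by simp
    then show ?thesis using k(1) by (metis dvd_triv_left le_imp_power_dvd dvd_trans)
  qed auto
qed

lemma power_p_inv_small: "e > 0 \<Longrightarrow> \<exists>m. (1 / real p) ^ m < e"
  using real_arch_pow_inv[of e "1 / real p"] p_inv by simp

lemma padic_null_iff: "padic_null p c \<longleftrightarrow> (\<lambda>n. w (of_int (c n))) \<longlonglongrightarrow> 0"
proof
  assume c: "padic_null p c"
  show "(\<lambda>n. w (of_int (c n))) \<longlonglongrightarrow> 0"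
  proof (rule LIMSEQ_I)
    fix e :: real assume "e > 0"
    then obtain m where m: "(1 / real p) ^ m < e" using power_p_inv_small by blast
    obtain N where "\<forall>n\<ge>N. int p ^ m dvd c n" using c unfolding padic_null_def by blast
    then have "\<forall>n\<ge>N. w (of_int (c n)) \<le> (1 / real p) ^ m" by (simp add: abs_of_int_le_power_iff)
    then show "\<exists>N. \<forall>n\<ge>N. norm (w (of_int (c n)) - 0) < e" using m by (auto intro!: exI[of _ N])
  qed
next
  assume c: "(\<lambda>n. w (of_int (c n))) \<longlonglongrightarrow> 0"
  show "padic_null p c" unfolding padic_null_def
  proof
    fix m
    have "eventually (\<lambda>n. w (of_int (c n)) < (1 / real p) ^ m) sequentially"
      by (rule order_tendstoD(2)[OF c]) (use p_inv in simp)
    then show "\<exists>N. \<forall>n\<ge>N. int p ^ m dvd c n"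
      unfolding eventually_sequentially by (metis abs_of_int_le_power_iff less_imp_le)
  qed
qed

lemma padic_cauchy_iff: "padic_cauchy p c \<longleftrightarrow> (\<lambda>n. of_int (c n)) \<in> Cau"
proof
  assume c: "padic_cauchy p c"
  show "(\<lambda>n. of_int (c n)) \<in> Cau"
  proof (rule Cau_I)
    fix e :: real assume "e > 0"
    then obtain m where m: "(1 / real p) ^ m < e" using power_p_inv_small by blast
    obtain N where "\<forall>a\<ge>N. \<forall>b\<ge>N. int p ^ m dvd c a - c b" using c unfolding padic_cauchy_def by blast
    then have "\<forall>a\<ge>N. \<forall>b\<ge>N. w (of_int (c a - c b)) < e"
      using m by (meson abs_of_int_le_power_iff le_less_trans)
    then show "\<exists>N. \<forall>a\<ge>N. \<forall>b\<ge>N. w (of_int (c a) - of_int (c b)) < e" by auto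
  qed simp
next
  assume c: "(\<lambda>n. of_int (c n)) \<in> Cau"
  show "padic_cauchy p c" unfolding padic_cauchy_def
  proof
    fix m
    obtain N where N: "\<forall>a\<ge>N. \<forall>b\<ge>N. w (of_int (c a) - of_int (c b)) < (1 / real p) ^ m"
      using Cau_D[OF c, of "(1 / real p) ^ m"] p_inv by auto
    then have "int p ^ m dvd c a - c b" if "a \<ge> N" "b \<ge> N" for a b
      using that abs_of_int_le_power_iff[of "c a - c b" m] by (simp add: less_imp_le)
    then show "\<exists>N. \<forall>a\<ge>N. \<forall>b\<ge>N. int p ^ m dvd c a - c b" by blast
  qed
qed

lemma abs_eq_1I: "x \<in> E \<Longrightarrow> w (x - 1) < 1 \<Longrightarrow> w x = 1"
  using abs_eqI[of x 1] by simp

text \<open>Induction on x^(n+1) - y^(n+1) = x (x^n - y^n) + (x - y) y^n. The bound does not depend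
  on n, which later allows exponents that vary with the index.\<close>

lemma abs_power_diff_le:
  assumes "x \<in> E" "y \<in> E" "w x = 1" "w y = 1"
  shows "w (x ^ n - y ^ n) \<le> w (x - y)"
proof (induction n)
  case (Suc n)
  have "x ^ Suc n - y ^ Suc n = x * (x ^ n - y ^ n) + (x - y) * y ^ n" by (simp add: algebra_simps)
  also have "w \<dots> \<le> max (w (x * (x ^ n - y ^ n))) (w ((x - y) * y ^ n))"
    by (intro ultrametric mem_intros assms)
  also have "\<dots> \<le> w (x - y)"
    using Suc by (simp add: abs_mult abs_power assms diff_mem power_mem)
  finally show ?case .
qed (use assms in \<open>simp add: diff_mem\<close>)

lemma abs_powi_diff_le:
  assumes "x \<in> E" "y \<in> E" "w x = 1" "w y = 1"
  shows "w (x powi n - y powi n) \<le> w (x - y)"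
proof (cases "n \<ge> 0")
  case True
  then show ?thesis using abs_power_diff_le[OF assms] by (simp add: power_int_def)
next
  case False
  have nz: "x \<noteq> 0" "y \<noteq> 0" using assms by auto
  define m where "m = nat (- n)"
  have "x powi n - y powi n = inverse (x ^ m) - inverse (y ^ m)"
    using False by (simp add: power_int_def m_def power_inverse)
  also have "\<dots> = (y ^ m - x ^ m) / (x ^ m * y ^ m)" using nz by (simp add: field_simps)
  also have "w \<dots> = w (y ^ m - x ^ m)"
    by (simp add: abs_divide abs_mult abs_power assms mem_intros)
  also have "\<dots> \<le> w (y - x)" by (rule abs_power_diff_le) (use assms in auto)
  finally show ?thesis by (simp add: abs_commute assms)
qed

lemma abs_sum_powers:
  assumes "x \<in> E" "w (x - 1) < 1"
  shows "w ((\<Sum>i<n. x ^ i) - of_nat n) \<le> w (x - 1)"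
proof -
  have "(\<Sum>i<n. x ^ i) - of_nat n = (\<Sum>i<n. x ^ i - 1)" by (simp add: sum_subtractf)
  also have "w \<dots> \<le> w (x - 1)"
  proof (rule abs_sum_le)
    fix i
    show "x ^ i - 1 \<in> E \<and> w (x ^ i - 1) \<le> w (x - 1)"
      using abs_power_diff_le[of x 1 i] abs_eq_1I[OF assms] assms by (auto intro!: mem_intros)
  qed (use assms in \<open>simp add: diff_mem\<close>)
  finally show ?thesis .
qed

text \<open>The cofactor 1 + x + ... + x^(N-1) is N up to an error of value below 1, hence has value
  1. So no principal unit other than 1 is a root of unity of order prime to p, which makes the
  principal part unique.\<close>

lemma abs_power_minus_1_coprime:
  assumes "x \<in> E" "w (x - 1) < 1" "coprime N p"
  shows "w (x ^ N - 1) = w (x - 1)"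
proof -
  have "w (\<Sum>i<N. x ^ i) = w (of_nat N)"
    by (rule abs_eqI)
      (use abs_sum_powers[OF assms(1,2), of N] assms abs_of_nat_coprime[of N]
       in \<open>auto intro!: sum_mem power_mem\<close>)
  then have "w ((x - 1) * (\<Sum>i<N. x ^ i)) = w (x - 1)"
    using assms by (simp add: abs_mult sum_mem power_mem diff_mem abs_of_nat_coprime)
  then show ?thesis by (simp add: power_diff_1_eq)
qed

text \<open>The cofactor 1 + x + ... + x^(p-1) equals p up to an error of value w(x - 1). Taking
  p-th powers therefore contracts towards 1 by a fixed factor.\<close>

lemma abs_power_p_minus_1:
  assumes "x \<in> E" "w (x - 1) \<le> r" "r < 1"
  shows "w (x ^ p - 1) \<le> max (1 / real p) r * w (x - 1)"
proof -
  have "w (\<Sum>i<p. x ^ i) \<le> max (w ((\<Sum>i<p. x ^ i) - of_nat p)) (w (of_nat p))"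
    using ultrametric[of "(\<Sum>i<p. x ^ i) - of_nat p" "of_nat p"]
    by (simp add: assms sum_mem power_mem diff_mem)
  also have "\<dots> \<le> max (1 / real p) r"
    using abs_sum_powers[of x p] assms by (auto simp: abs_p)
  finally have "w ((x - 1) * (\<Sum>i<p. x ^ i)) \<le> max (1 / real p) r * w (x - 1)"
    using assms by (simp add: abs_mult sum_mem power_mem diff_mem mult.commute mult_left_mono)
  then show ?thesis by (simp add: power_diff_1_eq)
qed

lemma abs_power_p_power_minus_1:
  assumes "x \<in> E" "w (x - 1) \<le> r" "r < 1"
  shows "w (x ^ (p ^ n) - 1) \<le> max (1 / real p) r ^ n * w (x - 1)"
proof (induction n)
  case (Suc n)
  have m: "max (1 / real p) r \<ge> 0" "max (1 / real p) r \<le> 1" using p_inv assms by (auto simp: le_max_iff_disj)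
  have "w (x ^ (p ^ n) - 1) \<le> 1 * w (x - 1)"
    using Suc mult_right_mono[OF power_le_one[OF m, of n], of "w (x - 1)"] assms(1)
    by (simp add: diff_mem)
  then have "w ((x ^ p ^ n) ^ p - 1) \<le> max (1 / real p) r * w (x ^ p ^ n - 1)"
    by (intro abs_power_p_minus_1) (use assms in \<open>auto intro: power_mem\<close>)
  also have "\<dots> \<le> max (1 / real p) r * (max (1 / real p) r ^ n * w (x - 1))"
    by (rule mult_left_mono[OF Suc]) (use m in simp)
  finally show ?case by (simp add: power_mult[symmetric] mult_ac)
qed simp

text \<open>Continuity of u^e in the exponent, with a bound that is uniform in all bases of distance
  at most r from 1. This uniformity is what makes powers of a sequence by a p-adic exponent
  Cauchy.\<close>

lemma abs_powi_minus_1: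
  assumes "x \<in> E" "w (x - 1) \<le> r" "r < 1" "int p ^ n dvd e"
  shows "w (x powi e - 1) \<le> max (1 / real p) r ^ n"
proof -
  obtain j where j: "e = int (p ^ n) * j" using assms(4) by auto
  have m: "max (1 / real p) r \<ge> 0" "max (1 / real p) r \<le> 1" using p_inv assms by (auto simp: le_max_iff_disj)
  have w1: "w x = 1" using assms by (intro abs_eq_1I) auto
  have "x powi e - 1 = (x ^ (p ^ n)) powi j - 1 powi j"
    unfolding j power_int_mult power_int_of_nat by simp
  also have "w \<dots> \<le> w (x ^ (p ^ n) - 1)"
    by (rule abs_powi_diff_le) (use assms w1 in \<open>auto simp: abs_power power_mem\<close>)
  also have "\<dots> \<le> max (1 / real p) r ^ n * w (x - 1)"
    by (rule abs_power_p_power_minus_1[OF assms(1-3)])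
  also have "\<dots> \<le> max (1 / real p) r ^ n * 1"
    by (rule mult_left_mono) (use assms m in auto)
  finally show ?thesis by simp
qed

abbreviation "PU \<equiv> principal_units E w"

lemma PU_simps [simp]: "x \<otimes>\<^bsub>PU\<^esub> y = x \<otimes>\<^bsub>Ew\<^esub> y" "\<one>\<^bsub>PU\<^esub> = \<one>\<^bsub>Ew\<^esub>"
  by (simp_all add: principal_units_def units_of_def)

lemma cls_eventually_eq:
  assumes "s \<in> Cau" "t \<in> Cau" "\<And>n. n \<ge> N \<Longrightarrow> s n = t n" shows "cls s = cls t"
proof -
  have "(\<lambda>n. w (s n - t n)) \<longlonglongrightarrow> 0"
    by (rule tendsto_eventually) (use assms(3) in \<open>auto simp: eventually_sequentially intro!: exI[of _ N]\<close>)
  then show ?thesis using cls_eq_iff[OF assms(1,2)] by simp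
qed

text \<open>The bound r < 1 has to be uniform in n: values below 1 could still have the limit
  1.\<close>

lemma PU_I: assumes "s \<in> Cau" "\<And>n. n \<ge> N \<Longrightarrow> w (s n - 1) \<le> r" "r < 1" shows "cls s \<in> carrier PU"
proof -
  have c: "(\<lambda>n. s n - 1) \<in> Cau" using Cau_diff[OF assms(1) Cau_const[OF one_mem]] .
  have "completion_abs E w (cls (\<lambda>n. s n - 1)) \<le> r"
    by (rule LIMSEQ_le_const2[OF completion_abs_tendsto[OF c]]) (use assms in blast)
  then show ?thesis
    using assms by (simp add: principal_units_def completion_one completion_minus)
qed

lemma PU_E:
  assumes "x \<in> carrier PU"
  obtains s r N where "s \<in> Cau" "x = cls s" "r < 1" "\<And>n. n \<ge> N \<Longrightarrow> w (s n - 1) \<le> r"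
proof -
  have x: "x \<in> carrier Ew" and a: "completion_abs E w (x \<ominus>\<^bsub>Ew\<^esub> \<one>\<^bsub>Ew\<^esub>) < 1"
    using assms by (auto simp: principal_units_def)
  obtain s where s: "s \<in> Cau" "x = cls s" using completionE[OF x] .
  have c: "(\<lambda>n. s n - 1) \<in> Cau" using Cau_diff[OF s(1) Cau_const[OF one_mem]] .
  define l where "l = completion_abs E w (cls (\<lambda>n. s n - 1))"
  have l: "l < 1" using a s by (simp add: completion_one completion_minus l_def)
  \<comment> \<open>The midpoint of l and 1 lies above the limit and is still below 1, so it serves
    as a uniform bound.\<close>
  have "eventually (\<lambda>n. w (s n - 1) < (l + 1) / 2) sequentially"
    by (rule order_tendstoD(2)[OF completion_abs_tendsto[OF c]]) (use l in \<open>simp add: l_def\<close>)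
  then obtain N where "\<And>n. n \<ge> N \<Longrightarrow> w (s n - 1) < (l + 1) / 2" by (auto simp: eventually_sequentially)
  then show ?thesis using that[of s "(l + 1) / 2" N] s l by (auto intro: less_imp_le)
qed

lemma Cau_inverse:
  assumes "s \<in> Cau" "\<And>n. n \<ge> N \<Longrightarrow> w (s n) = 1" shows "(\<lambda>n. inverse (s n)) \<in> Cau"
proof (rule Cau_I)
  fix e :: real assume "e > 0"
  then obtain M where M: "\<forall>m\<ge>M. \<forall>n\<ge>M. w (s m - s n) < e" using Cau_D[OF assms(1)] by blast
  have "w (inverse (s m) - inverse (s n)) < e" if "m \<ge> max M N" "n \<ge> max M N" for m n
    using abs_powi_diff_le[OF Cau_mem Cau_mem, OF assms(1) assms(1), of m n "-1"] assms(2) M that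
    by (fastforce simp: power_int_minus)
  then show "\<exists>N. \<forall>m\<ge>N. \<forall>n\<ge>N. w (inverse (s m) - inverse (s n)) < e" by blast
qed (intro inverse_mem Cau_mem assms)

text \<open>Finitely many members of s may vanish, where the inverse is 0 by convention; the class
  only sees the indices from N on.\<close>

lemma PU_inverse:
  assumes s: "s \<in> Cau" "\<And>n. n \<ge> N \<Longrightarrow> w (s n - 1) \<le> r" "r < 1"
  shows "cls (\<lambda>n. inverse (s n)) \<in> carrier PU" "cls (\<lambda>n. inverse (s n)) \<otimes>\<^bsub>Ew\<^esub> cls s = \<one>\<^bsub>Ew\<^esub>"
    "(\<lambda>n. inverse (s n)) \<in> Cau"
proof -
  have w1: "w (s n) = 1" if "n \<ge> N" for n
    using s that by (intro abs_eq_1I Cau_mem) (auto intro: le_less_trans)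
  have c: "(\<lambda>n. inverse (s n)) \<in> Cau" by (rule Cau_inverse[OF s(1) w1])
  then show "(\<lambda>n. inverse (s n)) \<in> Cau" .
  have "w (inverse (s n) - 1) \<le> r" if "n \<ge> N" for n
    using abs_powi_diff_le[OF Cau_mem one_mem, OF s(1) w1[OF that], of "-1"] s(2)[OF that]
    by (simp add: power_int_minus)
  then show "cls (\<lambda>n. inverse (s n)) \<in> carrier PU" using PU_I[OF c] s(3) by blast
  have "inverse (s n) * s n = 1" if "n \<ge> N" for n using w1[OF that] by (cases "s n = 0") auto
  then show "cls (\<lambda>n. inverse (s n)) \<otimes>\<^bsub>Ew\<^esub> cls s = \<one>\<^bsub>Ew\<^esub>"
    by (simp add: completion_mult c s completion_one)
      (rule cls_eventually_eq[of _ _ N], use c s Cau_mult in auto)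
qed

lemma PU_mult_closed: assumes "x \<in> carrier PU" "y \<in> carrier PU" shows "x \<otimes>\<^bsub>Ew\<^esub> y \<in> carrier PU"
proof -
  obtain s r N where s: "s \<in> Cau" "x = cls s" "r < 1" "\<And>n. n \<ge> N \<Longrightarrow> w (s n - 1) \<le> r"
    using PU_E[OF assms(1)] by metis
  obtain s' r' N' where s': "s' \<in> Cau" "y = cls s'" "r' < 1" "\<And>n. n \<ge> N' \<Longrightarrow> w (s' n - 1) \<le> r'"
    using PU_E[OF assms(2)] by metis
  have "w (s n * s' n - 1) \<le> max r r'" if n: "n \<ge> max N N'" for n
  proof -
    have "s n * s' n - 1 = s n * (s' n - 1) + (s n - 1)" by (simp add: algebra_simps)
    also have "w \<dots> \<le> max (w (s n * (s' n - 1))) (w (s n - 1))"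
      by (intro ultrametric mem_intros Cau_mem[OF s(1)] Cau_mem[OF s'(1)] one_mem)
    also have "w (s n * (s' n - 1)) = w (s' n - 1)"
      using abs_eq_1I[OF Cau_mem[OF s(1)], of n] s(3) s(4)[of n] n
      by (simp add: abs_mult Cau_mem[OF s(1)] Cau_mem[OF s'(1)] diff_mem)
    also have "max (w (s' n - 1)) (w (s n - 1)) \<le> max r r'" using s(4)[of n] s'(4)[of n] n by auto
    finally show ?thesis .
  qed
  then have "cls (\<lambda>n. s n * s' n) \<in> carrier PU"
    by (intro PU_I[of _ "max N N'" "max r r'"] Cau_mult s(1) s'(1)) (use s(3) s'(3) in auto)
  then show ?thesis by (simp add: completion_mult s s')
qed

lemma PU_carrier_subset: "x \<in> carrier PU \<Longrightarrow> x \<in> carrier Ew"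
  by (auto simp: principal_units_def)

lemma comm_group_PU: "comm_group PU"
proof (rule comm_groupI)
  fix x assume x: "x \<in> carrier PU"
  obtain s r N where s: "s \<in> Cau" "x = cls s" "r < 1" "\<And>n. n \<ge> N \<Longrightarrow> w (s n - 1) \<le> r"
    using PU_E[OF x] by metis
  show "\<exists>y\<in>carrier PU. y \<otimes>\<^bsub>PU\<^esub> x = \<one>\<^bsub>PU\<^esub>"
    using PU_inverse[OF s(1,4,3)] s(2) by auto
next
  fix x y z assume "x \<in> carrier PU" "y \<in> carrier PU" "z \<in> carrier PU"
  then show "x \<otimes>\<^bsub>PU\<^esub> y \<otimes>\<^bsub>PU\<^esub> z = x \<otimes>\<^bsub>PU\<^esub> (y \<otimes>\<^bsub>PU\<^esub> z)"
    by (simp add: PU_carrier_subset Ew.m_assoc)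
next
  show "\<one>\<^bsub>PU\<^esub> \<in> carrier PU" using PU_I[of "\<lambda>_. 1" 0 0] by (simp add: completion_one)
qed (auto simp: PU_mult_closed PU_carrier_subset Ew.m_assoc Ew.m_comm)

sublocale PU: comm_group PU by (rule comm_group_PU)

lemma PU_inv:
  assumes s: "s \<in> Cau" "\<And>n. n \<ge> N \<Longrightarrow> w (s n - 1) \<le> r" "r < 1"
  shows "inv\<^bsub>PU\<^esub> (cls s) = cls (\<lambda>n. inverse (s n))"
  using PU_inverse[OF s] PU_I[OF s] by (intro PU.inv_equality) auto

lemma PU_nat_pow: "s \<in> Cau \<Longrightarrow> cls s [^]\<^bsub>PU\<^esub> (k::nat) = cls (\<lambda>n. s n ^ k)"
  by (induction k) (auto simp: completion_one completion_mult Cau_power mult.commute)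

lemma PU_int_pow:
  assumes s: "s \<in> Cau" "\<And>n. n \<ge> N \<Longrightarrow> w (s n - 1) \<le> r" "r < 1"
  shows "cls s [^]\<^bsub>PU\<^esub> (k::int) = cls (\<lambda>n. s n powi k)"
proof (cases "k \<ge> 0")
  case True
  then obtain m where "k = int m" using nonneg_int_cases by blast
  then show ?thesis using PU_nat_pow[OF s(1)] by (simp add: int_pow_int)
next
  case False
  then obtain m where m: "k = - int m" by (metis int_cases2 of_nat_0_le_iff)
  have w1: "w (s n) = 1" if "n \<ge> N" for n
    using s that by (intro abs_eq_1I Cau_mem) (auto intro: le_less_trans)
  have "w (s n ^ m - 1) \<le> r" if "n \<ge> N" for n
    using abs_power_diff_le[OF Cau_mem one_mem, OF s(1) w1[OF that] abs_1, of m] s(2)[OF that] by simp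
  then have "inv\<^bsub>PU\<^esub> (cls (\<lambda>n. s n ^ m)) = cls (\<lambda>n. inverse (s n ^ m))"
    using PU_inv[OF Cau_power[OF s(1)]] s(3) by blast
  then show ?thesis
    using PU_I[OF s] by (simp add: m PU.int_pow_neg int_pow_int PU_nat_pow[OF s(1)] power_int_minus)
qed

text \<open>The difference of two powers is split in two: the base changes at a fixed exponent,
  which does not increase distances, and then the exponent changes at a fixed base, where p-adic
  closeness of the exponents is used.\<close>

lemma Cau_powi:
  assumes s: "s \<in> Cau" "\<And>n. n \<ge> N \<Longrightarrow> w (s n - 1) \<le> r" "r < 1" and k: "padic_cauchy p k"
  shows "(\<lambda>n. s n powi k n) \<in> Cau"
proof (rule Cau_I)
  fix e :: real assume e: "e > 0"
  have q: "max (1 / real p) r < 1" "max (1 / real p) r \<ge> 0" using p_inv s by (auto simp: le_max_iff_disj)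
  obtain M where M: "max (1 / real p) r ^ M < e" using real_arch_pow_inv[OF e q(1)] by blast
  obtain N1 where N1: "\<forall>m\<ge>N1. \<forall>n\<ge>N1. w (s m - s n) < e" using Cau_D[OF s(1) e] by blast
  obtain N2 where N2: "\<forall>a\<ge>N2. \<forall>b\<ge>N2. int p ^ M dvd k a - k b" using k unfolding padic_cauchy_def by blast
  note sE = Cau_mem[OF s(1)]
  have w1: "w (s n) = 1" if "n \<ge> N" for n
    using s that by (intro abs_eq_1I Cau_mem) (auto intro: le_less_trans)
  have "w (s m powi k m - s n powi k n) < e" if mn: "m \<ge> max N (max N1 N2)" "n \<ge> max N (max N1 N2)" for m n
  proof -
    have nz: "s n \<noteq> 0" using w1[of n] mn by auto
    have "s m powi k m - s n powi k n =
      (s m powi k m - s n powi k m) + s n powi k n * (s n powi (k m - k n) - 1)"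
      using nz by (simp add: algebra_simps flip: power_int_add)
    also have "w \<dots> \<le> max (w (s m powi k m - s n powi k m)) (w (s n powi k n * (s n powi (k m - k n) - 1)))"
      by (intro ultrametric mem_intros sE one_mem)
    also have "w (s m powi k m - s n powi k m) < e"
      using abs_powi_diff_le[OF sE sE w1 w1, of m n "k m"] N1 mn by (meson le_less_trans max.boundedE)
    moreover have "w (s n powi k n * (s n powi (k m - k n) - 1)) < e"
    proof -
      have "w (s n powi k n * (s n powi (k m - k n) - 1)) = w (s n powi (k m - k n) - 1)"
        using mn by (simp add: abs_mult sE powi_mem diff_mem abs_powi w1)
      also have "\<dots> \<le> max (1 / real p) r ^ M"
        using mn N2 by (intro abs_powi_minus_1 sE s) auto
      finally show ?thesis using M by simp
    qed
    ultimately show ?thesis by simp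
  qed
  then show "\<exists>N. \<forall>m\<ge>N. \<forall>n\<ge>N. w (s m powi k m - s n powi k n) < e" by blast
qed (intro powi_mem Cau_mem s)

lemma completion_tendsto_iff:
  assumes "\<And>n. t n \<in> Cau" "u \<in> Cau"
  shows "completion_tendsto E w (\<lambda>n. cls (t n)) (cls u) \<longleftrightarrow>
    (\<lambda>n. completion_abs E w (cls (\<lambda>m. t n m - u m))) \<longlonglongrightarrow> 0"
  using assms by (simp add: completion_tendsto_def completion_minus)

text \<open>A double limit is replaced by a diagonal one: as u is Cauchy, the distance of x n from
  the class of u and the value of x n - u n differ by a null sequence. For integers x n this turns
  convergence in Z_p into \<open>padic_null\<close>.\<close>

lemma completion_tendsto_const_iff:
  assumes x: "\<And>n. x n \<in> E" and u: "u \<in> Cau"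
  shows "completion_tendsto E w (\<lambda>n. cls (\<lambda>_. x n)) (cls u) \<longleftrightarrow> (\<lambda>n. w (x n - u n)) \<longlonglongrightarrow> 0"
proof -
  define A where "A n = completion_abs E w (cls (\<lambda>m. x n - u m))" for n
  have lim: "(\<lambda>m. w (x n - u m)) \<longlonglongrightarrow> A n" for n
    unfolding A_def by (intro completion_abs_tendsto Cau_diff Cau_const x u)
  have "(\<lambda>n. A n - w (x n - u n)) \<longlonglongrightarrow> 0"
  proof (rule LIMSEQ_I)
    fix e :: real assume e: "e > 0"
    obtain N where N: "\<forall>m\<ge>N. \<forall>n\<ge>N. w (u m - u n) < e / 2" using Cau_D[OF u, of "e / 2"] e by auto
    have "norm (A n - w (x n - u n) - 0) < e" if n: "n \<ge> N" for n
    proof -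
      have "(\<lambda>m. \<bar>w (x n - u m) - w (x n - u n)\<bar>) \<longlonglongrightarrow> \<bar>A n - w (x n - u n)\<bar>"
        by (intro tendsto_intros lim)
      moreover have "\<bar>w (x n - u m) - w (x n - u n)\<bar> \<le> e / 2" if "m \<ge> N" for m
      proof -
        have "\<bar>w (x n - u m) - w (x n - u n)\<bar> \<le> w ((x n - u m) - (x n - u n))"
          by (intro abs_le_diff mem_intros x Cau_mem[OF u])
        also have "(x n - u m) - (x n - u n) = u n - u m" by simp
        also have "w \<dots> \<le> e / 2" using N n that by (auto intro: less_imp_le)
        finally show ?thesis .
      qed
      ultimately have "\<bar>A n - w (x n - u n)\<bar> \<le> e / 2" by (intro LIMSEQ_le_const2) blast+
      then show ?thesis using e by simp
    qed
    then show "\<exists>N. \<forall>n\<ge>N. norm (A n - w (x n - u n) - 0) < e" by blast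
  qed
  note d = this
  have "A \<longlonglongrightarrow> 0 \<longleftrightarrow> (\<lambda>n. w (x n - u n)) \<longlonglongrightarrow> 0"
    using tendsto_diff[OF _ d, of A 0] tendsto_add[OF d, of "\<lambda>n. w (x n - u n)" 0] by auto
  then show ?thesis
    using completion_tendsto_iff[of "\<lambda>n _. x n" u] x u unfolding A_def by simp
qed

text \<open>Through y n, the distance of the two limits is at most the maximum of two null
  sequences. The definite description in \<open>padic_pow\<close> depends on this.\<close>

lemma completion_tendsto_unique:
  assumes y: "\<And>n. y n \<in> carrier Ew" and z: "z \<in> carrier Ew" "z' \<in> carrier Ew"
    and l: "completion_tendsto E w y z" "completion_tendsto E w y z'"
  shows "z = z'"
proof -
  obtain t t' where t: "t \<in> Cau" "z = cls t" "t' \<in> Cau" "z' = cls t'"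
    using completionE[OF z(1)] completionE[OF z(2)] by metis
  have "\<forall>n. \<exists>s. s \<in> Cau \<and> y n = cls s" using y completionE by metis
  then obtain Y where Y: "\<And>n. Y n \<in> Cau" "\<And>n. y n = cls (Y n)" by metis
  define A where "A n = completion_abs E w (cls (\<lambda>m. Y n m - t m))" for n
  define A' where "A' n = completion_abs E w (cls (\<lambda>m. Y n m - t' m))" for n
  define B where "B = completion_abs E w (cls (\<lambda>m. t m - t' m))"
  have lims: "(\<lambda>m. w (Y n m - t m)) \<longlonglongrightarrow> A n" "(\<lambda>m. w (Y n m - t' m)) \<longlonglongrightarrow> A' n"
      "(\<lambda>m. w (t m - t' m)) \<longlonglongrightarrow> B" for n
    unfolding A_def A'_def B_def by (intro completion_abs_tendsto Cau_diff Y t)+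
  have ye: "y = (\<lambda>n. cls (Y n))" using Y(2) by auto
  have A0: "A \<longlonglongrightarrow> 0" "A' \<longlonglongrightarrow> 0"
    using l completion_tendsto_iff[OF Y(1) t(1)] completion_tendsto_iff[OF Y(1) t(3)]
    unfolding A_def A'_def ye t by auto
  have "B \<le> max (A n) (A' n)" for n
  proof (rule LIMSEQ_le[OF lims(3) tendsto_max[OF lims(1,2)]])
    have "w (t m - t' m) \<le> max (w (Y n m - t m)) (w (Y n m - t' m))" for m
      using abs_triangle[OF Cau_mem[OF t(1), of m] Cau_mem[OF Y(1), of n m] Cau_mem[OF t(3), of m]]
        abs_commute[OF Cau_mem[OF t(1)] Cau_mem[OF Y(1)], of m n m] by simp
    then show "\<exists>N. \<forall>m\<ge>N. w (t m - t' m) \<le> max (w (Y n m - t m)) (w (Y n m - t' m))" by blast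
  qed
  then have "B \<le> max 0 0" by (intro LIMSEQ_le_const[OF tendsto_max[OF A0]]) auto
  moreover have "B \<ge> 0" by (rule LIMSEQ_le_const[OF lims(3)]) (use t in \<open>auto intro!: exI[of _ 0] abs_nonneg diff_mem Cau_mem[OF t(1)] Cau_mem[OF t(3)]\<close>)
  ultimately have "(\<lambda>m. w (t m - t' m)) \<longlonglongrightarrow> 0" using lims(3) by simp
  then show ?thesis using cls_eq_iff[OF t(1,3)] t by simp
qed

end

section \<open>P-adic powers and principal parts\<close>

locale padic_place = valued_field + Q: valued_field \<rat> "padic_abs p" p
begin

text \<open>The power is computed diagonally, with the n-th exponent applied to the n-th member of
  the base. Replacing the exponents by others with the same p-adic limit changes it by a null
  sequence.\<close>

lemma padic_pow_eq:
  assumes s: "s \<in> Cau" "\<And>n. n \<ge> N \<Longrightarrow> w (s n - 1) \<le> r" "r < 1"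
    and k: "padic_cauchy p k"
  shows "padic_pow p E w (cls s) (Q.cls (\<lambda>n. of_int (k n))) = cls (\<lambda>n. s n powi k n)"
    "cls (\<lambda>n. s n powi k n) \<in> carrier PU"
proof -
  note sE = Cau_mem[OF s(1)]
  have w1: "w (s n) = 1" if "n \<ge> N" for n
    using s that by (intro abs_eq_1I Cau_mem) (auto intro: le_less_trans)
  have c: "(\<lambda>n. s n powi k n) \<in> Cau" by (rule Cau_powi[OF s k])
  have "w (s n powi k n - 1) \<le> r" if "n \<ge> N" for n
    using abs_powi_diff_le[OF sE one_mem w1[OF that] abs_1, of "k n"] s(2)[OF that] by simp
  then show pu: "cls (\<lambda>n. s n powi k n) \<in> carrier PU" by (rule PU_I[OF c _ s(3)])
  have kQ: "(\<lambda>n. of_int (k n)) \<in> Q.Cau" using k Q.padic_cauchy_iff by simp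
  have q: "max (1 / real p) r < 1" "max (1 / real p) r \<ge> 0" using p_inv s by (auto simp: le_max_iff_disj)
  \<comment> \<open>The convergence premise in the definition of \<open>padic_pow\<close> says that
    k' and k differ by a p-adic null sequence.\<close>
  have conv_iff: "completion_tendsto \<rat> (padic_abs p) (\<lambda>n. to_completion \<rat> (padic_abs p) (of_int (k' n)))
      (Q.cls (\<lambda>n. of_int (k n))) \<longleftrightarrow> padic_null p (\<lambda>n. k' n - k n)" for k'
    unfolding Q.to_completion_eq
    by (subst Q.completion_tendsto_const_iff[OF _ kQ]) (simp_all add: Q.padic_null_iff)
  have powk: "(\<lambda>m. s m powi j) \<in> Cau" for j using Cau_powi[OF s padic_cauchy_const] .
  have lim: "completion_tendsto E w (\<lambda>n. cls s [^]\<^bsub>PU\<^esub> k' n) (cls (\<lambda>n. s n powi k n))"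
    if k': "padic_null p (\<lambda>n. k' n - k n)" for k'
  proof -
    have "(\<lambda>n. completion_abs E w (cls (\<lambda>m. s m powi k' n - s m powi k m))) \<longlonglongrightarrow> 0"
  proof (rule LIMSEQ_I)
    fix e :: real assume e: "e > 0"
    obtain M where M: "max (1 / real p) r ^ M < e" using real_arch_pow_inv[OF e q(1)] by blast
    obtain N1 where N1: "\<forall>a\<ge>N1. \<forall>b\<ge>N1. int p ^ M dvd k a - k b" using k unfolding padic_cauchy_def by blast
    obtain N2 where N2: "\<forall>n\<ge>N2. int p ^ M dvd k' n - k n" using k' unfolding padic_null_def by blast
    have "norm (completion_abs E w (cls (\<lambda>m. s m powi k' n - s m powi k m)) - 0) < e"
      if n: "n \<ge> max N1 N2" for n
    proof -
      have lim: "(\<lambda>m. w (s m powi k' n - s m powi k m)) \<longlonglongrightarrow>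
          completion_abs E w (cls (\<lambda>m. s m powi k' n - s m powi k m))" (is "_ \<longlonglongrightarrow> ?L")
        by (intro completion_abs_tendsto Cau_diff powk c)
      have "w (s m powi k' n - s m powi k m) \<le> max (1 / real p) r ^ M" if m: "m \<ge> max N N1" for m
      proof -
        have nz: "s m \<noteq> 0" using w1[of m] m by auto
        have d: "int p ^ M dvd k' n - k m"
        proof -
          have "int p ^ M dvd (k' n - k n) + (k n - k m)" by (rule dvd_add) (use N1 N2 m n in auto)
          then show ?thesis by simp
        qed
        have "s m powi k' n - s m powi k m = s m powi k m * (s m powi (k' n - k m) - 1)"
          using nz by (simp add: algebra_simps flip: power_int_add)
        also have "w \<dots> = w (s m powi (k' n - k m) - 1)"
          using m by (simp add: abs_mult sE powi_mem diff_mem abs_powi w1)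
        also have "\<dots> \<le> max (1 / real p) r ^ M"
          using m d by (intro abs_powi_minus_1 sE s) auto
        finally show ?thesis .
      qed
      then have "?L \<le> max (1 / real p) r ^ M" by (intro LIMSEQ_le_const2[OF lim]) blast
      moreover have "?L \<ge> 0"
        by (rule LIMSEQ_le_const[OF lim]) (auto intro!: exI[of _ 0] abs_nonneg diff_mem powi_mem sE)
      ultimately show ?thesis using M by simp
    qed
    then show "\<exists>N. \<forall>n\<ge>N. norm (completion_abs E w (cls (\<lambda>m. s m powi k' n - s m powi k m)) - 0) < e" by blast
  qed
    then show ?thesis
      using completion_tendsto_iff[of "\<lambda>n m. s m powi k' n", OF powk c] PU_int_pow[OF s] by simp
  qed
  show "padic_pow p E w (cls s) (Q.cls (\<lambda>n. of_int (k n))) = cls (\<lambda>n. s n powi k n)"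
    unfolding padic_pow_def
  proof (rule the_equality)
    \<comment> \<open>The sequence k is itself admissible, so any candidate z is a limit of the same
      integer powers and limits are unique.\<close>
    fix z assume z: "z \<in> carrier PU \<and> (\<forall>k'.
        completion_tendsto \<rat> (padic_abs p) (\<lambda>n. to_completion \<rat> (padic_abs p) (of_int (k' n)))
          (Q.cls (\<lambda>n. of_int (k n))) \<longrightarrow> completion_tendsto E w (\<lambda>n. cls s [^]\<^bsub>PU\<^esub> k' n) z)"
    then have "completion_tendsto E w (\<lambda>n. cls s [^]\<^bsub>PU\<^esub> k n) z" using conv_iff[of k] by simp
    moreover have "completion_tendsto E w (\<lambda>n. cls s [^]\<^bsub>PU\<^esub> k n) (cls (\<lambda>n. s n powi k n))"
      using lim[of k] by simp
    ultimately show "z = cls (\<lambda>n. s n powi k n)"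
      by (intro completion_tendsto_unique[of "\<lambda>n. cls s [^]\<^bsub>PU\<^esub> k n"])
        (use z pu PU_carrier_subset powk in \<open>auto simp: PU_int_pow[OF s]\<close>)
  qed (use pu lim conv_iff in auto)
qed

end

context valued_field
begin

text \<open>Here u may be far from 1 and only u^M is close. As M and p^n are coprime, e is M times a
  multiple of p^n, and the estimate is applied to u^M.\<close>

lemma abs_powi_minus_1':
  assumes u: "u \<in> E" "w (u ^ M - 1) \<le> r" "r < 1" and M: "coprime M p" "int M dvd e" "int p ^ n dvd e"
  shows "w (u powi e - 1) \<le> max (1 / real p) r ^ n"
proof -
  have "coprime (int M) (int p ^ n)" using M by simp
  then have "int p ^ n * int M dvd e" using M by (metis coprime_commute divides_mult)
  then obtain j where "e = int p ^ n * int M * j" by blast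
  then have j: "e = int M * (int p ^ n * j)" by simp
  have "u powi e = (u ^ M) powi (int p ^ n * j)"
    unfolding j power_int_mult[of u "int M"] power_int_of_nat by simp
  then show ?thesis using abs_powi_minus_1[of "u ^ M" r n "int p ^ n * j"] u by (simp add: power_mem)
qed

text \<open>For u far from 1, p-adic closeness of exponents is not enough; their differences must in
  the end also be multiples of M, so that u^M can take over.\<close>

lemma Cau_powi':
  assumes u: "u \<in> E" "w u = 1" "w (u ^ M - 1) < 1" and M: "coprime M p" "M > 0"
    and k: "padic_cauchy p k" "\<And>n. n \<ge> N \<Longrightarrow> int M dvd k n - k N"
  shows "(\<lambda>n. u powi k n) \<in> Cau"
proof (rule Cau_I)
  fix e :: real assume e: "e > 0"
  define r where "r = w (u ^ M - 1)"
  have q: "max (1 / real p) r < 1" "max (1 / real p) r \<ge> 0" using p_inv u r_def by (auto simp: le_max_iff_disj)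
  obtain j where j: "max (1 / real p) r ^ j < e" using real_arch_pow_inv[OF e q(1)] by blast
  obtain N2 where N2: "\<forall>a\<ge>N2. \<forall>b\<ge>N2. int p ^ j dvd k a - k b" using k unfolding padic_cauchy_def by blast
  have nz: "u \<noteq> 0" using u by auto
  have "w (u powi k m - u powi k n) < e" if mn: "m \<ge> max N N2" "n \<ge> max N N2" for m n
  proof -
    have "int M dvd (k m - k N) - (k n - k N)" by (rule dvd_diff) (use k mn in auto)
    then have d: "int M dvd k m - k n" by simp
    have "u powi k m - u powi k n = u powi k n * (u powi (k m - k n) - 1)"
      using nz by (simp add: algebra_simps flip: power_int_add)
    also have "w \<dots> = w (u powi (k m - k n) - 1)"
      by (simp add: abs_mult u powi_mem diff_mem abs_powi)
    also have "\<dots> \<le> max (1 / real p) r ^ j"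
      by (rule abs_powi_minus_1'[OF _ _ _ M(1) d]) (use u mn N2 in \<open>auto simp: r_def\<close>)
    finally show ?thesis using j by simp
  qed
  then show "\<exists>N. \<forall>m\<ge>N. \<forall>n\<ge>N. w (u powi k m - u powi k n) < e" by blast
qed (intro powi_mem u)

text \<open>With h n = \<open>teich_exp p n\<close>, u = u^(1 - h) u^h. Eventually M divides h n, so
  the second factor is a power of u^M and principal; the first factor has M-th power (u^M)^(1 - h),
  which tends to 1 because 1 - h tends to 0.\<close>

lemma principal_part_eq:
  assumes u: "u \<in> E" "w u = 1" "w (u ^ M - 1) < 1" and M: "coprime M p" "M > 0"
  shows "principal_part p E w (to_completion E w u) = cls (\<lambda>n. u powi teich_exp p n)"
    and "(\<lambda>n. u powi teich_exp p n) \<in> Cau"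
    and "\<exists>N. \<forall>n\<ge>N. w (u powi teich_exp p n - 1) \<le> w (u ^ M - 1)"
proof -
  define h where "h = teich_exp p"
  define r where "r = w (u ^ M - 1)"
  have nz: "u \<noteq> 0" using u by auto
  obtain N where N: "\<And>n. n \<ge> N \<Longrightarrow> int M dvd h n" using teich_exp_dvd[OF M] unfolding h_def by blast
  have h1: "padic_null p (\<lambda>n. h n - 1)" unfolding h_def by (rule teich_exp_cong)
  have hc: "padic_cauchy p h"
    using padic_cauchy_add[OF padic_null_imp_cauchy[OF h1] padic_cauchy_const[of p 1]] by simp
  have c: "(\<lambda>n. u powi h n) \<in> Cau"
    by (rule Cau_powi'[OF u M hc, of N]) (use N in \<open>auto intro: dvd_diff\<close>)
  have zc: "(\<lambda>n. u powi (1 - h n)) \<in> Cau"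
    by (rule Cau_powi'[OF u M padic_cauchy_diff[OF padic_cauchy_const hc], of N]) 
      (use N in \<open>auto intro: dvd_diff\<close>)
  have le: "w (u powi h n - 1) \<le> r" if n: "n \<ge> N" for n
  proof -
    obtain j where j: "h n = int M * j" using N[OF n] by blast
    have "u powi h n - 1 = (u ^ M) powi j - 1 powi j"
      unfolding j power_int_mult power_int_of_nat by simp
    also have "w \<dots> \<le> w (u ^ M - 1)"
      by (rule abs_powi_diff_le) (use u in \<open>auto simp: abs_power power_mem\<close>)
    finally show ?thesis by (simp add: r_def)
  qed
  have r1: "r < 1" using u by (simp add: r_def)
  have pu: "cls (\<lambda>n. u powi h n) \<in> carrier PU" by (rule PU_I[OF c le r1])
  show "(\<lambda>n. u powi teich_exp p n) \<in> Cau" using c by (simp add: h_def)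
  show "\<exists>N. \<forall>n\<ge>N. w (u powi teich_exp p n - 1) \<le> w (u ^ M - 1)"
    using le unfolding h_def r_def by blast
  have zM: "cls (\<lambda>n. u powi (1 - h n)) [^]\<^bsub>Ew\<^esub> M = \<one>\<^bsub>Ew\<^esub>"
    unfolding completion_pow[OF zc] completion_one
  proof (subst cls_eq_iff[OF Cau_power[OF zc] Cau_const[OF one_mem]], rule LIMSEQ_I)
    fix e :: real assume e: "e > 0"
    have q: "max (1 / real p) r < 1" using p_inv r1 by auto
    obtain j where j: "max (1 / real p) r ^ j < e" using real_arch_pow_inv[OF e q(1)] by blast
    obtain N where N: "\<forall>n\<ge>N. int p ^ j dvd h n - 1" using h1 unfolding padic_null_def by blast
    have "w ((u powi (1 - h n)) ^ M - 1) < e" if "n \<ge> N" for n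
    proof -
      have "(u powi (1 - h n)) ^ M = (u ^ M) powi (1 - h n)"
        by (simp add: power_int_power power_int_power' mult.commute)
      also have "w (\<dots> - 1) \<le> max (1 / real p) r ^ j"
        by (rule abs_powi_minus_1) (use u r1 N that in \<open>auto simp: r_def power_mem dvd_diff_commute\<close>)
      finally show ?thesis using j by simp
    qed
    then show "\<exists>N. \<forall>n\<ge>N. norm (w ((u powi (1 - h n)) ^ M - 1) - 0) < e"
      using u by (auto simp: abs_nonneg diff_mem power_mem powi_mem)
  qed
  have ux: "cls (\<lambda>_. u) = cls (\<lambda>n. u powi (1 - h n)) \<otimes>\<^bsub>Ew\<^esub> cls (\<lambda>n. u powi h n)"
    using nz by (simp add: completion_mult zc c flip: power_int_add)
  show "principal_part p E w (to_completion E w u) = cls (\<lambda>n. u powi teich_exp p n)"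
    unfolding principal_part_def to_completion_eq h_def[symmetric]
  proof (rule the_equality)
    show "cls (\<lambda>n. u powi h n) \<in> carrier PU \<and> (\<exists>z\<in>carrier Ew. \<exists>n>0. coprime n p \<and>
        z [^]\<^bsub>Ew\<^esub> n = \<one>\<^bsub>Ew\<^esub> \<and> cls (\<lambda>_. u) = z \<otimes>\<^bsub>Ew\<^esub> cls (\<lambda>n. u powi h n))"
      using pu zM ux zc M by (auto intro!: bexI[of _ "cls (\<lambda>n. u powi (1 - h n))"] exI[of _ M])
  next
    fix y assume "y \<in> carrier PU \<and> (\<exists>z\<in>carrier Ew. \<exists>n>0. coprime n p \<and>
        z [^]\<^bsub>Ew\<^esub> n = \<one>\<^bsub>Ew\<^esub> \<and> cls (\<lambda>_. u) = z \<otimes>\<^bsub>Ew\<^esub> y)"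
    then obtain z n where y: "y \<in> carrier PU" "z \<in> carrier Ew" "n > 0" "coprime n p"
      "z [^]\<^bsub>Ew\<^esub> n = \<one>\<^bsub>Ew\<^esub>" "cls (\<lambda>_. u) = z \<otimes>\<^bsub>Ew\<^esub> y" by blast
    define y0 where "y0 = cls (\<lambda>n. u powi h n)"
    define z0 where "z0 = cls (\<lambda>n. u powi (1 - h n))"
    have y0: "y0 \<in> carrier PU" and z0: "z0 \<in> carrier Ew" "z0 [^]\<^bsub>Ew\<^esub> M = \<one>\<^bsub>Ew\<^esub>"
      using pu zc zM by (auto simp: y0_def z0_def)
    have yE: "y \<in> carrier Ew" "y0 \<in> carrier Ew" using y y0 PU_carrier_subset by auto
    have eq: "z \<otimes>\<^bsub>Ew\<^esub> y = z0 \<otimes>\<^bsub>Ew\<^esub> y0" using ux y(6) by (simp add: y0_def z0_def)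
    have pw: "(a \<otimes>\<^bsub>Ew\<^esub> b) [^]\<^bsub>Ew\<^esub> (n * M) = b [^]\<^bsub>Ew\<^esub> (n * M)"
      if "a \<in> carrier Ew" "b \<in> carrier Ew" "a [^]\<^bsub>Ew\<^esub> (n * M) = \<one>\<^bsub>Ew\<^esub>" for a b
      using that by (simp add: Ew.nat_pow_distrib)
    have "z [^]\<^bsub>Ew\<^esub> (n * M) = \<one>\<^bsub>Ew\<^esub>" using y by (simp add: Ew.nat_pow_pow[symmetric])
    moreover have "z0 [^]\<^bsub>Ew\<^esub> (n * M) = \<one>\<^bsub>Ew\<^esub>"
      using z0 by (subst mult.commute) (simp add: Ew.nat_pow_pow[symmetric])
    ultimately have eqn: "y [^]\<^bsub>Ew\<^esub> (n * M) = y0 [^]\<^bsub>Ew\<^esub> (n * M)"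
      using pw[of z y] pw[of z0 y0] eq y z0 yE by simp
    \<comment> \<open>The quotient of two candidates is a principal unit killed by n * M, which is
      prime to p. Such an exponent preserves the distance from 1, so the quotient is 1.\<close>
    define v where "v = y \<otimes>\<^bsub>PU\<^esub> inv\<^bsub>PU\<^esub> y0"
    have v: "v \<in> carrier PU" using y y0 by (simp only: v_def PU.m_closed PU.inv_closed)
    have PUpow: "a [^]\<^bsub>PU\<^esub> (j::nat) = a [^]\<^bsub>Ew\<^esub> j" for a j
      by (induction j) auto
    have "v [^]\<^bsub>PU\<^esub> (n * M) = y [^]\<^bsub>PU\<^esub> (n * M) \<otimes>\<^bsub>PU\<^esub> inv\<^bsub>PU\<^esub> (y0 [^]\<^bsub>PU\<^esub> (n * M))"
      unfolding v_def using y y0 by (simp only: PU.nat_pow_distrib PU.inv_closed PU.nat_pow_inv)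
    also have "\<dots> = \<one>\<^bsub>PU\<^esub>" unfolding PUpow eqn[unfolded PUpow] using y0
      by (metis PU.r_inv PU.nat_pow_closed PUpow)
    finally have vpow: "v [^]\<^bsub>Ew\<^esub> (n * M) = \<one>\<^bsub>Ew\<^esub>" by (simp add: PUpow)
    obtain s r' N' where s: "s \<in> Cau" "v = cls s" "r' < 1" "\<And>n. n \<ge> N' \<Longrightarrow> w (s n - 1) \<le> r'"
      using PU_E[OF v] by metis
    have "(\<lambda>i. w (s i ^ (n * M) - 1)) \<longlonglongrightarrow> 0"
      using vpow cls_eq_iff[OF Cau_power[OF s(1)] Cau_const[OF one_mem]]
      by (simp add: s(2) completion_pow[OF s(1)] completion_one)
    moreover have "eventually (\<lambda>i. w (s i ^ (n * M) - 1) = w (s i - 1)) sequentially"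
      unfolding eventually_sequentially
      using s(3,4) y(4) M by (intro exI[of _ N'] allI impI abs_power_minus_1_coprime Cau_mem[OF s(1)])
        (auto intro: le_less_trans)
    ultimately have "(\<lambda>i. w (s i - 1)) \<longlonglongrightarrow> 0" by (rule Lim_transform_eventually)
    then have "v = \<one>\<^bsub>PU\<^esub>"
      using cls_eq_iff[OF s(1) Cau_const[OF one_mem]] by (simp add: s(2) completion_one)
    then show "y = cls (\<lambda>n. u powi h n)"
      unfolding v_def using y y0 by (metis PU.inv_equality PU.inv_inv PU.inv_closed y0_def)
  qed
qed

end

context padic_place
begin

text \<open>Projection to the principal part and p-adic exponentiation merge into one integer
  exponent of the original u at each index. Bilinearity and the kernel thereby become questions
  about integer powers.\<close>

lemma leopoldt_pairing_eq:
  assumes u: "u \<in> E" "w u = 1" "w (u ^ M - 1) < 1" and M: "coprime M p" "M > 0"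
    and k: "padic_cauchy p k"
  shows "padic_pow p E w (principal_part p E w (to_completion E w u)) (Q.cls (\<lambda>n. of_int (k n)))
      = cls (\<lambda>n. u powi (teich_exp p n * k n))" (is "?L = _")
    and "cls (\<lambda>n. u powi (teich_exp p n * k n)) \<in> carrier PU"
    and "(\<lambda>n. u powi (teich_exp p n * k n)) \<in> Cau"
proof -
  note pp = principal_part_eq[OF u M]
  obtain N where N: "\<And>n. n \<ge> N \<Longrightarrow> w (u powi teich_exp p n - 1) \<le> w (u ^ M - 1)" using pp(3) by blast
  note e = padic_pow_eq[OF pp(2) N u(3) k] Cau_powi[OF pp(2) N u(3) k]
  show "?L = cls (\<lambda>n. u powi (teich_exp p n * k n))"
    using e(1) unfolding pp(1) power_int_mult by simp
  show "cls (\<lambda>n. u powi (teich_exp p n * k n)) \<in> carrier PU"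
    using e(2) unfolding power_int_mult by simp
  show "(\<lambda>n. u powi (teich_exp p n * k n)) \<in> Cau"
    using e(3) unfolding power_int_mult by simp
qed

end

section \<open>Tensor products\<close>

locale tensor =
  A: comm_group A + B: comm_group B for A :: "('a, 'm) monoid_scheme" and B :: "('b, 'n) monoid_scheme"
begin

abbreviation "FG \<equiv> free_Abelian_group (carrier A \<times> carrier B)"
abbreviation "TR \<equiv> tensor_relations A B"
abbreviation "TP \<equiv> tensor_product A B"
abbreviation "pt \<equiv> pure_tensor A B"

sublocale FG: comm_group FG by (rule abelian_free_Abelian_group)

definition "bilin_rels =
     {frag_of (a \<otimes>\<^bsub>A\<^esub> a', b) - frag_of (a, b) - frag_of (a', b) | a a' b.
         a \<in> carrier A \<and> a' \<in> carrier A \<and> b \<in> carrier B} \<union>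
      {frag_of (a, b \<otimes>\<^bsub>B\<^esub> b') - frag_of (a, b) - frag_of (a, b') | a b b'.
         a \<in> carrier A \<and> b \<in> carrier B \<and> b' \<in> carrier B}"

lemma TR_eq: "TR = generate FG bilin_rels"
  by (simp add: tensor_relations_def bilin_rels_def)

lemma frag_diff_closed: "x \<in> carrier FG \<Longrightarrow> y \<in> carrier FG \<Longrightarrow> x - y \<in> carrier FG"
  using keys_diff[of x y] by auto

lemma frag_of_closed: "a \<in> carrier A \<Longrightarrow> b \<in> carrier B \<Longrightarrow> frag_of (a, b) \<in> carrier FG"
  by simp

lemma bilin_rels_subset: "bilin_rels \<subseteq> carrier FG"
  unfolding bilin_rels_def by (safe; intro frag_diff_closed frag_of_closed) auto

lemma subgroup_TR: "subgroup TR FG"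
  unfolding TR_eq by (rule FG.generate_is_subgroup[OF bilin_rels_subset])

lemma normal_TR: "TR \<lhd> FG" by (rule FG.subgroup_imp_normal[OF subgroup_TR])

sublocale TR: normal TR FG by (rule normal_TR)

lemma comm_group_TP: "comm_group TP"
  unfolding tensor_product_def by (rule FG.abelian_FactGroup[OF subgroup_TR])

sublocale TP: comm_group TP by (rule comm_group_TP)

definition coset where "coset x = TR #>\<^bsub>FG\<^esub> x"

lemma TP_carrier: "carrier TP = coset ` carrier FG"
  by (simp add: tensor_product_def carrier_FactGroup coset_def)

lemma coset_closed [simp]: "x \<in> carrier FG \<Longrightarrow> coset x \<in> carrier TP"
  unfolding TP_carrier by blast

lemma coset_add: "x \<in> carrier FG \<Longrightarrow> y \<in> carrier FG \<Longrightarrow> coset x \<otimes>\<^bsub>TP\<^esub> coset y = coset (x + y)"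
  using TR.rcos_sum[of x y] by (simp add: tensor_product_def coset_def)

lemma coset_eqI:
  assumes "x \<in> carrier FG" "y \<in> carrier FG" "x - y \<in> TR" shows "coset x = coset y"
proof -
  have "x \<in> coset y"
    unfolding coset_def r_coset_def using assms(3) by (auto intro!: bexI[of _ "x - y"])
  then show ?thesis
    unfolding coset_def using FG.repr_independence[OF _ assms(2) subgroup_TR, of x] by simp
qed

lemma pt_eq: "pt a b = coset (frag_of (a, b))"
  by (simp add: pure_tensor_def coset_def)

lemma pt_closed [simp]: "a \<in> carrier A \<Longrightarrow> b \<in> carrier B \<Longrightarrow> pt a b \<in> carrier TP"
  by (simp add: pt_eq)

lemma coset_pt_mult:
  assumes "x \<in> carrier FG" "y \<in> carrier FG" "z \<in> carrier FG" "x - y - z \<in> bilin_rels"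
  shows "coset x = coset y \<otimes>\<^bsub>TP\<^esub> coset z"
proof -
  have yz: "y + z \<in> carrier FG" using FG.m_closed[OF assms(2,3)] by simp
  have "x - (y + z) \<in> TR" unfolding TR_eq using generate.incl[OF assms(4)] by (simp add: diff_diff_eq)
  then show ?thesis unfolding coset_add[OF assms(2,3)] using coset_eqI[OF assms(1) yz] by simp
qed

lemma pt_mult_left:
  assumes "a \<in> carrier A" "a' \<in> carrier A" "b \<in> carrier B"
  shows "pt (a \<otimes>\<^bsub>A\<^esub> a') b = pt a b \<otimes>\<^bsub>TP\<^esub> pt a' b"
  unfolding pt_eq by (rule coset_pt_mult) (use assms in \<open>auto simp: bilin_rels_def\<close>)

lemma pt_mult_right:
  assumes "a \<in> carrier A" "b \<in> carrier B" "b' \<in> carrier B"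
  shows "pt a (b \<otimes>\<^bsub>B\<^esub> b') = pt a b \<otimes>\<^bsub>TP\<^esub> pt a b'"
  unfolding pt_eq by (rule coset_pt_mult) (use assms in \<open>auto simp: bilin_rels_def\<close>)

lemma pt_hom_left: "b \<in> carrier B \<Longrightarrow> group_hom A TP (\<lambda>a. pt a b)"
  by unfold_locales (auto simp: hom_def pt_mult_left)

lemma pt_hom_right: "a \<in> carrier A \<Longrightarrow> group_hom B TP (pt a)"
  by unfold_locales (auto simp: hom_def pt_mult_right)

text \<open>No case for inverses is needed, since the inverse of a pure tensor is pure. In the
  proof, Q quantifies over the left factor to be closed under products, and it is carried for x and
  its inverse together because the free group is generated by differences.\<close>

lemma tensor_induct [consumes 1, case_names unit pure]:
  assumes W: "W \<in> carrier TP" and one: "P \<one>\<^bsub>TP\<^esub>"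
    and step: "\<And>Y a b. Y \<in> carrier TP \<Longrightarrow> P Y \<Longrightarrow> a \<in> carrier A \<Longrightarrow> b \<in> carrier B \<Longrightarrow> P (Y \<otimes>\<^bsub>TP\<^esub> pt a b)"
  shows "P W"
proof -
  define Q where "Q Z \<longleftrightarrow> (\<forall>Y\<in>carrier TP. P Y \<longrightarrow> P (Y \<otimes>\<^bsub>TP\<^esub> Z))" for Z
  have Q_mult: "Q (Z \<otimes>\<^bsub>TP\<^esub> Z')" if "Q Z" "Q Z'" "Z \<in> carrier TP" "Z' \<in> carrier TP" for Z Z'
    using that unfolding Q_def by (simp flip: TP.m_assoc)
  have Q_pt: "Q (pt a b)" if "a \<in> carrier A" "b \<in> carrier B" for a b
    using step that unfolding Q_def by blast
  have inv_pt: "inv\<^bsub>TP\<^esub> (pt a b) = pt (inv\<^bsub>A\<^esub> a) b" if "a \<in> carrier A" "b \<in> carrier B" for a b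
    using group_hom.hom_inv[OF pt_hom_left[OF that(2)] that(1)] by simp
  have coset_minus: "coset (- x) = inv\<^bsub>TP\<^esub> (coset x)" if "x \<in> carrier FG" for x
  proof (rule TP.inv_equality[symmetric])
    have m: "- x \<in> carrier FG" using that by simp
    show "coset (- x) \<otimes>\<^bsub>TP\<^esub> coset x = \<one>\<^bsub>TP\<^esub>"
      using that unfolding coset_add[OF m that]
      by (simp add: coset_def tensor_product_def) (metis FG.coset_mult_one TR.subset one_free_Abelian_group)
  qed (use that in auto)
  obtain x where x: "x \<in> carrier FG" "W = coset x" using W TP_carrier by auto
  have "Q (coset x) \<and> Q (inv\<^bsub>TP\<^esub> (coset x))"
    using x(1)[unfolded carrier_free_Abelian_group_iff]
  proof (induction x rule: free_Abelian_group_induct[consumes 1, case_names 1 2 3])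
    case 1
    have "coset 0 = \<one>\<^bsub>TP\<^esub>"
      by (simp add: coset_def tensor_product_def) (metis FG.coset_mult_one TR.subset one_free_Abelian_group)
    then show ?case by (simp add: Q_def)
  next
    case (2 x y)
    then have c: "x \<in> carrier FG" "y \<in> carrier FG" "- y \<in> carrier FG" by auto
    have e: "coset (x - y) = coset x \<otimes>\<^bsub>TP\<^esub> inv\<^bsub>TP\<^esub> (coset y)"
      using coset_add[OF c(1,3)] coset_minus[OF c(2)] by simp
    have "inv\<^bsub>TP\<^esub> (coset (x - y)) = inv\<^bsub>TP\<^esub> (coset x) \<otimes>\<^bsub>TP\<^esub> coset y"
      unfolding e using c by (simp add: TP.inv_mult)
    then show ?case using 2 c e by (auto intro!: Q_mult)
  next
    case (3 ab)
    then show ?case by (cases ab) (auto simp: Q_pt inv_pt simp flip: pt_eq)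
  qed
  then have "P (\<one>\<^bsub>TP\<^esub> \<otimes>\<^bsub>TP\<^esub> W)" unfolding Q_def x(2) using one by blast
  then show ?thesis using W by simp
qed

text \<open>The map on the free abelian group kills the bilinearity relations and so factors through
  the quotient. Restricting it to the carrier meets the extensionality clause, and induction over
  pure tensors gives the uniqueness that \<open>tensor_lift\<close> asks for.\<close>

lemma tensor_lift_props:
  assumes G: "comm_group G"
    and f: "\<And>a b. a \<in> carrier A \<Longrightarrow> b \<in> carrier B \<Longrightarrow> f a b \<in> carrier G"
    and left: "\<And>a a' b. a \<in> carrier A \<Longrightarrow> a' \<in> carrier A \<Longrightarrow> b \<in> carrier B \<Longrightarrow>
                 f (a \<otimes>\<^bsub>A\<^esub> a') b = f a b \<otimes>\<^bsub>G\<^esub> f a' b"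
    and right: "\<And>a b b'. a \<in> carrier A \<Longrightarrow> b \<in> carrier B \<Longrightarrow> b' \<in> carrier B \<Longrightarrow>
                 f a (b \<otimes>\<^bsub>B\<^esub> b') = f a b \<otimes>\<^bsub>G\<^esub> f a b'"
  shows "tensor_lift A B G f \<in> hom TP G"
    and "\<And>a b. a \<in> carrier A \<Longrightarrow> b \<in> carrier B \<Longrightarrow> tensor_lift A B G f (pt a b) = f a b"
proof -
  interpret G: comm_group G by fact
  obtain h where h: "h \<in> hom FG G" "\<And>x. x \<in> carrier A \<times> carrier B \<Longrightarrow> h (frag_of x) = case_prod f x"
  proof -
    have "case_prod f ` (carrier A \<times> carrier B) \<subseteq> carrier G" using f by auto
    from G.free_Abelian_group_universal[OF this] show thesis using that by metis
  qed
  interpret h: group_hom FG G h by unfold_locales (rule h(1))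
  have hdiff: "h (x - y) = h x \<otimes>\<^bsub>G\<^esub> inv\<^bsub>G\<^esub> (h y)" if "x \<in> carrier FG" "y \<in> carrier FG" for x y
  proof -
    have "- y \<in> carrier FG" using that by simp
    then show ?thesis using h.hom_mult[OF that(1), of "- y"] h.hom_inv[OF that(2)] that by simp
  qed
  have rel: "h (x - y - z) = \<one>\<^bsub>G\<^esub>"
    if "x \<in> carrier FG" "y \<in> carrier FG" "z \<in> carrier FG" "h x = h y \<otimes>\<^bsub>G\<^esub> h z" for x y z
    using that by (simp only: hdiff frag_diff_closed)
      (metis G.inv_mult G.m_assoc G.m_closed G.inv_closed G.r_inv h.hom_closed)
  have "bilin_rels \<subseteq> kernel FG G h"
  proof
    fix r assume r: "r \<in> bilin_rels"
    then have "h r = \<one>\<^bsub>G\<^esub>"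
      unfolding bilin_rels_def by (elim UnE CollectE exE conjE) (simp only:, rule rel; simp add: h(2) left right)+
    then show "r \<in> kernel FG G h" using r bilin_rels_subset unfolding kernel_def by blast
  qed
  then have "TR \<subseteq> kernel FG G h"
    unfolding TR_eq by (rule FG.generate_subgroup_incl[OF _ h.subgroup_kernel])
  then obtain g where g: "g \<in> hom (FG Mod TR) G" "\<And>x. x \<in> carrier FG \<Longrightarrow> g (TR #>\<^bsub>FG\<^esub> x) = h x"
    using h.FactGroup_universal_kernel[OF normal_TR] by metis
  define k where "k = restrict g (carrier TP)"
  have k_hom: "k \<in> hom TP G"
    using g(1) TP.m_closed unfolding k_def tensor_product_def[symmetric] by (auto simp: hom_def)
  have k_pt: "k (pt a b) = f a b" if "a \<in> carrier A" "b \<in> carrier B" for a b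
  proof -
    have "pt a b \<in> carrier TP" using that by simp
    then show ?thesis using that g(2)[of "frag_of (a, b)"] h(2)[of "(a, b)"] by (simp add: k_def pure_tensor_def)
  qed
  have "tensor_lift A B G f = k"
    unfolding tensor_lift_def
  proof (rule the_equality)
    show "k \<in> hom TP G \<and> k \<in> extensional (carrier TP) \<and>
      (\<forall>a\<in>carrier A. \<forall>b\<in>carrier B. k (pt a b) = f a b)"
      using k_hom k_pt by (auto simp: k_def)
  next
    fix k' assume k': "k' \<in> hom TP G \<and> k' \<in> extensional (carrier TP) \<and>
      (\<forall>a\<in>carrier A. \<forall>b\<in>carrier B. k' (pt a b) = f a b)"
    interpret k: group_hom TP G k by unfold_locales (rule k_hom)
    interpret k': group_hom TP G k' by unfold_locales (use k' in simp)
    show "k' = k"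
    proof (rule extensionalityI)
      fix W assume "W \<in> carrier TP"
      then show "k' W = k W"
        by (induction W rule: tensor_induct) (use k' k_pt in auto)
    qed (use k' in \<open>auto simp: k_def\<close>)
  qed
  then show "tensor_lift A B G f \<in> hom TP G"
    "\<And>a b. a \<in> carrier A \<Longrightarrow> b \<in> carrier B \<Longrightarrow> tensor_lift A B G f (pt a b) = f a b"
    using k_hom k_pt by auto
qed

definition tsum where "tsum I a u = finprod TP (\<lambda>i. pt (a i) (u i)) I"

lemma tsum_closed [simp]: "(\<forall>i\<in>I. a i \<in> carrier A) \<Longrightarrow> (\<forall>i\<in>I. u i \<in> carrier B) \<Longrightarrow> tsum I a u \<in> carrier TP"
  unfolding tsum_def by (intro TP.finprod_closed) auto

lemma tsum_insert:
  "finite I \<Longrightarrow> i \<notin> I \<Longrightarrow> (\<forall>i\<in>insert i I. a i \<in> carrier A) \<Longrightarrow> (\<forall>i\<in>insert i I. u i \<in> carrier B) \<Longrightarrow>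
    tsum (insert i I) a u = pt (a i) (u i) \<otimes>\<^bsub>TP\<^esub> tsum I a u"
  unfolding tsum_def by (subst TP.finprod_insert) auto

lemma tsum_cong:
  "(\<And>i. i \<in> I \<Longrightarrow> a i = a' i \<and> u i = u' i) \<Longrightarrow> (\<forall>i\<in>I. a i \<in> carrier A) \<Longrightarrow> (\<forall>i\<in>I. u i \<in> carrier B) \<Longrightarrow> tsum I a u = tsum I a' u'"
  unfolding tsum_def by (rule TP.finprod_cong') auto

text \<open>An elementary operation on a sum of two terms: multiplying the second unit by u^s is
  compensated by subtracting s times a' from the first coefficient.\<close>

lemma tensor_exchange:
  assumes a: "a \<in> carrier A" "a' \<in> carrier A" and u: "u \<in> carrier B" "u' \<in> carrier B"
  shows "pt (a \<otimes>\<^bsub>A\<^esub> a' [^]\<^bsub>A\<^esub> (- s :: int)) u \<otimes>\<^bsub>TP\<^esub> pt a' (u' \<otimes>\<^bsub>B\<^esub> u [^]\<^bsub>B\<^esub> s) = pt a u \<otimes>\<^bsub>TP\<^esub> pt a' u'"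
proof -
  interpret l: group_hom A TP "\<lambda>a. pt a u" by (rule pt_hom_left) fact
  interpret r: group_hom B TP "pt a'" by (rule pt_hom_right) fact
  have "pt (a' [^]\<^bsub>A\<^esub> (- s)) u = pt a' u [^]\<^bsub>TP\<^esub> (- s)" "pt a' (u [^]\<^bsub>B\<^esub> s) = pt a' u [^]\<^bsub>TP\<^esub> s"
    using l.hom_int_pow[of a' "- s"] r.hom_int_pow[of u s] a u by auto
  moreover have "x \<otimes>\<^bsub>TP\<^esub> inv\<^bsub>TP\<^esub> z \<otimes>\<^bsub>TP\<^esub> (y \<otimes>\<^bsub>TP\<^esub> z) = x \<otimes>\<^bsub>TP\<^esub> y"
    if "x \<in> carrier TP" "y \<in> carrier TP" "z \<in> carrier TP" for x y z
  proof -
    have "x \<otimes>\<^bsub>TP\<^esub> inv\<^bsub>TP\<^esub> z \<otimes>\<^bsub>TP\<^esub> (y \<otimes>\<^bsub>TP\<^esub> z) = x \<otimes>\<^bsub>TP\<^esub> y \<otimes>\<^bsub>TP\<^esub> (z \<otimes>\<^bsub>TP\<^esub> inv\<^bsub>TP\<^esub> z)"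
      by (simp only: TP.m_ac TP.m_closed TP.inv_closed that)
    then show ?thesis using that by simp
  qed
  ultimately show ?thesis
    using a u by (simp add: pt_mult_left pt_mult_right TP.int_pow_neg)
qed

text \<open>The separate term in c, later the torsion unit -1, absorbs torsion without being counted
  in n. A minimal n can then be played off against any multiplicative relation.\<close>

definition trep where
  "trep c n W \<longleftrightarrow> (\<exists>(I :: nat set) a u d. finite I \<and> card I = n \<and> (\<forall>i\<in>I. a i \<in> carrier A) \<and>
    (\<forall>i\<in>I. u i \<in> carrier B) \<and> d \<in> carrier A \<and> W = tsum I a u \<otimes>\<^bsub>TP\<^esub> pt d c)"

lemma trepI:
  "finite (I :: nat set) \<Longrightarrow> \<forall>i\<in>I. a i \<in> carrier A \<Longrightarrow> \<forall>i\<in>I. u i \<in> carrier B \<Longrightarrow> d \<in> carrier A \<Longrightarrow>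
    W = tsum I a u \<otimes>\<^bsub>TP\<^esub> pt d c \<Longrightarrow> trep c (card I) W"
  unfolding trep_def by (rule exI[of _ I], rule exI[of _ a], rule exI[of _ u], rule exI[of _ d]) simp

lemma trep_mult:
  assumes "trep c n W" "d \<in> carrier A" "c \<in> carrier B"
  shows "trep c n (W \<otimes>\<^bsub>TP\<^esub> pt d c)"
proof -
  obtain I :: "nat set" and a u d' where I: "finite I" "card I = n" "\<forall>i\<in>I. a i \<in> carrier A"
      "\<forall>i\<in>I. u i \<in> carrier B" "d' \<in> carrier A" "W = tsum I a u \<otimes>\<^bsub>TP\<^esub> pt d' c"
    using assms(1) unfolding trep_def by metis
  have "W \<otimes>\<^bsub>TP\<^esub> pt d c = tsum I a u \<otimes>\<^bsub>TP\<^esub> pt (d' \<otimes>\<^bsub>A\<^esub> d) c"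
    using I(3-6) assms by (simp add: pt_mult_left TP.m_assoc)
  from trepI[OF I(1,3,4) _ this] show ?thesis using I(2,5) assms by simp
qed

text \<open>A Euclidean algorithm on the exponents of the relation. While two are nonzero, an
  exchange lowers the sum of their absolute values; when one is left, its unit is torsion and its
  term is absorbed into c.\<close>

lemma tensor_reduce:
  assumes tors: "\<forall>v\<in>carrier B. \<forall>k::int. k \<noteq> 0 \<longrightarrow> v [^]\<^bsub>B\<^esub> k = \<one>\<^bsub>B\<^esub> \<longrightarrow> v = \<one>\<^bsub>B\<^esub> \<or> v = c"
    and c: "c \<in> carrier B" and I: "finite (I :: nat set)"
    and "(\<forall>i\<in>I. a i \<in> carrier A)" "(\<forall>i\<in>I. u i \<in> carrier B)"
    and "finprod B (\<lambda>i. u i [^]\<^bsub>B\<^esub> (e i :: int)) I = \<one>\<^bsub>B\<^esub>" "\<exists>i\<in>I. e i \<noteq> 0"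
  shows "\<exists>n<card I. trep c n (tsum I a u)"
  using assms(4-)
proof (induction "nat (\<Sum>i\<in>I. \<bar>e i\<bar>)" arbitrary: a u e rule: less_induct)
  case less
  show ?case
  proof (cases "\<exists>i\<in>I. \<exists>j\<in>I. i \<noteq> j \<and> e i \<noteq> 0 \<and> e j \<noteq> 0")
    case True
    then obtain i0 j0 where ij0: "i0 \<in> I" "j0 \<in> I" "i0 \<noteq> j0" "e i0 \<noteq> 0" "e j0 \<noteq> 0" by blast
    obtain i j where ij: "i \<in> I" "j \<in> I" "i \<noteq> j" "e j \<noteq> 0" "\<bar>e i\<bar> \<ge> \<bar>e j\<bar>"
    proof (cases "\<bar>e i0\<bar> \<ge> \<bar>e j0\<bar>")
      case True
      then show ?thesis using that[of i0 j0] ij0 by simp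
    next
      case False
      then show ?thesis using that[of j0 i0] ij0 by simp
    qed
    \<comment> \<open>As e i is at least as large as e j in absolute value, this sign makes e i - s
      * e j smaller in absolute value by exactly that of e j.\<close>
    define s where "s = sgn (e i * e j)"
    have ei: "e i \<noteq> 0" using ij by auto
    have s: "\<bar>e i - s * e j\<bar> = \<bar>e i\<bar> - \<bar>e j\<bar>"
      using ij ei unfolding s_def by (cases "e i > 0"; cases "e j > 0") (auto simp: sgn_mult)
    define J where "J = I - {i, j}"
    have J: "I = insert i (insert j J)" "i \<notin> insert j J" "j \<notin> J" "finite J"
      using ij I by (auto simp: J_def)
    define a' where "a' = a(i := a i \<otimes>\<^bsub>A\<^esub> a j [^]\<^bsub>A\<^esub> (- s))"
    define u' where "u' = u(j := u j \<otimes>\<^bsub>B\<^esub> u i [^]\<^bsub>B\<^esub> s)"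
    define e' where "e' = e(i := e i - s * e j)"
    have ac: "a i \<in> carrier A" "a j \<in> carrier A" "u i \<in> carrier B" "u j \<in> carrier B"
      "(\<forall>i\<in>J. a i \<in> carrier A)" "(\<forall>i\<in>J. u i \<in> carrier B)"
      using less.prems ij J_def by auto
    have a': "(\<forall>i\<in>I. a' i \<in> carrier A)" and u': "(\<forall>i\<in>I. u' i \<in> carrier B)"
      using less.prems ij by (auto simp: a'_def u'_def)
    have JJ: "tsum J a' u' = tsum J a u"
      by (rule tsum_cong[symmetric]) (use ac J in \<open>auto simp: a'_def u'_def\<close>)
    have eqS: "tsum I a u = tsum I a' u'"
    proof -
      have "tsum I a' u' = pt (a' i) (u' i) \<otimes>\<^bsub>TP\<^esub> (pt (a' j) (u' j) \<otimes>\<^bsub>TP\<^esub> tsum J a' u')"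
        using a' u' J by (simp add: tsum_insert)
      also have "\<dots> = (pt (a' i) (u' i) \<otimes>\<^bsub>TP\<^esub> pt (a' j) (u' j)) \<otimes>\<^bsub>TP\<^esub> tsum J a u"
        unfolding JJ using a' u' ac J by (simp add: TP.m_assoc)
      also have "pt (a' i) (u' i) \<otimes>\<^bsub>TP\<^esub> pt (a' j) (u' j) = pt (a i) (u i) \<otimes>\<^bsub>TP\<^esub> pt (a j) (u j)"
        using ij tensor_exchange[OF ac(1,2,3,4), of s] by (simp add: a'_def u'_def)
      also have "\<dots> \<otimes>\<^bsub>TP\<^esub> tsum J a u = tsum I a u"
        using less.prems ac J by (simp add: tsum_insert TP.m_assoc)
      finally show ?thesis by simp
    qed
    have rel: "finprod B (\<lambda>i. u' i [^]\<^bsub>B\<^esub> e' i) I = \<one>\<^bsub>B\<^esub>"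
    proof -
      define R where "R = finprod B (\<lambda>i. u i [^]\<^bsub>B\<^esub> e i) J"
      have R: "R \<in> carrier B" unfolding R_def using ac by (intro B.finprod_closed) auto
      have RR: "finprod B (\<lambda>i. u' i [^]\<^bsub>B\<^esub> e' i) J = R"
        unfolding R_def by (rule B.finprod_cong') (use ac J in \<open>auto simp: u'_def e'_def\<close>)
      have "finprod B (\<lambda>i. u' i [^]\<^bsub>B\<^esub> e' i) I = u' i [^]\<^bsub>B\<^esub> e' i \<otimes>\<^bsub>B\<^esub> (u' j [^]\<^bsub>B\<^esub> e' j \<otimes>\<^bsub>B\<^esub> R)"
        unfolding RR[symmetric] J(1)
        by (subst B.finprod_insert; (subst B.finprod_insert)?) (use u' J in auto)
      also have "\<dots> = u i [^]\<^bsub>B\<^esub> (e i - s * e j) \<otimes>\<^bsub>B\<^esub> ((u j \<otimes>\<^bsub>B\<^esub> u i [^]\<^bsub>B\<^esub> s) [^]\<^bsub>B\<^esub> e j \<otimes>\<^bsub>B\<^esub> R)"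
        using ij by (simp add: u'_def e'_def)
      also have "\<dots> = u i [^]\<^bsub>B\<^esub> e i \<otimes>\<^bsub>B\<^esub> (u j [^]\<^bsub>B\<^esub> e j \<otimes>\<^bsub>B\<^esub> R)"
      proof -
        have "x \<otimes>\<^bsub>B\<^esub> inv\<^bsub>B\<^esub> z \<otimes>\<^bsub>B\<^esub> (y \<otimes>\<^bsub>B\<^esub> z \<otimes>\<^bsub>B\<^esub> R) = x \<otimes>\<^bsub>B\<^esub> (y \<otimes>\<^bsub>B\<^esub> R)"
          if "x \<in> carrier B" "y \<in> carrier B" "z \<in> carrier B" for x y z
        proof -
          have "x \<otimes>\<^bsub>B\<^esub> inv\<^bsub>B\<^esub> z \<otimes>\<^bsub>B\<^esub> (y \<otimes>\<^bsub>B\<^esub> z \<otimes>\<^bsub>B\<^esub> R) = x \<otimes>\<^bsub>B\<^esub> (y \<otimes>\<^bsub>B\<^esub> R) \<otimes>\<^bsub>B\<^esub> (z \<otimes>\<^bsub>B\<^esub> inv\<^bsub>B\<^esub> z)"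
            by (simp only: B.m_ac B.m_closed B.inv_closed that R)
          then show ?thesis using that R by simp
        qed
        then show ?thesis
          using ac by (simp add: B.int_pow_distrib B.int_pow_pow B.int_pow_diff)
      qed
      also have "\<dots> = finprod B (\<lambda>i. u i [^]\<^bsub>B\<^esub> e i) I"
        unfolding R_def J(1)
        by (subst B.finprod_insert; (subst B.finprod_insert)?) (use ac J in auto)
      finally show ?thesis using less.prems by simp
    qed
    have smaller: "nat (\<Sum>i\<in>I. \<bar>e' i\<bar>) < nat (\<Sum>i\<in>I. \<bar>e i\<bar>)"
    proof -
      have "(\<Sum>i\<in>I. \<bar>e' i\<bar>) < (\<Sum>i\<in>I. \<bar>e i\<bar>)"
        by (rule sum_strict_mono_ex1[OF I]) (use s ij in \<open>auto simp: e'_def intro!: bexI[of _ i]\<close>)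
      moreover have "(\<Sum>i\<in>I. \<bar>e' i\<bar>) \<ge> 0" by (rule sum_nonneg) simp
      ultimately show ?thesis by linarith
    qed
    have "\<exists>i\<in>I. e' i \<noteq> 0" using ij by (intro bexI[of _ j]) (auto simp: e'_def)
    from less.hyps[OF smaller a' u' rel this] show ?thesis unfolding eqS .
  next
    case False
    obtain i where i: "i \<in> I" "e i \<noteq> 0" using less.prems by blast
    define J where "J = I - {i}"
    have J: "I = insert i J" "i \<notin> J" "finite J" using i I by (auto simp: J_def)
    have ac: "a i \<in> carrier A" "u i \<in> carrier B" "(\<forall>i\<in>J. a i \<in> carrier A)" "(\<forall>i\<in>J. u i \<in> carrier B)"
      using less.prems J by auto
    have z: "e j = 0" if "j \<in> J" for j using False i that J by auto
    have "finprod B (\<lambda>i. u i [^]\<^bsub>B\<^esub> e i) J = \<one>\<^bsub>B\<^esub>"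
      by (rule B.finprod_one_eqI) (simp add: z)
    then have "u i [^]\<^bsub>B\<^esub> e i = \<one>\<^bsub>B\<^esub>"
      using less.prems(3) ac J by (simp add: B.finprod_insert Pi_def)
    then have "u i = \<one>\<^bsub>B\<^esub> \<or> u i = c" using tors ac(2) i(2) by blast
    then obtain d where d: "d \<in> carrier A" "pt (a i) (u i) = pt d c"
    proof
      assume "u i = \<one>\<^bsub>B\<^esub>"
      then have "pt (a i) (u i) = pt \<one>\<^bsub>A\<^esub> c"
        using group_hom.hom_one[OF pt_hom_left[OF c]] group_hom.hom_one[OF pt_hom_right[OF ac(1)]] by simp
      then show thesis using that[of "\<one>\<^bsub>A\<^esub>"] by simp
    qed (use that[of "a i"] ac in auto)
    have "tsum I a u = tsum J a u \<otimes>\<^bsub>TP\<^esub> pt d c"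
      using J ac d less.prems(1,2) c by (simp add: tsum_insert TP.m_comm)
    note W = this
    have cJ: "card J < card I" using J by simp
    from trepI[OF J(3) ac(3,4) d(1) W] cJ show ?thesis by blast
  qed
qed

text \<open>Among all representations one with the fewest terms is taken; a relation between its
  units would allow \<open>tensor_reduce\<close> to shorten it. Finite generation of B is not
  assumed.\<close>

lemma tensor_representation:
  assumes tors: "\<forall>v\<in>carrier B. \<forall>k::int. k \<noteq> 0 \<longrightarrow> v [^]\<^bsub>B\<^esub> k = \<one>\<^bsub>B\<^esub> \<longrightarrow> v = \<one>\<^bsub>B\<^esub> \<or> v = c"
    and c: "c \<in> carrier B" and W: "W \<in> carrier TP"
  obtains I :: "nat set" and a u d where "finite I" "(\<forall>i\<in>I. a i \<in> carrier A)" "(\<forall>i\<in>I. u i \<in> carrier B)" "d \<in> carrier A"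
    "W = tsum I a u \<otimes>\<^bsub>TP\<^esub> pt d c"
    "\<forall>e :: nat \<Rightarrow> int. finprod B (\<lambda>i. u i [^]\<^bsub>B\<^esub> e i) I = \<one>\<^bsub>B\<^esub> \<longrightarrow> (\<forall>i\<in>I. e i = 0)"
proof -
  have "\<exists>(I :: nat set) a u. finite I \<and> (\<forall>i\<in>I. a i \<in> carrier A) \<and> (\<forall>i\<in>I. u i \<in> carrier B) \<and> W = tsum I a u"
    using W
  proof (induction W rule: tensor_induct)
    case unit
    show ?case by (rule exI[of _ "{}"]) (simp add: tsum_def)
  next
    case (pure Y b v)
    then obtain I a u where I: "finite (I :: nat set)" "(\<forall>i\<in>I. a i \<in> carrier A)" "(\<forall>i\<in>I. u i \<in> carrier B)" "Y = tsum I a u"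
      by blast
    obtain i where i: "i \<notin> I" using ex_new_if_finite[OF infinite_UNIV_nat I(1)] by blast
    have f: "\<forall>j\<in>insert i I. (a(i := b)) j \<in> carrier A" "\<forall>j\<in>insert i I. (u(i := v)) j \<in> carrier B"
      using I pure by auto
    have "tsum I (a(i := b)) (u(i := v)) = Y"
      unfolding I(4) by (rule tsum_cong[symmetric]) (use I i in auto)
    then have "Y \<otimes>\<^bsub>TP\<^esub> pt b v = tsum (insert i I) (a(i := b)) (u(i := v))"
      unfolding tsum_insert[OF I(1) i f]
      using TP.m_comm[of Y "pt b v"] pure by fastforce
    then show ?case using f I(1) by (intro exI[of _ "insert i I"]) blast
  qed
  then obtain I :: "nat set" and a u where I: "finite I" "(\<forall>i\<in>I. a i \<in> carrier A)" "(\<forall>i\<in>I. u i \<in> carrier B)" "W = tsum I a u"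
    by blast
  have "W = tsum I a u \<otimes>\<^bsub>TP\<^esub> pt \<one>\<^bsub>A\<^esub> c"
    using I group_hom.hom_one[OF pt_hom_left[OF c]] by simp
  then have r: "trep c (card I) W" using trepI[OF I(1,2,3), of "\<one>\<^bsub>A\<^esub>"] by simp
  define n where "n = (LEAST n. trep c n W)"
  have n: "trep c n W" "\<And>m. trep c m W \<Longrightarrow> n \<le> m"
    unfolding n_def using r by (auto intro: LeastI Least_le)
  from n(1) obtain I :: "nat set" and a u d where I: "finite I" "card I = n" "\<forall>i\<in>I. a i \<in> carrier A"
      "\<forall>i\<in>I. u i \<in> carrier B" "d \<in> carrier A" "W = tsum I a u \<otimes>\<^bsub>TP\<^esub> pt d c"
    unfolding trep_def by metis
  have "\<forall>i\<in>I. e i = 0" if e: "finprod B (\<lambda>i. u i [^]\<^bsub>B\<^esub> e i) I = \<one>\<^bsub>B\<^esub>" for e :: "nat \<Rightarrow> int"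
  proof (rule ccontr)
    assume "\<not> (\<forall>i\<in>I. e i = 0)"
    then have nz: "\<exists>i\<in>I. e i \<noteq> 0" by blast
    have "\<exists>m<card I. trep c m (tsum I a u)"
      by (rule tensor_reduce[where e = e]) (fact tors c I e nz)+
    then obtain m where "m < card I" "trep c m (tsum I a u)" by auto
    then show False using trep_mult[OF _ I(5) c, of m "tsum I a u"] n(2)[of m] I(2,6) by simp
  qed
  then show thesis using that[OF I(1,3,4,5,6)] by simp
qed

end

section \<open>A criterion for the Leopoldt condition\<close>

lemma algebraic_int_power_relation:
  fixes x :: "'a :: field_char_0"
  assumes "algebraic_int x"
  obtains d a where "d > 0" "x ^ d = (\<Sum>i<d. of_int (a i) * x ^ i)"
proof -
  obtain q where q: "poly (map_poly of_int q) x = 0" "lead_coeff q = (1 :: int)"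
    using assms unfolding algebraic_int_altdef_ipoly by blast
  define d where "d = degree q"
  have dpos: "d > 0"
  proof (rule ccontr)
    assume "\<not> d > 0"
    then have "q = [:1:]" using q(2) by (metis d_def degree_eq_zeroE gr0I lead_coeff_pCons(2))
    then show False using q(1) by (simp add: map_poly_pCons)
  qed
  have "degree (map_poly of_int q :: 'a poly) = d" by (simp add: d_def degree_map_poly)
  then have "0 = (\<Sum>i\<le>d. of_int (coeff q i) * x ^ i)"
    using q(1) by (simp add: poly_altdef coeff_map_poly)
  also have "\<dots> = (\<Sum>i<d. of_int (coeff q i) * x ^ i) + x ^ d"
    using q(2) by (simp add: d_def flip: lessThan_Suc_atMost)
  finally have "x ^ d = - (\<Sum>i<d. of_int (coeff q i) * x ^ i)"
    by (simp add: eq_neg_iff_add_eq_0 add.commute)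
  also have "\<dots> = (\<Sum>i<d. of_int (- coeff q i) * x ^ i)" by (simp add: sum_negf)
  finally show ?thesis using that[OF dpos, of "\<lambda>i. - coeff q i"] by simp
qed

text \<open>One d serves for all powers. Hence the coefficient vectors modulo p form a finite set,
  which is the input to the pigeonhole argument in \<open>unit_power_close_1\<close>.\<close>

lemma algebraic_int_powers_finite_rank:
  fixes x :: "'a :: field_char_0"
  assumes "algebraic_int x"
  obtains d where "\<And>n. \<exists>c :: nat \<Rightarrow> int. x ^ n = (\<Sum>i<d. of_int (c i) * x ^ i)"
proof -
  obtain d a where d: "d > 0" "x ^ d = (\<Sum>i<d. of_int (a i) * x ^ i)"
    using algebraic_int_power_relation[OF assms] .
  obtain e where e: "d = Suc e" using d(1) gr0_conv_Suc by blast
  have "\<exists>c :: nat \<Rightarrow> int. x ^ n = (\<Sum>i<d. of_int (c i) * x ^ i)" for n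
  proof (induction n)
    case 0
    have "(\<Sum>i<d. of_int (if i = 0 then 1 else 0) * x ^ i) = (\<Sum>i<d. if i = 0 then 1 else 0)"
      by (rule sum.cong) auto
    also have "\<dots> = 1" using d(1) by simp
    finally have "x ^ 0 = (\<Sum>i<d. of_int (if i = 0 then 1 else 0) * x ^ i)" by simp
    then show ?case by (rule exI[of _ "\<lambda>i. if i = 0 then 1 else 0"])
  next
    case (Suc n)
    then obtain c :: "nat \<Rightarrow> int" where c: "x ^ n = (\<Sum>i<d. of_int (c i) * x ^ i)" by blast
    \<comment> \<open>Multiplication by x shifts the coefficients, and the overflowing top
      coefficient c e is fed back through the relation for x^d.\<close>
    define c' where "c' i = (case i of 0 \<Rightarrow> 0 | Suc j \<Rightarrow> c j) + c e * a i" for i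
    have "(\<Sum>i<d. of_int (case i of 0 \<Rightarrow> 0 | Suc j \<Rightarrow> c j) * x ^ i) = (\<Sum>i<e. of_int (c i) * x ^ Suc i)"
      unfolding e by (subst sum.lessThan_Suc_shift) simp
    moreover have "(\<Sum>i<d. of_int (c e * a i) * x ^ i) = of_int (c e) * x ^ d"
      unfolding d(2) by (simp add: sum_distrib_left mult.assoc)
    moreover have "x ^ Suc n = (\<Sum>i<d. of_int (c i) * x ^ Suc i)"
      by (simp add: c sum_distrib_left mult_ac)
    ultimately have "x ^ Suc n = (\<Sum>i<d. of_int (c' i) * x ^ i)"
      by (simp add: c'_def distrib_right sum.distrib e)
    then show ?case by blast
  qed
  then show ?thesis using that by blast
qed

context valued_field
begin

text \<open>If w x > 1, then x^d is an integral combination of lower powers, all of value at most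
  that of x^(d-1), which is too small.\<close>

lemma abs_algebraic_int_le_1: assumes "x \<in> E" "algebraic_int x" shows "w x \<le> 1"
proof (rule ccontr)
  assume "\<not> w x \<le> 1"
  then have g: "w x > 1" by simp
  obtain d a where d: "d > 0" "x ^ d = (\<Sum>i<d. of_int (a i) * x ^ i)"
    using algebraic_int_power_relation[OF assms(2)] .
  have "w (x ^ d) \<le> w x ^ (d - 1)"
    unfolding d(2)
  proof (rule abs_sum_le)
    fix i assume "i \<in> {..<d}"
    then have "w x ^ i \<le> w x ^ (d - 1)" using g by (intro power_increasing) auto
    then have "w (of_int (a i)) * w x ^ i \<le> 1 * w x ^ (d - 1)"
      using abs_of_int_le_1[of "a i"] g by (intro mult_mono) auto
    then show "of_int (a i) * x ^ i \<in> E \<and> w (of_int (a i) * x ^ i) \<le> w x ^ (d - 1)"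
      using assms(1) by (simp add: abs_mult abs_power mult_mem power_mem)
  qed (use g in simp)
  moreover have "w x ^ (d - 1) < w x ^ d" using g d(1) by (intro power_strict_increasing) auto
  ultimately show False by (simp add: abs_power assms(1))
qed

lemma abs_unit:
  assumes "x \<in> E" "algebraic_int x" "algebraic_int (inverse x)" "x \<noteq> 0" shows "w x = 1"
proof -
  have "w x \<le> 1" "w (inverse x) \<le> 1" using assms by (auto intro!: abs_algebraic_int_le_1 inverse_mem)
  then have "inverse (w x) \<le> 1" by (simp add: abs_inverse assms(1))
  moreover have "w x > 0" using abs_nonneg[OF assms(1)] abs_eq_0[OF assms(1)] assms(4) by linarith
  ultimately show ?thesis using \<open>w x \<le> 1\<close> by (simp add: inverse_le_1_iff)
qed

text \<open>The middle binomial coefficients of (z + 1)^p are divisible by p, so y^p - 1 and z^p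
  with z = y - 1 agree up to value 1/p. In other words, the residue field has no element of order
  p.\<close>

lemma abs_frobenius: assumes "y \<in> E" "w y \<le> 1" "w (y ^ p - 1) < 1" shows "w (y - 1) < 1"
proof -
  define z where "z = y - 1"
  have z: "z \<in> E" using assms by (simp add: z_def diff_mem)
  have wz: "w z \<le> 1" using abs_diff_le[of y 1] assms unfolding z_def by (simp add: max_def split: if_splits)
  obtain p' where p': "p = Suc p'" using p_gt_1 by (cases p) auto
  define S where "S = (\<Sum>k=1..<p. of_nat (p choose k) * z ^ k)"
  have "y ^ p = (z + 1) ^ p" by (simp add: z_def)
  also have "\<dots> = (\<Sum>k\<le>p. of_nat (p choose k) * z ^ k)" by (simp add: binomial_ring)
  also have "{..p} = insert 0 (insert p {1..<p})" using p_gt_1 by auto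
  also have "(\<Sum>k\<in>\<dots>. of_nat (p choose k) * z ^ k) = 1 + (z ^ p + S)"
    using p_gt_1 by (subst sum.insert; (subst sum.insert)?) (auto simp: S_def)
  finally have e: "z ^ p = (y ^ p - 1) - S" by simp
  have SE: "S \<in> E" unfolding S_def by (intro sum_mem mem_intros z of_nat_mem)
  have "w S \<le> 1 / real p"
    unfolding S_def
  proof (rule abs_sum_le)
    fix k assume k: "k \<in> {1..<p}"
    have "p dvd (p choose k)" using k prime_p by (intro dvd_choose_prime) auto
    then have "w (of_int (int (p choose k))) \<le> (1 / real p) ^ 1"
      by (subst abs_of_int_le_power_iff) auto
    then have "w (of_nat (p choose k)) * w z ^ k \<le> (1 / real p) * 1"
      using wz z by (intro mult_mono power_le_one) auto
    then show "of_nat (p choose k) * z ^ k \<in> E \<and> w (of_nat (p choose k) * z ^ k) \<le> 1 / real p"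
      using z by (simp add: abs_mult abs_power mult_mem power_mem)
  qed simp
  then have "w S < 1" using p_inv(2) by linarith
  then have "max (w (y ^ p - 1)) (w S) < 1" using assms(3) by simp
  moreover have "w (z ^ p) \<le> max (w (y ^ p - 1)) (w S)"
    unfolding e by (intro abs_diff_le mem_intros assms SE one_mem)
  ultimately have "w (z ^ p) < 1" by linarith
  then have "w z < 1"
    using z p_gt_1 by (simp add: abs_power power_less_one_iff)
  then show ?thesis by (simp add: z_def)
qed

text \<open>Two powers of x have the same coefficients modulo p, so some x^M is close to 1. The
  least such M is prime to p, since \<open>abs_frobenius\<close> would otherwise allow division by
  p. This replaces finiteness of the residue field.\<close>

lemma unit_power_close_1:
  assumes x: "x \<in> E" "algebraic_int x" "w x = 1"
  obtains M where "M > 0" "coprime M p" "w (x ^ M - 1) < 1"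
proof -
  obtain d where d: "\<And>n. \<exists>c :: nat \<Rightarrow> int. x ^ n = (\<Sum>i<d. of_int (c i) * x ^ i)"
    using algebraic_int_powers_finite_rank[OF x(2)] by metis
  then obtain c :: "nat \<Rightarrow> nat \<Rightarrow> int" where c: "\<And>n. x ^ n = (\<Sum>i<d. of_int (c n i) * x ^ i)" by metis
  define g where "g n = (\<lambda>i\<in>{..<d}. c n i mod int p)" for n
  have "range g \<subseteq> (\<Pi>\<^sub>E i\<in>{..<d}. {0..<int p})" using p_gt_1 by (auto simp: g_def)
  then have "finite (range g)" by (rule finite_subset) (auto intro: finite_PiE)
  then have "\<not> inj g" using finite_imageD infinite_UNIV_nat by blast
  then obtain n0 m0 where nm0: "n0 \<noteq> m0" "g n0 = g m0" by (auto simp: inj_def)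
  define n m where "n = min n0 m0" and "m = max n0 m0"
  have nm: "n < m" "g n = g m" using nm0 by (auto simp: n_def m_def min_def max_def)
  have "x ^ m - x ^ n = (\<Sum>i<d. of_int (c m i - c n i) * x ^ i)"
    unfolding c[of m] c[of n] by (simp add: sum_subtractf left_diff_distrib)
  also have "w \<dots> \<le> 1 / real p"
  proof (rule abs_sum_le)
    fix i assume i: "i \<in> {..<d}"
    have "c n i mod int p = c m i mod int p" using fun_cong[OF nm(2), of i] i by (simp add: g_def)
    then have "int p ^ 1 dvd c m i - c n i" by (simp add: mod_eq_dvd_iff dvd_diff_commute)
    then have "w (of_int (c m i - c n i)) \<le> (1 / real p) ^ 1" by (subst abs_of_int_le_power_iff)
    moreover have "w (of_int (c m i - c n i) * x ^ i) = w (of_int (c m i - c n i))"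
      unfolding abs_mult[OF of_int_mem power_mem[OF x(1)]] by (simp add: abs_power x)
    ultimately show "of_int (c m i - c n i) * x ^ i \<in> E \<and> w (of_int (c m i - c n i) * x ^ i) \<le> 1 / real p"
      using mult_mem[OF of_int_mem power_mem[OF x(1)]] by (simp only: power_one_right simp_thms)
  qed simp
  finally have "w (x ^ m - x ^ n) < 1" using p_inv(2) by linarith
  moreover have "x ^ m - x ^ n = x ^ n * (x ^ (m - n) - 1)"
    using nm by (simp add: algebra_simps flip: power_add)
  ultimately have l: "w (x ^ (m - n) - 1) < 1"
    using x by (simp add: abs_mult abs_power power_mem diff_mem)
  define P where "P M \<longleftrightarrow> M > 0 \<and> w (x ^ M - 1) < 1" for M :: nat
  have "P (m - n)" using l nm by (simp add: P_def)
  define M where "M = (LEAST M. P M)"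
  have M: "P M" "\<And>k. P k \<Longrightarrow> M \<le> k" unfolding M_def using \<open>P (m - n)\<close> by (auto intro: LeastI Least_le)
  have "coprime M p"
  proof (rule ccontr)
    assume "\<not> coprime M p"
    then have "p dvd M" using prime_p by (metis coprime_commute prime_imp_coprime)
    then obtain k where k: "M = k * p" by (metis dvd_div_mult_self)
    have "w (x ^ k - 1) < 1"
      by (rule abs_frobenius) (use M(1) x in \<open>auto simp: P_def k power_mult power_mem abs_power\<close>)
    moreover have "k > 0" using M(1) by (auto simp: P_def k)
    ultimately have "M \<le> k" using M(2)[of k] by (simp add: P_def)
    then show False using k p_gt_1 \<open>k > 0\<close> by simp
  qed
  then show ?thesis using M(1) that by (auto simp: P_def)
qed

end

text \<open>Dividing by a fixed a costs only the fixed power of p contained in a.\<close>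

lemma padic_null_cancel:
  assumes "padic_null p (\<lambda>n. a * c n)" "a \<noteq> 0" "Factorial_Ring.prime p"
  shows "padic_null p c"
  unfolding padic_null_def
proof
  fix m
  define k where "k = multiplicity (int p) a"
  obtain b where b: "a = int p ^ k * b" "\<not> int p dvd b"
    using multiplicity_decompose'[of a "int p"] assms(2) prime_gt_1_nat[OF assms(3)] unfolding k_def by auto
  have cop: "coprime (int p ^ j) b" for j
    using b(2) assms(3) by (metis coprime_power_left_iff prime_imp_coprime prime_nat_int_transfer)
  obtain N where N: "\<forall>n\<ge>N. int p ^ (k + m) dvd a * c n" using assms(1) unfolding padic_null_def by blast
  have "int p ^ m dvd c n" if "n \<ge> N" for n
  proof -
    have "int p ^ k * int p ^ m dvd int p ^ k * (b * c n)" using N that by (simp add: b(1) power_add mult_ac)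
    then have "int p ^ m dvd b * c n" using prime_gt_1_nat[OF assms(3)] by simp
    then show ?thesis using cop by (simp add: coprime_dvd_mult_right_iff)
  qed
  then show "\<exists>N. \<forall>n\<ge>N. int p ^ m dvd c n" by blast
qed

text \<open>With h the exponents, c = h c - c (h - 1), and h - 1 is null.\<close>

lemma padic_null_teich_cancel:
  assumes "padic_null p (\<lambda>n. teich_exp p n * c n)" shows "padic_null p c"
proof -
  have "padic_null p (\<lambda>n. c n * (teich_exp p n - 1))" by (rule padic_null_mult[OF teich_exp_cong])
  from padic_null_diff[OF assms this] show ?thesis by (simp add: algebra_simps)
qed

text \<open>Divisibility is requested one power higher because for p = 2 halving loses one factor of
  p.\<close>

lemma padic_cauchy_halve:
  assumes "padic_cauchy p (\<lambda>n. 2 * c n)" "Factorial_Ring.prime p" shows "padic_cauchy p c"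
  unfolding padic_cauchy_def
proof
  fix m
  obtain N where N: "\<forall>a\<ge>N. \<forall>b\<ge>N. int p ^ Suc m dvd 2 * c a - 2 * c b"
    using assms(1) unfolding padic_cauchy_def by blast
  have "int p ^ m dvd c a - c b" if "a \<ge> N" "b \<ge> N" for a b
  proof -
    have d: "int p ^ Suc m dvd 2 * (c a - c b)" using N that by (simp add: algebra_simps)
    show ?thesis
    proof (cases "p = 2")
      case True
      have "2 * int p ^ m dvd 2 * (c a - c b)" using d True by (simp only: power_Suc of_nat_numeral)
      then show ?thesis by (subst (asm) dvd_mult_cancel_left) simp
    next
      case False
      then have "odd p" using assms(2) prime_odd_nat[of p] prime_ge_2_nat[of p] by force
      then have "coprime (int p ^ Suc m) 2" by simp
      then have "int p ^ Suc m dvd c a - c b" using d coprime_dvd_mult_right_iff by blast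
      then show ?thesis by (metis dvd_mult_right power_Suc)
    qed
  qed
  then show "\<exists>N. \<forall>a\<ge>N. \<forall>b\<ge>N. int p ^ m dvd c a - c b" by blast
qed

section \<open>The additive group Z_p described by integer sequences\<close>

locale padic_rationals = Q: valued_field \<rat> "padic_abs p" p for p
begin

definition Zp where "Zp = add_monoid (padic_integers p)"
definition zcls where "zcls k = Q.cls (\<lambda>n. of_int (k n))"

text \<open>A value below p means that p does not divide the denominator, which is therefore
  invertible modulo p^n. The bound is p and not 1 because a sequence representing a p-adic integer
  has values at most 1 only in the limit.\<close>

lemma rational_approx:
  assumes "r \<in> \<rat>" "padic_abs p r < real p"
  shows "\<exists>k. padic_abs p (r - of_int k) \<le> (1 / real p) ^ n"
proof -
  obtain q where q: "r = of_rat q" using assms(1) by (auto elim: Rats_cases)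
  obtain a b where ab: "quotient_of q = (a, b)" by fastforce
  have b: "b > 0" "coprime a b" using quotient_of_denom_pos[OF ab] quotient_of_coprime[OF ab] by auto
  have r: "r = of_int a / of_int b" unfolding q using quotient_of_div[OF ab] by (simp add: of_rat_divide)
  have npb: "\<not> int p dvd b"
  proof
    assume d: "int p dvd b"
    then have "\<not> int p dvd a" using b(2) Q.prime_p
      by (metis coprime_common_divisor not_prime_unit prime_nat_int_transfer)
    then have "padic_abs p (of_int a) = 1" using Q.abs_of_int_less_1_iff[of a] Q.abs_of_int_le_1[of a] by linarith
    then have e: "padic_abs p r = 1 / padic_abs p (of_int b)" by (simp add: r Q.abs_divide)
    have "padic_abs p (of_int b) \<le> (1 / real p) ^ 1" using d by (subst Q.abs_of_int_le_power_iff) simp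
    moreover have "padic_abs p (of_int b) > 0"
      using Q.abs_nonneg[OF Q.of_int_mem[of b]] Q.abs_eq_0[OF Q.of_int_mem[of b]] b(1) by (simp add: less_le)
    ultimately have "padic_abs p r \<ge> real p" unfolding e using Q.p_gt_1 by (simp add: field_simps)
    then show False using assms(2) by simp
  qed
  then have wb: "padic_abs p (of_int b) = 1" using Q.abs_of_int_less_1_iff[of b] Q.abs_of_int_le_1[of b] by linarith
  have "coprime b (int p ^ n)" using npb Q.prime_p
    by (metis coprime_commute coprime_power_right_iff prime_imp_coprime prime_nat_int_transfer)
  then obtain c e where ce: "c * b + e * int p ^ n = 1" by (metis bezout_int coprime_iff_gcd_eq_1)
  have "r - of_int (a * c) = of_int (a * (e * int p ^ n)) / of_int b"
  proof -
    have "e * int p ^ n = 1 - c * b" using ce by simp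
    then have E1: "of_int (e * int p ^ n) = (1 - of_int c * of_int b :: complex)"
      by (simp only: of_int_diff of_int_1 of_int_mult)
    then show ?thesis using b(1) unfolding r of_int_mult[of a] E1 by (simp add: field_simps)
  qed
  also have "padic_abs p \<dots> = padic_abs p (of_int (a * (e * int p ^ n)))" using wb by (simp only: Q.abs_divide Q.of_int_mem)
  also have "\<dots> \<le> (1 / real p) ^ n" by (subst Q.abs_of_int_le_power_iff) simp
  finally show ?thesis by blast
qed

lemma zcls_completion: "padic_cauchy p k \<Longrightarrow> zcls k \<in> carrier Q.Ew"
  by (simp add: zcls_def Q.padic_cauchy_iff)

text \<open>Density of Z in Z_p: n-th members within p^-n of an integer are replaced by that
  integer. This is why all exponents can be taken from Z at each index.\<close>

lemma Zp_carrier: "carrier Zp = {zcls k | k. padic_cauchy p k}"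
proof (rule Set.set_eqI)
  fix a
  have c: "a \<in> carrier Zp \<longleftrightarrow> a \<in> carrier Q.Ew \<and> completion_abs \<rat> (padic_abs p) a \<le> 1"
    by (simp add: Zp_def padic_integers_def)
  show "a \<in> carrier Zp \<longleftrightarrow> a \<in> {zcls k | k. padic_cauchy p k}"
  proof
    assume "a \<in> carrier Zp"
    then have a: "a \<in> carrier Q.Ew" "completion_abs \<rat> (padic_abs p) a \<le> 1" using c by auto
    obtain s where s: "s \<in> Q.Cau" "a = Q.cls s" using Q.completionE[OF a(1)] .
    have "eventually (\<lambda>n. padic_abs p (s n) < real p) sequentially"
      by (rule order_tendstoD(2)[OF Q.completion_abs_tendsto[OF s(1)]]) (use a s Q.p_gt_1 in simp)
    then obtain N where N: "\<And>n. n \<ge> N \<Longrightarrow> padic_abs p (s n) < real p" by (auto simp: eventually_sequentially)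
    have "\<forall>n. \<exists>k. n \<ge> N \<longrightarrow> padic_abs p (s n - of_int k) \<le> (1 / real p) ^ n"
      using rational_approx[OF Q.Cau_mem[OF s(1)] N] by blast
    then obtain k where k: "\<And>n. n \<ge> N \<Longrightarrow> padic_abs p (s n - of_int (k n)) \<le> (1 / real p) ^ n" by metis
    have "(\<lambda>n. s n - of_int (k n)) \<in> Q.Nul"
    proof -
      have "(\<lambda>n. padic_abs p (s n - of_int (k n))) \<longlonglongrightarrow> 0"
      proof (rule tendsto_sandwich[OF _ _ tendsto_const])
        show "(\<lambda>n. (1 / real p) ^ n) \<longlonglongrightarrow> 0" by (rule LIMSEQ_realpow_zero) (use Q.p_gt_1 in auto)
        show "\<forall>\<^sub>F n in sequentially. 0 \<le> padic_abs p (s n - of_int (k n))"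
          by (simp add: Q.diff_mem Q.Cau_mem[OF s(1)])
        show "\<forall>\<^sub>F n in sequentially. padic_abs p (s n - of_int (k n)) \<le> (1 / real p) ^ n"
          using k by (auto simp: eventually_sequentially)
      qed
      then show ?thesis by (simp add: Q.Nul_iff Q.diff_mem Q.Cau_mem[OF s(1)])
    qed
    note n = this
    have kc: "(\<lambda>n. of_int (k n)) \<in> Q.Cau" using Q.Cau_diff[OF s(1) Q.Nul_Cau[OF n]] by simp
    have "a = zcls k"
      using n unfolding s(2) zcls_def by (subst Q.cls_eq_iff[OF s(1) kc]) (simp add: Q.Nul_iff)
    then show "a \<in> {zcls k | k. padic_cauchy p k}" using kc by (auto simp: Q.padic_cauchy_iff)
  next
    assume "a \<in> {zcls k | k. padic_cauchy p k}"
    then obtain k where k: "a = zcls k" "padic_cauchy p k" by blast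
    have kc: "(\<lambda>n. of_int (k n)) \<in> Q.Cau" using k by (simp add: Q.padic_cauchy_iff)
    have "completion_abs \<rat> (padic_abs p) a \<le> 1"
      unfolding k(1) zcls_def
      by (rule LIMSEQ_le_const2[OF Q.completion_abs_tendsto[OF kc]]) (auto simp: Q.abs_of_int_le_1)
    then show "a \<in> carrier Zp" using c zcls_completion[OF k(2)] k(1) by simp
  qed
qed

lemma zcls_closed [simp]: "padic_cauchy p k \<Longrightarrow> zcls k \<in> carrier Zp"
  unfolding Zp_carrier by blast

lemma Zp_cases: assumes "a \<in> carrier Zp" obtains k where "padic_cauchy p k" "a = zcls k"
  using assms unfolding Zp_carrier by blast

lemma Zp_mult: "x \<otimes>\<^bsub>Zp\<^esub> y = x \<oplus>\<^bsub>Q.Ew\<^esub> y" and Zp_one: "\<one>\<^bsub>Zp\<^esub> = \<zero>\<^bsub>Q.Ew\<^esub>"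
  by (simp_all add: Zp_def padic_integers_def)

lemma zcls_add:
  "padic_cauchy p k \<Longrightarrow> padic_cauchy p l \<Longrightarrow> zcls k \<otimes>\<^bsub>Zp\<^esub> zcls l = zcls (\<lambda>n. k n + l n)"
  unfolding Zp_mult zcls_def by (subst Q.completion_add) (simp_all add: Q.padic_cauchy_iff)

lemma zcls_eq_iff:
  "padic_cauchy p k \<Longrightarrow> padic_cauchy p l \<Longrightarrow> zcls k = zcls l \<longleftrightarrow> padic_null p (\<lambda>n. k n - l n)"
  unfolding zcls_def by (subst Q.cls_eq_iff) (simp_all add: Q.padic_cauchy_iff Q.padic_null_iff)

lemma zcls_0: "\<one>\<^bsub>Zp\<^esub> = zcls (\<lambda>_. 0)"
  unfolding Zp_one zcls_def by (simp add: Q.completion_zero)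

lemma comm_group_Zp: "comm_group Zp"
proof (rule comm_groupI)
  fix x y assume "x \<in> carrier Zp" "y \<in> carrier Zp"
  then obtain k l where kl: "padic_cauchy p k" "x = zcls k" "padic_cauchy p l" "y = zcls l"
    using Zp_cases by metis
  show "x \<otimes>\<^bsub>Zp\<^esub> y \<in> carrier Zp" using kl by (simp only: zcls_add zcls_closed padic_cauchy_add)
  show "x \<otimes>\<^bsub>Zp\<^esub> y = y \<otimes>\<^bsub>Zp\<^esub> x" using kl by (simp only: zcls_add add.commute)
next
  fix x y z assume "x \<in> carrier Zp" "y \<in> carrier Zp" "z \<in> carrier Zp"
  then obtain k l m where "padic_cauchy p k" "x = zcls k" "padic_cauchy p l" "y = zcls l"
      "padic_cauchy p m" "z = zcls m"
    using Zp_cases by metis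
  then show "x \<otimes>\<^bsub>Zp\<^esub> y \<otimes>\<^bsub>Zp\<^esub> z = x \<otimes>\<^bsub>Zp\<^esub> (y \<otimes>\<^bsub>Zp\<^esub> z)"
    by (simp only: zcls_add padic_cauchy_add add.assoc)
next
  show "\<one>\<^bsub>Zp\<^esub> \<in> carrier Zp" by (simp only: zcls_0 zcls_closed padic_cauchy_const)
next
  fix x assume "x \<in> carrier Zp"
  then obtain k where k: "padic_cauchy p k" "x = zcls k" using Zp_cases by metis
  then show "\<one>\<^bsub>Zp\<^esub> \<otimes>\<^bsub>Zp\<^esub> x = x" by (simp only: zcls_0 zcls_add padic_cauchy_const add_0_left)
next
  fix x assume "x \<in> carrier Zp"
  then obtain k where k: "padic_cauchy p k" "x = zcls k" using Zp_cases by metis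
  have m: "padic_cauchy p (\<lambda>n. - k n)" using padic_cauchy_diff[OF padic_cauchy_const[of p 0] k(1)] by simp
  have "zcls (\<lambda>n. - k n) \<otimes>\<^bsub>Zp\<^esub> x = \<one>\<^bsub>Zp\<^esub>"
    unfolding k(2) zcls_add[OF m k(1)] zcls_0 by simp
  then show "\<exists>y\<in>carrier Zp. y \<otimes>\<^bsub>Zp\<^esub> x = \<one>\<^bsub>Zp\<^esub>" using zcls_closed[OF m] by blast
qed

end

text \<open>The properties of E on which the criterion rests. That torsion is only 1 and -1 comes
  from the fields being real; see \<open>leopoldt_field_subfield\<close>.\<close>

locale leopoldt_field = complex_subfield E + padic_rationals p for E p +
  assumes integers_mult: "x \<in> ring_of_integers E \<Longrightarrow> y \<in> ring_of_integers E \<Longrightarrow> x * y \<in> ring_of_integers E"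
    and places_nonempty: "places_above p E \<noteq> {}"
    and torsion: "u \<in> carrier (unit_group E) \<Longrightarrow> k \<noteq> 0 \<Longrightarrow> u powi k = 1 \<Longrightarrow> u = 1 \<or> u = -1"
begin

abbreviation "U \<equiv> unit_group E"

lemma one_integer: "1 \<in> ring_of_integers E" "-1 \<in> ring_of_integers E"
  by (auto simp: ring_of_integers_def minus_mem algebraic_int_minus)

lemma U_simps [simp]: "x \<otimes>\<^bsub>U\<^esub> y = x * y" "\<one>\<^bsub>U\<^esub> = 1"
  by (simp_all add: units_of_def)

lemma comm_group_U: "comm_group U"
proof (rule comm_monoid.units_comm_group)
  show "comm_monoid (subring_of (ring_of_integers E))"
    by (rule comm_monoidI) (auto simp: one_integer integers_mult)
qed

sublocale U: comm_group U by (rule comm_group_U)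

lemma U_iff: "u \<in> carrier U \<longleftrightarrow> u \<in> E \<and> u \<noteq> 0 \<and> algebraic_int u \<and> algebraic_int (inverse u)"
proof
  assume "u \<in> carrier U"
  then obtain v where "u \<in> ring_of_integers E" "v \<in> ring_of_integers E" "u * v = 1"
    by (auto simp: units_of_def Units_def)
  moreover from this(3) have "v = inverse u" by (metis inverse_unique)
  ultimately show "u \<in> E \<and> u \<noteq> 0 \<and> algebraic_int u \<and> algebraic_int (inverse u)"
    by (auto simp: ring_of_integers_def)
next
  assume "u \<in> E \<and> u \<noteq> 0 \<and> algebraic_int u \<and> algebraic_int (inverse u)"
  then show "u \<in> carrier U"
    by (auto simp: units_of_def Units_def ring_of_integers_def inverse_mem intro!: exI[of _ "inverse u"])
qed

lemma U_mem: "u \<in> carrier U \<Longrightarrow> u \<in> E" "u \<in> carrier U \<Longrightarrow> u \<noteq> 0" by (auto simp: U_iff)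

lemma U_inv: "u \<in> carrier U \<Longrightarrow> inv\<^bsub>U\<^esub> u = inverse u"
  by (rule U.inv_equality) (auto simp: U_iff inverse_mem)

lemma U_nat_pow: "u [^]\<^bsub>U\<^esub> (n :: nat) = u ^ n"
  by (induction n) (auto simp: mult.commute)

lemma U_int_pow: "u \<in> carrier U \<Longrightarrow> u [^]\<^bsub>U\<^esub> (n :: int) = u powi n"
  by (cases n rule: int_cases2)
    (auto simp: int_pow_int U.int_pow_neg U_nat_pow power_int_minus U_inv simp flip: U_nat_pow)

lemma U_finprod: "finite I \<Longrightarrow> (\<And>i. i \<in> I \<Longrightarrow> f i \<in> carrier U) \<Longrightarrow> finprod U f I = (\<Prod>i\<in>I. f i)"
  by (induction I rule: finite_induct) (auto simp: Pi_def)

sublocale T: tensor Zp U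
  by (rule tensor.intro) (rule comm_group_Zp, rule comm_group_U)

lemma place: "w \<in> places_above p E \<Longrightarrow> padic_place E w p"
  by (rule padic_place.intro[OF places_above_valued_field])
    (auto simp: Q.prime_p Q.valued_field_axioms complex_subfield_axioms)

abbreviation "PG \<equiv> product_group (places_above p E) (\<lambda>w. principal_units E w)"
abbreviation "pairing \<equiv> \<lambda>a u. \<lambda>w\<in>places_above p E. padic_pow p E w (principal_part p E w (to_completion E w u)) a"
abbreviation "wcls \<equiv> valued_field.cls E"

text \<open>The exponent M from \<open>unit_power_close_1\<close> varies with the unit and the
  place, but the resulting formula does not contain it. So units with different M can be multiplied
  termwise.\<close>

lemma pairing_eq:
  assumes w: "w \<in> places_above p E" and u: "u \<in> carrier U" and k: "padic_cauchy p k"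
  shows "pairing (zcls k) u w = wcls w (\<lambda>n. u powi (teich_exp p n * k n))"
    and "wcls w (\<lambda>n. u powi (teich_exp p n * k n)) \<in> carrier (principal_units E w)"
    and "(\<lambda>n. u powi (teich_exp p n * k n)) \<in> cauchy_sequences E w"
proof -
  interpret w: padic_place E w p by (rule place[OF w])
  have u': "u \<in> E" "u \<noteq> 0" "algebraic_int u" "algebraic_int (inverse u)" using u U_iff by auto
  have wu: "w u = 1" by (rule w.abs_unit) (use u' in auto)
  obtain M where M: "M > 0" "coprime M p" "w (u ^ M - 1) < 1"
    using w.unit_power_close_1[OF u'(1,3) wu] .
  note * = w.leopoldt_pairing_eq[OF u'(1) wu M(3,2,1) k]
  show "pairing (zcls k) u w = wcls w (\<lambda>n. u powi (teich_exp p n * k n))"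
    using *(1) w by (simp add: zcls_def)
  show "wcls w (\<lambda>n. u powi (teich_exp p n * k n)) \<in> carrier (principal_units E w)"
    "(\<lambda>n. u powi (teich_exp p n * k n)) \<in> cauchy_sequences E w" using * by auto
qed

lemma comm_group_PG: "comm_group PG"
proof (rule group.group_comm_groupI)
  have PU: "comm_group (principal_units E w)" if "w \<in> places_above p E" for w
  proof -
    interpret w: padic_place E w p by (rule place[OF that])
    show ?thesis by (rule w.comm_group_PU)
  qed
  show "group PG" using PU by (simp add: comm_group.axioms(2))
  fix x y assume xy: "x \<in> carrier PG" "y \<in> carrier PG"
  show "x \<otimes>\<^bsub>PG\<^esub> y = y \<otimes>\<^bsub>PG\<^esub> x"
    unfolding mult_product_group
  proof (rule restrict_ext)
    fix w assume w: "w \<in> places_above p E"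
    show "x w \<otimes>\<^bsub>principal_units E w\<^esub> y w = y w \<otimes>\<^bsub>principal_units E w\<^esub> x w"
      by (rule comm_monoid.m_comm[OF comm_group.axioms(1)[OF PU[OF w]]])
        (rule PiE_mem[OF xy(1)[unfolded carrier_product_group] w]
          PiE_mem[OF xy(2)[unfolded carrier_product_group] w])+
  qed
qed

lemma pairing_closed: "a \<in> carrier Zp \<Longrightarrow> u \<in> carrier U \<Longrightarrow> pairing a u \<in> carrier PG"
proof -
  assume a: "a \<in> carrier Zp" and u: "u \<in> carrier U"
  obtain k where k: "padic_cauchy p k" "a = zcls k" using Zp_cases[OF a] .
  show ?thesis
    unfolding carrier_product_group
  proof (rule PiE_I)
    fix w assume "w \<in> places_above p E"
    then show "pairing a u w \<in> carrier (principal_units E w)"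
      unfolding k(2) pairing_eq(1)[OF \<open>w \<in> _\<close> u k(1)] by (rule pairing_eq(2)[OF _ u k(1)])
  qed simp
qed

lemma pairing_left:
  assumes a: "a \<in> carrier Zp" "a' \<in> carrier Zp" and u: "u \<in> carrier U"
  shows "pairing (a \<otimes>\<^bsub>Zp\<^esub> a') u = pairing a u \<otimes>\<^bsub>PG\<^esub> pairing a' u"
proof -
  obtain k where k: "padic_cauchy p k" "a = zcls k" using Zp_cases[OF a(1)] .
  obtain l where l: "padic_cauchy p l" "a' = zcls l" using Zp_cases[OF a(2)] .
  have nz: "u \<noteq> 0" using u U_iff by auto
  have "pairing (a \<otimes>\<^bsub>Zp\<^esub> a') u w = pairing a u w \<otimes>\<^bsub>principal_units E w\<^esub> pairing a' u w"
    if w: "w \<in> places_above p E" for w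
  proof -
    interpret w: padic_place E w p by (rule place[OF w])
    show ?thesis
      unfolding k(2) l(2) zcls_add[OF k(1) l(1)] pairing_eq(1)[OF w u k(1)] pairing_eq(1)[OF w u l(1)]
        pairing_eq(1)[OF w u padic_cauchy_add[OF k(1) l(1)]] w.PU_simps
        w.completion_mult[OF pairing_eq(3)[OF w u k(1)] pairing_eq(3)[OF w u l(1)]]
      using nz by (simp add: power_int_add distrib_left)
  qed
  note eq = this
  show ?thesis unfolding mult_product_group U_simps by (rule restrict_ext) (use eq in simp)
qed

lemma pairing_right:
  assumes a: "a \<in> carrier Zp" and u: "u \<in> carrier U" "v \<in> carrier U"
  shows "pairing a (u \<otimes>\<^bsub>U\<^esub> v) = pairing a u \<otimes>\<^bsub>PG\<^esub> pairing a v"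
proof -
  obtain k where k: "padic_cauchy p k" "a = zcls k" using Zp_cases[OF a] .
  have uv: "u * v \<in> carrier U" using U.m_closed[OF u] by simp
  have "pairing a (u * v) w = pairing a u w \<otimes>\<^bsub>principal_units E w\<^esub> pairing a v w"
    if w: "w \<in> places_above p E" for w
  proof -
    interpret w: padic_place E w p by (rule place[OF w])
    show ?thesis
      unfolding k(2) pairing_eq(1)[OF w u(1) k(1)] pairing_eq(1)[OF w u(2) k(1)]
        pairing_eq(1)[OF w uv k(1)] w.PU_simps
        w.completion_mult[OF pairing_eq(3)[OF w u(1) k(1)] pairing_eq(3)[OF w u(2) k(1)]]
      by (simp add: power_int_mult_distrib)
  qed
  note eq = this
  show ?thesis unfolding mult_product_group U_simps by (rule restrict_ext) (use eq in simp)
qed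

lemma leopoldt_map_props:
  shows "leopoldt_map E p \<in> hom T.TP PG"
    and "a \<in> carrier Zp \<Longrightarrow> u \<in> carrier U \<Longrightarrow> leopoldt_map E p (T.pt a u) = pairing a u"
  unfolding leopoldt_map_def Zp_def[symmetric]
  using T.tensor_lift_props[OF comm_group_PG pairing_closed pairing_left pairing_right] by blast+

lemma leopoldt_map_tsum:
  assumes "finite I" "\<forall>i\<in>I. padic_cauchy p (k i)" "\<forall>i\<in>I. u i \<in> carrier U" "w \<in> places_above p E"
  shows "leopoldt_map E p (T.tsum I (\<lambda>i. zcls (k i)) u) w =
      wcls w (\<lambda>n. \<Prod>i\<in>I. u i powi (teich_exp p n * k i n)) \<and>
    (\<lambda>n. \<Prod>i\<in>I. u i powi (teich_exp p n * k i n)) \<in> cauchy_sequences E w"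
  using assms(1-3)
proof (induction I rule: finite_induct)
  case empty
  interpret w: padic_place E w p by (rule place[OF assms(4)])
  have "leopoldt_map E p \<one>\<^bsub>T.TP\<^esub> = \<one>\<^bsub>PG\<^esub>"
    by (rule hom_one[OF leopoldt_map_props(1) T.TP.is_group comm_group.axioms(2)[OF comm_group_PG]])
  then show ?case using assms(4) w.Cau_const[OF one_mem] by (simp add: T.tsum_def w.completion_one)
next
  case (insert i I)
  interpret w: padic_place E w p by (rule place[OF assms(4)])
  have c: "\<forall>j\<in>insert i I. zcls (k j) \<in> carrier Zp" using insert.prems(1) zcls_closed by blast
  have i: "padic_cauchy p (k i)" "u i \<in> carrier U" using insert.prems by auto
  have ts: "T.tsum I (\<lambda>i. zcls (k i)) u \<in> carrier T.TP"
    by (rule T.tsum_closed) (use c insert.prems in auto)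
  have "leopoldt_map E p (T.tsum (insert i I) (\<lambda>i. zcls (k i)) u) =
      pairing (zcls (k i)) (u i) \<otimes>\<^bsub>PG\<^esub> leopoldt_map E p (T.tsum I (\<lambda>i. zcls (k i)) u)"
    using T.tsum_insert[OF insert.hyps c insert.prems(2)] hom_mult[OF leopoldt_map_props(1) T.pt_closed ts]
      leopoldt_map_props(2) zcls_closed[OF i(1)] i(2) by simp
  then have "leopoldt_map E p (T.tsum (insert i I) (\<lambda>i. zcls (k i)) u) w =
      wcls w (\<lambda>n. u i powi (teich_exp p n * k i n)) \<otimes>\<^bsub>w.Ew\<^esub>
      wcls w (\<lambda>n. \<Prod>i\<in>I. u i powi (teich_exp p n * k i n))"
    using assms(4) insert pairing_eq(1)[OF assms(4) i(2,1)] by simp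
  then show ?case
    using insert pairing_eq(3)[OF assms(4) i(2,1)] by (simp add: w.completion_mult w.Cau_mult)
qed

text \<open>Elements of the tensor product are reduced to sums of pure tensors with multiplicatively
  independent units and one term for the torsion unit \<open>-1\<close>; squaring disposes of the latter.\<close>

theorem Leo_criterion:
  assumes H: "\<And>(I :: nat set) v c. finite I \<Longrightarrow> \<forall>i\<in>I. v i \<in> carrier U \<Longrightarrow>
      (\<forall>e :: nat \<Rightarrow> int. (\<Prod>i\<in>I. v i powi e i) = 1 \<longrightarrow> (\<forall>i\<in>I. e i = 0)) \<Longrightarrow>
      \<forall>w\<in>places_above p E. (\<lambda>n. w ((\<Prod>i\<in>I. v i powi c i n) - 1)) \<longlonglongrightarrow> 0 \<Longrightarrow> \<forall>i\<in>I. padic_null p (c i)"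
  shows "Leo E p"
proof -
  interpret L: group_hom T.TP PG "leopoldt_map E p"
    by (intro group_hom.intro group_hom_axioms.intro T.TP.is_group comm_group.axioms(2)[OF comm_group_PG]
        leopoldt_map_props)
  have m1: "-1 \<in> carrier U" by (simp add: U_iff minus_mem algebraic_int_minus)
  have "W = \<one>\<^bsub>T.TP\<^esub>" if W: "W \<in> carrier T.TP" "leopoldt_map E p W = \<one>\<^bsub>PG\<^esub>" for W
  proof -
    have tors: "\<forall>v\<in>carrier U. \<forall>k::int. k \<noteq> 0 \<longrightarrow> v [^]\<^bsub>U\<^esub> k = \<one>\<^bsub>U\<^esub> \<longrightarrow> v = \<one>\<^bsub>U\<^esub> \<or> v = -1"
      using torsion by (simp add: U_int_pow)
    obtain I :: "nat set" and a u d where I: "finite I" "\<forall>i\<in>I. a i \<in> carrier Zp" "\<forall>i\<in>I. u i \<in> carrier U"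
      "d \<in> carrier Zp" "W = T.tsum I a u \<otimes>\<^bsub>T.TP\<^esub> T.pt d (-1)"
      and indep: "\<forall>e :: nat \<Rightarrow> int. finprod U (\<lambda>i. u i [^]\<^bsub>U\<^esub> e i) I = \<one>\<^bsub>U\<^esub> \<longrightarrow> (\<forall>i\<in>I. e i = 0)"
      by (rule T.tensor_representation[OF tors m1 W(1)])
    obtain l where l: "padic_cauchy p l" "d = zcls l" using Zp_cases[OF I(4)] .
    have "\<forall>i\<in>I. \<exists>k. padic_cauchy p k \<and> a i = zcls k" using I(2) Zp_cases by metis
    then obtain k where k: "\<forall>i\<in>I. padic_cauchy p (k i)" "\<forall>i\<in>I. a i = zcls (k i)" by metis
    have zc: "\<forall>i\<in>I. zcls (k i) \<in> carrier Zp" using k(1) zcls_closed by blast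
    have ts: "T.tsum I a u = T.tsum I (\<lambda>i. zcls (k i)) u"
      by (rule T.tsum_cong) (use k I in auto)
    have tsc: "T.tsum I (\<lambda>i. zcls (k i)) u \<in> carrier T.TP" by (rule T.tsum_closed[OF zc I(3)])
    define h where "h = teich_exp p"
    have hk: "(\<Prod>i\<in>I. u i powi e i) = 1 \<longrightarrow> (\<forall>i\<in>I. e i = 0)" for e :: "nat \<Rightarrow> int"
    proof
      assume "(\<Prod>i\<in>I. u i powi e i) = 1"
      moreover have "u i [^]\<^bsub>U\<^esub> e i \<in> carrier U" if "i \<in> I" for i using I(3) that by simp
      ultimately have "finprod U (\<lambda>i. u i [^]\<^bsub>U\<^esub> e i) I = \<one>\<^bsub>U\<^esub>"
        using I(1,3) by (subst U_finprod[OF I(1)]) (blast, simp add: U_int_pow cong: prod.cong)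
      then show "\<forall>i\<in>I. e i = 0" using indep by blast
    qed
    have lim: "(\<lambda>n. w ((\<Prod>i\<in>I. u i powi (h n * k i n)) * (-1) powi (h n * l n) - 1)) \<longlonglongrightarrow> 0"
      if w: "w \<in> places_above p E" for w
    proof -
      interpret w: padic_place E w p by (rule place[OF w])
      note t = leopoldt_map_tsum[OF I(1) k(1) I(3) w]
      have "leopoldt_map E p W = leopoldt_map E p (T.tsum I (\<lambda>i. zcls (k i)) u) \<otimes>\<^bsub>PG\<^esub> pairing d (-1)"
        unfolding I(5) ts using tsc I(4) m1 leopoldt_map_props(2)[OF I(4) m1] by (simp add: L.hom_mult)
      then have "leopoldt_map E p W w =
          wcls w (\<lambda>n. \<Prod>i\<in>I. u i powi (h n * k i n)) \<otimes>\<^bsub>w.Ew\<^esub> wcls w (\<lambda>n. (-1) powi (h n * l n))"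
        using w t pairing_eq(1)[OF w m1 l(1)] l(2) by (simp add: h_def)
      then have "wcls w (\<lambda>n. (\<Prod>i\<in>I. u i powi (h n * k i n)) * (-1) powi (h n * l n)) = wcls w (\<lambda>_. 1)"
        using W(2) w t pairing_eq(3)[OF w m1 l(1)] by (simp add: h_def w.completion_mult w.completion_one)
      then show ?thesis
        using t pairing_eq(3)[OF w m1 l(1)] by (subst (asm) w.cls_eq_iff) (auto simp: h_def w.Cau_mult)
    qed
    \<comment> \<open>Squares of the products no longer contain the sign, and squaring does not
      increase the distance from 1.\<close>
    have lim2: "(\<lambda>n. w ((\<Prod>i\<in>I. u i powi (2 * (h n * k i n))) - 1)) \<longlonglongrightarrow> 0" if w: "w \<in> places_above p E" for w
    proof -
      interpret w: padic_place E w p by (rule place[OF w])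
      define P where "P n = (\<Prod>i\<in>I. u i powi (h n * k i n)) * (-1) powi (h n * l n)" for n
      have PE: "P n \<in> E" for n unfolding P_def by (intro mem_intros prod_mem one_mem) (use I(3) U_mem in auto)
      have u1: "w (u i) = 1" if "i \<in> I" for i
        using I(3) that U_iff by (intro w.abs_unit) auto
      have wP: "w (P n) = 1" for n
      proof -
        have "w (\<Prod>i\<in>I. u i powi (h n * k i n)) = (\<Prod>i\<in>I. w (u i powi (h n * k i n)))"
          by (rule w.abs_prod) (use I(3) U_mem in \<open>auto intro: powi_mem\<close>)
        also have "\<dots> = 1" by (rule prod.neutral) (use I(3) U_mem u1 in \<open>auto simp: w.abs_powi\<close>)
        finally show ?thesis
          unfolding P_def using I(3) U_mem
          by (subst w.abs_mult) (auto intro!: prod_mem powi_mem minus_mem simp: w.abs_powi w.abs_minus minus_mem)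
      qed
      have "(P n)\<^sup>2 = (\<Prod>i\<in>I. u i powi (2 * (h n * k i n)))" for n
      proof -
        have "((-1 :: complex) powi (h n * l n))\<^sup>2 = 1"
          by (simp add: power_int_minus_one_mult_self power2_eq_square)
        moreover have "x powi (2 * z) = (x powi z)\<^sup>2" for x :: complex and z
          by (subst mult.commute, subst power_int_mult) simp
        ultimately show ?thesis
          by (simp only: P_def power_mult_distrib prod_power_distrib mult_1_right)
      qed
      then have "w ((\<Prod>i\<in>I. u i powi (2 * (h n * k i n))) - 1) = w ((P n)\<^sup>2 - 1\<^sup>2)" for n by simp
      moreover have "w ((P n)\<^sup>2 - 1\<^sup>2) \<le> w (P n - 1)" for n
        by (rule w.abs_power_diff_le) (use PE wP in auto)
      moreover have "w ((P n)\<^sup>2 - 1\<^sup>2) \<ge> 0" for n by (intro w.abs_nonneg mem_intros PE one_mem)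
      moreover have "(\<lambda>n. w (P n - 1)) \<longlonglongrightarrow> 0" using lim[OF w] by (simp add: P_def)
      ultimately show ?thesis by (simp only:) (rule w.tendsto_0_squeeze)
    qed
    have null: "padic_null p (k i)" if "i \<in> I" for i
    proof -
      have "\<forall>i\<in>I. padic_null p (\<lambda>n. 2 * (h n * k i n))" by (rule H[OF I(1,3)]) (use hk lim2 in auto)
      then have "padic_null p (\<lambda>n. h n * k i n)"
        using padic_null_cancel[of p 2 "\<lambda>n. h n * k i n"] Q.prime_p that by simp
      then show ?thesis unfolding h_def by (rule padic_null_teich_cancel)
    qed
    have "T.tsum I a u = \<one>\<^bsub>T.TP\<^esub>"
      unfolding T.tsum_def
    proof (rule T.TP.finprod_one_eqI)
      fix i assume i: "i \<in> I"
      have "a i = \<one>\<^bsub>Zp\<^esub>" unfolding zcls_0 using k i null[OF i] zcls_eq_iff[of "k i" "\<lambda>_. 0"] by simp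
      then show "T.pt (a i) (u i) = \<one>\<^bsub>T.TP\<^esub>"
        using group_hom.hom_one[OF T.pt_hom_left[of "u i"]] I(3) i by simp
    qed
    then have W1: "W = T.pt d (-1)" using I(4,5) m1 T.pt_closed by simp
    obtain w where w: "w \<in> places_above p E" using places_nonempty by blast
    interpret w: padic_place E w p by (rule place[OF w])
    have nk: "eventually (\<lambda>n. w ((\<Prod>i\<in>I. u i powi (h n * k i n)) * (-1) powi (h n * l n) - 1) < 1) sequentially"
      using order_tendstoD(2)[OF lim[OF w]] by simp
    \<comment> \<open>The remaining tensor of d with -1 vanishes as soon as d is twice a p-adic
      integer, since it is then the tensor of that integer with (-1)^2 = 1.\<close>
    have "\<exists>j. padic_null p (\<lambda>n. l n - 2 * j n)"
    proof (cases "p = 2")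
      case False
      then have odd: "odd p" using Q.prime_p prime_odd_nat[of p] prime_ge_2_nat[of p] by force
      \<comment> \<open>For odd p, 2 is invertible in Z_p, and the integers (1 + p^n)/2 converge to
        its inverse.\<close>
      define j where "j n = l n * ((1 + int p ^ n) div 2)" for n
      have "l n - 2 * j n = - l n * int p ^ n" for n
      proof -
        have "2 * ((1 + int p ^ n) div 2) = 1 + int p ^ n" using odd by simp
        then have "2 * j n = l n * (1 + int p ^ n)" by (simp add: j_def)
        then show ?thesis by (simp add: algebra_simps)
      qed
      moreover have "padic_null p (\<lambda>n. - l n * int p ^ n)"
        unfolding padic_null_def by (intro allI exI impI dvd_mult le_imp_power_dvd)
      ultimately have "padic_null p (\<lambda>n. l n - 2 * j n)" by simp
      then show ?thesis by blast
    next
      case True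
      have "W = T.pt d (-1)" by (rule W1)
      moreover have "(\<lambda>n. w ((-1) powi (h n * l n) - 1)) \<longlonglongrightarrow> 0"
      proof -
        have e: "leopoldt_map E p W = pairing d (-1)" unfolding W1 by (rule leopoldt_map_props(2)[OF I(4) m1])
        have "pairing d (-1) = \<one>\<^bsub>PG\<^esub>" using e W(2) by simp
        then have "pairing d (-1) w = \<one>\<^bsub>PG\<^esub> w" by (rule fun_cong)
        then have "wcls w (\<lambda>n. (-1) powi (h n * l n)) = wcls w (\<lambda>_. 1)"
          using w pairing_eq(1)[OF w m1 l(1)] l(2) by (simp add: h_def w.completion_one)
        then show ?thesis
          using pairing_eq(3)[OF w m1 l(1)] by (subst (asm) w.cls_eq_iff) (auto simp: h_def)
      qed
      \<comment> \<open>For p = 2 an odd exponent gives -1 - 1 = -2, of value exactly 1/2. Being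
        strictly closer to 1 thus forces l n to be even, because h n is odd.\<close>
      then have "eventually (\<lambda>n. w ((-1) powi (h n * l n) - 1) < 1 / 2) sequentially"
        by (rule order_tendstoD(2)) simp
      then obtain N1 where N1: "\<And>n. n \<ge> N1 \<Longrightarrow> w ((-1) powi (h n * l n) - 1) < 1 / 2"
        by (auto simp: eventually_sequentially)
      obtain N2 where N2: "\<And>n. n \<ge> N2 \<Longrightarrow> int p ^ 1 dvd h n - 1"
        using teich_exp_cong[of p] unfolding padic_null_def h_def by blast
      have "even (l n)" if n: "n \<ge> max N1 N2" for n
      proof (rule ccontr)
        assume "odd (l n)"
        moreover have "odd (h n)" using N2[of n] n True by simp
        ultimately have "odd (h n * l n)" by simp
        then have e: "(-1 :: complex) powi (h n * l n) - 1 = - of_nat p"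
          using True by (simp add: power_int_minus_left)
        have "w ((-1) powi (h n * l n) - 1) = 1 / real p" by (simp only: e w.abs_minus of_nat_mem w.abs_p)
        then show False using N1[of n] n True by simp
      qed
      then have "l n - 2 * (l n div 2) = 0" if "n \<ge> max N1 N2" for n using that by simp
      then have "padic_null p (\<lambda>n. l n - 2 * (l n div 2))"
        unfolding padic_null_def by (metis dvd_0_right)
      then show ?thesis by (rule exI[of _ "\<lambda>n. l n div 2"])
    qed
    then obtain j where j: "padic_null p (\<lambda>n. l n - 2 * j n)" by blast
    have "padic_cauchy p (\<lambda>n. 2 * j n)"
      using padic_cauchy_diff[OF l(1) padic_null_imp_cauchy[OF j]] by simp
    then have jc: "padic_cauchy p j" by (rule padic_cauchy_halve) (rule Q.prime_p)
    have "d = zcls j \<otimes>\<^bsub>Zp\<^esub> zcls j"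
      unfolding l(2) zcls_add[OF jc jc] using zcls_eq_iff[OF l(1) padic_cauchy_add[OF jc jc]] j by simp
    then have "W = T.pt (zcls j) (-1) \<otimes>\<^bsub>T.TP\<^esub> T.pt (zcls j) (-1)"
      unfolding W1 using T.pt_mult_left zcls_closed[OF jc] m1 by blast
    also have "\<dots> = T.pt (zcls j) ((-1) \<otimes>\<^bsub>U\<^esub> (-1))"
      using T.pt_mult_right zcls_closed[OF jc] m1 by blast
    also have "\<dots> = \<one>\<^bsub>T.TP\<^esub>"
      using group_hom.hom_one[OF T.pt_hom_right[OF zcls_closed[OF jc]]] by simp
    finally show ?thesis .
  qed
  then show ?thesis unfolding Leo_def Zp_def[symmetric] L.inj_on_one_iff by blast
qed

end

section \<open>Existence of places\<close>

definition unital_subring :: "complex set \<Rightarrow> bool" where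
  "unital_subring V \<longleftrightarrow> 1 \<in> V \<and> (\<forall>x\<in>V. \<forall>y\<in>V. x - y \<in> V \<and> x * y \<in> V)"

lemma unital_subringD:
  assumes "unital_subring V"
  shows "1 \<in> V" "0 \<in> V" "x \<in> V \<Longrightarrow> y \<in> V \<Longrightarrow> x - y \<in> V" "x \<in> V \<Longrightarrow> y \<in> V \<Longrightarrow> x * y \<in> V"
    "x \<in> V \<Longrightarrow> - x \<in> V" "x \<in> V \<Longrightarrow> y \<in> V \<Longrightarrow> x + y \<in> V" "x \<in> V \<Longrightarrow> x ^ n \<in> V" "of_nat n \<in> V" "of_int k \<in> V"
proof -
  show a: "1 \<in> V" "\<And>x y. x \<in> V \<Longrightarrow> y \<in> V \<Longrightarrow> x - y \<in> V" "\<And>x y. x \<in> V \<Longrightarrow> y \<in> V \<Longrightarrow> x * y \<in> V"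
    using assms unfolding unital_subring_def by auto
  show z: "0 \<in> V" using a(2)[OF a(1) a(1)] by simp
  show m: "- x \<in> V" if "x \<in> V" for x using a(2)[OF z that] by simp
  show p: "x + y \<in> V" if "x \<in> V" "y \<in> V" for x y using a(2)[OF that(1) m[OF that(2)]] by simp
  show "x ^ n \<in> V" if "x \<in> V" for x n using that by (induction n) (auto intro: a)
  show n: "of_nat n \<in> V" for n by (induction n) (auto intro: p z a)
  show "of_int k \<in> V" by (cases k rule: int_cases2) (auto intro: n m)
qed

text \<open>Values at x of polynomials over V of degree at most n, in Horner form. The degree is
  kept as a parameter because the maximality argument is a descent on it.\<close>

primrec poly_values :: "complex set \<Rightarrow> complex \<Rightarrow> nat \<Rightarrow> complex set" where
  "poly_values V x 0 = V"
| "poly_values V x (Suc n) = {a + x * b | a b. a \<in> V \<and> b \<in> poly_values V x n}"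

context
  fixes V assumes V: "unital_subring V"
begin

lemmas Vs = unital_subringD[OF V]

lemma poly_values_Suc_mono: "y \<in> poly_values V x n \<Longrightarrow> y \<in> poly_values V x (Suc n)"
proof (induction n arbitrary: y)
  case 0
  have "y = y + x * 0 \<and> y \<in> V \<and> 0 \<in> poly_values V x 0" using 0 Vs(2) by simp
  then show ?case by (simp only: poly_values.simps(2) mem_Collect_eq) blast
next
  case (Suc n)
  then obtain a b where ab: "y = a + x * b" "a \<in> V" "b \<in> poly_values V x n" by auto
  then show ?case using Suc.IH[OF ab(3)] by (simp only: poly_values.simps(2)[of V x "Suc n"] mem_Collect_eq) blast
qed

lemma poly_values_mono: "n \<le> m \<Longrightarrow> y \<in> poly_values V x n \<Longrightarrow> y \<in> poly_values V x m"
  by (induction m rule: dec_induct) (auto intro: poly_values_Suc_mono simp del: poly_values.simps)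

lemma V_subset_poly_values: "y \<in> V \<Longrightarrow> y \<in> poly_values V x n"
  using poly_values_mono[of 0 n y x] by simp

lemma poly_values_diff: "y \<in> poly_values V x n \<Longrightarrow> z \<in> poly_values V x n \<Longrightarrow> y - z \<in> poly_values V x n"
proof (induction n arbitrary: y z)
  case (Suc n)
  obtain a b c d where *: "y = a + x * b" "a \<in> V" "b \<in> poly_values V x n" "z = c + x * d" "c \<in> V" "d \<in> poly_values V x n"
    using Suc.prems by auto
  have "y - z = (a - c) + x * (b - d)" using * by (simp add: algebra_simps)
  moreover have "a - c \<in> V" "b - d \<in> poly_values V x n" using * Suc.IH Vs(3) by simp_all
  ultimately show ?case by (simp only: poly_values.simps(2) mem_Collect_eq) blast
qed (auto intro: Vs)

lemma poly_values_0: "0 \<in> poly_values V x n" by (rule V_subset_poly_values[OF Vs(2)])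

lemma poly_values_add: "y \<in> poly_values V x n \<Longrightarrow> z \<in> poly_values V x n \<Longrightarrow> y + z \<in> poly_values V x n"
  using poly_values_diff[OF _ poly_values_diff[OF poly_values_0], of y x n z] by simp

lemma poly_values_smult: "c \<in> V \<Longrightarrow> y \<in> poly_values V x n \<Longrightarrow> c * y \<in> poly_values V x n"
proof (induction n arbitrary: y)
  case (Suc n)
  obtain a b where *: "y = a + x * b" "a \<in> V" "b \<in> poly_values V x n" using Suc.prems by auto
  have "c * y = c * a + x * (c * b)" using * by (simp add: algebra_simps)
  then show ?case using * Suc.IH[OF Suc.prems(1) *(3)] Vs(4)[OF Suc.prems(1) *(2)] by auto
qed (auto intro: Vs)

lemma poly_values_shift: "y \<in> poly_values V x n \<Longrightarrow> x * y \<in> poly_values V x (Suc n)"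
proof -
  assume "y \<in> poly_values V x n"
  then have "x * y = 0 + x * y \<and> 0 \<in> V \<and> y \<in> poly_values V x n" using Vs(2) by simp
  then show ?thesis by (simp only: poly_values.simps(2) mem_Collect_eq) blast
qed

lemma poly_values_mult: "y \<in> poly_values V x n \<Longrightarrow> z \<in> poly_values V x m \<Longrightarrow> y * z \<in> poly_values V x (n + m)"
proof (induction n arbitrary: y)
  case 0
  then show ?case using poly_values_smult by simp
next
  case (Suc n)
  obtain a b where *: "y = a + x * b" "a \<in> V" "b \<in> poly_values V x n" using Suc.prems by auto
  have "a * z \<in> poly_values V x (Suc n + m)"
    by (rule poly_values_mono[OF _ poly_values_smult[OF *(2) Suc.prems(2)]]) simp
  moreover have "x * (b * z) \<in> poly_values V x (Suc n + m)"
    using poly_values_shift[OF Suc.IH[OF *(3) Suc.prems(2)]] by simp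
  moreover have "y * z = a * z + x * (b * z)" using * by (simp add: algebra_simps)
  ultimately show ?case using poly_values_add by metis
qed

lemma poly_values_power_shift: "y \<in> poly_values V x n \<Longrightarrow> x ^ k * y \<in> poly_values V x (n + k)"
  by (induction k) (use poly_values_shift in \<open>auto simp: mult.assoc simp del: poly_values.simps\<close>)

lemma poly_values_top: "y \<in> poly_values V x (Suc n) \<Longrightarrow> \<exists>c\<in>V. \<exists>z\<in>poly_values V x n. y = c * x ^ Suc n + z"
proof (induction n arbitrary: y)
  case 0
  then show ?case by (auto simp: algebra_simps)
next
  case (Suc n)
  obtain a b where *: "y = a + x * b" "a \<in> V" "b \<in> poly_values V x (Suc n)"
    using Suc.prems by (simp only: poly_values.simps(2)[of V x "Suc n"] mem_Collect_eq) blast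
  obtain c z where cz: "c \<in> V" "z \<in> poly_values V x n" "b = c * x ^ Suc n + z" using Suc.IH[OF *(3)] by blast
  have "y = c * x ^ Suc (Suc n) + (a + x * z)" using * cz by (simp add: algebra_simps)
  moreover have "a + x * z \<in> poly_values V x (Suc n)" using * cz by auto
  ultimately show ?case using cz(1) by blast
qed

text \<open>Reversal of coefficients: the factor x^n clears all negative powers of x.\<close>

lemma poly_values_inverse:
  "x \<noteq> 0 \<Longrightarrow> y \<in> poly_values V (inverse x) n \<Longrightarrow> x ^ n * y \<in> poly_values V x n"
proof (induction n arbitrary: y)
  case (Suc n)
  obtain a b where *: "y = a + inverse x * b" "a \<in> V" "b \<in> poly_values V (inverse x) n" using Suc.prems by auto
  have "x ^ Suc n * y = x ^ Suc n * a + x ^ n * b" using * Suc.prems(1) by (simp add: algebra_simps)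
  moreover have "x ^ Suc n * a \<in> poly_values V x (Suc n)"
    using poly_values_power_shift[of a x 0 "Suc n"] *(2) by (simp del: poly_values.simps(2))
  moreover have "x ^ n * b \<in> poly_values V x (Suc n)"
    by (rule poly_values_Suc_mono) (rule Suc.IH[OF Suc.prems(1) *(3)])
  ultimately show ?case using poly_values_add by metis
qed simp

lemma poly_values_self: "x \<in> V \<Longrightarrow> poly_values V x n \<subseteq> V"
  by (induction n) (auto intro!: Vs(4,6))

lemma adjoin_subring: "unital_subring (\<Union>n. poly_values V x n)"
  unfolding unital_subring_def
proof (intro conjI ballI)
  show "1 \<in> (\<Union>n. poly_values V x n)" using V_subset_poly_values[OF Vs(1)] by blast
  fix y z assume "y \<in> (\<Union>n. poly_values V x n)" "z \<in> (\<Union>n. poly_values V x n)"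
  then obtain n m where nm: "y \<in> poly_values V x n" "z \<in> poly_values V x m" by blast
  then have "y \<in> poly_values V x (max n m)" "z \<in> poly_values V x (max n m)"
    using poly_values_mono by (meson max.cobounded1 max.cobounded2)+
  then show "y - z \<in> (\<Union>n. poly_values V x n)" using poly_values_diff by blast
  show "y * z \<in> (\<Union>n. poly_values V x n)" using poly_values_mult[OF nm] by blast
qed

end

text \<open>A subring that is maximal among those not containing \<open>1/p\<close> is a valuation ring.\<close>

lemma valuation_ring_exists:
  assumes p: "p > (1::nat)"
  shows "\<exists>V. unital_subring V \<and> inverse (of_nat p) \<notin> V \<and> (\<forall>x. x \<in> V \<or> inverse x \<in> V)"
proof -
  define AA where "AA = {V. unital_subring V \<and> inverse (of_nat p) \<notin> V}"
  have "\<int> \<in> AA"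
  proof -
    have "inverse (of_nat p) \<notin> (\<int> :: complex set)"
    proof
      assume "inverse (of_nat p) \<in> (\<int> :: complex set)"
      then obtain k where k: "inverse (of_nat p) = (of_int k :: complex)" by (auto elim: Ints_cases)
      then have "(of_int (k * int p) :: complex) = 1" using p by (simp add: field_simps flip: k)
      then have "k * int p = 1" by (metis of_int_eq_1_iff)
      then have "int p dvd 1" by (metis dvd_triv_right)
      then show False using p by simp
    qed
    then show ?thesis by (simp add: AA_def unital_subring_def)
  qed
  moreover have "\<Union>CC \<in> AA" if CC: "CC \<noteq> {}" "subset.chain AA CC" for CC
  proof -
    have sub: "\<And>V. V \<in> CC \<Longrightarrow> V \<in> AA" using CC by (auto simp: subset.chain_def)
    have ex: "\<exists>V\<in>CC. x \<in> V \<and> y \<in> V" if "x \<in> \<Union>CC" "y \<in> \<Union>CC" for x y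
      using that CC unfolding subset.chain_def by blast
    have "unital_subring (\<Union>CC)"
      unfolding unital_subring_def
    proof (intro conjI ballI)
      show "1 \<in> \<Union>CC" using CC(1) sub by (auto simp: AA_def unital_subring_def)
      fix x y assume "x \<in> \<Union>CC" "y \<in> \<Union>CC"
      then obtain V where "V \<in> CC" "x \<in> V" "y \<in> V" using ex by blast
      moreover from this(1) have "unital_subring V" using sub by (simp add: AA_def)
      ultimately show "x - y \<in> \<Union>CC" "x * y \<in> \<Union>CC" using unital_subringD(3,4) by blast+
    qed
    then show ?thesis using sub by (auto simp: AA_def)
  qed
  ultimately obtain V where V: "V \<in> AA" and max: "\<And>W. W \<in> AA \<Longrightarrow> V \<subseteq> W \<Longrightarrow> W = V"
    using subset_Zorn_nonempty[of AA] by blast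
  have sr: "unital_subring V" and pi: "inverse (of_nat p) \<notin> V" using V by (auto simp: AA_def)
  note Vs = unital_subringD[OF sr]
  have pV: "of_nat p \<in> V" by (rule Vs(8))
  have p0: "of_nat p \<noteq> (0 :: complex)" using p by simp
  \<comment> \<open>Adjoining anything new to the maximal subring must produce 1/p.\<close>
  have adj: "\<exists>n. inverse (of_nat p) \<in> poly_values V x n" if "x \<notin> V" for x
  proof (rule ccontr)
    assume n: "\<nexists>n. inverse (of_nat p) \<in> poly_values V x n"
    have "(\<Union>n. poly_values V x n) = V"
      by (rule max) (use n adjoin_subring[OF sr] V_subset_poly_values[OF sr] in \<open>auto simp: AA_def\<close>)
    moreover have "x * 1 \<in> poly_values V x (Suc 0)"
      by (rule poly_values_shift[OF sr]) (simp add: Vs(1))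
    ultimately have "x * 1 \<in> V" by blast
    then show False using that by simp
  qed
  \<comment> \<open>With y = 1 - p a: if 1/y were not in V, then 1/p would be a polynomial in 1/y,
    so y^n / p would lie in V for some n. But y^n = 1 - p b with b in V, which puts 1/p itself into
    V.\<close>
  have unit: "inverse (1 - of_nat p * a) \<in> V \<and> 1 - of_nat p * a \<noteq> 0" if a: "a \<in> V" for a
  proof -
    define y where "y = 1 - of_nat p * a"
    have yV: "y \<in> V" using a pV by (auto simp: y_def intro!: Vs(1,3,4))
    have y0: "y \<noteq> 0"
    proof
      assume "y = 0"
      then have "a = inverse (of_nat p)" using p0 by (simp add: y_def field_simps)
      then show False using a pi by simp
    qed
    have pow: "\<exists>b\<in>V. y ^ n = 1 - of_nat p * b" for n
    proof (induction n)
      case 0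
      show ?case by (rule bexI[of _ 0]) (auto intro: Vs)
    next
      case (Suc n)
      then obtain b where b: "b \<in> V" "y ^ n = 1 - of_nat p * b" by blast
      have "y ^ Suc n = y * (1 - of_nat p * b)" by (simp only: power_Suc b(2))
      also have "\<dots> = 1 - of_nat p * (a + b * y)" by (simp add: y_def algebra_simps)
      finally show ?case using Vs(6)[OF a Vs(4)[OF b(1) yV]] by blast
    qed
    have "inverse y \<in> V"
    proof (rule ccontr)
      assume "inverse y \<notin> V"
      then obtain n where n: "inverse (of_nat p) \<in> poly_values V (inverse y) n" using adj by blast
      have c: "y ^ n * inverse (of_nat p) \<in> V"
        using poly_values_inverse[OF sr y0 n] poly_values_self[OF sr yV] by blast
      obtain b where b: "b \<in> V" "y ^ n = 1 - of_nat p * b" using pow by blast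
      have "inverse (of_nat p) = y ^ n * inverse (of_nat p) + b" using p0 unfolding b(2) by (simp add: field_simps)
      then show False using Vs(6)[OF c b(1)] pi by simp
    qed
    then show ?thesis using y0 by (simp add: y_def)
  qed
  \<comment> \<open>The relation in powers of 1/x gives x = (p / u) z with u = 1 - p r a unit.
    Multiplying by a power of x expresses x^m by lower powers of x, which removes the leading term
    of the relation in powers of x.\<close>
  have step: "inverse (of_nat p) \<in> poly_values V x n"
    if h: "x \<noteq> 0" "inverse (of_nat p) \<in> poly_values V x (Suc n)"
      "inverse (of_nat p) \<in> poly_values V (inverse x) m" "m \<le> Suc n" for x n m
  proof (cases m)
    case 0
    then show ?thesis using h pi by simp
  next
    case (Suc k)
    obtain r z where rz: "inverse (of_nat p) = r + inverse x * z" "r \<in> V" "z \<in> poly_values V (inverse x) k"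
      using h(3) unfolding Suc by auto
    define u where "u = 1 - of_nat p * r"
    have u: "inverse u \<in> V" "u \<noteq> 0" using unit[OF rz(2)] by (auto simp: u_def)
    have "of_nat p * (inverse x * z) = u" using rz(1) p0 by (simp add: u_def field_simps)
    then have "x = inverse u * of_nat p * z" using h(1) u by (simp add: field_simps)
    then have "x ^ m = (inverse u * of_nat p) * (x ^ k * z)" by (simp add: Suc mult_ac)
    moreover have "x ^ k * z \<in> poly_values V x k" by (rule poly_values_inverse[OF sr h(1) rz(3)])
    ultimately have "x ^ m \<in> poly_values V x k"
      using poly_values_smult[OF sr Vs(4)[OF u(1) pV]] by simp
    then have "x ^ (Suc n - m) * x ^ m \<in> poly_values V x (k + (Suc n - m))"
      by (rule poly_values_power_shift[OF sr])
    moreover have "k + (Suc n - m) = n" "Suc n - m + m = Suc n" using Suc h(4) by auto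
    ultimately have xn: "x ^ Suc n \<in> poly_values V x n" by (simp flip: power_add)
    obtain c z where "c \<in> V" "z \<in> poly_values V x n" "inverse (of_nat p) = c * x ^ Suc n + z"
      using poly_values_top[OF sr h(2)] by blast
    then show ?thesis using poly_values_add[OF sr poly_values_smult[OF sr _ xn]] by metis
  qed
  \<comment> \<open>The larger of the two degrees is lowered, exchanging x and 1/x if necessary,
    until one relation has degree 0 and would put 1/p into V.\<close>
  have no: "\<not> (inverse (of_nat p) \<in> poly_values V x n \<and> inverse (of_nat p) \<in> poly_values V (inverse x) m)"
    if "x \<noteq> 0" for x n m
    using that
  proof (induction "n + m" arbitrary: n m x rule: less_induct)
    case less
    show ?case
    proof
      assume a: "inverse (of_nat p) \<in> poly_values V x n \<and> inverse (of_nat p) \<in> poly_values V (inverse x) m"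
      show False
      proof (cases "m \<le> n")
        case True
        show False
        proof (cases n)
          case 0
          then show False using a pi by simp
        next
          case (Suc n')
          then have "inverse (of_nat p) \<in> poly_values V x n'" using step[of x n' m] less.prems a True by blast
          then show False using less.hyps[of n' m x] less.prems a Suc by simp
        qed
      next
        case False
        then obtain m' where m': "m = Suc m'" by (cases m) auto
        have "inverse (of_nat p) \<in> poly_values V (inverse x) m'"
          using step[of "inverse x" m' n] less.prems a False m' by simp
        then show False using less.hyps[of n m' x] less.prems a m' by simp
      qed
    qed
  qed
  have "x \<in> V \<or> inverse x \<in> V" for x
  proof (rule ccontr)
    assume n: "\<not> (x \<in> V \<or> inverse x \<in> V)"
    then have "x \<noteq> 0" using Vs(2) by auto
    then show False using no adj n by blast
  qed
  then show ?thesis using sr pi by blast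
qed

section \<open>From a valuation ring to an absolute value on algebraic numbers\<close>

locale valuation_ring =
  fixes V :: "complex set" and p :: nat
  assumes subring: "unital_subring V" and p_inv_notin: "inverse (of_nat p) \<notin> V"
    and valuation: "x \<in> V \<or> inverse x \<in> V" and prime_p: "Factorial_Ring.prime p"
begin

lemmas V = unital_subringD[OF subring]

definition vunit where "vunit x \<longleftrightarrow> x \<noteq> 0 \<and> x \<in> V \<and> inverse x \<in> V"
definition vmax where "vmax x \<longleftrightarrow> x \<in> V \<and> \<not> vunit x"

lemma p_gt_1: "p > 1" using prime_gt_1_nat[OF prime_p] .
lemma p_nz [simp]: "of_nat p \<noteq> (0 :: complex)" using p_gt_1 by simp

lemma p_nat_nz [simp]: "p \<noteq> 0" "0 < p" using p_gt_1 by simp_all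

lemma p_powi_add: "of_nat p powi a * of_nat p powi b = (of_nat p powi (a + b) :: complex)"
  by (simp add: power_int_add)

lemma p_powi_power: "(of_nat p powi a) ^ n = (of_nat p powi (a * int n) :: complex)"
  by (simp add: power_int_mult)

lemma vunit_1 [simp]: "vunit 1" by (simp add: vunit_def V)
lemma vunit_mult: "vunit x \<Longrightarrow> vunit y \<Longrightarrow> vunit (x * y)" by (auto simp: vunit_def V)
lemma vunit_inverse: "vunit x \<Longrightarrow> vunit (inverse x)" by (auto simp: vunit_def)
lemma vunit_power: "vunit x \<Longrightarrow> vunit (x ^ n)" by (induction n) (auto intro: vunit_mult)
lemma vunit_minus: "vunit x \<Longrightarrow> vunit (- x)" by (auto simp: vunit_def V)

lemma vmax_mult: "vmax x \<Longrightarrow> y \<in> V \<Longrightarrow> vmax (x * y)"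
proof -
  assume x: "vmax x" and y: "y \<in> V"
  have "\<not> vunit (x * y)"
  proof
    assume u: "vunit (x * y)"
    then have "x \<noteq> 0" "y \<noteq> 0" by (auto simp: vunit_def)
    then have "inverse x = inverse (x * y) * y" by simp
    then have "inverse x \<in> V" using u y V(4) by (metis vunit_def)
    then show False using x \<open>x \<noteq> 0\<close> by (auto simp: vmax_def vunit_def)
  qed
  then show ?thesis using x y by (auto simp: vmax_def V)
qed

text \<open>One of x/y and y/x lies in V, so one summand can be factored out of the sum: the
  non-units of a valuation ring form an ideal.\<close>

lemma vmax_add: assumes "vmax x" "vmax y" shows "vmax (x + y)"
proof (cases "x = 0 \<or> y = 0")
  case False
  have *: "vmax (a + b)" if "vmax b" "a / b \<in> V" "b \<noteq> 0" for a b
  proof -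
    have "a + b = b * (1 + a / b)" using that by (simp add: field_simps)
    then show ?thesis using vmax_mult[OF that(1) V(6)[OF V(1) that(2)]] by simp
  qed
  have "x / y \<in> V \<or> y / x \<in> V" using valuation[of "x / y"] by simp
  then show ?thesis using *[of y x] *[of x y] assms False by (auto simp: add.commute)
qed (use assms in auto)

lemma vmax_p: "vmax (of_nat p)" using p_inv_notin by (auto simp: vmax_def vunit_def V)

lemma vmax_0: "vmax 0" by (simp add: vmax_def vunit_def V)

lemma vmax_sum: "(\<And>i. i \<in> I \<Longrightarrow> vmax (f i)) \<Longrightarrow> vmax (sum f I)"
  by (induction I rule: infinite_finite_induct) (auto intro: vmax_add vmax_0)

lemma vmax_imp_notunit: "vmax x \<Longrightarrow> \<not> vunit x" by (simp add: vmax_def)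

lemma vunit_of_int: assumes "\<not> int p dvd n" shows "vunit (of_int n)"
proof (rule ccontr)
  assume "\<not> vunit (of_int n)"
  then have n: "vmax (of_int n)" by (simp add: vmax_def V)
  have "coprime (int p) n" using assms prime_p by (metis prime_imp_coprime prime_nat_int_transfer)
  then obtain a b where ab: "a * int p + b * n = 1" by (metis bezout_int coprime_iff_gcd_eq_1)
  have "vmax (of_nat p * of_int a + of_int n * of_int b)"
    by (intro vmax_add vmax_mult vmax_p n V)
  moreover have "of_nat p * of_int a + of_int n * of_int b = (of_int (a * int p + b * n) :: complex)" by simp
  ultimately show False unfolding ab by (simp add: vmax_def)
qed

lemma vunit_p_powi_iff: "vunit (of_nat p powi k) \<longleftrightarrow> k = 0"
proof
  have *: "\<not> vunit (of_nat p ^ Suc n)" for n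
    using vmax_mult[OF vmax_p, of "of_nat p ^ n"] by (intro vmax_imp_notunit) (simp add: V)
  assume u: "vunit (of_nat p powi k)"
  show "k = 0"
  proof (rule ccontr)
    assume "k \<noteq> 0"
    define n where "n = nat \<bar>k\<bar> - 1"
    have n: "nat \<bar>k\<bar> = Suc n" using \<open>k \<noteq> 0\<close> by (simp add: n_def)
    have "vunit (of_nat p powi \<bar>k\<bar>)" using u vunit_inverse[OF u] by (auto simp: abs_if power_int_minus)
    then show False using *[of n] n by (simp add: power_int_def)
  qed
qed simp

text \<open>Up to units of \<open>V\<close>, the \<open>e\<close>-th power of \<open>x\<close> is \<open>p\<^sup>k\<close>, so the value of \<open>x\<close> has to be \<open>p\<close> to the
  power \<open>- k / e\<close>.\<close>

definition vrel where "vrel x e k \<longleftrightarrow> e > (0::nat) \<and> vunit (x ^ e * of_nat p powi (- k))"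

definition vabs where "vabs x = (if x = 0 then 0 else
   THE r. \<exists>e k. vrel x e k \<and> r = real p powr (- (of_int k / of_nat e)))"

text \<open>Eliminating x from two such relations leaves a power of p that is a unit of V, so its
  exponent is 0. Hence the quotient k / e, the only thing \<open>vabs\<close> uses, is well
  defined.\<close>

lemma vrel_unique: assumes "vrel x e k" "vrel x e' k'" shows "k * int e' = k' * int e"
proof -
  have "x \<noteq> 0" using assms by (auto simp: vrel_def vunit_def zero_power)
  have "vunit ((x ^ e * of_nat p powi (- k)) ^ e' * inverse ((x ^ e' * of_nat p powi (- k')) ^ e))"
    using assms unfolding vrel_def by (blast intro: vunit_mult[OF vunit_power vunit_inverse[OF vunit_power]])
  also have "(x ^ e * of_nat p powi (- k)) ^ e' * inverse ((x ^ e' * of_nat p powi (- k')) ^ e) =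
      (of_nat p powi (- k)) ^ e' * inverse ((of_nat p powi (- k')) ^ e)"
    using \<open>x \<noteq> 0\<close> by (simp add: power_mult_distrib field_simps flip: power_mult)
  also have "\<dots> = of_nat p powi (- (k * int e')) * of_nat p powi (k' * int e)"
    by (simp add: power_int_mult power_int_minus power_inverse)
  also have "\<dots> = of_nat p powi (k' * int e - k * int e')" by (simp add: p_powi_add)
  finally show ?thesis unfolding vunit_p_powi_iff by simp
qed

lemma vabs_eq: assumes "vrel x e k" shows "vabs x = real p powr (- (of_int k / of_nat e))"
proof -
  have "x \<noteq> 0" using assms by (auto simp: vrel_def vunit_def zero_power)
  have "(THE r. \<exists>e k. vrel x e k \<and> r = real p powr (- (of_int k / of_nat e))) = real p powr (- (of_int k / of_nat e))"
  proof (rule the_equality)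
    fix r assume "\<exists>e k. vrel x e k \<and> r = real p powr (- (of_int k / of_nat e))"
    then obtain e' k' where r: "vrel x e' k'" "r = real p powr (- (of_int k' / of_nat e'))" by blast
    have e: "e > 0" "e' > 0" using assms r by (auto simp: vrel_def)
    have "real_of_int (k * int e') = real_of_int (k' * int e)" using vrel_unique[OF assms r(1)] by simp
    then have "real_of_int k' / real e' = real_of_int k / real e" using e by (simp add: field_simps)
    then show "r = real p powr (- (of_int k / of_nat e))" using r by simp
  qed (use assms in blast)
  then show ?thesis using \<open>x \<noteq> 0\<close> by (simp add: vabs_def)
qed

lemma vrel_mult: assumes "vrel x e k" "vrel y e' k'" shows "vrel (x * y) (e * e') (k * int e' + k' * int e)"
proof -
  have "vunit ((x ^ e * of_nat p powi (- k)) ^ e' * (y ^ e' * of_nat p powi (- k')) ^ e)"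
    using assms unfolding vrel_def by (blast intro: vunit_mult[OF vunit_power vunit_power])
  also have "(x ^ e * of_nat p powi (- k)) ^ e' * (y ^ e' * of_nat p powi (- k')) ^ e =
    (x * y) ^ (e * e') * (of_nat p powi (- k * int e') * of_nat p powi (- k' * int e))"
    by (simp only: power_mult_distrib p_powi_power power_mult[symmetric]) (simp add: mult_ac)
  also have "of_nat p powi (- k * int e') * of_nat p powi (- k' * int e) = (of_nat p powi (- (k * int e' + k' * int e)) :: complex)"
    unfolding p_powi_add by (rule arg_cong) simp
  finally show ?thesis using assms by (simp add: vrel_def)
qed

lemma vabs_mult: assumes "vrel x e k" "vrel y e' k'" shows "vabs (x * y) = vabs x * vabs y"
proof -
  have e: "e > 0" "e' > 0" using assms by (auto simp: vrel_def)
  have "- (of_int (k * int e' + k' * int e) / of_nat (e * e')) = - (of_int k / of_nat e) + - (of_int k' / of_nat e' :: real)"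
    using e by (simp add: field_simps)
  then show ?thesis
    unfolding vabs_eq[OF vrel_mult[OF assms]] vabs_eq[OF assms(1)] vabs_eq[OF assms(2)] powr_add[symmetric]
    by (simp only:)
qed

lemma vabs_pos: "vrel x e k \<Longrightarrow> vabs x > 0" using p_gt_1 by (simp add: vabs_eq)

text \<open>A value of at most 1 puts x^e into V, and V is integrally closed: otherwise 1/x would be
  in the maximal ideal, and so would 1 = x^(-e) x^e. Conversely, for x in V a negative k would put a
  unit into the maximal ideal.\<close>

lemma vabs_le_1_iff: assumes "vrel x e k" shows "vabs x \<le> 1 \<longleftrightarrow> x \<in> V"
proof -
  have e: "e > 0" and u: "vunit (x ^ e * of_nat p powi (- k))" using assms by (auto simp: vrel_def)
  have x0: "x \<noteq> 0" using u e by (auto simp: vunit_def zero_power)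
  have "vabs x \<le> real p powr 0 \<longleftrightarrow> - (of_int k / of_nat e :: real) \<le> 0"
    unfolding vabs_eq[OF assms] by (rule powr_le_cancel_iff) (use p_gt_1 in simp)
  then have l: "vabs x \<le> 1 \<longleftrightarrow> k \<ge> 0" using e p_gt_1 by (simp add: zero_le_divide_iff)
  show ?thesis
  proof
    assume "vabs x \<le> 1"
    then have k: "k \<ge> 0" using l by simp
    have "x ^ e = (x ^ e * of_nat p powi (- k)) * of_nat p ^ nat k"
    proof -
      have "of_nat p powi (- k) * of_nat p powi k = (1 :: complex)" by (simp only: p_powi_add) simp
      moreover have "of_nat p powi k = (of_nat p ^ nat k :: complex)" using k by (simp add: power_int_def)
      ultimately show ?thesis by (simp add: mult.assoc)
    qed
    moreover have "x ^ e * of_nat p powi (- k) \<in> V" using u by (simp add: vunit_def)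
    ultimately have xe: "x ^ e \<in> V" using V(4) V(7,8) by metis
    show "x \<in> V"
    proof (rule ccontr)
      assume n: "x \<notin> V"
      then have m: "vmax (inverse x)" using valuation[of x] by (auto simp: vmax_def vunit_def)
      obtain e' where e': "e = Suc e'" using e gr0_conv_Suc by blast
      have "vmax (inverse x * (inverse x ^ e' * x ^ e))"
        using m by (intro vmax_mult V(4) V(7) xe) (simp_all add: vmax_def)
      moreover have "inverse x * (inverse x ^ e' * x ^ e) = 1"
        using x0 by (simp add: e' power_inverse field_simps)
      ultimately show False by (simp add: vmax_def)
    qed
  next
    assume x: "x \<in> V"
    show "vabs x \<le> 1" unfolding l
    proof (rule ccontr)
      assume "\<not> k \<ge> 0"
      then obtain m where m: "- k = int (Suc m)" by (metis neg_0_less_iff_less not_le zero_less_imp_eq_int gr0_conv_Suc)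
      have "vmax (of_nat p * (of_nat p ^ m * x ^ e))"
        by (intro vmax_mult vmax_p V(4) V(7) x V(8))
      moreover have "of_nat p * (of_nat p ^ m * x ^ e) = x ^ e * of_nat p powi (- k)"
        unfolding m by (simp add: power_int_def nat_add_distrib mult_ac)
      ultimately show False using u by (simp add: vmax_def)
    qed
  qed
qed

lemma vunit_int_multiplicity:
  assumes "n \<noteq> 0" shows "vunit (of_int n * of_nat p powi (- int (multiplicity (int p) n)))"
proof -
  obtain k where k: "n = int p ^ multiplicity (int p) n * k" "\<not> int p dvd k"
    using multiplicity_decompose'[of n "int p"] assms p_gt_1 by auto
  have "of_int n = (of_nat p ^ multiplicity (int p) n * of_int k :: complex)"
    by (subst k(1)) simp
  then have "of_int n * of_nat p powi (- int (multiplicity (int p) n)) = (of_int k :: complex)"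
    by (simp add: power_int_minus power_int_of_nat)
  then show ?thesis using vunit_of_int[OF k(2)] by simp
qed

text \<open>In a vanishing sum the largest value is attained at least twice. For the terms of a
  polynomial relation of x this makes a quotient of two terms a unit, and such a quotient is a power
  of x times a rational number, which is a power of p up to units.\<close>

lemma vrel_exists:
  assumes "algebraic x" "x \<noteq> 0" shows "\<exists>e k. vrel x e k"
proof -
  obtain q where q: "\<And>i. coeff q i \<in> \<int>" "q \<noteq> 0" "poly q x = 0"
    using assms(1) by (auto simp: algebraic_def)
  define I where "I = {i. coeff q i \<noteq> 0}"
  define t where "t i = coeff q i * x ^ i" for i
  have I: "I \<subseteq> {..degree q}" by (auto simp: I_def le_degree)
  then have fin: "finite I" by (rule finite_subset) simp
  have ne: "I \<noteq> {}" using q(2) by (auto simp: I_def poly_eq_iff)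
  have t0: "t i \<noteq> 0" if "i \<in> I" for i using that assms(2) by (auto simp: t_def I_def)
  have sum0: "(\<Sum>i\<in>I. t i) = 0"
  proof -
    have "(\<Sum>i\<in>I. t i) = (\<Sum>i\<le>degree q. t i)"
      by (rule sum.mono_neutral_left) (use I in \<open>auto simp: I_def t_def\<close>)
    then show ?thesis using q(3) by (simp add: poly_altdef t_def)
  qed
  \<comment> \<open>A term of largest value exists because any two elements are comparable under
    divisibility in V.\<close>
  have "\<exists>j\<in>J. \<forall>i\<in>J. t i / t j \<in> V" if "finite J" "J \<noteq> {}" "J \<subseteq> I" for J
    using that
  proof (induction J rule: finite_ne_induct)
    case (singleton j)
    then show ?case using t0 V(1) by simp
  next
    case (insert a J)
    then obtain j where j: "j \<in> J" "\<forall>i\<in>J. t i / t j \<in> V" by auto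
    have nz: "t a \<noteq> 0" "t j \<noteq> 0" using t0 insert.prems j by auto
    show ?case
    proof (cases "t a / t j \<in> V")
      case True
      then show ?thesis using j by auto
    next
      case False
      then have aj: "t j / t a \<in> V" using valuation[of "t a / t j"] by simp
      have "t i / t a \<in> V" if "i \<in> J" for i
      proof -
        have "t i / t a = (t i / t j) * (t j / t a)" using nz by simp
        moreover have "t i / t j \<in> V" using j that by blast
        ultimately show ?thesis using V(4)[OF _ aj] by metis
      qed
      then show ?thesis using nz V(1) by auto
    qed
  qed
  from this[OF fin ne subset_refl] obtain j where j: "j \<in> I" "\<And>i. i \<in> I \<Longrightarrow> t i / t j \<in> V" by blast
  \<comment> \<open>Otherwise all other quotients would lie in the maximal ideal, and so would their
    sum, which is -1.\<close>
  have "\<exists>i\<in>I. i \<noteq> j \<and> vunit (t i / t j)"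
  proof (rule ccontr)
    assume n: "\<not> (\<exists>i\<in>I. i \<noteq> j \<and> vunit (t i / t j))"
    have "vmax (\<Sum>i\<in>I - {j}. t i / t j)" by (rule vmax_sum) (use n j in \<open>auto simp: vmax_def\<close>)
    moreover have "(\<Sum>i\<in>I - {j}. t i / t j) = - 1"
    proof -
      have "(\<Sum>i\<in>I. t i / t j) = 0" using sum0 by (simp flip: sum_divide_distrib)
      then show ?thesis using sum.remove[OF fin j(1), of "\<lambda>i. t i / t j"] t0[OF j(1)]
        by (simp add: add_eq_0_iff)
    qed
    ultimately show False using vunit_minus[OF vunit_1] by (simp add: vmax_def)
  qed
  then obtain i where i: "i \<in> I" "i \<noteq> j" "vunit (t i / t j)" by blast
  have *: "\<exists>e k. vrel x e k" if ab: "a \<in> I" "b \<in> I" "a > b" "vunit (t a / t b)" for a b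
  proof -
    obtain ca cb where c: "coeff q a = of_int ca" "coeff q b = of_int cb" using q(1) by (metis Ints_cases)
    have c0: "ca \<noteq> 0" "cb \<noteq> 0" using ab(1,2) c by (auto simp: I_def)
    define ma mb where "ma = int (multiplicity (int p) ca)" and "mb = int (multiplicity (int p) cb)"
    have "vunit ((t a / t b) * ((of_int cb * of_nat p powi (- mb)) * inverse (of_int ca * of_nat p powi (- ma))))"
      unfolding ma_def mb_def
      by (rule vunit_mult[OF ab(4) vunit_mult[OF vunit_int_multiplicity vunit_inverse[OF vunit_int_multiplicity]]])
        (use c0 in auto)
    also have "(t a / t b) * ((of_int cb * of_nat p powi (- mb)) * inverse (of_int ca * of_nat p powi (- ma)))
        = (x ^ a / x ^ b) * (of_nat p powi (- mb) * inverse (of_nat p powi (- ma)))"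
      using c0 by (simp add: t_def c field_simps)
    also have "x ^ a / x ^ b = x ^ (a - b)" using ab(3) assms(2) by (simp add: power_diff)
    also have "of_nat p powi (- mb) * inverse (of_nat p powi (- ma)) = (of_nat p powi (- (mb - ma)) :: complex)"
      by (simp add: power_int_minus field_simps power_int_diff)
    finally have "vrel x (a - b) (mb - ma)" using ab(3) by (simp add: vrel_def)
    then show ?thesis by blast
  qed
  show ?thesis
  proof (cases "i > j")
    case True
    then show ?thesis using *[OF i(1) j(1) _ i(3)] by simp
  next
    case False
    moreover have "vunit (t j / t i)" using vunit_inverse[OF i(3)] by simp
    ultimately show ?thesis using *[OF j(1) i(1)] i(2) by simp
  qed
qed

lemma vabs_rational: assumes "x \<in> \<rat>" shows "vabs x = padic_abs p x"
proof -
  obtain q where q: "x = of_rat q" using assms by (auto elim: Rats_cases)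
  have the: "(THE r. of_rat r = x) = q" unfolding q by (rule the_equality) auto
  show ?thesis
  proof (cases "q = 0")
    case True
    then show ?thesis using q assms the by (simp add: padic_abs_def vabs_def padic_abs_rat_def)
  next
    case False
    obtain a b where ab: "quotient_of q = (a, b)" by fastforce
    have b: "b > 0" using quotient_of_denom_pos[OF ab] .
    have r: "x = of_int a / of_int b" unfolding q using quotient_of_div[OF ab] by (simp add: of_rat_divide)
    have a: "a \<noteq> 0" using False q r by auto
    define ma mb where "ma = int (multiplicity (int p) a)" and "mb = int (multiplicity (int p) b)"
    have "vunit ((of_int a * of_nat p powi (- ma)) * inverse (of_int b * of_nat p powi (- mb)))"
      unfolding ma_def mb_def using a b by (intro vunit_mult[OF vunit_int_multiplicity vunit_inverse[OF vunit_int_multiplicity]]) auto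
    also have "(of_int a * of_nat p powi (- ma)) * inverse (of_int b * of_nat p powi (- mb)) = x ^ 1 * of_nat p powi (- (ma - mb))"
      by (simp add: r power_int_minus field_simps power_int_diff)
    finally have "vrel x 1 (ma - mb)" by (simp add: vrel_def)
    then have "vabs x = real p powr (of_int (mb - ma))" by (simp add: vabs_eq)
    also have "\<dots> = real p powi (mb - ma)" using p_gt_1 by (subst powr_real_of_int') auto
    finally show ?thesis
      using False ab assms the by (simp add: padic_abs_def padic_abs_rat_def ma_def mb_def)
  qed
qed

text \<open>Dividing by the larger of two elements reduces the triangle inequality to closure of V
  under addition of 1, since comparison with 1 is membership in V. Algebraicity makes
  \<open>vabs\<close> meaningful on all of E.\<close>

lemma place_exists:
  assumes E: "complex_subfield E" and alg: "\<And>x. x \<in> E \<Longrightarrow> algebraic x"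
  shows "restrict vabs E \<in> places_above p E"
proof -
  interpret complex_subfield E by fact
  have mult: "vabs (x * y) = vabs x * vabs y" if xy: "x \<in> E" "y \<in> E" for x y
  proof (cases "x = 0 \<or> y = 0")
    case False
    obtain e k where 1: "vrel x e k" using vrel_exists[OF alg[OF xy(1)]] False by blast
    obtain e' k' where "vrel y e' k'" using vrel_exists[OF alg[OF xy(2)]] False by blast
    with 1 show ?thesis by (rule vabs_mult)
  qed (auto simp: vabs_def)
  have pos: "vabs x > 0" if "x \<in> E" "x \<noteq> 0" for x
    using vrel_exists[OF alg[OF that(1)] that(2)] vabs_pos by blast
  have z: "vabs 0 = 0" by (simp add: vabs_def)
  have nn: "vabs x \<ge> 0" if "x \<in> E" for x using pos[OF that] z by (cases "x = 0") auto
  have le1: "vabs x \<le> 1 \<longleftrightarrow> x \<in> V" if "x \<in> E" for x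
  proof (cases "x = 0")
    case True
    then show ?thesis using V(2) z by simp
  next
    case False
    then show ?thesis using vrel_exists[OF alg[OF that] False] vabs_le_1_iff by blast
  qed
  have ultra: "vabs (x + y) \<le> vabs y" if "x \<in> E" "y \<in> E" "vabs x \<le> vabs y" for x y
  proof (cases "y = 0")
    case True
    then show ?thesis using that pos[of x] z by (cases "x = 0") auto
  next
    case False
    have dE: "x / y \<in> E" "1 + x / y \<in> E" using that by (auto intro!: mem_intros)
    have "vabs x = vabs (x / y) * vabs y" using mult[OF dE(1) that(2)] False by simp
    then have "vabs (x / y) \<le> 1" using that(3) pos[OF that(2) False] by simp
    then have "1 + x / y \<in> V" using le1[OF dE(1)] V(1,6) by simp
    then have "vabs (1 + x / y) \<le> 1" using le1[OF dE(2)] by simp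
    moreover have "x + y = (1 + x / y) * y" using False by (simp add: field_simps)
    ultimately show ?thesis using mult[OF dE(2) that(2)] pos[OF that(2) False] by simp
  qed
  have tri: "vabs (x + y) \<le> vabs x + vabs y" if "x \<in> E" "y \<in> E" for x y
  proof (cases "vabs x \<le> vabs y")
    case True
    then show ?thesis using ultra[OF that] nn[OF that(1)] by simp
  next
    case False
    then show ?thesis using ultra[OF that(2,1)] nn[OF that(2)] by (simp add: add.commute)
  qed
  show ?thesis
    unfolding places_above_def absolute_value_def
  proof (intro CollectI conjI ballI)
    show "restrict vabs E x = 0 \<longleftrightarrow> x = 0" if "x \<in> E" for x
      using that pos[OF that] z by (cases "x = 0") auto
    show "restrict vabs E x = padic_abs p x" if "x \<in> \<rat>" for x
      using that Rats_subset vabs_rational[OF that] by auto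
  qed (use nn mult tri mult_mem add_mem in auto)
qed

end

lemma places_above_nonempty:
  assumes "complex_subfield E" "\<And>x. x \<in> E \<Longrightarrow> algebraic x" "Factorial_Ring.prime p"
  shows "places_above p E \<noteq> {}"
proof -
  obtain V where "unital_subring V" "inverse (of_nat p) \<notin> V" "\<forall>x. x \<in> V \<or> inverse x \<in> V"
    using valuation_ring_exists[OF prime_gt_1_nat[OF assms(3)]] by blast
  then interpret valuation_ring V p using assms(3) by unfold_locales auto
  show ?thesis using place_exists[OF assms(1,2)] by blast
qed

text \<open>A place of the rationals has all its values prescribed, so it can only be
  \<open>padic_abs p\<close>. The mere existence of a place thus shows that this function satisfies
  the axioms of an absolute value.\<close>

lemma valued_field_Rats:
  assumes "Factorial_Ring.prime p" shows "valued_field \<rat> (padic_abs p) p"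
proof -
  obtain w where w: "w \<in> places_above p \<rat>"
    using places_above_nonempty[OF complex_subfield_Rats rat_imp_algebraic assms] by blast
  then have "w = padic_abs p"
    by (intro extensionalityI[of _ \<rat>]) (auto simp: places_above_def padic_abs_def)
  then show ?thesis using places_above_valued_field[OF assms complex_subfield_Rats w] by simp
qed

section \<open>The splitting field of the cubic\<close>

abbreviation of_rat_poly :: "rat poly \<Rightarrow> complex poly" where
  "of_rat_poly \<equiv> map_poly of_rat"

lemma of_rat_poly_hom:
  "of_rat_poly (p + q) = of_rat_poly p + of_rat_poly q"
  "of_rat_poly (p * q) = of_rat_poly p * of_rat_poly q"
  "of_rat_poly 1 = 1"
  "pderiv (of_rat_poly p) = of_rat_poly (pderiv p)"
proof -
  show "of_rat_poly (p + q) = of_rat_poly p + of_rat_poly q"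
    by (rule poly_eqI) (simp add: coeff_map_poly of_rat_add)
  show "of_rat_poly (p * q) = of_rat_poly p * of_rat_poly q"
    by (rule poly_eqI) (simp add: coeff_map_poly coeff_mult of_rat_sum of_rat_mult)
  show "pderiv (of_rat_poly p) = of_rat_poly (pderiv p)"
    by (rule poly_eqI) (simp add: coeff_map_poly coeff_pderiv of_rat_mult of_rat_add)
qed (simp add: map_poly_1)

lemma coprime_rat_poly_no_common_root:
  assumes "coprime p q" "poly (of_rat_poly p) x = 0" "poly (of_rat_poly q) x = 0" shows False
proof -
  obtain a b where ab: "bezout_coefficients p q = (a, b)" by fastforce
  have "a * p + b * q = 1" using bezout_coefficients[OF ab] assms(1) by simp
  then have "poly (of_rat_poly (a * p + b * q)) x = 1" by (simp add: of_rat_poly_hom)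
  then show False using assms by (simp add: of_rat_poly_hom)
qed

lemma irreducible_rat_poly_dvd:
  assumes q: "Factorial_Ring.irreducible q" and x: "poly (of_rat_poly q) x = 0" "poly (of_rat_poly g) x = 0"
  shows "q dvd g"
proof (rule ccontr)
  assume "\<not> q dvd g"
  then have "coprime q g"
    using q unfolding coprime_def by (metis irreducibleD' dvd_trans)
  then show False using coprime_rat_poly_no_common_root x by blast
qed

text \<open>A multiple root would be a common root with the derivative, so the irreducible q would
  divide a nonzero polynomial of smaller degree.\<close>

lemma irreducible_rat_poly_rsquarefree:
  assumes q: "Factorial_Ring.irreducible q" shows "rsquarefree (of_rat_poly q)"
  unfolding rsquarefree_roots
proof (intro allI notI)
  fix a assume a: "poly (of_rat_poly q) a = 0 \<and> poly (pderiv (of_rat_poly q)) a = 0"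
  then have dvd: "q dvd pderiv q"
    using irreducible_rat_poly_dvd[OF q, of a "pderiv q"] by (simp add: of_rat_poly_hom)
  have deg: "degree q > 0"
  proof (rule ccontr)
    assume "\<not> degree q > 0"
    then obtain c where "q = [:c:]" by (metis degree_eq_zeroE gr0I)
    then show False using q by (cases "c = 0") (auto simp: Factorial_Ring.irreducible_def is_unit_const_poly_iff dvd_field_iff)
  qed
  then have "pderiv q \<noteq> 0" by (metis pderiv_eq_0_iff less_irrefl)
  then have "degree q \<le> degree (pderiv q)" using dvd by (rule dvd_imp_degree_le[rotated])
  then show False using deg by (simp add: degree_pderiv)
qed

lemma poly_cubic: "poly (cubic t) x = x ^ 3 - (of_int t)\<^sup>2 * x - 1"
  by (simp add: cubic_def algebra_simps power3_eq_cube)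

lemma of_rat_cubic: "of_rat_poly (cubic t) = cubic t"
  by (simp add: cubic_def map_poly_pCons of_rat_minus of_rat_power)

text \<open>A rational root would be an integer n with n (n^2 - t^2) = 1. Then n is 1 or -1, so t^2
  is 0 or 2, excluded by t >= 2. A cubic without rational roots has no linear factor and is
  irreducible.\<close>

lemma irreducible_cubic:
  assumes t: "t \<ge> 2" shows "Factorial_Ring.irreducible (cubic t :: rat poly)"
proof -
  have noroot: "poly (cubic t :: rat poly) r \<noteq> 0" for r
  proof
    assume r: "poly (cubic t :: rat poly) r = 0"
    have e: "of_rat r ^ 3 - (of_int t)\<^sup>2 * of_rat r - 1 = (0 :: complex)"
    proof -
      have "of_rat (r ^ 3 - (of_int t)\<^sup>2 * r - 1) = (0 :: complex)" using r by (simp add: poly_cubic)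
      then show ?thesis by (simp add: of_rat_diff of_rat_mult of_rat_power)
    qed
    have "algebraic_int (of_rat r :: complex)"
    proof (rule algebraic_int.intros)
      show "lead_coeff (cubic t :: complex poly) = 1" by (simp add: cubic_def)
      show "\<forall>i. coeff (cubic t :: complex poly) i \<in> \<int>"
        by (auto simp: cubic_def coeff_pCons split: nat.splits)
      show "poly (cubic t) (of_rat r :: complex) = 0" using e by (simp add: poly_cubic)
    qed
    then have "(of_rat r :: complex) \<in> \<int>" by (rule rational_algebraic_int_is_int) simp
    then obtain n where n: "(of_rat r :: complex) = of_int n" by (auto elim: Ints_cases)
    have "(of_int (n ^ 3 - t\<^sup>2 * n - 1) :: complex) = 0" using e unfolding n by simp
    then have n3: "n * (n\<^sup>2 - t\<^sup>2) = 1" by (simp only: of_int_eq_0_iff) (simp add: algebra_simps power2_eq_square power3_eq_cube)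
    then have "n = 1 \<or> n = -1" by (auto simp: zmult_eq_1_iff)
    moreover have "t\<^sup>2 \<ge> 2\<^sup>2" using t by (intro power_mono) auto
    ultimately show False using n3 by auto
  qed
  show ?thesis
    unfolding Factorial_Ring.irreducible_def
  proof (intro conjI allI impI)
    show "cubic t \<noteq> (0 :: rat poly)" by (simp add: cubic_def)
    show "\<not> cubic t dvd (1 :: rat poly)" by (simp add: cubic_def is_unit_poly_iff)
    fix g h :: "rat poly" assume gh: "cubic t = g * h"
    then have nz: "g \<noteq> 0" "h \<noteq> 0" by (auto simp: cubic_def)
    have "degree (cubic t :: rat poly) = 3" by (simp add: cubic_def)
    then have deg: "degree g + degree h = 3" using degree_mult_eq[OF nz] gh by simp
    have lin: False if "degree k = 1" "k dvd (cubic t :: rat poly)" for k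
    proof -
      obtain b m where bm: "k = pCons b m" by (cases k) auto
      have m: "degree m = 0" "m \<noteq> 0"
        using that(1) unfolding bm by (auto simp: degree_pCons_eq_if split: if_splits)
      obtain a where a: "m = [:a:]" using degree_eq_zeroE[OF m(1)] by blast
      then have k: "k = [:b, a:]" "a \<noteq> 0" using bm m by auto
      have "poly k (- b / a) = 0" using k by simp
      then have "poly (cubic t :: rat poly) (- b / a) = 0" using that(2) by (metis dvdE mult_zero_left poly_mult)
      then show False using noroot by blast
    qed
    have "degree g \<noteq> 1" "degree h \<noteq> 1" using lin[of g] lin[of h] gh by auto
    then have "degree g = 0 \<or> degree h = 0" using deg by linarith
    then show "g dvd 1 \<or> h dvd 1" using nz by (auto simp: is_unit_iff_degree)
  qed
qed

text \<open>The elements of \<open>K\<close> are written as triples of coordinates with respect to \<open>1, l, l\<^sup>2\<close>, those of \<open>F\<close> as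
  pairs of triples with respect to \<open>1\<close> and a square root \<open>d\<close> of the discriminant; changing \<open>l\<close> and \<open>d\<close>
  gives the embeddings.\<close>

definition kval :: "complex \<Rightarrow> rat \<times> rat \<times> rat \<Rightarrow> complex" where
  "kval l v = (case v of (a, b, c) \<Rightarrow> of_rat a + of_rat b * l + of_rat c * l\<^sup>2)"

fun kadd :: "rat \<times> rat \<times> rat \<Rightarrow> rat \<times> rat \<times> rat \<Rightarrow> rat \<times> rat \<times> rat" where
  "kadd (a, b, c) (a', b', c') = (a + a', b + b', c + c')"

fun kscale :: "rat \<Rightarrow> rat \<times> rat \<times> rat \<Rightarrow> rat \<times> rat \<times> rat" where
  "kscale r (a, b, c) = (r * a, r * b, r * c)"

text \<open>The product reduced by l^3 = T l + 1 and l^4 = T l^2 + l, with T in place of t^2. No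
  particular root occurs, so one formula serves for all conjugates.\<close>

fun kmul :: "rat \<Rightarrow> rat \<times> rat \<times> rat \<Rightarrow> rat \<times> rat \<times> rat \<Rightarrow> rat \<times> rat \<times> rat" where
  "kmul T (a, b, c) (a', b', c') = (a * a' + (b * c' + c * b'),
     a * b' + b * a' + T * (b * c' + c * b') + c * c', a * c' + b * b' + c * a' + T * (c * c'))"

lemma kval_add: "kval l (kadd u v) = kval l u + kval l v"
  by (cases u; cases v) (simp add: kval_def of_rat_add algebra_simps)

lemma kval_scale: "kval l (kscale r v) = of_rat r * kval l v"
  by (cases v) (simp add: kval_def of_rat_mult algebra_simps)

lemma kval_mul_aux:
  fixes T a b c a1 b1 c1 l :: complex
  assumes "l ^ 3 = T * l + 1"
  shows "(a + b * l + c * l\<^sup>2) * (a1 + b1 * l + c1 * l\<^sup>2) = (a * a1 + (b * c1 + c * b1)) +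
    (a * b1 + b * a1 + T * (b * c1 + c * b1) + c * c1) * l + (a * c1 + b * b1 + c * a1 + T * (c * c1)) * l\<^sup>2"
  using assms by Groebner_Basis.algebra

lemma kval_mul:
  assumes "l ^ 3 = of_rat T * l + 1"
  shows "kval l (kmul T u v) = kval l u * kval l v"
  using kval_mul_aux[OF assms]
  by (cases u; cases v) (simp add: kval_def of_rat_add of_rat_mult)

definition fval :: "complex \<Rightarrow> complex \<Rightarrow> (rat \<times> rat \<times> rat) \<times> (rat \<times> rat \<times> rat) \<Rightarrow> complex" where
  "fval l d v = kval l (fst v) + d * kval l (snd v)"

text \<open>The roots enter through Vieta's relations and in a chosen order. The relations are
  symmetric, so \<open>rotate\<close> carries every fact about l1 over to the other roots.\<close>

locale cubic_field =
  fixes t :: int and l1 l2 l3 :: complex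
  assumes t_ge_2: "t \<ge> 2"
    and root_sum: "l1 + l2 + l3 = 0" and root_sum2: "l1 * l2 + l1 * l3 + l2 * l3 = - ((of_int t)\<^sup>2)"
    and root_prod: "l1 * l2 * l3 = 1"
    and real_roots: "l1 \<in> \<real>" "l2 \<in> \<real>" "l3 \<in> \<real>"
begin

definition T :: rat where "T = (of_int t)\<^sup>2"
definition D :: rat where "D = 4 * T ^ 3 - 27"
definition \<delta> :: complex where "\<delta> = (l1 - l2) * (l2 - l3) * (l1 - l3)"

lemma of_rat_T: "of_rat T = (of_int t)\<^sup>2" by (simp add: T_def of_rat_power)
lemma of_rat_D: "of_rat D = 4 * of_rat T ^ 3 - (27 :: complex)"
  by (simp add: D_def of_rat_diff of_rat_mult of_rat_power)

lemmas rels = root_sum root_sum2[folded of_rat_T] root_prod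

lemma cubic_root: "l1 ^ 3 = of_rat T * l1 + 1"
  using rels by Groebner_Basis.algebra

lemma delta_square: "\<delta>\<^sup>2 = of_rat D"
  unfolding of_rat_D \<delta>_def using rels by Groebner_Basis.algebra

text \<open>By definition \<open>\<delta>\<close> is l2 - l3 times the derivative 3 l1^2 - T of the
  cubic at l1. Inverting this derivative as a quadratic polynomial in l1 over the discriminant shows
  that l2 and l3 lie in the field generated by l1 and \<open>\<delta>\<close>.\<close>

lemma l2_relation: "(l2 - l3) * of_rat D = - \<delta> * (4 * (of_rat T)\<^sup>2 + 9 * l1 - 6 * of_rat T * l1\<^sup>2)"
  unfolding of_rat_D \<delta>_def using rels by Groebner_Basis.algebra

lemma rotate: "cubic_field t l2 l3 l1"
  using t_ge_2 root_sum root_sum2 root_prod real_roots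
  by (intro cubic_field.intro) (simp_all add: ac_simps)

lemma rotate_delta: "cubic_field.\<delta> l2 l3 l1 = \<delta>"
  unfolding \<delta>_def cubic_field.\<delta>_def[OF rotate] by (simp add: algebra_simps)

lemma poly_cubic_eq: "poly (cubic t) x = (x - l1) * (x - l2) * (x - l3)"
  unfolding poly_cubic using rels unfolding of_rat_T by Groebner_Basis.algebra

lemma cubic_roots_iff: "poly (cubic t) x = 0 \<longleftrightarrow> x = l1 \<or> x = l2 \<or> x = l3"
  by (simp add: poly_cubic_eq)

text \<open>With s = 2 t^3 the discriminant is s^2 - 27, and s >= 16 puts it strictly between (s -
  1)^2 and s^2. This makes the Galois group larger than the alternating group.\<close>

lemma D_not_square: "of_rat r ^ 2 \<noteq> (of_rat D :: complex)"
proof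
  assume "of_rat r ^ 2 = (of_rat D :: complex)"
  then have "(of_rat (r\<^sup>2) :: complex) = of_rat D" by (simp add: of_rat_power)
  then have rD: "r\<^sup>2 = D" by simp
  define s where "s = 2 * t ^ 3"
  have Ds: "D = of_int (s\<^sup>2 - 27)" by (simp add: D_def T_def s_def power_mult_distrib flip: power_mult)
  have "algebraic_int (of_rat r :: complex)"
  proof (rule algebraic_int_root)
    show "algebraic_int (of_int (s\<^sup>2 - 27) :: complex)" by (rule algebraic_int_of_int)
    show "poly (monom 1 2) (of_rat r :: complex) = of_int (s\<^sup>2 - 27)"
      by (simp only: poly_monom mult_1 of_rat_power[symmetric] rD Ds of_rat_of_int_eq)
  qed (auto simp: degree_monom_eq)
  then have "(of_rat r :: complex) \<in> \<int>" by (rule rational_algebraic_int_is_int) simp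
  then obtain n where n: "(of_rat r :: complex) = of_int n" by (auto elim: Ints_cases)
  then have "r = of_int n" by (metis of_rat_eq_iff of_rat_of_int_eq)
  then have "(of_int (n\<^sup>2) :: rat) = of_int (s\<^sup>2 - 27)" using rD Ds by simp
  then have n2: "\<bar>n\<bar>\<^sup>2 = s\<^sup>2 - 27" by (simp only: of_int_eq_iff power2_abs)
  have "2 ^ 3 \<le> t ^ 3" using t_ge_2 by (intro power_mono) auto
  then have s: "s \<ge> 16" by (simp add: s_def)
  have "\<bar>n\<bar> < s"
  proof (rule ccontr)
    assume "\<not> \<bar>n\<bar> < s"
    then have "s\<^sup>2 \<le> \<bar>n\<bar>\<^sup>2" using s by (intro power_mono) auto
    then show False using n2 by simp
  qed
  then have "\<bar>n\<bar>\<^sup>2 \<le> (s - 1)\<^sup>2" by (intro power_mono) auto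
  then have "s\<^sup>2 - 27 \<le> s\<^sup>2 - 2 * s + 1" using n2 by (simp add: power2_eq_square algebra_simps)
  then show False using s by simp
qed

lemma D_nz: "D \<noteq> 0" using D_not_square[of 0] by auto

lemma delta_nz: "\<delta> \<noteq> 0" using delta_square D_nz by auto

lemma distinct_roots: "l1 \<noteq> l2" "l2 \<noteq> l3" "l1 \<noteq> l3" using delta_nz by (auto simp: \<delta>_def)

lemma kval_eq_0: assumes "kval l1 v = 0" shows "v = (0, 0, 0)"
proof -
  obtain a b c where v: "v = (a, b, c)" by (cases v) auto
  have "poly (of_rat_poly [:a, b, c:]) l1 = 0"
    using assms by (simp add: v kval_def map_poly_pCons algebra_simps power2_eq_square)
  moreover have "poly (of_rat_poly (cubic t)) l1 = 0" by (simp add: of_rat_cubic cubic_roots_iff)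
  ultimately have d: "cubic t dvd [:a, b, c:]"
    using irreducible_rat_poly_dvd[OF irreducible_cubic[OF t_ge_2]] by blast
  have "[:a, b, c:] = 0"
  proof (rule ccontr)
    assume nz: "[:a, b, c:] \<noteq> 0"
    have "degree (cubic t :: rat poly) = 3" by (simp add: cubic_def)
    then have "3 \<le> degree [:a, b, c:]" using dvd_imp_degree_le[OF d nz] by simp
    moreover have "degree [:a, b, c:] \<le> 2" by (simp add: degree_pCons_eq_if)
    ultimately show False by simp
  qed
  then show ?thesis by (simp add: v)
qed

lemma kval_nz: "v \<noteq> (0, 0, 0) \<Longrightarrow> kval l1 v \<noteq> 0 \<and> kval l2 v \<noteq> 0 \<and> kval l3 v \<noteq> 0"
  using kval_eq_0 cubic_field.kval_eq_0[OF rotate] cubic_field.kval_eq_0[OF cubic_field.rotate[OF rotate]] by blast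

text \<open>The norm form of K over the rationals in the coordinates 1, l, l^2.\<close>

definition knorm :: "rat \<times> rat \<times> rat \<Rightarrow> rat" where
  "knorm v = (case v of (a, b, c) \<Rightarrow> a ^ 3 + 2 * T * a\<^sup>2 * c - T * a * b\<^sup>2 - 3 * a * b * c +
     T\<^sup>2 * a * c\<^sup>2 + b ^ 3 - T * b * c\<^sup>2 + c ^ 3)"

lemma knorm_aux:
  fixes a b c :: complex
  shows "(a + b * l1 + c * l1\<^sup>2) * (a + b * l2 + c * l2\<^sup>2) * (a + b * l3 + c * l3\<^sup>2) =
    a ^ 3 + 2 * of_rat T * a\<^sup>2 * c - of_rat T * a * b\<^sup>2 - 3 * a * b * c +
     (of_rat T)\<^sup>2 * a * c\<^sup>2 + b ^ 3 - of_rat T * b * c\<^sup>2 + c ^ 3"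
  using rels by Groebner_Basis.algebra

lemma knorm: "kval l1 v * kval l2 v * kval l3 v = of_rat (knorm v)"
  using knorm_aux by (cases v) (simp add: kval_def knorm_def of_rat_add of_rat_diff of_rat_mult of_rat_power)

text \<open>Taking norms in u = -\<open>\<delta>\<close> w gives N(u)^2 = D^3 N(w)^2, so a nonzero w
  would make D a rational square.\<close>

lemma fval_eq_0: assumes "fval l1 \<delta> v = 0" shows "v = ((0, 0, 0), (0, 0, 0))"
proof -
  obtain u w where v: "v = (u, w)" by (cases v) auto
  have cr: "l1 ^ 3 = of_rat T * l1 + 1" "l2 ^ 3 = of_rat T * l2 + 1" "l3 ^ 3 = of_rat T * l3 + 1"
    using rels by Groebner_Basis.algebra+
  have uw: "kval l1 u = - \<delta> * kval l1 w" using assms by (simp add: v fval_def add_eq_0_iff)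
  have "kval l1 (kadd (kmul T u u) (kscale (- D) (kmul T w w))) = 0"
    by (simp add: kval_add kval_scale kval_mul[OF cr(1)] uw of_rat_minus power2_eq_square flip: delta_square)
  then have z: "kadd (kmul T u u) (kscale (- D) (kmul T w w)) = (0, 0, 0)" by (rule kval_eq_0)
  \<comment> \<open>Only the squared relation has rational coordinates and survives at the other
    roots; the sign there is unknown, which is harmless after squaring the norm.\<close>
  have pm: "kval l u = \<delta> * kval l w \<or> kval l u = - \<delta> * kval l w" if "l ^ 3 = of_rat T * l + 1" for l
  proof -
    have "kval l (kadd (kmul T u u) (kscale (- D) (kmul T w w))) = 0" unfolding z by (simp add: kval_def)
    then have "(kval l u)\<^sup>2 = (\<delta> * kval l w)\<^sup>2"
      by (simp add: kval_add kval_scale kval_mul[OF that] of_rat_minus power_mult_distrib delta_square power2_eq_square[of "kval _ _"])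
    then show ?thesis by (simp add: power2_eq_iff)
  qed
  have "of_rat (knorm u) = \<delta> * of_rat D * of_rat (knorm w) \<or> of_rat (knorm u) = - \<delta> * of_rat D * of_rat (knorm w)"
    unfolding knorm[symmetric] delta_square[symmetric]
    using pm[OF cr(1)] pm[OF cr(2)] pm[OF cr(3)] by (elim disjE) (simp_all add: power2_eq_square)
  then have sq: "of_rat ((knorm u)\<^sup>2) = of_rat D * (of_rat ((D * knorm w)\<^sup>2) :: complex)"
    unfolding delta_square[symmetric] of_rat_power of_rat_mult by (elim disjE) (simp_all add: power_mult_distrib)
  have "w = (0, 0, 0)"
  proof (rule ccontr)
    assume "w \<noteq> (0, 0, 0)"
    then have "kval l1 w * kval l2 w * kval l3 w \<noteq> 0" using kval_nz by simp
    then have nz: "D * knorm w \<noteq> 0" using D_nz unfolding knorm by simp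
    have "of_rat (knorm u / (D * knorm w)) ^ 2 = (of_rat D :: complex)"
    proof -
      have "(of_rat D :: complex) \<noteq> 0" "(of_rat (knorm w) :: complex) \<noteq> 0" using nz by auto
      then show ?thesis using sq
        by (simp add: of_rat_divide of_rat_mult power_divide of_rat_power power_mult_distrib)
    qed
    then show False using D_not_square by blast
  qed
  moreover from this have "kval l1 u = 0" using uw by (simp add: kval_def)
  then have "u = (0, 0, 0)" by (rule kval_eq_0)
  ultimately show ?thesis by (simp add: v)
qed

lemma kval_uminus: "kval l (kscale (-1) v) = - kval l v" by (simp add: kval_scale)

lemma fval_inj: assumes "fval l1 \<delta> v = fval l1 \<delta> w" shows "v = w"
proof -
  have "fval l1 \<delta> (kadd (fst v) (kscale (-1) (fst w)), kadd (snd v) (kscale (-1) (snd w))) = 0"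
    using assms by (simp add: fval_def kval_add kval_uminus algebra_simps)
  from fval_eq_0[OF this] show ?thesis by (cases v; cases w) auto
qed

definition F :: "complex set" where "F = range (fval l1 \<delta>)"
definition K :: "complex set" where "K = range (kval l1)"

definition emb :: "complex \<Rightarrow> complex \<Rightarrow> complex \<Rightarrow> complex" where
  "emb l d = (\<lambda>x\<in>F. fval l d (inv_into UNIV (fval l1 \<delta>) x))"

lemma fval_mem_F [simp]: "fval l1 \<delta> v \<in> F" by (auto simp: F_def)

lemma emb_fval: "emb l d (fval l1 \<delta> v) = fval l d v"
proof -
  have "inj (fval l1 \<delta>)" using fval_inj by (auto intro: injI)
  then show ?thesis by (simp add: emb_def)
qed

lemma fval_ring:
  assumes "l ^ 3 = of_rat T * l + 1" "d\<^sup>2 = of_rat D"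
  shows "fval l d v + fval l d w = fval l d (kadd (fst v) (fst w), kadd (snd v) (snd w))"
    "fval l d v * fval l d w = fval l d
       (kadd (kmul T (fst v) (fst w)) (kscale D (kmul T (snd v) (snd w))),
        kadd (kmul T (fst v) (snd w)) (kmul T (snd v) (fst w)))"
    "- fval l d v = fval l d (kscale (-1) (fst v), kscale (-1) (snd v))"
  by (simp_all add: fval_def kval_add kval_scale kval_mul[OF assms(1)] power2_eq_square algebra_simps flip: assms(2))

lemma F_cases: assumes "x \<in> F" obtains v where "x = fval l1 \<delta> v" using assms by (auto simp: F_def)

lemma F_add: "x \<in> F \<Longrightarrow> y \<in> F \<Longrightarrow> x + y \<in> F" and F_mult: "x \<in> F \<Longrightarrow> y \<in> F \<Longrightarrow> x * y \<in> F"
  and F_minus: "x \<in> F \<Longrightarrow> - x \<in> F"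
  unfolding F_def by (auto simp: fval_ring[OF cubic_root delta_square])

lemma F_of_rat: "of_rat r \<in> F"
proof -
  have "of_rat r = fval l1 \<delta> ((r, 0, 0), (0, 0, 0))" by (simp add: fval_def kval_def)
  then show ?thesis by (metis fval_mem_F)
qed

lemma F_l1: "l1 \<in> F" and F_delta: "\<delta> \<in> F"
proof -
  have "l1 = fval l1 \<delta> ((0, 1, 0), (0, 0, 0))" "\<delta> = fval l1 \<delta> ((0, 0, 0), (1, 0, 0))"
    by (simp_all add: fval_def kval_def)
  then show "l1 \<in> F" "\<delta> \<in> F" by (metis fval_mem_F)+
qed

lemma F_power: "x \<in> F \<Longrightarrow> x ^ n \<in> F"
  using F_of_rat[of 1] by (induction n) (auto intro: F_mult)

lemma F_fval: assumes "l \<in> F" "d \<in> F" shows "fval l d v \<in> F"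
  unfolding fval_def kval_def
  by (auto simp: split_beta intro!: F_add F_mult F_power F_of_rat assms)

lemma l2_eq: "l2 = of_rat (-1/2) * (l1 + \<delta> * (4 * (of_rat T)\<^sup>2 + 9 * l1 - 6 * of_rat T * l1\<^sup>2) * of_rat (1 / D))"
    "l3 = of_rat (-1/2) * (l1 - \<delta> * (4 * (of_rat T)\<^sup>2 + 9 * l1 - 6 * of_rat T * l1\<^sup>2) * of_rat (1 / D))"
proof -
  have D0: "(of_rat D :: complex) \<noteq> 0" using D_nz by simp
  have d: "l2 - l3 = - \<delta> * (4 * (of_rat T)\<^sup>2 + 9 * l1 - 6 * of_rat T * l1\<^sup>2) * of_rat (1 / D)" (is "_ = ?R")
    using l2_relation D0 by (simp add: of_rat_divide field_simps)
  have s: "l2 + l3 = - l1" using root_sum by (simp add: add_eq_0_iff algebra_simps)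
  have h: "of_rat (-1/2) = (-1/2 :: complex)" by (simp add: of_rat_divide of_rat_minus)
  have "2 * l2 = (l2 + l3) + (l2 - l3)" "2 * l3 = (l2 + l3) - (l2 - l3)" by simp_all
  then have "2 * l2 = - l1 + ?R" "2 * l3 = - l1 - ?R" unfolding s d .
  then show "l2 = of_rat (-1/2) * (l1 + \<delta> * (4 * (of_rat T)\<^sup>2 + 9 * l1 - 6 * of_rat T * l1\<^sup>2) * of_rat (1 / D))"
    "l3 = of_rat (-1/2) * (l1 - \<delta> * (4 * (of_rat T)\<^sup>2 + 9 * l1 - 6 * of_rat T * l1\<^sup>2) * of_rat (1 / D))"
    unfolding h by (simp_all add: field_simps)
qed

text \<open>Embeddings of F into the complex numbers. Nothing is required outside F, so plain
  compositions of functions and restrictions to F qualify.\<close>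

definition fhom :: "(complex \<Rightarrow> complex) \<Rightarrow> bool" where
  "fhom s \<longleftrightarrow> (\<forall>x\<in>F. \<forall>y\<in>F. s (x + y) = s x + s y \<and> s (x * y) = s x * s y) \<and> (\<forall>r. s (of_rat r) = of_rat r)"

lemma fhomD:
  assumes "fhom s"
  shows "x \<in> F \<Longrightarrow> y \<in> F \<Longrightarrow> s (x + y) = s x + s y" "x \<in> F \<Longrightarrow> y \<in> F \<Longrightarrow> s (x * y) = s x * s y"
    "s (of_rat r) = of_rat r" "x \<in> F \<Longrightarrow> s (- x) = - s x" "x \<in> F \<Longrightarrow> y \<in> F \<Longrightarrow> s (x - y) = s x - s y"
    "x \<in> F \<Longrightarrow> s (x ^ n) = s x ^ n" "s 0 = 0" "s 1 = 1" "s (of_int k) = of_int k"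
proof -
  show a: "s (x + y) = s x + s y" "s (x * y) = s x * s y" if "x \<in> F" "y \<in> F" for x y
    using assms that by (auto simp: fhom_def)
  show r: "s (of_rat r) = of_rat r" for r using assms by (simp add: fhom_def)
  show z: "s 0 = 0" "s 1 = 1" "s (of_int k) = of_int k" using r[of 0] r[of 1] r[of "of_int k"] by simp_all
  show m: "s (- x) = - s x" if "x \<in> F" for x
    using a(1)[OF that F_minus[OF that]] z by (simp add: eq_neg_iff_add_eq_0 add.commute)
  show "s (x - y) = s x - s y" if "x \<in> F" "y \<in> F" for x y
    using a(1)[OF that(1) F_minus[OF that(2)]] m[OF that(2)] by simp
  show "s (x ^ n) = s x ^ n" if "x \<in> F" for x n
    by (induction n) (auto simp: z a F_power that)
qed

lemma fhom_fval: assumes "fhom s" "l \<in> F" "d \<in> F" shows "s (fval l d v) = fval (s l) (s d) v"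
  using assms(2,3)
  by (simp add: fval_def kval_def split_beta fhomD[OF assms(1)] F_add F_mult F_power F_of_rat)

lemma fhom_eqI:
  assumes "fhom s" "fhom s'" "s l1 = s' l1" "s \<delta> = s' \<delta>" "x \<in> F" shows "s x = s' x"
proof -
  obtain v where "x = fval l1 \<delta> v" using F_cases[OF assms(5)] .
  then show ?thesis using assms by (simp add: fhom_fval F_l1 F_delta)
qed

lemma fhom_emb:
  assumes "l ^ 3 = of_rat T * l + 1" "d\<^sup>2 = of_rat D" shows "fhom (emb l d)"
  unfolding fhom_def
proof (intro conjI ballI allI)
  fix x y assume xy: "x \<in> F" "y \<in> F"
  obtain v w where v: "x = fval l1 \<delta> v" "y = fval l1 \<delta> w" using F_cases xy by metis
  show "emb l d (x + y) = emb l d x + emb l d y" "emb l d (x * y) = emb l d x * emb l d y"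
    unfolding v fval_ring(1,2)[OF cubic_root delta_square] emb_fval fval_ring(1,2)[OF assms] by simp_all
next
  fix r
  have "of_rat r = fval l1 \<delta> ((r, 0, 0), (0, 0, 0))" "fval l d ((r, 0, 0), (0, 0, 0)) = of_rat r"
    by (simp_all add: fval_def kval_def)
  then show "emb l d (of_rat r) = of_rat r" using emb_fval by metis
qed

lemma emb_l1: "emb l d l1 = l" and emb_delta: "emb l d \<delta> = d"
proof -
  have "l1 = fval l1 \<delta> ((0, 1, 0), (0, 0, 0))" "\<delta> = fval l1 \<delta> ((0, 0, 0), (1, 0, 0))"
    by (simp_all add: fval_def kval_def)
  then have "emb l d l1 = fval l d ((0, 1, 0), (0, 0, 0))" "emb l d \<delta> = fval l d ((0, 0, 0), (1, 0, 0))"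
    using emb_fval by metis+
  then show "emb l d l1 = l" "emb l d \<delta> = d" by (simp_all add: fval_def kval_def)
qed

lemma F_l2: "l2 \<in> F" and F_l3: "l3 \<in> F"
proof -
  have n: "numeral k \<in> F" for k using F_of_rat[of "numeral k"] by simp
  have "4 * (of_rat T)\<^sup>2 + 9 * l1 - 6 * of_rat T * l1\<^sup>2 \<in> F"
    using F_add[OF F_add F_minus] by (simp add: n F_add F_mult F_power F_of_rat F_l1)
  then have R: "\<delta> * (4 * (of_rat T)\<^sup>2 + 9 * l1 - 6 * of_rat T * l1\<^sup>2) * of_rat (1 / D) \<in> F"
    by (intro F_mult F_of_rat F_delta)
  show "l2 \<in> F" by (subst l2_eq(1)) (intro F_mult F_of_rat F_add F_l1 R)
  have "l3 = - l1 - l2" using root_sum by (simp add: algebra_simps add_eq_0_iff)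
  then show "l3 \<in> F" using F_add[OF F_minus[OF F_l1] F_minus[OF \<open>l2 \<in> F\<close>]] by simp
qed

definition \<rho> where "\<rho> = emb l2 \<delta>"
definition \<tau> where "\<tau> = emb l1 (- \<delta>)"

lemma cubic_root2: "l2 ^ 3 = of_rat T * l2 + 1"
  using rels by Groebner_Basis.algebra

lemma fhom_rho: "fhom \<rho>" and fhom_tau: "fhom \<tau>"
  unfolding \<rho>_def \<tau>_def by (rule fhom_emb; simp add: cubic_root cubic_root2 delta_square)+

lemma emb_mem: "x \<in> F \<Longrightarrow> l \<in> F \<Longrightarrow> d \<in> F \<Longrightarrow> emb l d x \<in> F"
  by (elim F_cases) (simp add: emb_fval F_fval)

lemma rho_mem: "x \<in> F \<Longrightarrow> \<rho> x \<in> F" and tau_mem: "x \<in> F \<Longrightarrow> \<tau> x \<in> F"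
  unfolding \<rho>_def \<tau>_def by (auto intro: emb_mem F_l1 F_l2 F_delta F_minus)

lemma rho_gens: "\<rho> l1 = l2" "\<rho> \<delta> = \<delta>" and tau_gens: "\<tau> l1 = l1" "\<tau> \<delta> = - \<delta>"
  by (simp_all add: \<rho>_def \<tau>_def emb_l1 emb_delta)

lemma fhom_l2:
  assumes s: "fhom s"
  shows "s l2 = of_rat (-1/2) * (s l1 + s \<delta> * (4 * (of_rat T)\<^sup>2 + 9 * s l1 - 6 * of_rat T * (s l1)\<^sup>2) * of_rat (1 / D))"
    "s l3 = of_rat (-1/2) * (s l1 - s \<delta> * (4 * (of_rat T)\<^sup>2 + 9 * s l1 - 6 * of_rat T * (s l1)\<^sup>2) * of_rat (1 / D))"
proof -
  have n: "numeral k \<in> F" "s (numeral k) = numeral k" for k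
    using F_of_rat[of "numeral k"] fhomD(3)[OF s, of "numeral k"] by simp_all
  have d: "x - y \<in> F" if "x \<in> F" "y \<in> F" for x y using F_add[OF that(1) F_minus[OF that(2)]] by simp
  note c = F_add F_mult F_power F_of_rat F_l1 F_delta n d fhomD[OF s]
  show "s l2 = of_rat (-1/2) * (s l1 + s \<delta> * (4 * (of_rat T)\<^sup>2 + 9 * s l1 - 6 * of_rat T * (s l1)\<^sup>2) * of_rat (1 / D))"
    by (subst l2_eq(1)) (simp only: c)
  show "s l3 = of_rat (-1/2) * (s l1 - s \<delta> * (4 * (of_rat T)\<^sup>2 + 9 * s l1 - 6 * of_rat T * (s l1)\<^sup>2) * of_rat (1 / D))"
    by (subst l2_eq(2)) (simp only: c)
qed

text \<open>Rotating the roots leaves \<open>\<delta>\<close> unchanged, so the formula for l2 in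
  terms of l1 and \<open>\<delta>\<close> becomes, after rotation, the one for l3 in terms of
  l2.\<close>

lemma rho_roots: "\<rho> l2 = l3" "\<rho> l3 = l1"
  using fhom_l2[OF fhom_rho] cubic_field.l2_eq[OF rotate, unfolded rotate_delta]
  unfolding rho_gens cubic_field.T_def[OF rotate] T_def cubic_field.D_def[OF rotate] D_def by simp_all

lemma tau_roots: "\<tau> l2 = l3" "\<tau> l3 = l2"
  using fhom_l2[OF fhom_tau] l2_eq unfolding tau_gens by simp_all

lemma fhom_comp: "fhom s \<Longrightarrow> fhom s' \<Longrightarrow> (\<And>x. x \<in> F \<Longrightarrow> s' x \<in> F) \<Longrightarrow> fhom (\<lambda>x. s (s' x))"
  unfolding fhom_def by auto

lemma fhom_id: "fhom (\<lambda>x. x)" by (simp add: fhom_def)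

lemma fhom_rho_rho: "fhom (\<lambda>x. \<rho> (\<rho> x))"
  by (rule fhom_comp[OF fhom_rho fhom_rho]) (rule rho_mem)

lemma fhom_tau_rho: "fhom (\<lambda>x. \<tau> (\<rho> x))"
  by (rule fhom_comp[OF fhom_tau fhom_rho]) (rule rho_mem)

lemma fhom_tau_tau: "fhom (\<lambda>x. \<tau> (\<tau> x))"
  by (rule fhom_comp[OF fhom_tau fhom_tau]) (rule tau_mem)

lemma fhom_rho_rho_rho: "fhom (\<lambda>x. \<rho> (\<rho> (\<rho> x)))"
  by (rule fhom_comp[OF fhom_rho fhom_rho_rho]) (intro rho_mem)

lemma fhom_rho_rho_tau: "fhom (\<lambda>x. \<rho> (\<rho> (\<tau> x)))"
  by (rule fhom_comp[OF fhom_rho_rho fhom_tau]) (rule tau_mem)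

lemma rho3: "x \<in> F \<Longrightarrow> \<rho> (\<rho> (\<rho> x)) = x"
  by (rule fhom_eqI[OF fhom_rho_rho_rho fhom_id]) (simp_all add: rho_gens rho_roots)

lemma tau2: "x \<in> F \<Longrightarrow> \<tau> (\<tau> x) = x"
  by (rule fhom_eqI[OF fhom_tau_tau fhom_id]) (simp_all add: tau_gens fhomD(4)[OF fhom_tau F_delta])

lemma tau_rho: "x \<in> F \<Longrightarrow> \<tau> (\<rho> x) = \<rho> (\<rho> (\<tau> x))"
  by (rule fhom_eqI[OF fhom_tau_rho fhom_rho_rho_tau])
    (simp_all add: tau_gens rho_gens tau_roots rho_roots fhomD(4)[OF fhom_rho F_delta])

lemma tau_fixed: assumes "x \<in> F" "\<tau> x = x" shows "x \<in> K"
proof -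
  obtain v where v: "x = fval l1 \<delta> v" using F_cases[OF assms(1)] .
  have "fval l1 (- \<delta>) v = fval l1 \<delta> v" using assms(2) unfolding v \<tau>_def emb_fval .
  then have "\<delta> * kval l1 (snd v) = 0" by (simp add: fval_def)
  then have "x = kval l1 (fst v)" by (simp add: v fval_def)
  then show ?thesis by (auto simp: K_def)
qed

lemma K_subset_F: "K \<subseteq> F"
proof
  fix x assume "x \<in> K"
  then obtain u where "x = kval l1 u" by (auto simp: K_def)
  then have "x = fval l1 \<delta> (u, (0, 0, 0))" by (simp add: fval_def kval_def)
  then show "x \<in> F" by (metis fval_mem_F)
qed

lemma kval_as_fval: "kval l1 u = fval l1 \<delta> (u, (0, 0, 0))" by (simp add: fval_def kval_def)

lemma K_iff: "x \<in> K \<longleftrightarrow> x \<in> F \<and> \<tau> x = x"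
proof
  assume x: "x \<in> K"
  then obtain u where u: "x = kval l1 u" by (auto simp: K_def)
  have "\<tau> x = fval l1 (- \<delta>) (u, (0, 0, 0))" unfolding u kval_as_fval \<tau>_def emb_fval ..
  then show "x \<in> F \<and> \<tau> x = x" using x K_subset_F u by (auto simp: fval_def kval_def)
qed (use tau_fixed in auto)

text \<open>Such an element lies in K and equals its three conjugates there, hence is a third of its
  trace. The trace is rational because the roots have sum 0 and sum of squares 2 t^2.\<close>

lemma fixed_rational: assumes "x \<in> F" "\<tau> x = x" "\<rho> x = x" shows "x \<in> \<rat>"
proof -
  have "x \<in> K" using assms K_iff by blast
  then obtain u where u: "x = kval l1 u" unfolding K_def by blast
  obtain a b c where abc: "u = (a, b, c)" by (cases u) auto
  have r: "\<rho> (fval l1 \<delta> (u, (0, 0, 0))) = fval l2 \<delta> (u, (0, 0, 0))" unfolding \<rho>_def emb_fval ..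
  have x1: "x = kval l2 u" using assms(3) r by (simp add: u kval_as_fval) (simp add: fval_def kval_def)
  have "\<rho> (kval l2 u) = kval l3 u"
    unfolding kval_def abc by (simp add: fhomD[OF fhom_rho] F_add F_mult F_power F_of_rat F_l2 rho_roots)
  then have x2: "x = kval l3 u" using assms(3) x1 by simp
  have "3 * x = kval l1 u + kval l2 u + kval l3 u" using u x1 x2 by simp
  also have "\<dots> = 3 * of_rat a + of_rat b * (l1 + l2 + l3) + of_rat c * (l1\<^sup>2 + l2\<^sup>2 + l3\<^sup>2)"
    by (simp add: abc kval_def algebra_simps)
  also have "l1\<^sup>2 + l2\<^sup>2 + l3\<^sup>2 = 2 * of_rat T" using rels by Groebner_Basis.algebra
  finally have "3 * x = of_rat (3 * a + c * (2 * T))" using root_sum by (simp add: of_rat_add of_rat_mult)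
  then obtain q where "3 * x = of_rat q" by blast
  then have "x = of_rat q / 3" by (simp add: mult.commute)
  also have "\<dots> = of_rat (q / 3)" by (simp only: of_rat_divide of_rat_numeral_eq)
  finally show ?thesis by simp
qed

end

section \<open>F as a totally real Galois extension\<close>

context cubic_field
begin

lemma F_diff: "x \<in> F \<Longrightarrow> y \<in> F \<Longrightarrow> x - y \<in> F"
  using F_add[OF _ F_minus, of x y] by simp

lemma F_0: "0 \<in> F" and F_1: "1 \<in> F" using F_of_rat[of 0] F_of_rat[of 1] by simp_all

lemma F_sum: "(\<And>i. i \<in> I \<Longrightarrow> f i \<in> F) \<Longrightarrow> sum f I \<in> F"
  by (induction I rule: infinite_finite_induct) (auto intro: F_add F_0)

lemma fhom_sum: "fhom s \<Longrightarrow> (\<And>i. i \<in> I \<Longrightarrow> f i \<in> F) \<Longrightarrow> s (sum f I) = (\<Sum>i\<in>I. s (f i))"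
  by (induction I rule: infinite_finite_induct) (auto simp: fhomD F_sum)

lemma of_rat_real: "(of_rat r :: complex) \<in> \<real>"
proof -
  have "(of_rat r :: complex) = of_real (of_rat r)" by (cases r) (simp add: of_rat_rat)
  then show ?thesis by (metis Reals_of_real)
qed

lemma fval_real: "l \<in> \<real> \<Longrightarrow> d \<in> \<real> \<Longrightarrow> fval l d v \<in> \<real>"
  unfolding fval_def kval_def split_beta by (intro Reals_add Reals_mult Reals_power of_rat_real)

lemma delta_real: "\<delta> \<in> \<real>"
  unfolding \<delta>_def by (intro Reals_mult Reals_diff real_roots)

lemma F_real: "x \<in> F \<Longrightarrow> x \<in> \<real>"
  by (elim F_cases) (simp add: fval_real real_roots delta_real)

definition conjs :: "complex \<Rightarrow> complex list" where
  "conjs x = [x, \<rho> x, \<rho> (\<rho> x), \<tau> x, \<rho> (\<tau> x), \<rho> (\<rho> (\<tau> x))]"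

lemma conjs_mem: "x \<in> F \<Longrightarrow> y \<in> set (conjs x) \<Longrightarrow> y \<in> F"
  by (auto simp: conjs_def intro: rho_mem tau_mem)

definition Fpoly :: "complex poly \<Rightarrow> bool" where "Fpoly p \<longleftrightarrow> (\<forall>i. coeff p i \<in> F)"

lemma Fpoly_mult: "Fpoly p \<Longrightarrow> Fpoly q \<Longrightarrow> Fpoly (p * q)"
  by (auto simp: Fpoly_def coeff_mult intro!: F_sum F_mult)

lemma map_poly_mult: "fhom s \<Longrightarrow> Fpoly p \<Longrightarrow> Fpoly q \<Longrightarrow> map_poly s (p * q) = map_poly s p * map_poly s q"
  by (rule poly_eqI) (simp add: coeff_map_poly coeff_mult fhomD Fpoly_def fhom_sum F_mult)

definition lin :: "complex \<Rightarrow> complex poly" where "lin a = [:- a, 1:]"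

lemma Fpoly_lin: "a \<in> F \<Longrightarrow> Fpoly (lin a)"
  by (auto simp: Fpoly_def lin_def coeff_pCons F_minus F_0 F_1 split: nat.splits)

lemma map_poly_lin: "fhom s \<Longrightarrow> a \<in> F \<Longrightarrow> map_poly s (lin a) = lin (s a)"
  by (simp add: lin_def map_poly_pCons fhomD)

text \<open>The characteristic polynomial of x over the rationals, of degree six also when x lies in
  a smaller field.\<close>

definition charpoly :: "complex \<Rightarrow> complex poly" where
  "charpoly x = lin x * lin (\<rho> x) * lin (\<rho> (\<rho> x)) * lin (\<tau> x) * lin (\<rho> (\<tau> x)) * lin (\<rho> (\<rho> (\<tau> x)))"

lemma Fpoly_charpoly: "x \<in> F \<Longrightarrow> Fpoly (charpoly x)"
  unfolding charpoly_def by (intro Fpoly_mult Fpoly_lin rho_mem tau_mem)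

lemma map_poly_charpoly:
  assumes "fhom s" "x \<in> F"
  shows "map_poly s (charpoly x) = lin (s x) * lin (s (\<rho> x)) * lin (s (\<rho> (\<rho> x))) * lin (s (\<tau> x)) *
    lin (s (\<rho> (\<tau> x))) * lin (s (\<rho> (\<rho> (\<tau> x))))"
  unfolding charpoly_def
  by (simp add: map_poly_mult[OF assms(1)] map_poly_lin[OF assms(1)] Fpoly_mult Fpoly_lin rho_mem tau_mem assms(2))

lemma charpoly_rho: "x \<in> F \<Longrightarrow> map_poly \<rho> (charpoly x) = charpoly x"
  unfolding map_poly_charpoly[OF fhom_rho] by (simp add: rho3 tau_mem charpoly_def mult_ac)

lemma charpoly_tau: "x \<in> F \<Longrightarrow> map_poly \<tau> (charpoly x) = charpoly x"
  unfolding map_poly_charpoly[OF fhom_tau]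
  by (simp add: tau_rho tau2 rho_mem tau_mem rho3 charpoly_def mult_ac)

lemma charpoly_rational: assumes "x \<in> F" shows "coeff (charpoly x) i \<in> \<rat>"
proof (rule fixed_rational)
  show "coeff (charpoly x) i \<in> F" using Fpoly_charpoly[OF assms] by (simp add: Fpoly_def)
  show "\<tau> (coeff (charpoly x) i) = coeff (charpoly x) i"
    using arg_cong[OF charpoly_tau[OF assms], of "\<lambda>p. coeff p i"] by (simp add: coeff_map_poly fhomD[OF fhom_tau])
  show "\<rho> (coeff (charpoly x) i) = coeff (charpoly x) i"
    using arg_cong[OF charpoly_rho[OF assms], of "\<lambda>p. coeff p i"] by (simp add: coeff_map_poly fhomD[OF fhom_rho])
qed

lemma poly_charpoly: "poly (charpoly x) z = (z - x) * (z - \<rho> x) * (z - \<rho> (\<rho> x)) * (z - \<tau> x) * (z - \<rho> (\<tau> x)) * (z - \<rho> (\<rho> (\<tau> x)))"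
proof -
  have "poly (lin a) z = z - a" for a by (simp add: lin_def)
  then show ?thesis by (simp only: charpoly_def poly_mult)
qed

lemma charpoly_root: "poly (charpoly x) z = 0 \<longleftrightarrow> z \<in> set (conjs x)"
  by (simp add: poly_charpoly conjs_def)

lemma charpoly_monic: "lead_coeff (charpoly x) = 1" "charpoly x \<noteq> 0" "degree (charpoly x) = 6"
proof -
  have l: "lead_coeff (lin a) = 1" "degree (lin a) = 1" "lin a \<noteq> 0" "coeff (lin a) (Suc 0) = 1" for a by (simp_all add: lin_def)
  show "charpoly x \<noteq> 0" unfolding charpoly_def by (simp add: l)
  show "lead_coeff (charpoly x) = 1" unfolding charpoly_def lead_coeff_mult by (simp add: l)
  show "degree (charpoly x) = 6" unfolding charpoly_def by (simp add: degree_mult_eq l)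
qed

lemma charpoly_of_rat: assumes "x \<in> F" obtains P where "charpoly x = of_rat_poly P" "P \<noteq> 0"
proof -
  obtain P where P: "charpoly x = of_rat_poly P" using charpoly_rational[OF assms] ratpolyE by metis
  then have "P \<noteq> 0" using charpoly_monic(2)[of x] by auto
  then show ?thesis using P that by blast
qed

lemma F_algebraic: "x \<in> F \<Longrightarrow> algebraic x"
proof -
  assume x: "x \<in> F"
  obtain P where P: "charpoly x = of_rat_poly P" using charpoly_of_rat[OF x] by metis
  have "algebraic x \<longleftrightarrow> (\<exists>p. (\<forall>i. coeff p i \<in> \<rat>) \<and> p \<noteq> 0 \<and> poly p x = 0)" by (rule algebraic_altdef)
  then show ?thesis using charpoly_rational[OF x] charpoly_monic(2) charpoly_root[of x x]
    by (auto simp: conjs_def)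
qed

text \<open>The constant coefficient of \<open>charpoly x\<close> is x times the product of the
  other conjugates and is rational, so this product is 1/x up to a rational factor.\<close>

lemma F_inverse: assumes "x \<in> F" shows "inverse x \<in> F"
proof (cases "x = 0")
  case False
  define y where "y = \<rho> x * \<rho> (\<rho> x) * \<tau> x * \<rho> (\<tau> x) * \<rho> (\<rho> (\<tau> x))"
  have yF: "y \<in> F" unfolding y_def by (intro F_mult rho_mem tau_mem assms)
  have "coeff (charpoly x) 0 = poly (charpoly x) 0" by (simp add: poly_0_coeff_0)
  also have "\<dots> = x * y" by (simp add: poly_charpoly y_def)
  finally have "x * y \<in> \<rat>" using charpoly_rational[OF assms, of 0] by simp
  then obtain r where r: "x * y = of_rat r" by (auto elim: Rats_cases)
  have nz: "\<rho> z \<noteq> 0" if "z \<in> F" "z \<noteq> 0" for z using rho3[OF that(1)] that fhomD(7)[OF fhom_rho] by metis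
  have nz': "\<tau> z \<noteq> 0" if "z \<in> F" "z \<noteq> 0" for z using tau2[OF that(1)] that fhomD(7)[OF fhom_tau] by metis
  have "y \<noteq> 0" using False assms nz nz' by (simp add: y_def rho_mem tau_mem)
  then have "inverse x = y * of_rat (1 / r)"
    using False by (simp add: of_rat_divide field_simps flip: r)
  then show ?thesis using F_mult[OF yF F_of_rat] by simp
qed (simp add: F_0)

lemma subfield_F: "complex_subfield F"
  by (rule complex_subfield.intro) (auto simp: subfield_complex_iff F_1 F_diff F_mult F_inverse)

sublocale F: complex_subfield F by (rule subfield_F)

lemma fhom_inverse: "fhom s \<Longrightarrow> x \<in> F \<Longrightarrow> s (inverse x) = inverse (s x)"
proof (cases "x = 0")
  case False
  assume s: "fhom s" "x \<in> F"
  have "s x * s (inverse x) = 1"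
    using fhomD(2)[OF s F_inverse[OF s(2)]] False fhomD(8)[OF s(1)] by simp
  then show ?thesis by (metis inverse_unique)
qed (simp add: fhomD(7))

lemma fhom_nz: "fhom s \<Longrightarrow> x \<in> F \<Longrightarrow> x \<noteq> 0 \<Longrightarrow> s x \<noteq> 0"
  using fhomD(2)[OF _ _ F_inverse, of s x x] fhomD(8)[of s] by (metis mult_zero_left right_inverse zero_neq_one)

lemma subfield_K: "complex_subfield K"
  by (rule complex_subfield.intro)
    (auto simp: subfield_complex_iff K_iff F_1 F_diff F_mult F_inverse fhomD[OF fhom_tau] fhom_inverse[OF fhom_tau])

sublocale K: complex_subfield K by (rule subfield_K)

lemma l1_K: "l1 \<in> K" by (simp add: K_iff F_l1 tau_gens)

lemma generate_field_l1: "generate_field complex_ring {l1} = K"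
proof -
  interpret field complex_ring by (rule field_complex_ring)
  interpret G: complex_subfield "generate_field complex_ring {l1}"
    by (rule complex_subfield.intro) (rule generate_field_is_subfield, simp)
  have l1: "l1 \<in> generate_field complex_ring {l1}" by (rule generate_field.incl) simp
  show ?thesis
  proof
    show "generate_field complex_ring {l1} \<subseteq> K"
      by (rule generate_field_min_subfield1[OF _ K.subfield]) (auto simp: l1_K)
    show "K \<subseteq> generate_field complex_ring {l1}"
      using l1 by (auto simp: K_def kval_def split_beta intro!: G.mem_intros)
  qed
qed

lemma number_field_F: "number_field F"
proof -
  interpret field complex_ring by (rule field_complex_ring)
  define Us where "Us = [1, l1, l1\<^sup>2, \<delta>, \<delta> * l1, \<delta> * l1\<^sup>2]"
  have sQ: "subfield \<rat> complex_ring" using complex_subfield.subfield[OF complex_subfield_Rats] .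
  have le: "line_extension \<rat> a E = {k * a + v | k v. k \<in> \<rat> \<and> v \<in> E}" for a E
    by (auto simp: line_extension_def set_add_def' r_coset_def) 
  have "Span \<rat> Us = F"
  proof
    show "Span \<rat> Us \<subseteq> F"
      by (auto simp: Us_def le intro!: F_add F_mult F_power F_l1 F_delta F_0 F_1 dest: subsetD[OF F.Rats_subset])
    show "F \<subseteq> Span \<rat> Us"
    proof
      fix x assume "x \<in> F"
      then obtain a b c a' b' c' where x: "x = fval l1 \<delta> ((a, b, c), (a', b', c'))"
        by (metis F_cases prod.exhaust)
      have ex: "k * u + v \<in> line_extension \<rat> u E" if "k \<in> \<rat>" "v \<in> E" for k u v E using that by (auto simp: le)
      have "x = of_rat a * 1 + (of_rat b * l1 + (of_rat c * l1\<^sup>2 + (of_rat a' * \<delta> + (of_rat b' * (\<delta> * l1) + (of_rat c' * (\<delta> * l1\<^sup>2) + 0)))))"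
        by (simp add: x fval_def kval_def algebra_simps)
      also have "\<dots> \<in> Span \<rat> Us" unfolding Us_def Span.simps foldr.simps comp_apply by (intro ex) auto
      finally show "x \<in> Span \<rat> Us" .
    qed
  qed
  then have "finite_dimension \<rat> F" using Span_finite_dimension[OF sQ, of Us] by simp
  then show ?thesis unfolding number_field_def using F.subfield by blast
qed

text \<open>An irreducible q with a root x in F divides the characteristic polynomial of x, all of
  whose roots are conjugates in F.\<close>

lemma galois_extension_F: "galois_extension F"
  unfolding galois_extension_def
proof (intro conjI allI impI)
  show "number_field F" by (rule number_field_F)
  fix q :: "rat poly" assume q: "Factorial_Ring.irreducible q \<and> (\<exists>x\<in>F. poly (of_rat_poly q) x = 0)"
  then obtain x where x: "x \<in> F" "poly (of_rat_poly q) x = 0" by blast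
  show "rsquarefree (of_rat_poly q)" using irreducible_rat_poly_rsquarefree q by blast
  obtain P where P: "charpoly x = of_rat_poly P" using charpoly_of_rat[OF x(1)] by metis
  have "poly (of_rat_poly P) x = 0" using charpoly_root[of x x] unfolding P[symmetric] by (simp add: conjs_def)
  then have "q dvd P" using irreducible_rat_poly_dvd q x by blast
  then obtain g where "P = q * g" by blast
  then have "poly (charpoly x) y = 0" if "poly (of_rat_poly q) y = 0" for y
    using that by (simp add: P of_rat_poly_hom)
  then show "{y. poly (of_rat_poly q) y = 0} \<subseteq> F"
    using conjs_mem[OF x(1)] by (auto simp: charpoly_root)
qed

text \<open>Any Galois extension that contains one root of the irreducible cubic contains all three,
  and with them \<open>\<delta>\<close>.\<close>

lemma galois_closure_K: "galois_closure K = F"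
  unfolding galois_closure_def
proof (rule antisym)
  show "galois_extension hull K \<subseteq> F" by (rule hull_minimal[where S = galois_extension]) (use K_subset_F galois_extension_F in auto)
  show "F \<subseteq> galois_extension hull K"
    unfolding hull_def
  proof (rule Inter_greatest)
    fix S assume "S \<in> {S. galois_extension S \<and> K \<subseteq> S}"
    then have S: "galois_extension S" "K \<subseteq> S" by auto
    then interpret S: complex_subfield S
      by (intro complex_subfield.intro) (simp add: galois_extension_def number_field_def)
    have roots: "{x. poly (cubic t) x = 0} \<subseteq> S"
    proof -
      have "\<exists>x\<in>S. poly (of_rat_poly (cubic t)) x = 0"
        using l1_K S(2) by (auto simp: of_rat_cubic cubic_roots_iff)
      then have "{x. poly (of_rat_poly (cubic t)) x = 0} \<subseteq> S"
        using S(1) irreducible_cubic[OF t_ge_2] unfolding galois_extension_def by blast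
      then show ?thesis by (simp add: of_rat_cubic)
    qed
    then have l: "l1 \<in> S" "l2 \<in> S" "l3 \<in> S" by (auto simp: cubic_roots_iff)
    show "F \<subseteq> S"
      using l by (auto simp: F_def fval_def kval_def \<delta>_def split_beta intro!: S.mem_intros)
  qed
qed

lemma ring_hom_fhom: assumes "s \<in> ring_hom (subring_of F) complex_ring" shows "fhom s"
proof -
  have add: "s (x + y) = s x + s y" and mult: "s (x * y) = s x * s y" if "x \<in> F" "y \<in> F" for x y
    using ring_hom_add[OF assms] ring_hom_mult[OF assms] that by auto
  have one: "s 1 = 1" using ring_hom_one[OF assms] by simp
  have zero: "s 0 = 0" using add[OF F_0 F_0] by simp
  have minus: "s (- x) = - s x" if "x \<in> F" for x
    using add[OF that F_minus[OF that]] zero by (simp add: eq_neg_iff_add_eq_0 add.commute)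
  have nat: "s (of_nat n) = of_nat n" for n by (induction n) (auto simp: zero one add F.of_nat_mem F_1)
  have int: "s (of_int k) = of_int k" for k by (cases k rule: int_cases2) (auto simp: nat minus)
  have "s (of_rat r) = of_rat r" for r
  proof -
    obtain a b where r: "r = Rat.Fract a b" "b > 0" by (cases r) auto
    have "of_rat r * of_int b = (of_int a :: complex)" using r(2) by (simp add: r(1) of_rat_rat)
    then have "s (of_rat r) * of_int b = of_int a" using mult[OF F_of_rat F.of_int_mem, of r b] int by metis
    then show ?thesis using r(2) by (simp add: r(1) of_rat_rat field_simps)
  qed
  then show ?thesis using add mult by (auto simp: fhom_def)
qed

lemma fhom_root: assumes "fhom s" "x \<in> F" "poly (cubic t) x = 0" shows "poly (cubic t) (s x) = 0"
proof -
  have "s (x ^ 3 - (of_int t)\<^sup>2 * x - 1) = s x ^ 3 - (of_int t)\<^sup>2 * s x - 1"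
    using assms(2) by (simp add: fhomD[OF assms(1)] F_diff F_mult F_power F_1)
  then show ?thesis using assms(3) fhomD(7)[OF assms(1)] by (simp add: poly_cubic)
qed

lemma totally_real_F: "totally_real F"
  unfolding totally_real_def
proof (intro ballI image_subsetI)
  fix s x assume "s \<in> ring_hom (subring_of F) complex_ring" and x: "x \<in> F"
  then have s: "fhom s" by (rule_tac ring_hom_fhom)
  obtain v where v: "x = fval l1 \<delta> v" using F_cases[OF x] .
  have "poly (cubic t) (s l1) = 0" by (rule fhom_root[OF s F_l1]) (simp add: cubic_roots_iff)
  then have l: "s l1 \<in> \<real>" using real_roots by (auto simp: cubic_roots_iff)
  have "(s \<delta>)\<^sup>2 = \<delta>\<^sup>2" using fhomD(6)[OF s F_delta, of 2] fhomD(3)[OF s, of D] by (simp add: delta_square)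
  then have d: "s \<delta> \<in> \<real>" using delta_real by (auto simp: power2_eq_iff)
  show "s x \<in> \<real>" unfolding v fhom_fval[OF s F_l1 F_delta] by (rule fval_real[OF l d])
qed

end

section \<open>The Galois group as permutations of the roots\<close>

context cubic_field
begin

text \<open>The indices run from 1 to 3 because \<open>sym_group 3\<close> acts on
  \<open>{1..3}\<close>.\<close>

definition root :: "nat \<Rightarrow> complex" where "root i = (if i = 1 then l1 else if i = 2 then l2 else l3)"

lemma atLeastAtMost_1_3: "{1..3::nat} = {1, 2, 3}" by auto

lemma root_inj: "i \<in> {1..3} \<Longrightarrow> j \<in> {1..3} \<Longrightarrow> root i = root j \<longleftrightarrow> i = j"
  using distinct_roots unfolding atLeastAtMost_1_3 by (auto simp: root_def)

lemma root_surj: "poly (cubic t) x = 0 \<longleftrightarrow> (\<exists>i\<in>{1..3}. x = root i)"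
  unfolding atLeastAtMost_1_3 by (auto simp: cubic_roots_iff root_def)

lemma root_F: "root i \<in> F" by (simp add: root_def F_l1 F_l2 F_l3)

definition root_perm :: "(complex \<Rightarrow> complex) \<Rightarrow> nat \<Rightarrow> nat" where
  "root_perm s i = (if i \<in> {1..3} then THE j. j \<in> {1..3} \<and> s (root i) = root j else i)"

lemma root_perm: assumes "fhom s" "i \<in> {1..3}"
  shows "root_perm s i \<in> {1..3}" "s (root i) = root (root_perm s i)"
proof -
  have "poly (cubic t) (root i) = 0" using assms(2) root_surj by blast
  then have "poly (cubic t) (s (root i)) = 0" by (rule fhom_root[OF assms(1) root_F])
  then obtain j where j: "j \<in> {1..3}" "s (root i) = root j" using root_surj by blast
  have "root_perm s i = j"
    unfolding root_perm_def using assms(2) j root_inj by (auto intro!: the_equality)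
  then show "root_perm s i \<in> {1..3}" "s (root i) = root (root_perm s i)" using j by auto
qed

lemma root_perm_eqI: "fhom s \<Longrightarrow> i \<in> {1..3} \<Longrightarrow> j \<in> {1..3} \<Longrightarrow> s (root i) = root j \<Longrightarrow> root_perm s i = j"
  using root_perm root_inj by metis

lemma fhom_diff_eq_0: "fhom s \<Longrightarrow> x \<in> F \<Longrightarrow> y \<in> F \<Longrightarrow> s x = s y \<Longrightarrow> x = y"
  using fhom_nz[of s "x - y"] by (auto simp: fhomD F_diff)

lemma root_perm_permutes: assumes "fhom s" shows "root_perm s permutes {1..3}"
proof (rule bij_imp_permutes)
  have "inj_on (root_perm s) {1..3}"
  proof (rule inj_onI)
    fix i j assume ij: "i \<in> {1..3}" "j \<in> {1..3}" "root_perm s i = root_perm s j"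
    then have "s (root i) = s (root j)" using root_perm(2)[OF assms] by metis
    then have "root i = root j" using fhom_diff_eq_0[OF assms root_F root_F] by blast
    then show "i = j" using root_inj ij by blast
  qed
  moreover have "root_perm s ` {1..3} \<subseteq> {1..3}" using root_perm(1)[OF assms] by blast
  ultimately show "bij_betw (root_perm s) {1..3} {1..3}"
    by (simp add: bij_betw_def endo_inj_surj)
qed (auto simp: root_perm_def)

lemma galois_group_carrier:
  "s \<in> carrier (galois_group F) \<longleftrightarrow> s \<in> Bij F \<and> fhom s"
proof
  assume "s \<in> carrier (galois_group F)"
  then have s: "s \<in> Bij F" "s \<in> ring_iso (subring_of F) (subring_of F)" by (auto simp: galois_group_def)
  have "s \<in> ring_hom (subring_of F) (subring_of F)" using s(2) by (simp add: ring_iso_def)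
  then have "s \<in> ring_hom (subring_of F) complex_ring"
    by (auto simp: ring_hom_def)
  then show "s \<in> Bij F \<and> fhom s" using s ring_hom_fhom by blast
next
  assume s: "s \<in> Bij F \<and> fhom s"
  then have b: "bij_betw s F F" by (simp add: Bij_def)
  have "s \<in> ring_iso (subring_of F) (subring_of F)"
    unfolding ring_iso_def
  proof (intro CollectI conjI)
    show "s \<in> ring_hom (subring_of F) (subring_of F)"
      by (rule ring_hom_memI) (use s b in \<open>auto simp: fhomD bij_betw_def\<close>)
  qed (use b in simp)
  moreover have "s q = q" if "q \<in> \<rat>" for q using that s by (auto simp: fhomD elim!: Rats_cases)
  ultimately show "s \<in> carrier (galois_group F)" using s by (simp add: galois_group_def)
qed

lemma galois_group_mult:
  "s \<in> Bij F \<Longrightarrow> s' \<in> Bij F \<Longrightarrow> s \<otimes>\<^bsub>galois_group F\<^esub> s' = compose F s s'"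
  by (simp add: galois_group_def BijGroup_def)

lemma galois_groupI:
  assumes "fhom s" "\<And>x. x \<in> F \<Longrightarrow> s x \<in> F" "\<And>x. x \<in> F \<Longrightarrow> s' x \<in> F"
    "\<And>x. x \<in> F \<Longrightarrow> s (s' x) = x" "\<And>x. x \<in> F \<Longrightarrow> s' (s x) = x"
  shows "restrict s F \<in> carrier (galois_group F)"
proof -
  have "bij_betw (restrict s F) F F"
    by (rule bij_betw_byWitness[where f' = s']) (use assms in auto)
  then have "restrict s F \<in> Bij F" by (simp add: Bij_def)
  moreover have "fhom (restrict s F)"
    using assms(1) by (auto simp: fhom_def F_add F_mult F_of_rat)
  ultimately show ?thesis unfolding galois_group_carrier by simp
qed

lemma tau_rho_rho: "x \<in> F \<Longrightarrow> \<tau> (\<rho> (\<rho> x)) = \<rho> (\<tau> x)"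
  by (simp add: tau_rho rho_mem tau_mem rho3)

text \<open>An automorphism is determined by its action on the roots, since \<open>\<delta>\<close>
  is a polynomial in them. Surjectivity is a count: six explicit automorphisms are told apart by the
  images of l1 and l2, and there are only six permutations.\<close>

lemma galois_group_iso: "galois_group F \<cong> sym_group 3"
proof -
  define G where "G = carrier (galois_group F)"
  have hom: "root_perm \<in> hom (galois_group F) (sym_group 3)"
  proof (rule homI)
    fix s assume "s \<in> carrier (galois_group F)"
    then show "root_perm s \<in> carrier (sym_group 3)"
      using root_perm_permutes by (simp add: galois_group_carrier sym_group_def del: One_nat_def)
  next
    fix s s' assume s: "s \<in> carrier (galois_group F)" "s' \<in> carrier (galois_group F)"
    then have b: "s \<in> Bij F" "s' \<in> Bij F" "fhom s" "fhom s'" by (auto simp: galois_group_carrier)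
    have m: "s' x \<in> F" if "x \<in> F" for x using b(2) that by (auto simp: Bij_def bij_betw_def)
    have c: "fhom (compose F s s')"
      using fhom_comp[OF b(3,4) m] by (auto simp: fhom_def compose_def F_add F_mult F_of_rat)
    have "root_perm (compose F s s') i = (root_perm s \<circ> root_perm s') i" for i
    proof (cases "i \<in> {1..3}")
      case True
      have "compose F s s' (root i) = root (root_perm s (root_perm s' i))"
        using root_perm(2)[OF b(4) True] root_perm(2)[OF b(3) root_perm(1)[OF b(4) True]]
        by (simp add: compose_def root_F)
      then show ?thesis
        using root_perm_eqI[OF c True root_perm(1)[OF b(3) root_perm(1)[OF b(4) True]]] by simp
    next
      case False
      have n: "root_perm f i = i" for f using False unfolding root_perm_def by (rule if_not_P)
      then show ?thesis by (simp only: n comp_apply)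
    qed
    then show "root_perm (s \<otimes>\<^bsub>galois_group F\<^esub> s') = root_perm s \<otimes>\<^bsub>sym_group 3\<^esub> root_perm s'"
      using b by (simp add: galois_group_mult sym_group_def fun_eq_iff)
  qed
  have inj: "inj_on root_perm G"
  proof (rule inj_onI)
    fix s s' assume s: "s \<in> G" "s' \<in> G" "root_perm s = root_perm s'"
    then have b: "s \<in> Bij F" "s' \<in> Bij F" "fhom s" "fhom s'" by (auto simp: galois_group_carrier G_def)
    have "s (root i) = s' (root i)" if "i \<in> {1..3}" for i
      using root_perm(2)[OF b(3) that] root_perm(2)[OF b(4) that] s(3) by simp
    from this[of 1] this[of 2] this[of 3]
    have r: "s l1 = s' l1" "s l2 = s' l2" "s l3 = s' l3" by (simp_all add: root_def)
    have d: "s \<delta> = s' \<delta>" unfolding \<delta>_def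
      by (simp add: fhomD[OF b(3)] fhomD[OF b(4)] F_diff F_mult F_l1 F_l2 F_l3 r)
    show "s = s'"
      by (rule extensionalityI[of _ F]) (use b fhom_eqI[OF b(3,4) r(1) d] in \<open>auto simp: Bij_def\<close>)
  qed
  have sub: "root_perm ` G \<subseteq> {p. p permutes {1..3}}"
    using root_perm_permutes by (auto simp: G_def galois_group_carrier)
  have card6: "card {p. p permutes {1..3::nat}} = 6" using card_permutations[of "{1..3::nat}" 3] by (simp add: fact_numeral)
  have fin: "finite {p. p permutes {1..3::nat}}" by (rule finite_permutations) simp
  have finG: "finite G" using finite_subset[OF sub fin] inj finite_imageD by blast
  define ev where "ev s = (s l1, s l2)" for s :: "complex \<Rightarrow> complex"
  define six where "six = [\<lambda>x. x, \<rho>, \<lambda>x. \<rho> (\<rho> x), \<tau>, \<lambda>x. \<rho> (\<tau> x), \<lambda>x. \<rho> (\<rho> (\<tau> x))]"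
  have sixG: "restrict s F \<in> G" if "s \<in> set six" for s
  proof -
    have rt: "fhom (\<lambda>x. \<rho> (\<tau> x))" by (rule fhom_comp[OF fhom_rho fhom_tau]) (rule tau_mem)
    have "restrict (\<lambda>x. x) F \<in> G" unfolding G_def by (rule galois_groupI[of _ "\<lambda>x. x"]) (simp_all add: fhom_id)
    moreover have "restrict \<rho> F \<in> G" unfolding G_def
      by (rule galois_groupI[of _ "\<lambda>x. \<rho> (\<rho> x)"]) (simp_all add: fhom_rho rho_mem rho3)
    moreover have "restrict (\<lambda>x. \<rho> (\<rho> x)) F \<in> G" unfolding G_def
      by (rule galois_groupI[of _ \<rho>]) (simp_all add: fhom_rho_rho rho_mem rho3)
    moreover have "restrict \<tau> F \<in> G" unfolding G_def
      by (rule galois_groupI[of _ \<tau>]) (simp_all add: fhom_tau tau_mem tau2)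
    moreover have "restrict (\<lambda>x. \<rho> (\<tau> x)) F \<in> G" unfolding G_def
      by (rule galois_groupI[of _ "\<lambda>x. \<rho> (\<tau> x)"]) (simp_all add: rt tau_mem rho_mem tau_rho tau2 rho3)
    moreover have "restrict (\<lambda>x. \<rho> (\<rho> (\<tau> x))) F \<in> G" unfolding G_def
      by (rule galois_groupI[of _ "\<lambda>x. \<rho> (\<rho> (\<tau> x))"])
        (simp_all add: fhom_rho_rho_tau tau_mem rho_mem tau_rho_rho tau_rho tau2 rho3)
    ultimately show ?thesis using that by (auto simp: six_def)
  qed
  have "ev ` (\<lambda>s. restrict s F) ` set six = {(l1, l2), (l2, l3), (l3, l1), (l1, l3), (l2, l1), (l3, l2)}"
    by (auto simp: six_def ev_def F_l1 F_l2 rho_gens rho_roots tau_gens tau_roots)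
  then have "card (ev ` (\<lambda>s. restrict s F) ` set six) = 6" using distinct_roots by auto
  moreover have "card (ev ` (\<lambda>s. restrict s F) ` set six) \<le> card ((\<lambda>s. restrict s F) ` set six)"
    by (rule card_image_le) simp
  moreover have "card ((\<lambda>s. restrict s F) ` set six) \<le> card G"
    by (rule card_mono[OF finG]) (use sixG in blast)
  ultimately have "card (root_perm ` G) \<ge> 6" using card_image[OF inj] by simp
  then have "root_perm ` G = {p. p permutes {1..3}}"
    using card_seteq[OF fin sub] card6 by simp
  then have "root_perm \<in> Group.iso (galois_group F) (sym_group 3)"
    using hom inj by (simp add: Group.iso_def bij_betw_def G_def sym_group_def)
  then show ?thesis unfolding is_iso_def by blast
qed

lemma algebraic_int_fhom: assumes "fhom s" "x \<in> F" "algebraic_int x" shows "algebraic_int (s x)"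
proof -
  obtain q :: "int poly" where q: "poly (map_poly of_int q) x = 0" "lead_coeff q = 1"
    using assms(3) unfolding algebraic_int_altdef_ipoly by blast
  have e: "poly (map_poly of_int q) z = (\<Sum>i\<le>degree q. of_int (coeff q i) * z ^ i)" for z :: complex
    by (simp add: poly_altdef degree_map_poly coeff_map_poly)
  have "poly (map_poly of_int q) (s x) = s (poly (map_poly of_int q) x)"
    unfolding e using assms(1,2) by (simp add: fhom_sum fhomD F_mult F_power)
  then have "poly (map_poly of_int q) (s x) = 0" using q(1) fhomD(7)[OF assms(1)] by simp
  then show ?thesis using q(2) unfolding algebraic_int_altdef_ipoly by blast
qed

end

text \<open>A prime factor of the denominator would give the number a value above 1 at that
  prime.\<close>

lemma rational_integer_criterion:
  assumes "x \<in> \<rat>" "\<And>p. Factorial_Ring.prime p \<Longrightarrow> padic_abs p x \<le> 1" shows "x \<in> \<int>"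
proof -
  obtain q where q: "x = of_rat q" using assms(1) by (auto elim: Rats_cases)
  obtain a b where ab: "quotient_of q = (a, b)" by fastforce
  have b: "b > 0" "coprime a b" using quotient_of_denom_pos[OF ab] quotient_of_coprime[OF ab] by auto
  have r: "x = of_int a / of_int b" unfolding q using quotient_of_div[OF ab] by (simp add: of_rat_divide)
  have "b = 1"
  proof (rule ccontr)
    assume "b \<noteq> 1"
    then have "nat b \<noteq> 1" using b(1) by auto
    then obtain p where p: "Factorial_Ring.prime p" "p dvd nat b" using prime_factor_nat by blast
    then have pb: "int p dvd b" using b(1) by (metis int_dvd_int_iff nat_0_le less_imp_le)
    interpret valued_field \<rat> "padic_abs p" p by (rule valued_field_Rats[OF p(1)])
    have "\<not> int p dvd a" using b(2) pb p(1)
      by (metis coprime_common_divisor not_prime_unit prime_nat_int_transfer)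
    then have a: "padic_abs p (of_int a) = 1" using abs_of_int_less_1_iff[of a] abs_of_int_le_1[of a] by linarith
    have bl: "padic_abs p (of_int b) < 1" using pb abs_of_int_less_1_iff by blast
    have "of_int a = x * of_int b" using b(1) by (simp add: r)
    then have "padic_abs p (of_int a) = padic_abs p x * padic_abs p (of_int b)"
      using abs_mult[OF assms(1) of_int_mem] by simp
    also have "\<dots> \<le> 1 * padic_abs p (of_int b)"
      by (rule mult_right_mono) (use assms(2)[OF p(1)] in auto)
    finally show False using a bl by simp
  qed
  then show ?thesis by (simp add: r)
qed

context cubic_field
begin

text \<open>Integrality is tested at all non-archimedean places, which makes the closure of the
  algebraic integers under addition and multiplication immediate.\<close>

lemma fhom_rho_tau: "fhom (\<lambda>x. \<rho> (\<tau> x))"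
  by (rule fhom_comp[OF fhom_rho fhom_tau]) (rule tau_mem)

lemma conjs_integral:
  assumes x: "x \<in> F" "algebraic_int x" and y: "y \<in> set (conjs x)" shows "algebraic_int y"
  using y x(2) algebraic_int_fhom[OF fhom_rho x] algebraic_int_fhom[OF fhom_rho_rho x]
    algebraic_int_fhom[OF fhom_tau x] algebraic_int_fhom[OF fhom_rho_tau x] algebraic_int_fhom[OF fhom_rho_rho_tau x]
  by (auto simp: conjs_def)

lemma conjs_abs_le_1:
  assumes "x \<in> F" "algebraic_int x" "y \<in> set (conjs x)" "Factorial_Ring.prime p" "w \<in> places_above p F"
  shows "w y \<le> 1"
proof -
  interpret w: valued_field F w p by (rule places_above_valued_field[OF assms(4) subfield_F assms(5)])
  show ?thesis by (rule w.abs_algebraic_int_le_1[OF conjs_mem[OF assms(1,3)] conjs_integral[OF assms(1-3)]])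
qed

text \<open>Polynomials whose coefficients have value at most 1 at a place are closed under
  products, which applies to the linear factors. The coefficients are rational, so any one place
  above p decides whether they are p-integral.\<close>

lemma charpoly_integral:
  assumes x: "x \<in> F"
    and R: "\<forall>p w. Factorial_Ring.prime p \<longrightarrow> w \<in> places_above p F \<longrightarrow> (\<forall>y\<in>set (conjs x). w y \<le> 1)"
  shows "coeff (charpoly x) i \<in> \<int>"
proof (rule rational_integer_criterion[OF charpoly_rational[OF x]])
  fix p assume p: "Factorial_Ring.prime (p::nat)"
  obtain w where w: "w \<in> places_above p F" using places_above_nonempty[OF subfield_F F_algebraic p] by blast
  interpret w: valued_field F w p by (rule places_above_valued_field[OF p subfield_F w])
  define good where "good q \<longleftrightarrow> (\<forall>i. coeff q i \<in> F \<and> w (coeff q i) \<le> 1)" for q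
  have gmult: "good (q * q')" if "good q" "good q'" for q q'
    unfolding good_def coeff_mult
  proof (intro allI conjI)
    fix i
    show "(\<Sum>j\<le>i. coeff q j * coeff q' (i - j)) \<in> F"
      using that by (auto simp: good_def intro!: F_sum F_mult)
    show "w (\<Sum>j\<le>i. coeff q j * coeff q' (i - j)) \<le> 1"
      by (rule w.abs_sum_le) (use that in \<open>auto simp: good_def w.abs_mult F_mult intro!: mult_le_one\<close>)
  qed
  have glin: "good (lin y)" if "y \<in> set (conjs x)" for y
  proof -
    have "y \<in> F" "w y \<le> 1" using conjs_mem[OF x that] R p w that by auto
    then show ?thesis
      by (auto simp: good_def lin_def coeff_pCons F_minus F_0 F_1 w.abs_minus split: nat.splits)
  qed
  have "good (charpoly x)"
    unfolding charpoly_def by (intro gmult glin) (auto simp: conjs_def)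
  then have "w (coeff (charpoly x) i) \<le> 1" by (simp add: good_def)
  moreover have "w (coeff (charpoly x) i) = padic_abs p (coeff (charpoly x) i)"
    using w charpoly_rational[OF x] by (auto simp: places_above_def)
  ultimately show "padic_abs p (coeff (charpoly x) i) \<le> 1" by simp
qed

text \<open>All conjugates are built into the condition, so the roots of \<open>charpoly\<close> are
  controlled directly and places need not be transported along automorphisms.\<close>

lemma algebraic_int_F_iff:
  assumes x: "x \<in> F"
  shows "algebraic_int x \<longleftrightarrow> (\<forall>p w. Factorial_Ring.prime p \<longrightarrow> w \<in> places_above p F \<longrightarrow> (\<forall>y\<in>set (conjs x). w y \<le> 1))"
    (is "_ \<longleftrightarrow> ?R")
proof
  assume "algebraic_int x"
  then show ?R using conjs_abs_le_1[OF x] by blast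
next
  assume ?R
  from charpoly_integral[OF x this] show "algebraic_int x"
    by (intro algebraic_int.intros[OF charpoly_monic(1)[of x]]) (auto simp: charpoly_root conjs_def)
qed

lemma F_integer_mult:
  assumes "x \<in> F" "y \<in> F" "algebraic_int x" "algebraic_int y" shows "algebraic_int (x * y)"
  unfolding algebraic_int_F_iff[OF F_mult[OF assms(1,2)]]
proof (intro allI impI ballI)
  fix p w z assume p: "Factorial_Ring.prime p" and w: "w \<in> places_above p F" and z: "z \<in> set (conjs (x * y))"
  interpret w: valued_field F w p by (rule places_above_valued_field[OF p subfield_F w])
  obtain a b where ab: "z = a * b" "a \<in> set (conjs x)" "b \<in> set (conjs y)"
    using z assms(1,2) fhomD(2)[OF fhom_rho assms(1,2)] fhomD(2)[OF fhom_tau assms(1,2)] fhomD(2)[OF fhom_rho_rho assms(1,2)]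
      fhomD(2)[OF fhom_rho_tau assms(1,2)] fhomD(2)[OF fhom_rho_rho_tau assms(1,2)]
    by (auto simp: conjs_def)
  have "w a \<le> 1" "w b \<le> 1" using ab p w algebraic_int_F_iff assms by blast+
  then show "w z \<le> 1"
    unfolding ab(1) w.abs_mult[OF conjs_mem[OF assms(1) ab(2)] conjs_mem[OF assms(2) ab(3)]]
    using conjs_mem ab assms by (intro mult_le_one) auto
qed

lemma F_integer_add:
  assumes "x \<in> F" "y \<in> F" "algebraic_int x" "algebraic_int y" shows "algebraic_int (x + y)"
  unfolding algebraic_int_F_iff[OF F_add[OF assms(1,2)]]
proof (intro allI impI ballI)
  fix p w z assume p: "Factorial_Ring.prime p" and w: "w \<in> places_above p F" and z: "z \<in> set (conjs (x + y))"
  interpret w: valued_field F w p by (rule places_above_valued_field[OF p subfield_F w])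
  obtain a b where ab: "z = a + b" "a \<in> set (conjs x)" "b \<in> set (conjs y)"
    using z assms(1,2) fhomD(1)[OF fhom_rho assms(1,2)] fhomD(1)[OF fhom_tau assms(1,2)] fhomD(1)[OF fhom_rho_rho assms(1,2)]
      fhomD(1)[OF fhom_rho_tau assms(1,2)] fhomD(1)[OF fhom_rho_rho_tau assms(1,2)]
    by (auto simp: conjs_def)
  have "w a \<le> 1" "w b \<le> 1" using ab p w algebraic_int_F_iff assms by blast+
  then show "w z \<le> 1"
    unfolding ab(1) using w.ultrametric[OF conjs_mem[OF assms(1) ab(2)] conjs_mem[OF assms(2) ab(3)]] by simp
qed

lemma l1_integer: "algebraic_int l1"
proof (rule algebraic_int.intros)
  show "lead_coeff (cubic t :: complex poly) = 1" by (simp add: cubic_def)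
  show "\<forall>i. coeff (cubic t :: complex poly) i \<in> \<int>"
    by (auto simp: cubic_def coeff_pCons split: nat.splits)
  show "poly (cubic t) l1 = 0" by (simp add: cubic_roots_iff)
qed

lemma generate_ring_integers: "generate_ring complex_ring {l1} \<subseteq> ring_of_integers K"
proof
  fix x assume "x \<in> generate_ring complex_ring {l1}"
  then have "x \<in> K \<and> algebraic_int x"
  proof (induction rule: generate_ring.induct)
    case (eng_add x y)
    then show ?case using K_subset_F F_integer_add by (auto intro: K.add_mem)
  next
    case (eng_mult x y)
    then show ?case using K_subset_F F_integer_mult by (auto intro: K.mult_mem)
  qed (auto simp: l1_K l1_integer algebraic_int_minus K.minus_mem)
  then show "x \<in> ring_of_integers K" by (simp add: ring_of_integers_def)
qed

text \<open>The cubic equation reads l (l - t)(l + t) = 1, which is where the two units come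
  from.\<close>

lemma root_inverse: "l1 * (l1\<^sup>2 - (of_int t)\<^sup>2) = 1" "(l1 + of_int t) * (l1 * (l1 - of_int t)) = 1"
  using cubic_root unfolding of_rat_T by (simp_all add: algebra_simps power2_eq_square power3_eq_cube)

lemma units_generate_ring:
  "l1 \<in> Units (subring_of (generate_ring complex_ring {l1}))"
  "l1 + of_int t \<in> Units (subring_of (generate_ring complex_ring {l1}))"
proof -
  define R where "R = generate_ring complex_ring {l1}"
  have l: "l1 \<in> R" unfolding R_def by (rule generate_ring.incl) simp
  have 1: "1 \<in> R" unfolding R_def using generate_ring.one[of complex_ring] by simp
  have a: "x + y \<in> R" and m: "x * y \<in> R" if "x \<in> R" "y \<in> R" for x y
    using that generate_ring.eng_add[of _ complex_ring] generate_ring.eng_mult[of _ complex_ring] unfolding R_def by fastforce+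
  have n: "- x \<in> R" if "x \<in> R" for x
    using that generate_ring.a_inv[of _ complex_ring] unfolding R_def by fastforce
  have z: "0 \<in> R" using a[OF 1 n[OF 1]] by simp
  have nat: "of_nat k \<in> R" for k by (induction k) (auto intro: a z 1)
  have int: "of_int k \<in> R" for k by (cases k rule: int_cases2) (auto intro: nat n)
  have d: "x - y \<in> R" if "x \<in> R" "y \<in> R" for x y using a[OF that(1) n[OF that(2)]] by simp
  have "l1\<^sup>2 - (of_int t)\<^sup>2 \<in> R" "l1 * (l1 - of_int t) \<in> R" "l1 + of_int t \<in> R"
    unfolding power2_eq_square by (intro d m a l int)+
  then show "l1 \<in> Units (subring_of (generate_ring complex_ring {l1}))"
    "l1 + of_int t \<in> Units (subring_of (generate_ring complex_ring {l1}))"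
    using l root_inverse mult.commute[of "l1\<^sup>2 - (of_int t)\<^sup>2" l1]
      mult.commute[of "l1 * (l1 - of_int t)" "l1 + of_int t"]
    unfolding R_def[symmetric] Units_def
    by (auto intro: bexI[of _ "l1\<^sup>2 - (of_int t)\<^sup>2"] bexI[of _ "l1 * (l1 - of_int t)"])
qed

end

text \<open>The values at -t, -1, 0, t, t + 1 have signs -, +, -, -, +. The location of the roots
  matters later: \<open>units_independent\<close> needs the signs of their logarithms.\<close>

lemma real_roots_exist:
  assumes t: "t \<ge> (2::int)"
  obtains a b c :: real where "a > of_int t" "-1 < b" "b < 0" "c < -1"
    "poly (cubic t) a = 0" "poly (cubic t) b = 0" "poly (cubic t) c = 0"
proof -
  define f where "f x = x ^ 3 - (of_int t)\<^sup>2 * x - (1 :: real)" for x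
  have f: "poly (cubic t) x = f x" for x by (simp add: poly_cubic f_def)
  have cont: "isCont f x" for x unfolding f_def by (intro continuous_intros)
  define s where "s = real_of_int t"
  have s: "s \<ge> 2" using t by (simp add: s_def)
  have fs: "f x = x ^ 3 - s\<^sup>2 * x - 1" for x by (simp add: f_def s_def)
  have s2: "s\<^sup>2 \<ge> 4" using power_mono[OF s, of 2] by simp
  have m1: "f (-1) > 0" using s2 by (simp add: fs)
  have m2: "f 0 < 0" "f s < 0" "f (- s) < 0" by (simp_all add: fs power2_eq_square power3_eq_cube)
  have m3: "f (s + 1) > 0"
  proof -
    have "f (s + 1) = 2 * s\<^sup>2 + 3 * s" by (simp add: fs power2_eq_square power3_eq_cube algebra_simps)
    then show ?thesis using s s2 by simp
  qed
  have "\<exists>a\<ge>s. a \<le> s + 1 \<and> f a = 0" by (rule IVT) (use m2 m3 cont in auto)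
  then obtain a where a: "a \<ge> s" "f a = 0" by blast
  have "\<exists>c\<ge>-s. c \<le> -1 \<and> f c = 0" by (rule IVT) (use m1 m2 cont s in auto)
  then obtain c where c: "c \<le> -1" "f c = 0" by blast
  have "\<exists>b\<ge>-1. b \<le> 0 \<and> f b = 0" by (rule IVT2) (use m1 m2 cont in auto)
  then obtain b where b: "-1 \<le> b" "b \<le> 0" "f b = 0" by blast
  have "a \<noteq> s" "c \<noteq> -1" "b \<noteq> -1" "b \<noteq> 0" using a b c m1 m2 by auto
  then show ?thesis using that[of a b c] a b c by (auto simp: f s_def)
qed

text \<open>Dividing differences of the three equations by differences of the distinct roots yields
  Vieta's relations. A given root l is put first by rotation.\<close>

lemma cubic_field_exists:
  assumes t: "t \<ge> 2" and l: "poly (cubic t) (l :: complex) = 0"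
  obtains l2 l3 where "cubic_field t l l2 l3"
proof -
  obtain a b c :: real where abc: "a > of_int t" "-1 < b" "b < 0" "c < -1"
    "poly (cubic t) a = 0" "poly (cubic t) b = 0" "poly (cubic t) c = 0" using real_roots_exist[OF t] .
  have d: "a - b \<noteq> 0" "a - c \<noteq> 0" "b - c \<noteq> 0" using abc(1-4) t by auto
  define s where "s = real_of_int t"
  have e: "a ^ 3 - s\<^sup>2 * a - 1 = 0" "b ^ 3 - s\<^sup>2 * b - 1 = 0" "c ^ 3 - s\<^sup>2 * c - 1 = 0"
    using abc(5-7) by (simp_all add: poly_cubic s_def)
  have q: "(a - b) * (a\<^sup>2 + a * b + b\<^sup>2 - s\<^sup>2) = 0" "(a - c) * (a\<^sup>2 + a * c + c\<^sup>2 - s\<^sup>2) = 0"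
    using e by Groebner_Basis.algebra+
  then have q: "a\<^sup>2 + a * b + b\<^sup>2 - s\<^sup>2 = 0" "a\<^sup>2 + a * c + c\<^sup>2 - s\<^sup>2 = 0" using d by auto
  have "(b - c) * (a + b + c) = 0" using q by Groebner_Basis.algebra
  then have s0: "a + b + c = 0" using d by simp
  have s1: "a * b + a * c + b * c = - (s\<^sup>2)" using s0 q by Groebner_Basis.algebra
  have s2: "a * b * c = 1" using s0 q e by Groebner_Basis.algebra
  have cf: "cubic_field t (of_real a) (of_real b) (of_real c)"
  proof (rule cubic_field.intro)
    show "of_real a + of_real b + of_real c = (0 :: complex)" using s0 by (metis of_real_0 of_real_add)
    show "of_real a * of_real b + of_real a * of_real c + of_real b * of_real c = - ((of_int t)\<^sup>2 :: complex)"
      using arg_cong[OF s1, of complex_of_real] by (simp add: s_def)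
    show "of_real a * of_real b * of_real c = (1 :: complex)" using s2 by (metis of_real_1 of_real_mult)
  qed (use t in auto)
  have "l = of_real a \<or> l = of_real b \<or> l = of_real c" using l cubic_field.cubic_roots_iff[OF cf] by simp
  then show ?thesis
    using that cf cubic_field.rotate[OF cf] cubic_field.rotate[OF cubic_field.rotate[OF cf]] by blast
qed

lemma card_real_roots: assumes t: "t \<ge> 2" shows "card {x :: real. poly (cubic t) x = 0} = 3"
proof -
  obtain a b c :: real where abc: "a > of_int t" "-1 < b" "b < 0" "c < -1"
    "poly (cubic t) a = 0" "poly (cubic t) b = 0" "poly (cubic t) c = 0" using real_roots_exist[OF t] .
  have "{a, b, c} \<subseteq> {x. poly (cubic t) x = 0}" using abc by auto
  moreover have nz: "cubic t \<noteq> (0 :: real poly)" by (simp add: cubic_def)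
  then have "finite {x :: real. poly (cubic t) x = 0}" by (rule poly_roots_finite)
  ultimately have "card {a, b, c} \<le> card {x :: real. poly (cubic t) x = 0}" by (intro card_mono)
  moreover have "card {a, b, c} = 3" using abc(1-4) t by auto
  moreover have "card {x :: real. poly (cubic t) x = 0} \<le> degree (cubic t :: real poly)"
    by (rule card_poly_roots_bound) (rule nz)
  moreover have "degree (cubic t :: real poly) = 3" by (simp add: cubic_def)
  ultimately show ?thesis by simp
qed

section \<open>Dependence of units and linear approximation of powers\<close>

text \<open>The pigeonhole step of Dirichlet's unit theorem: among the products of \<open>r + 1\<close> units with
  exponents in \<open>{0..N}\<close>, of which there are \<open>(N + 1)\<^bsup>r + 1\<^esup>\<close>, the logarithmic vectors fill only
  \<open>O(N\<^bsup>r\<^esup>)\<close> unit boxes.\<close>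

lemma units_dependent_pigeonhole:
  fixes u :: "nat \<Rightarrow> complex" and L :: "nat \<Rightarrow> complex \<Rightarrow> real" and r :: nat
  defines "P \<equiv> \<lambda>e :: nat \<Rightarrow> nat. \<Prod>i\<le>r. u i ^ e i"
  assumes fin: "finite S" and nz: "\<And>i. u i \<noteq> 0"
    and L: "\<And>k e. k < r \<Longrightarrow> L k (P e) = (\<Sum>i\<le>r. real (e i) * L k (u i))"
    and small: "\<And>e e'. (\<forall>k<r. \<bar>L k (P e) - L k (P e')\<bar> \<le> 1) \<Longrightarrow> P e / P e' \<in> S"
  shows "\<exists>e e'. P e = P e' \<and> (\<exists>i\<le>r. e i \<noteq> e' i)"
proof (rule ccontr)
  assume n: "\<nexists>e e'. P e = P e' \<and> (\<exists>i\<le>r. e i \<noteq> e' i)"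
  have Pnz: "P e \<noteq> 0" for e using nz by (simp add: P_def)
  define C where "C = nat \<lceil>\<Sum>k<r. \<Sum>i\<le>r. \<bar>L k (u i)\<bar>\<rceil> + 1"
  have C: "(\<Sum>i\<le>r. \<bar>L k (u i)\<bar>) \<le> real C" if "k < r" for k
  proof -
    have "(\<Sum>i\<le>r. \<bar>L k (u i)\<bar>) \<le> (\<Sum>k<r. \<Sum>i\<le>r. \<bar>L k (u i)\<bar>)"
      by (rule member_le_sum) (use that in \<open>auto intro: sum_nonneg\<close>)
    also have "\<dots> \<le> real C" unfolding C_def by linarith
    finally show ?thesis .
  qed
  define m where "m = card S"
  have count: "(N + 1) ^ Suc r \<le> (2 * (N * C) + 3) ^ r * m" for N :: nat
  proof -
    define A where "A = (\<Pi>\<^sub>E i\<in>{..r}. {0..N})"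
    define B where "B = (\<Pi>\<^sub>E k\<in>{..<r}. {- int (N * C) - 1..int (N * C) + 1})"
    define g where "g e = (\<lambda>k\<in>{..<r}. \<lfloor>L k (P e)\<rfloor>)" for e
    have finA: "finite A" unfolding A_def by (rule finite_PiE) auto
    have finB: "finite B" unfolding B_def by (rule finite_PiE) auto
    have inj: "e = e'" if "e \<in> A" "e' \<in> A" "P e = P e'" for e e'
    proof (rule PiE_ext[of _ "{..r}"])
      show "e \<in> (\<Pi>\<^sub>E i\<in>{..r}. {0..N})" "e' \<in> (\<Pi>\<^sub>E i\<in>{..r}. {0..N})" using that by (simp_all add: A_def)
      show "e i = e' i" if "i \<in> {..r}" for i using n \<open>P e = P e'\<close> that by auto
    qed
    have gB: "g e \<in> B" if "e \<in> A" for e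
      unfolding B_def g_def
    proof (rule restrict_PiE_iff[THEN iffD2], intro ballI)
      fix k assume k: "k \<in> {..<r}"
      have "\<bar>L k (P e)\<bar> \<le> (\<Sum>i\<le>r. \<bar>real (e i) * L k (u i)\<bar>)"
        using k by (simp add: L sum_abs)
      also have "\<dots> \<le> (\<Sum>i\<le>r. real N * \<bar>L k (u i)\<bar>)"
      proof (rule sum_mono)
        fix i assume "i \<in> {..r}"
        then have "e i \<le> N" using that PiE_mem[of e "{..r}" "\<lambda>_. {0..N}" i] by (simp add: A_def)
        then show "\<bar>real (e i) * L k (u i)\<bar> \<le> real N * \<bar>L k (u i)\<bar>" by (simp add: abs_mult mult_right_mono)
      qed
      also have "\<dots> = real N * (\<Sum>i\<le>r. \<bar>L k (u i)\<bar>)" by (simp add: sum_distrib_left)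
      also have "\<dots> \<le> real N * real C" using C[of k] k by (intro mult_left_mono) auto
      finally have "\<bar>L k (P e)\<bar> \<le> of_int (int (N * C))" by simp
      then show "\<lfloor>L k (P e)\<rfloor> \<in> {- int (N * C) - 1..int (N * C) + 1}"
        unfolding atLeastAtMost_iff by linarith
    qed
    \<comment> \<open>Dividing the products of one box by a fixed one among them is injective and
      lands in S.\<close>
    have fib: "card {e \<in> A. g e = b} \<le> m" for b
    proof (cases "{e \<in> A. g e = b} = {}")
      case False
      then obtain e0 where e0: "e0 \<in> A" "g e0 = b" by blast
      have "(\<lambda>e. P e / P e0) ` {e \<in> A. g e = b} \<subseteq> S"
      proof (rule image_subsetI)
        fix e assume e: "e \<in> {e \<in> A. g e = b}"
        have "\<bar>L k (P e) - L k (P e0)\<bar> \<le> 1" if "k < r" for k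
        proof -
          have "g e k = g e0 k" using e e0 by simp
          then have "\<lfloor>L k (P e)\<rfloor> = \<lfloor>L k (P e0)\<rfloor>" using that by (simp add: g_def)
          then show ?thesis by linarith
        qed
        then show "P e / P e0 \<in> S" by (intro small) blast
      qed
      moreover have "inj_on (\<lambda>e. P e / P e0) {e \<in> A. g e = b}"
        by (rule inj_onI) (use inj Pnz in auto)
      ultimately show ?thesis unfolding m_def using card_inj_on_le fin by blast
    qed (simp only: card.empty le0)
    have "A = (\<Union>b\<in>B. {e \<in> A. g e = b})" using gB by auto
    then have "card A \<le> (\<Sum>b\<in>B. card {e \<in> A. g e = b})" using card_UN_le[OF finB] by metis
    also have "\<dots> \<le> (\<Sum>b\<in>B. m)" by (rule sum_mono) (rule fib)
    finally have "card A \<le> card B * m" by simp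
    moreover have "card A = (N + 1) ^ Suc r" unfolding A_def by (simp add: card_PiE)
    moreover have "card B = (2 * (N * C) + 3) ^ r"
    proof -
      have "card {- int (N * C) - 1..int (N * C) + 1} = 2 * (N * C) + 3"
        by (simp add: nat_eq_iff mult.commute)
      then show ?thesis unfolding B_def by (simp add: card_PiE)
    qed
    ultimately show ?thesis by simp
  qed
  \<comment> \<open>Taking N = M turns the count into (M + 1)^(r+1) <= M (M + 1)^r, which is
    absurd.\<close>
  define M where "M = (2 * C + 3) ^ r * m"
  have "(M + 1) ^ Suc r \<le> (2 * (M * C) + 3) ^ r * m" by (rule count)
  also have "\<dots> \<le> ((2 * C + 3) * (M + 1)) ^ r * m"
    by (intro mult_right_mono power_mono) (auto simp: algebra_simps)
  also have "\<dots> = ((2 * C + 3) ^ r * m) * (M + 1) ^ r" by (simp only: power_mult_distrib mult_ac)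
  also have "\<dots> = M * (M + 1) ^ r" by (simp only: M_def)
  finally show False by simp
qed

text \<open>Northcott's argument: there are finitely many polynomials of bounded degree with bounded
  integer coefficients, each with finitely many roots.\<close>

lemma finite_bounded_algebraic:
  fixes C :: real
  assumes "\<And>x. x \<in> S \<Longrightarrow> \<exists>q :: complex poly. degree q = d \<and> q \<noteq> 0 \<and> poly q x = 0 \<and>
      (\<forall>i. coeff q i \<in> \<int> \<and> norm (coeff q i) \<le> C)"
  shows "finite S"
proof -
  define Z :: "complex set" where "Z = of_int ` {- \<lceil>C\<rceil>..\<lceil>C\<rceil>}"
  define Q where "Q = {q :: complex poly. degree q = d \<and> q \<noteq> 0 \<and> (\<forall>i. coeff q i \<in> Z)}"
  have "finite Q"
  proof (rule finite_imageD)
    have "(\<lambda>q. \<lambda>i\<in>{..d}. coeff q i) ` Q \<subseteq> (\<Pi>\<^sub>E i\<in>{..d}. Z)"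
      by (rule image_subsetI) (simp only: restrict_PiE_iff, simp add: Q_def)
    then show "finite ((\<lambda>q. \<lambda>i\<in>{..d}. coeff q i) ` Q)"
      by (rule finite_subset) (rule finite_PiE, auto simp: Z_def)
    show "inj_on (\<lambda>q. \<lambda>i\<in>{..d}. coeff q i) Q"
    proof (rule inj_onI, rule poly_eqI)
      fix q q' i assume q: "q \<in> Q" "q' \<in> Q" "(\<lambda>i\<in>{..d}. coeff q i) = (\<lambda>i\<in>{..d}. coeff q' i)"
      show "coeff q i = coeff q' i"
      proof (cases "i \<le> d")
        case True
        then show ?thesis using fun_cong[OF q(3), of i] by simp
      next
        case False
        then show ?thesis using q by (simp add: Q_def coeff_eq_0)
      qed
    qed
  qed
  then have "finite (\<Union>q\<in>Q. {x. poly q x = 0})" by (auto simp: Q_def intro!: poly_roots_finite)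
  moreover have "S \<subseteq> (\<Union>q\<in>Q. {x. poly q x = 0})"
  proof
    fix x assume "x \<in> S"
    then obtain q where q: "degree q = d" "q \<noteq> 0" "poly q x = 0" "\<And>i. coeff q i \<in> \<int>" "\<And>i. norm (coeff q i) \<le> C"
      using assms by blast
    have "coeff q i \<in> Z" for i
    proof -
      obtain k where k: "coeff q i = of_int k" using q(4) by (metis Ints_cases)
      have "real_of_int \<bar>k\<bar> \<le> C" using q(5)[of i] by (simp add: k)
      then have "k \<in> {- \<lceil>C\<rceil>..\<lceil>C\<rceil>}" unfolding atLeastAtMost_iff by linarith
      then show ?thesis unfolding Z_def k by blast
    qed
    then show "x \<in> (\<Union>q\<in>Q. {x. poly q x = 0})" using q by (auto simp: Q_def)
  qed
  ultimately show ?thesis by (rule finite_subset[rotated])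
qed

text \<open>Integer rows that are independent over Z remain independent over Z_p. The columns in J
  are eliminated one at a time; pivots are nonzero integers, which \<open>padic_null_cancel\<close>
  can divide out.\<close>

lemma padic_null_independent:
  fixes e :: "'a \<Rightarrow> 'b \<Rightarrow> int" and c :: "'a \<Rightarrow> nat \<Rightarrow> int"
  assumes "finite J" "finite I" "Factorial_Ring.prime p"
    and indep: "\<And>z :: 'a \<Rightarrow> int. \<forall>k\<in>J. (\<Sum>i\<in>I. z i * e i k) = 0 \<Longrightarrow> \<forall>i\<in>I. z i = 0"
    and null: "\<And>k. k \<in> J \<Longrightarrow> padic_null p (\<lambda>n. \<Sum>i\<in>I. c i n * e i k)"
  shows "\<forall>i\<in>I. padic_null p (c i)"
  using assms
proof (induction J arbitrary: I e rule: finite_induct)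
  case empty
  have "I = {}" using empty.prems(3)[of "\<lambda>_. 1"] by auto
  then show ?case by simp
next
  case (insert k J)
  show ?case
  proof (cases "\<forall>i\<in>I. e i k = 0")
    case True
    show ?thesis
    proof (rule insert.IH[of I e])
      show "\<forall>i\<in>I. z i = 0" if "\<forall>j\<in>J. (\<Sum>i\<in>I. z i * e i j) = 0" for z
        using that True by (intro insert.prems(3)) simp
    qed (use insert.prems in auto)
  next
    case False
    then obtain a where a: "a \<in> I" "e a k \<noteq> 0" by blast
    define I' where "I' = I - {a}"
    have I': "finite I'" "a \<notin> I'" "I = insert a I'" using a insert.prems(1) by (auto simp: I'_def)
    \<comment> \<open>Fraction-free elimination of column k with pivot row a: cross-multiplication
      keeps the entries integral.\<close>
    define f where "f i j = e a k * e i j - e i k * e a j" for i j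
    have fz: "(\<Sum>i\<in>I. (if i = a then - (\<Sum>i\<in>I'. z i * e i k) else e a k * z i) * e i j) = (\<Sum>i\<in>I'. z i * f i j)" for z :: "'a \<Rightarrow> int" and j
    proof -
      have "(\<Sum>i\<in>I'. (if i = a then - (\<Sum>i\<in>I'. z i * e i k) else e a k * z i) * e i j) = (\<Sum>i\<in>I'. e a k * z i * e i j)"
        by (rule sum.cong) (use I' in auto)
      then show ?thesis
        using I' by (simp add: f_def algebra_simps sum_subtractf sum_distrib_left sum_distrib_right)
    qed
    have *: "\<forall>i\<in>I'. padic_null p (c i)"
    proof (rule insert.IH[of I' f])
      fix z :: "'a \<Rightarrow> int" assume z: "\<forall>j\<in>J. (\<Sum>i\<in>I'. z i * f i j) = 0"
      have "\<forall>i\<in>I. (if i = a then - (\<Sum>i\<in>I'. z i * e i k) else e a k * z i) = 0"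
      proof (rule insert.prems(3), rule ballI)
        fix j assume "j \<in> insert k J"
        moreover have "(\<Sum>i\<in>I'. z i * f i k) = 0" by (simp add: f_def)
        ultimately show "(\<Sum>i\<in>I. (if i = a then - (\<Sum>i\<in>I'. z i * e i k) else e a k * z i) * e i j) = 0"
          unfolding fz using z by auto
      qed
      then show "\<forall>i\<in>I'. z i = 0" using a(2) I' by (auto split: if_splits)
    next
      fix j assume j: "j \<in> J"
      have "padic_null p (\<lambda>n. e a k * (\<Sum>i\<in>I. c i n * e i j) - e a j * (\<Sum>i\<in>I. c i n * e i k))"
        by (intro padic_null_diff padic_null_mult insert.prems(4)) (use j in auto)
      also have "(\<lambda>n. e a k * (\<Sum>i\<in>I. c i n * e i j) - e a j * (\<Sum>i\<in>I. c i n * e i k)) = (\<lambda>n. \<Sum>i\<in>I'. c i n * f i j)"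
        using I' by (simp add: fun_eq_iff f_def algebra_simps sum_subtractf sum_distrib_left sum_distrib_right)
      finally show "padic_null p (\<lambda>n. \<Sum>i\<in>I'. c i n * f i j)" .
    qed (use I' insert.prems in auto)
    have "padic_null p (\<lambda>n. (\<Sum>i\<in>I. c i n * e i k) - (\<Sum>i\<in>I'. e i k * c i n))"
      by (intro padic_null_diff padic_null_sum padic_null_mult insert.prems(4)) (use * in auto)
    moreover have "(\<lambda>n. (\<Sum>i\<in>I. c i n * e i k) - (\<Sum>i\<in>I'. e i k * c i n)) = (\<lambda>n. e a k * c a n)"
      using I' by (simp add: fun_eq_iff mult.commute)
    ultimately have "padic_null p (c a)" using padic_null_cancel[OF _ a(2) insert.prems(2)] by simp
    then show ?thesis using * I' by simp
  qed
qed

section \<open>Linear approximation of powers near 1\<close>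

context valued_field
begin

text \<open>For p = 2 the radius 1/2 would be too large: -1 = 1 + (-2) is torsion and has distance
  1/2 from 1.\<close>

definition log_radius :: real where "log_radius = (if p = 2 then 1 / 4 else 1 / real p)"

lemma log_radius: "0 < log_radius" "log_radius < 1" "log_radius \<le> 1 / real p" "log_radius \<le> 1 / 2"
  using p_gt_1 by (auto simp: log_radius_def field_simps)

text \<open>A binomial term with 1 < k < p gains one factor 1/p from the coefficient and one from
  x^(k-1). The term k = p gains both from x^(p-1), by p - 1 >= 2 for odd p and by the smaller radius
  for p = 2.\<close>

lemma one_plus_power_p:
  assumes x: "x \<in> E" "w x \<le> log_radius"
  shows "w ((1 + x) ^ p - 1 - of_nat p * x) \<le> 1 / real p * (1 / real p * w x)"
proof -
  define S where "S = (\<Sum>k=2..p. of_nat (p choose k) * x ^ k)"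
  have "(1 + x) ^ p = (\<Sum>k\<le>p. of_nat (p choose k) * x ^ k)"
    by (subst add.commute) (simp add: binomial_ring)
  also have "{..p} = insert 0 (insert 1 {2..p})" using p_gt_1 by auto
  also have "(\<Sum>k\<in>\<dots>. of_nat (p choose k) * x ^ k) = 1 + of_nat p * x + S"
    by (subst sum.insert; (subst sum.insert)?) (auto simp: S_def)
  finally have e: "(1 + x) ^ p - 1 - of_nat p * x = S" by simp
  have wx: "w x \<ge> 0" "w x \<le> 1" using x log_radius by auto
  have "w S \<le> 1 / real p * (1 / real p * w x)"
    unfolding S_def
  proof (rule abs_sum_le)
    fix k assume k: "k \<in> {2..p}"
    have "w (of_nat (p choose k)) * w x ^ (k - 1) \<le> 1 / real p * (1 / real p)"
    proof (cases "k = p")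
      case True
      show ?thesis
      proof (cases "p = 2")
        case p2: True
        have "w x \<le> 1 / 4" using x(2) p2 unfolding log_radius_def by simp
        then show ?thesis using True p2 by simp
      next
        case False
        then have "p - 1 \<ge> 2" using p_gt_1 by simp
        then have "w x ^ (p - 1) \<le> w x ^ 2" using wx by (intro power_decreasing) auto
        also have "\<dots> \<le> (1 / real p) ^ 2" using x(2) wx log_radius(3) by (intro power_mono) auto
        finally show ?thesis using True by (simp add: power2_eq_square)
      qed
    next
      case False
      have "p dvd (p choose k)" using k False prime_p by (intro dvd_choose_prime) auto
      then have "w (of_int (int (p choose k))) \<le> (1 / real p) ^ 1"
        by (subst abs_of_int_le_power_iff) auto
      moreover have "w x ^ (k - 1) \<le> w x ^ 1" using k wx by (intro power_decreasing) auto
      then have "w x ^ (k - 1) \<le> 1 / real p" using x(2) log_radius(3) by simp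
      ultimately show ?thesis using wx by (intro mult_mono) auto
    qed
    then have "w (of_nat (p choose k)) * w x ^ (k - 1) * w x \<le> 1 / real p * (1 / real p) * w x"
      using wx by (intro mult_right_mono) auto
    moreover have "w x ^ k = w x ^ (k - 1) * w x" using k by (cases k) (auto simp: mult.commute)
    ultimately have "w (of_nat (p choose k) * x ^ k) \<le> 1 / real p * (1 / real p * w x)"
      using x(1) by (simp add: abs_mult abs_power power_mem mult.assoc)
    then show "of_nat (p choose k) * x ^ k \<in> E \<and> w (of_nat (p choose k) * x ^ k) \<le> 1 / real p * (1 / real p * w x)"
      using x(1) by (simp add: mult_mem power_mem)
  qed (use wx in auto)
  then show ?thesis unfolding e .
qed

text \<open>A quadratic error that ignores the size of n. It suffices for the part of an exponent
  that is prime to p.\<close>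

lemma one_plus_power:
  assumes x: "x \<in> E" "w x \<le> 1"
  shows "w ((1 + x) ^ n - 1 - of_nat n * x) \<le> w x * w x"
proof (induction n)
  case (Suc n)
  have "(1 + x) ^ Suc n - 1 - of_nat (Suc n) * x = (1 + x) * ((1 + x) ^ n - 1 - of_nat n * x) + of_nat n * (x * x)"
    by (simp add: algebra_simps)
  also have "w \<dots> \<le> max (w ((1 + x) * ((1 + x) ^ n - 1 - of_nat n * x))) (w (of_nat n * (x * x)))"
    by (intro ultrametric mem_intros x one_mem of_nat_mem)
  also have "\<dots> \<le> w x * w x"
  proof -
    have "w (1 + x) \<le> 1" using ultrametric[of 1 x] x by simp
    then have "w (1 + x) * w ((1 + x) ^ n - 1 - of_nat n * x) \<le> 1 * (w x * w x)"
      using Suc x by (intro mult_mono) (auto intro!: abs_nonneg mem_intros)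
    moreover have "w (of_nat n) * (w x * w x) \<le> 1 * (w x * w x)"
      using abs_of_nat_le_1[of n] x by (intro mult_right_mono) auto
    ultimately show ?thesis using x by (simp add: abs_mult mem_intros)
  qed
  finally show ?case .
qed (use x in simp)

text \<open>First-order form of \<open>(1 + x)\<^bsup>m\<^esup> = exp (m log (1 + x))\<close> inside the disc of convergence.\<close>

lemma one_plus_powi:
  assumes x: "x \<in> E" "w x \<le> log_radius"
  shows "w ((1 + x) powi m - 1 - of_int m * x) \<le> 1 / real p * (w (of_int m) * w x)"
proof -
  have wx: "w x \<ge> 0" "w x \<le> 1 / real p" "w x \<le> 1" using x log_radius by auto
  have pp: "0 \<le> 1 / real p" "1 / real p \<le> 1" using p_inv by auto
  \<comment> \<open>Exponents p^k: each further p-th power multiplies both the linear term and the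
    error bound by 1/p, and the new base stays in the disc.\<close>
  have ppow: "w ((1 + x) ^ (p ^ k) - 1 - of_nat (p ^ k) * x) \<le> 1 / real p * ((1 / real p) ^ k * w x)" for k
  proof (induction k)
    case 0
    have "w x * w x \<le> 1 / real p * w x" using wx by (intro mult_right_mono) auto
    then show ?case using wx x by simp
  next
    case (Suc k)
    define y where "y = (1 + x) ^ (p ^ k) - 1"
    have yE: "y \<in> E" unfolding y_def by (intro mem_intros x one_mem)
    have wpk: "w (of_nat (p ^ k)) = (1 / real p) ^ k" by (simp add: abs_power abs_p)
    have pk: "0 \<le> (1 / real p) ^ k" "(1 / real p) ^ k \<le> 1" using pp by (simp_all add: power_le_one)
    have yd: "w (y - of_nat (p ^ k) * x) \<le> 1 / real p * ((1 / real p) ^ k * w x)" using Suc by (simp add: y_def)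
    have wy: "w y \<le> (1 / real p) ^ k * w x"
    proof -
      have "w y \<le> max (w (y - of_nat (p ^ k) * x)) (w (of_nat (p ^ k) * x))"
        using ultrametric[of "y - of_nat (p ^ k) * x" "of_nat (p ^ k) * x"] yE x by (simp add: mem_intros)
      also have "w (of_nat (p ^ k) * x) = (1 / real p) ^ k * w x" by (simp only: abs_mult of_nat_mem x wpk)
      also have "max (w (y - of_nat (p ^ k) * x)) ((1 / real p) ^ k * w x) \<le> (1 / real p) ^ k * w x"
        using yd mult_right_mono[OF pp(2), of "(1 / real p) ^ k * w x"] pk wx by simp
      finally show ?thesis .
    qed
    then have "w y \<le> log_radius" using x(2) mult_right_mono[OF pk(2) wx(1)] by simp
    then have a: "w ((1 + y) ^ p - 1 - of_nat p * y) \<le> 1 / real p * (1 / real p * w y)"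
      by (rule one_plus_power_p[OF yE])
    have "(1 + x) ^ (p ^ Suc k) = (1 + y) ^ p" by (simp add: y_def mult.commute flip: power_mult)
    then have "(1 + x) ^ (p ^ Suc k) - 1 - of_nat (p ^ Suc k) * x =
        ((1 + y) ^ p - 1 - of_nat p * y) + of_nat p * (y - of_nat (p ^ k) * x)"
      by (simp add: algebra_simps)
    also have "w \<dots> \<le> max (w ((1 + y) ^ p - 1 - of_nat p * y)) (w (of_nat p * (y - of_nat (p ^ k) * x)))"
      by (intro ultrametric mem_intros yE x one_mem of_nat_mem)
    also have "\<dots> \<le> 1 / real p * ((1 / real p) ^ Suc k * w x)"
    proof (rule max.boundedI)
      have "1 / real p * w y \<le> (1 / real p) ^ Suc k * w x"
        using mult_left_mono[OF wy pp(1)] by (simp add: mult.assoc)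
      then show "w ((1 + y) ^ p - 1 - of_nat p * y) \<le> 1 / real p * ((1 / real p) ^ Suc k * w x)"
        using a mult_left_mono[OF _ pp(1)] by (meson order_trans)
      have "w (of_nat p * (y - of_nat (p ^ k) * x)) = 1 / real p * w (y - of_nat (p ^ k) * x)"
        using yE x by (simp add: abs_mult abs_p mem_intros)
      also have "\<dots> \<le> 1 / real p * (1 / real p * ((1 / real p) ^ k * w x))" by (rule mult_left_mono[OF yd pp(1)])
      finally show "w (of_nat p * (y - of_nat (p ^ k) * x)) \<le> 1 / real p * ((1 / real p) ^ Suc k * w x)"
        by (simp add: mult.assoc)
    qed
    finally show ?case .
  qed
  \<comment> \<open>A general exponent is p^k n with n prime to p. The factor p^k carries the whole
    value of m, so multiplying by n is allowed to use the crude bound.\<close>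
  have nat: "w ((1 + x) ^ m - 1 - of_nat m * x) \<le> 1 / real p * (w (of_nat m) * w x)" for m :: nat
  proof (cases "m = 0")
    case False
    define k where "k = multiplicity p m"
    obtain n where n: "m = p ^ k * n" "\<not> p dvd n"
      using multiplicity_decompose'[of m p] False p_gt_1 unfolding k_def by auto
    define y where "y = (1 + x) ^ (p ^ k) - 1"
    have yE: "y \<in> E" unfolding y_def by (intro mem_intros x one_mem)
    have wn: "w (of_nat n) = 1"
      using n(2) prime_p by (intro abs_of_nat_coprime) (metis coprime_commute prime_imp_coprime)
    have wpk: "w (of_nat (p ^ k)) = (1 / real p) ^ k" by (simp add: abs_power abs_p)
    have pk: "0 \<le> (1 / real p) ^ k" "(1 / real p) ^ k \<le> 1" using pp by (simp_all add: power_le_one)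
    have wm: "w (of_nat m) = (1 / real p) ^ k" by (simp only: n(1) of_nat_mult abs_mult of_nat_mem wpk wn mult_1_right)
    have yd: "w (y - of_nat (p ^ k) * x) \<le> 1 / real p * ((1 / real p) ^ k * w x)" using ppow[of k] by (simp add: y_def)
    have wy: "w y \<le> (1 / real p) ^ k * w x"
    proof -
      have "w y \<le> max (w (y - of_nat (p ^ k) * x)) (w (of_nat (p ^ k) * x))"
        using ultrametric[of "y - of_nat (p ^ k) * x" "of_nat (p ^ k) * x"] yE x by (simp add: mem_intros)
      also have "w (of_nat (p ^ k) * x) = (1 / real p) ^ k * w x" by (simp only: abs_mult of_nat_mem x wpk)
      also have "max (w (y - of_nat (p ^ k) * x)) ((1 / real p) ^ k * w x) \<le> (1 / real p) ^ k * w x"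
        using yd mult_right_mono[OF pp(2), of "(1 / real p) ^ k * w x"] pk wx by simp
      finally show ?thesis .
    qed
    have wy1: "w y \<le> 1 / real p" "w y \<ge> 0" using wy mult_right_mono[OF pk(2) wx(1)] wx yE by auto
    have "(1 + x) ^ m = (1 + y) ^ n" by (simp add: y_def n(1) power_mult)
    then have "(1 + x) ^ m - 1 - of_nat m * x = ((1 + y) ^ n - 1 - of_nat n * y) + of_nat n * (y - of_nat (p ^ k) * x)"
      by (simp add: n(1) algebra_simps)
    also have "w \<dots> \<le> max (w ((1 + y) ^ n - 1 - of_nat n * y)) (w (of_nat n * (y - of_nat (p ^ k) * x)))"
      by (intro ultrametric mem_intros yE x one_mem of_nat_mem)
    also have "\<dots> \<le> 1 / real p * ((1 / real p) ^ k * w x)"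
    proof (rule max.boundedI)
      have "w ((1 + y) ^ n - 1 - of_nat n * y) \<le> w y * w y"
        by (rule one_plus_power[OF yE]) (use wy1 pp in linarith)
      also have "\<dots> \<le> 1 / real p * ((1 / real p) ^ k * w x)" by (rule mult_mono) (use wy wy1 pp in auto)
      finally show "w ((1 + y) ^ n - 1 - of_nat n * y) \<le> 1 / real p * ((1 / real p) ^ k * w x)" .
      show "w (of_nat n * (y - of_nat (p ^ k) * x)) \<le> 1 / real p * ((1 / real p) ^ k * w x)"
        using yd wn abs_mult[OF of_nat_mem[of n] diff_mem[OF yE mult_mem[OF of_nat_mem[of "p ^ k"] x(1)]]] by simp
    qed
    finally show ?thesis by (simp add: wm)
  qed simp
  show ?thesis
  proof (cases "m \<ge> 0")
    case True
    then show ?thesis using nat[of "nat m"] by (simp add: power_int_def)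
  next
    case False
    \<comment> \<open>With (1 + x)^n = 1 + z, the error for the exponent -n is (n x z - (z - n x)) /
      (1 + z): a product of two small terms and the error already known.\<close>
    define n where "n = nat (- m)"
    have m: "m = - int n" using False by (simp add: n_def)
    define z where "z = (1 + x) ^ n - 1"
    have zE: "z \<in> E" unfolding z_def by (intro mem_intros x one_mem)
    have nE: "of_nat n * x \<in> E" by (intro mem_intros x of_nat_mem)
    have wn: "0 \<le> w (of_nat n)" "w (of_nat n) \<le> 1" by (simp_all add: abs_of_nat_le_1)
    have wnx: "w (of_nat n * x) = w (of_nat n) * w x" by (simp only: abs_mult of_nat_mem x)
    have nx0: "0 \<le> w (of_nat n) * w x" "w (of_nat n) * w x \<le> 1 / real p"
      using wn wx mult_mono[OF wn(2) wx(2)] by auto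
    have zd: "w (z - of_nat n * x) \<le> 1 / real p * (w (of_nat n) * w x)" using nat[of n] by (simp add: z_def)
    have wz: "w z \<le> w (of_nat n) * w x"
    proof -
      have "w z \<le> max (w (z - of_nat n * x)) (w (of_nat n * x))"
        using ultrametric[OF diff_mem[OF zE nE] nE] by simp
      then show ?thesis unfolding wnx using zd mult_right_mono[OF pp(2) nx0(1)] by simp
    qed
    have "w z < 1" using wz nx0(2) p_inv(2) by linarith
    then have w1z: "w (1 + z) = 1" using zE by (intro abs_eq_1I) (auto intro!: mem_intros)
    then have nz: "1 + z \<noteq> 0" by auto
    have "(1 + x) powi m = 1 / (1 + z)" by (simp add: m z_def power_int_minus inverse_eq_divide)
    then have "(1 + x) powi m - 1 - of_int m * x = (of_nat n * x * z - (z - of_nat n * x)) / (1 + z)"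
      using nz by (simp add: m field_simps)
    also have "w \<dots> = w (of_nat n * x * z - (z - of_nat n * x))"
      using zE nE by (simp add: abs_divide w1z mem_intros)
    also have "\<dots> \<le> max (w (of_nat n * x * z)) (w (z - of_nat n * x))"
      by (intro abs_diff_le mem_intros zE x of_nat_mem)
    also have "\<dots> \<le> 1 / real p * (w (of_nat n) * w x)"
    proof (rule max.boundedI)
      have "w (of_nat n * x * z) = w (of_nat n) * w x * w z" by (simp only: abs_mult[OF nE zE] wnx)
      also have "\<dots> \<le> w (of_nat n) * w x * (1 / real p)"
        by (rule mult_left_mono) (use wz nx0 in auto)
      finally show "w (of_nat n * x * z) \<le> 1 / real p * (w (of_nat n) * w x)" by (simp add: mult.commute)
    qed (rule zd)
    finally show ?thesis by (simp add: m abs_minus)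
  qed
qed

text \<open>The error is strictly smaller than the linear term, so the latter alone determines the
  value.\<close>

lemma abs_one_plus_powi:
  assumes x: "x \<in> E" "w x \<le> log_radius"
  shows "w ((1 + x) powi m - 1) = w (of_int m) * w x"
proof (cases "w (of_int m) * w x = 0")
  case True
  then have "m = 0 \<or> x = 0" using abs_eq_0[OF x(1)] abs_eq_0[OF of_int_mem[of m]] by auto
  then show ?thesis by auto
next
  case False
  then have pos: "w (of_int m) * w x > 0" using x by (simp add: less_le abs_nonneg)
  have "w ((1 + x) powi m - 1) = w (of_int m * x)"
  proof (rule abs_eqI)
    have "w ((1 + x) powi m - 1 - of_int m * x) \<le> 1 / real p * (w (of_int m) * w x)" by (rule one_plus_powi[OF x])
    also have "\<dots> < 1 * (w (of_int m) * w x)" by (rule mult_strict_right_mono[OF p_inv(2) pos])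
    finally show "w ((1 + x) powi m - 1 - of_int m * x) < w (of_int m * x)"
      by (simp only: abs_mult of_int_mem x mult_1)
  qed (auto intro!: mem_intros x)
  then show ?thesis by (simp only: abs_mult of_int_mem x)
qed

text \<open>A suitable power of u is 1 + x with x in the disc, and x is nonzero because u is not
  torsion. Then the value of c n times that of x is the distance of (1 + x)^(c n) from 1, which is
  at most the distance of u^(c n) from 1.\<close>

lemma non_torsion_padic_null:
  assumes u: "u \<in> E" "algebraic_int u" "w u = 1" and nt: "\<And>m :: nat. m > 0 \<Longrightarrow> u ^ m \<noteq> 1"
    and lim: "(\<lambda>n. w (u powi c n - 1)) \<longlonglongrightarrow> 0"
  shows "padic_null p c"
proof -
  obtain M where M: "M > 0" "w (u ^ M - 1) < 1" using unit_power_close_1[OF u] by metis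
  define r where "r = w (u ^ M - 1)"
  have r: "r < 1" "r \<ge> 0" using M u by (auto simp: r_def intro!: abs_nonneg mem_intros)
  define q where "q = max (1 / real p) r"
  have q: "q < 1" "q \<ge> 0" using p_inv r by (auto simp: q_def)
  obtain s where s: "q ^ s < log_radius" using real_arch_pow_inv[OF log_radius(1) q(1)] by blast
  define x where "x = (u ^ M) ^ (p ^ s) - 1"
  have xE: "x \<in> E" unfolding x_def by (intro mem_intros u one_mem)
  have "w x \<le> q ^ s * r"
    unfolding x_def q_def r_def by (rule abs_power_p_power_minus_1) (use u M in \<open>auto intro: power_mem\<close>)
  also have "\<dots> \<le> q ^ s * 1" using r q by (intro mult_left_mono) auto
  finally have wx: "w x \<le> log_radius" using s by simp
  have x0: "x \<noteq> 0" using nt[of "M * p ^ s"] M p_gt_1 by (simp add: x_def power_mult)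
  then have wx0: "w x > 0" using xE abs_nonneg[OF xE] abs_eq_0[OF xE] by linarith
  have e: "(u powi c n) ^ (M * p ^ s) = (1 + x) powi c n" for n
  proof -
    define k where "k = M * p ^ s"
    have "(u powi c n) ^ k = u powi (c n * int k)" by (simp add: power_int_mult)
    also have "\<dots> = u powi (int k * c n)" by (simp only: mult.commute)
    also have "\<dots> = (u ^ k) powi c n" by (simp only: power_int_mult power_int_of_nat)
    also have "u ^ k = 1 + x" by (simp add: x_def k_def power_mult)
    finally show ?thesis by (simp only: k_def)
  qed
  have "w (of_int (c n)) * w x \<le> w (u powi c n - 1)" for n
  proof -
    have "w ((u powi c n) ^ (M * p ^ s) - 1 ^ (M * p ^ s)) \<le> w (u powi c n - 1)"
      by (rule abs_power_diff_le) (use u in \<open>auto intro: powi_mem simp: abs_powi\<close>)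
    then show ?thesis unfolding e using abs_one_plus_powi[OF xE wx] by simp
  qed
  then have b: "w (of_int (c n)) \<le> w (u powi c n - 1) * (1 / w x)" for n using wx0 by (simp add: field_simps)
  have "(\<lambda>n. w (of_int (c n))) \<longlonglongrightarrow> 0"
    by (rule tendsto_0_squeeze[where g = "\<lambda>n. w (u powi c n - 1) * (1 / w x)"])
      (rule abs_nonneg[OF of_int_mem] b tendsto_mult_left_zero[OF lim])+
  then show ?thesis by (simp add: padic_null_iff)
qed

end

section \<open>Units of the splitting field\<close>

lemma coeff_mult_lin_bound:
  assumes "\<And>i. norm (coeff q i) \<le> B" "norm a \<le> C"
  shows "norm (coeff (q * [:- a, 1 :: complex:]) i) \<le> B * (1 + C)"
proof -
  have B: "B \<ge> 0" using assms(1)[of 0] norm_ge_zero order_trans by blast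
  have C: "C \<ge> 0" using assms(2) norm_ge_zero order_trans by blast
  have "coeff (q * [:- a, 1:]) i = coeff (pCons 0 q) i - a * coeff q i" by simp
  also have "norm \<dots> \<le> norm (coeff (pCons 0 q) i) + norm (a * coeff q i)" by (rule norm_triangle_ineq4)
  also have "\<dots> \<le> B + C * B"
  proof (rule add_mono)
    show "norm (coeff (pCons 0 q) i) \<le> B" using assms(1) B by (cases i) auto
    show "norm (a * coeff q i) \<le> C * B"
      unfolding norm_mult using assms B C by (intro mult_mono) auto
  qed
  finally show ?thesis by (simp add: algebra_simps)
qed

lemma common_exponent:
  fixes R :: "'i \<Rightarrow> int \<Rightarrow> bool"
  assumes "finite I" "\<And>i. i \<in> I \<Longrightarrow> \<exists>m. m \<noteq> 0 \<and> R i m" "\<And>i m k. R i m \<Longrightarrow> R i (m * k)"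
  shows "\<exists>M. M \<noteq> 0 \<and> (\<forall>i\<in>I. R i M)"
  using assms(1,2)
proof (induction I rule: finite_induct)
  case empty
  then show ?case by (intro exI[of _ 1]) simp
next
  case (insert j I)
  obtain M where M: "M \<noteq> 0" "\<forall>i\<in>I. R i M" using insert by blast
  obtain m where m: "m \<noteq> 0" "R j m" using insert.prems by blast
  have "R j (M * m)" using assms(3)[OF m(2), of M] by (simp add: mult.commute)
  then have "M * m \<noteq> 0 \<and> (\<forall>i\<in>insert j I. R i (M * m))" using M m assms(3) by auto
  then show ?case by blast
qed

lemma prod_powi_powi:
  fixes x :: "'i \<Rightarrow> 'a :: field"
  shows "(\<Prod>i\<in>I. x i powi c i) powi M = (\<Prod>i\<in>I. x i powi (c i * M))"
  by (induction I rule: infinite_finite_induct) (auto simp: power_int_mult_distrib power_int_mult)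

lemma prod_powi_common:
  fixes x :: "'i \<Rightarrow> 'a :: field"
  assumes "\<And>i. i \<in> I \<Longrightarrow> x i powi M = f i"
  shows "(\<Prod>i\<in>I. x i powi c i) powi M = (\<Prod>i\<in>I. f i powi c i)"
  unfolding prod_powi_powi
  by (rule prod.cong) (simp_all flip: assms power_int_mult add: mult.commute)

lemma powi_sum:
  fixes x :: "'a :: field"
  assumes "x \<noteq> 0" shows "(\<Prod>i\<in>I. x powi e i) = x powi (\<Sum>i\<in>I. e i)"
  by (induction I rule: infinite_finite_induct) (auto simp: power_int_add assms)

lemma real_root_of_unity:
  assumes "x \<in> \<real>" "x powi m = (1 :: complex)" "m \<noteq> 0" shows "x\<^sup>2 = 1"
proof -
  obtain r where r: "x = of_real r" using assms(1) by (auto elim: Reals_cases)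
  define n where "n = nat \<bar>m\<bar>"
  have "x ^ n = 1"
    using assms(2) by (cases "m \<ge> 0") (auto simp: n_def power_int_def power_inverse)
  then have "norm (x ^ n) = 1" by simp
  then have "\<bar>r\<bar> ^ n = 1" by (simp add: norm_power r)
  then have "\<bar>r\<bar> = 1" using assms(3) power_eq_iff_eq_base[of n "\<bar>r\<bar>" 1] by (simp add: n_def)
  then have "r\<^sup>2 = 1" by (simp add: abs_square_eq_1)
  then show ?thesis by (simp add: r flip: of_real_power)
qed

context valued_field
begin

lemma abs_mult_diff_1_le:
  assumes "x \<in> E" "y \<in> E" "w x = 1" shows "w (x * y - 1) \<le> max (w (x - 1)) (w (y - 1))"
proof -
  have "w (x * y - 1) \<le> max (w (x * y - x)) (w (x - 1))" by (rule abs_triangle) (auto intro: assms mult_mem)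
  also have "x * y - x = x * (y - 1)" by (simp add: algebra_simps)
  also have "w \<dots> = w (y - 1)" using assms by (simp add: abs_mult diff_mem)
  finally show ?thesis by (simp add: max.commute)
qed

end

context cubic_field
begin

definition UF :: "complex set" where
  "UF = {x \<in> F. x \<noteq> 0 \<and> algebraic_int x \<and> algebraic_int (inverse x)}"

lemma UF_D: assumes "x \<in> UF" shows "x \<in> F" "x \<noteq> 0" "algebraic_int x" using assms by (auto simp: UF_def)

lemma UF_mult: "x \<in> UF \<Longrightarrow> y \<in> UF \<Longrightarrow> x * y \<in> UF"
  by (auto simp: UF_def F_mult F_inverse intro!: F_integer_mult)
lemma UF_inverse: "x \<in> UF \<Longrightarrow> inverse x \<in> UF" by (auto simp: UF_def F_inverse)
lemma UF_1: "1 \<in> UF" by (simp add: UF_def F_1)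
lemma UF_power: "x \<in> UF \<Longrightarrow> x ^ n \<in> UF" by (induction n) (auto intro: UF_mult UF_1)
lemma UF_powi: "x \<in> UF \<Longrightarrow> x powi m \<in> UF" by (auto simp: power_int_def intro!: UF_power UF_inverse)
lemma UF_prod: "(\<And>i. i \<in> I \<Longrightarrow> f i \<in> UF) \<Longrightarrow> prod f I \<in> UF"
  by (induction I rule: infinite_finite_induct) (auto intro: UF_mult UF_1)

lemma UF_fhom: "fhom s \<Longrightarrow> (\<And>y. y \<in> F \<Longrightarrow> s y \<in> F) \<Longrightarrow> x \<in> UF \<Longrightarrow> s x \<in> UF"
  using algebraic_int_fhom[of s x] algebraic_int_fhom[of s "inverse x"] fhom_inverse[of s x] fhom_nz[of s x]
  by (simp add: UF_def F_inverse)

lemma UF_rho: "x \<in> UF \<Longrightarrow> \<rho> x \<in> UF" and UF_tau: "x \<in> UF \<Longrightarrow> \<tau> x \<in> UF"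
  by (rule UF_fhom[OF fhom_rho rho_mem] UF_fhom[OF fhom_tau tau_mem]; assumption)+

lemma UF_l1: "l1 \<in> UF" and UF_l1_t: "l1 + of_int t \<in> UF"
proof -
  have tF: "of_int k \<in> F" for k by (rule F.of_int_mem)
  have l1t: "algebraic_int (l1 + of_int k)" for k by (rule F_integer_add[OF F_l1 tF l1_integer]) simp
  have "inverse l1 = l1 * l1 + of_int (- (t\<^sup>2))" "l1 \<noteq> 0"
    using root_inverse(1) by (auto simp: inverse_unique power2_eq_square)
  moreover have "algebraic_int (l1 * l1 + of_int (- (t\<^sup>2)))"
    by (rule F_integer_add[OF F_mult[OF F_l1 F_l1] tF F_integer_mult[OF F_l1 F_l1 l1_integer l1_integer]])
      (rule algebraic_int_of_int)
  ultimately show "l1 \<in> UF" by (simp add: UF_def F_l1 l1_integer)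
  have "inverse (l1 + of_int t) = l1 * (l1 + of_int (- t))" "l1 + of_int t \<noteq> 0"
    using root_inverse(2) by (auto simp: inverse_unique)
  moreover have "algebraic_int (l1 * (l1 + of_int (- t)))"
    by (rule F_integer_mult[OF F_l1 F_add[OF F_l1 tF] l1_integer l1t])
  ultimately show "l1 + of_int t \<in> UF" using l1t by (simp add: UF_def F_l1 F_add tF)
qed

lemma fhom_powi: "fhom s \<Longrightarrow> x \<in> F \<Longrightarrow> s (x powi m) = s x powi m"
  by (simp add: power_int_def fhomD F_inverse fhom_inverse)

lemma fhom_prod: "fhom s \<Longrightarrow> (\<And>i. i \<in> I \<Longrightarrow> f i \<in> F) \<Longrightarrow> s (prod f I) = (\<Prod>i\<in>I. s (f i))"
  by (induction I rule: infinite_finite_induct) (auto simp: fhomD F.prod_mem)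

lemma fhom_prod_powi:
  "fhom s \<Longrightarrow> (\<And>i. i \<in> I \<Longrightarrow> f i \<in> F) \<Longrightarrow> s (\<Prod>i\<in>I. f i powi c i) = (\<Prod>i\<in>I. s (f i) powi c i)"
  by (subst fhom_prod) (auto simp: fhom_powi F.powi_mem)

lemma UF_rational: assumes "x \<in> UF" "x \<in> \<rat>" shows "x = 1 \<or> x = -1"
proof -
  have "x \<in> \<int>" "inverse x \<in> \<int>"
    using assms by (auto simp: UF_def intro!: rational_algebraic_int_is_int)
  then obtain m n where mn: "x = of_int m" "inverse x = of_int n" by (auto elim!: Ints_cases)
  have "of_int (m * n) = x * inverse x" using mn by simp
  also have "\<dots> = of_int 1" using assms(1) by (simp add: UF_def)
  finally have "m * n = 1" by (simp only: of_int_eq_iff)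
  then show ?thesis using mn(1) by (auto simp: zmult_eq_1_iff)
qed

lemma UF_norm_1: assumes "x \<in> UF" "\<tau> x = x" "\<rho> x = x" shows "norm x = 1"
  using UF_rational[OF assms(1) fixed_rational[OF UF_D(1)[OF assms(1)] assms(2,3)]] by auto

text \<open>For a unit of K this is its norm to the rationals, which is fixed by
  \<open>\<rho>\<close> and \<open>\<tau>\<close> and therefore 1 or -1.\<close>

lemma tau_fixed_unit_norm: assumes x: "x \<in> UF" "\<tau> x = x" shows "norm x * norm (\<rho> x) * norm (\<rho> (\<rho> x)) = 1"
proof -
  note F = UF_D(1)[OF x(1)]
  have "norm (x * \<rho> x * \<rho> (\<rho> x)) = 1"
    by (rule UF_norm_1)
      (simp_all add: UF_mult UF_rho x F F_mult rho_mem fhomD(2)[OF fhom_tau] fhomD(2)[OF fhom_rho]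
        tau_rho tau_rho_rho rho3)
  then show ?thesis by (simp add: norm_mult)
qed

lemma rho_fixed_unit_norm: assumes x: "x \<in> UF" "\<rho> x = x" shows "norm x * norm (\<tau> x) = 1"
proof -
  note F = UF_D(1)[OF x(1)]
  have r: "\<rho> (\<tau> x) = \<tau> x" using tau_rho_rho[OF F] x by simp
  have "norm (x * \<tau> x) = 1"
    by (rule UF_norm_1)
      (simp_all add: UF_mult UF_tau x F F_mult tau_mem fhomD(2)[OF fhom_tau] fhomD(2)[OF fhom_rho] r tau2)
  then show ?thesis by (simp add: norm_mult)
qed

lemma unit_norm: assumes x: "x \<in> UF"
  shows "(x * \<rho> x * \<rho> (\<rho> x) * (\<tau> x * \<rho> (\<tau> x) * \<rho> (\<rho> (\<tau> x))))\<^sup>2 = 1"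
proof -
  note F = UF_D(1)[OF x(1)]
  define y where "y = x * \<rho> x * \<rho> (\<rho> x) * (\<tau> x * \<rho> (\<tau> x) * \<rho> (\<rho> (\<tau> x)))"
  have "y \<in> \<rat>" unfolding y_def
    by (rule fixed_rational)
      (simp_all add: F F_mult rho_mem tau_mem fhomD(2)[OF fhom_tau] fhomD(2)[OF fhom_rho] rho3 tau2
        tau_rho tau_rho_rho)
  moreover have "y \<in> UF" by (simp add: y_def UF_mult UF_rho UF_tau x)
  ultimately have "y = 1 \<or> y = -1" by (rule_tac UF_rational)
  then show ?thesis by (auto simp: y_def[symmetric])
qed

text \<open>Multiplying by a linear factor with root of size at most C enlarges coefficients by at
  most 1 + C, and \<open>charpoly\<close> has six such factors.\<close>

lemma finite_bounded_integers:
  assumes C: "C \<ge> 0"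
  shows "finite {x \<in> F. algebraic_int x \<and> (\<forall>y\<in>set (conjs x). norm y \<le> C)}"
proof (rule finite_bounded_algebraic[where d = 6 and C = "(1 + C) ^ 6"])
  fix x assume x: "x \<in> {x \<in> F. algebraic_int x \<and> (\<forall>y\<in>set (conjs x). norm y \<le> C)}"
  have i: "coeff (charpoly x) i \<in> \<int>" for i
    by (rule charpoly_integral) (use x conjs_abs_le_1 in auto)
  have b: "norm (coeff (q * lin a) i) \<le> (1 + C) ^ Suc n"
    if "\<And>i. norm (coeff q i) \<le> (1 + C) ^ n" "a \<in> set (conjs x)" for q a n i
    using coeff_mult_lin_bound[OF that(1), of a C] x that(2) by (simp add: lin_def mult.commute)
  have "norm (coeff (1 :: complex poly) i) \<le> (1 + C) ^ 0" for i :: nat by (cases i) auto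
  then have "norm (coeff (1 * lin x * lin (\<rho> x) * lin (\<rho> (\<rho> x)) * lin (\<tau> x) * lin (\<rho> (\<tau> x)) * lin (\<rho> (\<rho> (\<tau> x)))) i) \<le>
      (1 + C) ^ Suc (Suc (Suc (Suc (Suc (Suc 0)))))" for i
    by (intro b) (auto simp: conjs_def)
  then have "norm (coeff (charpoly x) i) \<le> (1 + C) ^ 6" for i by (simp add: charpoly_def eval_nat_numeral)
  then show "\<exists>q. degree q = 6 \<and> q \<noteq> 0 \<and> poly q x = 0 \<and> (\<forall>i. coeff q i \<in> \<int> \<and> norm (coeff q i) \<le> (1 + C) ^ 6)"
    using charpoly_monic i charpoly_root[of x x] by (intro exI[of _ "charpoly x"]) (auto simp: conjs_def)
qed

lemma abs_ln_le_1: "x \<noteq> 0 \<Longrightarrow> \<bar>ln (norm x)\<bar> \<le> 1 \<Longrightarrow> exp (-1) \<le> norm x \<and> norm x \<le> exp 1"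
  for x :: complex
  using ln_ge_iff[of "norm x" "-1"] ln_le_cancel_iff[of "norm x" "exp 1"] by auto

lemma ln_norm_prod_power:
  fixes u :: "nat \<Rightarrow> complex"
  assumes "\<And>i. u i \<noteq> 0" shows "ln (norm (\<Prod>i\<le>r. u i ^ e i)) = (\<Sum>i\<le>r. real (e i) * ln (norm (u i)))"
  using assms by (simp add: prod_norm[symmetric] norm_power ln_prod ln_realpow)

text \<open>A unit of K has three absolute values with product 1, so two logarithms control all of
  them; three units are then dependent by the pigeonhole lemma with r = 2.\<close>

lemma tau_fixed_units_dependent:
  assumes u: "\<And>i :: nat. u i \<in> UF" "\<And>i. \<tau> (u i) = u i"
  shows "\<exists>e e'. (\<Prod>i\<le>2. u i ^ e i) = (\<Prod>i\<le>2. u i ^ e' i) \<and> (\<exists>i\<le>2. e i \<noteq> e' i)"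
proof (rule units_dependent_pigeonhole[where L = "\<lambda>k x. if k = 0 then ln (norm x) else ln (norm (\<rho> x))"])
  show "finite {x \<in> F. algebraic_int x \<and> (\<forall>y\<in>set (conjs x). norm y \<le> exp 2)}"
    by (rule finite_bounded_integers) simp
  show "u i \<noteq> 0" for i by (rule UF_D(2)[OF u(1)])
  note uF = UF_D(1)[OF u(1)]
  have P: "(\<Prod>i\<le>2. u i ^ e i) \<in> UF" for e by (intro UF_prod UF_power u)
  have tP: "\<tau> (\<Prod>i\<le>2. u i ^ e i) = (\<Prod>i\<le>2. u i ^ e i)" for e
    using fhom_prod_powi[OF fhom_tau, of "{..2}" u "\<lambda>i. int (e i)"] by (simp add: uF u(2))
  have rP: "\<rho> (\<Prod>i\<le>2. u i ^ e i) = (\<Prod>i\<le>2. \<rho> (u i) ^ e i)" for e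
    using fhom_prod_powi[OF fhom_rho, of "{..2}" u "\<lambda>i. int (e i)"] by (simp add: uF)
  show "(if k = 0 then ln (norm (\<Prod>i\<le>2. u i ^ e i)) else ln (norm (\<rho> (\<Prod>i\<le>2. u i ^ e i)))) =
      (\<Sum>i\<le>2. real (e i) * (if k = 0 then ln (norm (u i)) else ln (norm (\<rho> (u i)))))" for k :: nat and e
    unfolding rP
    using ln_norm_prod_power[of u, OF UF_D(2)[OF u(1)]] ln_norm_prod_power[of "\<lambda>i. \<rho> (u i)", OF UF_D(2)[OF UF_rho[OF u(1)]]]
    by simp
  fix e e' :: "nat \<Rightarrow> nat"
  define x y where "x = (\<Prod>i\<le>2. u i ^ e i)" and "y = (\<Prod>i\<le>2. u i ^ e' i)"
  have xy: "x \<in> UF" "y \<in> UF" "\<tau> x = x" "\<tau> y = y" by (simp_all add: x_def y_def P tP)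
  assume "\<forall>k<2::nat. \<bar>(if k = 0 then ln (norm (\<Prod>i\<le>2. u i ^ e i)) else ln (norm (\<rho> (\<Prod>i\<le>2. u i ^ e i)))) -
      (if k = 0 then ln (norm (\<Prod>i\<le>2. u i ^ e' i)) else ln (norm (\<rho> (\<Prod>i\<le>2. u i ^ e' i))))\<bar> \<le> 1"
  then have l: "\<bar>ln (norm x) - ln (norm y)\<bar> \<le> 1" "\<bar>ln (norm (\<rho> x)) - ln (norm (\<rho> y))\<bar> \<le> 1"
    by (auto simp: x_def y_def dest: spec[of _ 0] spec[of _ 1])
  define z where "z = x * inverse y"
  have z: "z \<in> UF" "\<tau> z = z"
    using xy by (simp_all add: z_def UF_mult UF_inverse fhomD(2)[OF fhom_tau] UF_D F_inverse fhom_inverse[OF fhom_tau])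
  have rz: "\<rho> z = \<rho> x * inverse (\<rho> y)"
    using xy by (simp add: z_def fhomD(2)[OF fhom_rho] UF_D F_inverse fhom_inverse[OF fhom_rho])
  note nz = UF_D(2)[OF xy(1)] UF_D(2)[OF xy(2)] UF_D(2)[OF UF_rho[OF xy(1)]] UF_D(2)[OF UF_rho[OF xy(2)]]
    UF_D(2)[OF z(1)] UF_D(2)[OF UF_rho[OF z(1)]]
  have "\<bar>ln (norm z)\<bar> \<le> 1" "\<bar>ln (norm (\<rho> z))\<bar> \<le> 1"
    using l nz unfolding rz unfolding z_def by (simp_all add: norm_mult norm_inverse ln_mult ln_inverse)
  note b = abs_ln_le_1[OF nz(5) this(1)] abs_ln_le_1[OF nz(6) this(2)]
  have pos: "norm (\<rho> (\<rho> z)) \<ge> 0" by simp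
  \<comment> \<open>The norm relation bounds the third conjugate, since the first two have absolute
    value at least exp(-1).\<close>
  have "exp (-1) * exp (-1) * norm (\<rho> (\<rho> z)) \<le> norm z * norm (\<rho> z) * norm (\<rho> (\<rho> z))"
    using b by (intro mult_mono) auto
  also have "\<dots> = 1" by (rule tau_fixed_unit_norm[OF z])
  finally have "norm (\<rho> (\<rho> z)) \<le> exp 2" by (simp add: exp_minus field_simps flip: exp_add)
  moreover have "norm z \<le> exp 2" "norm (\<rho> z) \<le> exp 2"
    using b order_trans[of _ "exp 1" "exp (2 :: real)"] by simp_all
  ultimately have "\<forall>c\<in>set (conjs z). norm c \<le> exp 2" using z(2) by (simp add: conjs_def)
  then have "z \<in> {x \<in> F. algebraic_int x \<and> (\<forall>y\<in>set (conjs x). norm y \<le> exp 2)}"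
    using UF_D[OF z(1)] by simp
  then show "(\<Prod>i\<le>2. u i ^ e i) / (\<Prod>i\<le>2. u i ^ e' i) \<in> {x \<in> F. algebraic_int x \<and> (\<forall>y\<in>set (conjs x). norm y \<le> exp 2)}"
    by (simp add: z_def x_def y_def divide_inverse)
qed

text \<open>Units of the quadratic subfield have two absolute values with product 1, so a single
  logarithm suffices and any two units are dependent.\<close>

lemma rho_fixed_units_dependent:
  assumes u: "\<And>i :: nat. u i \<in> UF" "\<And>i. \<rho> (u i) = u i"
  shows "\<exists>e e'. (\<Prod>i\<le>1. u i ^ e i) = (\<Prod>i\<le>1. u i ^ e' i) \<and> (\<exists>i\<le>1. e i \<noteq> e' i)"
proof (rule units_dependent_pigeonhole[where L = "\<lambda>k x. ln (norm x)"])
  show "finite {x \<in> F. algebraic_int x \<and> (\<forall>y\<in>set (conjs x). norm y \<le> exp 1)}"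
    by (rule finite_bounded_integers) simp
  show "u i \<noteq> 0" for i by (rule UF_D(2)[OF u(1)])
  note uF = UF_D(1)[OF u(1)]
  have P: "(\<Prod>i\<le>1. u i ^ e i) \<in> UF" for e by (intro UF_prod UF_power u)
  have rP: "\<rho> (\<Prod>i\<le>1. u i ^ e i) = (\<Prod>i\<le>1. u i ^ e i)" for e
    using fhom_prod_powi[OF fhom_rho, of "{..1}" u "\<lambda>i. int (e i)"] by (simp add: uF u(2))
  show "ln (norm (\<Prod>i\<le>1. u i ^ e i)) = (\<Sum>i\<le>1. real (e i) * ln (norm (u i)))" for e
    by (rule ln_norm_prod_power[of u, OF UF_D(2)[OF u(1)]])
  fix e e' :: "nat \<Rightarrow> nat"
  define x y where "x = (\<Prod>i\<le>1. u i ^ e i)" and "y = (\<Prod>i\<le>1. u i ^ e' i)"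
  have xy: "x \<in> UF" "y \<in> UF" "\<rho> x = x" "\<rho> y = y" unfolding x_def y_def by (rule P rP)+
  assume "\<forall>k<1::nat. \<bar>ln (norm (\<Prod>i\<le>1. u i ^ e i)) - ln (norm (\<Prod>i\<le>1. u i ^ e' i))\<bar> \<le> 1"
  then have l: "\<bar>ln (norm x) - ln (norm y)\<bar> \<le> 1" unfolding x_def y_def by blast
  define z where "z = x * inverse y"
  have z: "z \<in> UF" "\<rho> z = z"
    using xy by (simp_all add: z_def UF_mult UF_inverse fhomD(2)[OF fhom_rho] UF_D F_inverse fhom_inverse[OF fhom_rho])
  note nz = UF_D(2)[OF xy(1)] UF_D(2)[OF xy(2)] UF_D(2)[OF z(1)]
  have "\<bar>ln (norm z)\<bar> \<le> 1"
    using l nz unfolding z_def by (simp_all add: norm_mult norm_inverse ln_mult ln_inverse)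
  note b = abs_ln_le_1[OF nz(3) this]
  have r: "\<rho> (\<tau> z) = \<tau> z" using tau_rho_rho[OF UF_D(1)[OF z(1)]] z by simp
  have "exp (-1) * norm (\<tau> z) \<le> norm z * norm (\<tau> z)" using b by (intro mult_mono) auto
  also have "\<dots> = 1" by (rule rho_fixed_unit_norm[OF z])
  finally have "norm (\<tau> z) \<le> exp 1" by (simp add: exp_minus field_simps)
  then have "\<forall>c\<in>set (conjs z). norm c \<le> exp 1" using b z(2) r by (auto simp: conjs_def)
  then have "z \<in> {x \<in> F. algebraic_int x \<and> (\<forall>y\<in>set (conjs x). norm y \<le> exp 1)}"
    using UF_D[OF z(1)] by simp
  then show "(\<Prod>i\<le>1. u i ^ e i) / (\<Prod>i\<le>1. u i ^ e' i) \<in> {x \<in> F. algebraic_int x \<and> (\<forall>y\<in>set (conjs x). norm y \<le> exp 1)}"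
    unfolding z_def x_def y_def divide_inverse .
qed

end

lemma ln_powi: "x > 0 \<Longrightarrow> ln (x powi m) = of_int m * ln (x :: real)"
  by (cases "m \<ge> 0") (simp_all add: power_int_def ln_realpow ln_inverse)

text \<open>The hypotheses are a homogeneous linear system whose determinant is, up to sign, x1 y2 +
  x2 y1 > 0.\<close>

lemma signs_imp_zero:
  fixes a b :: int and x1 y1 x2 y2 :: real
  assumes "a * x1 + b * y1 = 0" "b * y2 = a * x2" "x1 > 0" "y1 > 0" "x2 > 0" "y2 > 0"
  shows "a = 0 \<and> b = 0"
proof -
  have "a * (x1 * y2 + x2 * y1) = (a * x1 + b * y1) * y2 - (b * y2 - a * x2) * y1" by (simp add: algebra_simps)
  then have "a * (x1 * y2 + x2 * y1) = 0" using assms(1,2) by simp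
  moreover have "x1 * y2 + x2 * y1 > 0" using assms by (intro add_pos_pos mult_pos_pos)
  ultimately have "a = 0" by simp
  then show ?thesis using assms by simp
qed

section \<open>Independence of the two explicit units and relations to other units\<close>

context cubic_field
begin

lemma root_relation:
  assumes rel: "l1 powi a * (l1 + of_int t) powi b = 1" and z: "poly (cubic t) (z :: complex) = 0"
  shows "z powi a * (z + of_int t) powi b = 1"
proof -
  have *: "s l1 powi a * (s l1 + of_int t) powi b = 1" if s: "fhom s" for s
  proof -
    have "s (l1 powi a * (l1 + of_int t) powi b) = s l1 powi a * (s l1 + of_int t) powi b"
      using fhomD(1)[OF s F_l1 F.of_int_mem[of t]] fhomD(9)[OF s, of t]
      by (simp add: fhomD(2)[OF s] fhom_powi[OF s] F.powi_mem F_l1 F_add)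
    then show ?thesis using rel fhomD(8)[OF s] by simp
  qed
  show ?thesis
    using z rel *[OF fhom_rho] *[OF fhom_rho_rho] by (auto simp: cubic_roots_iff rho_gens rho_roots)
qed

text \<open>A relation also holds at the other roots. At the root above t the logarithms of both
  units are positive; at the root in (-1, 0) the first is negative and the second positive. These
  two equations admit only the zero exponents.\<close>

lemma units_independent:
  assumes rel: "l1 powi a * (l1 + of_int t) powi b = 1" shows "a = 0 \<and> b = 0"
proof -
  obtain r1 r2 r3 :: real where r: "r1 > of_int t" "-1 < r2" "r2 < 0"
    "poly (cubic t) r1 = 0" "poly (cubic t) r2 = 0" using real_roots_exist[OF t_ge_2] by metis
  have l: "a * ln \<bar>x\<bar> + b * ln (x + of_int t) = 0"
    if x: "poly (cubic t) x = 0" "x \<noteq> 0" "x + of_int t > 0" for x :: real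
  proof -
    have "poly (cubic t) (of_real x :: complex) = of_real (poly (cubic t) x)" by (simp add: poly_cubic)
    then have "poly (cubic t) (of_real x :: complex) = 0" using x by simp
    from root_relation[OF rel this]
    have "norm (of_real x powi a * (of_real (x + of_int t)) powi b :: complex) = 1" by simp
    then have "\<bar>x\<bar> powi a * (x + of_int t) powi b = 1"
      using x by (simp add: norm_mult norm_power_int del: of_real_add)
    then have "ln (\<bar>x\<bar> powi a * (x + of_int t) powi b) = 0" by simp
    then show ?thesis using x by (simp add: ln_mult ln_powi)
  qed
  have t: "real_of_int t \<ge> 2" using t_ge_2 by simp
  show ?thesis
  proof (rule signs_imp_zero)
    show "a * ln \<bar>r1\<bar> + b * ln (r1 + of_int t) = 0" by (rule l) (use r t in auto)
    show "b * ln (r2 + of_int t) = a * (- ln \<bar>r2\<bar>)" using l[of r2] r t by auto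
    show "- ln \<bar>r2\<bar> > 0" using r by simp
  qed (use r t in auto)
qed

lemma multiplicatively_independent_l1: "multiplicatively_independent [l1, l1 + of_int t]"
  unfolding multiplicatively_independent_def
proof (intro conjI allI impI)
  show "0 \<notin> set [l1, l1 + of_int t]" using UF_D(2)[OF UF_l1] UF_D(2)[OF UF_l1_t] by auto
  fix e :: "nat \<Rightarrow> int" and i
  assume "(\<Prod>i<length [l1, l1 + of_int t]. [l1, l1 + of_int t] ! i powi e i) = 1" "i < length [l1, l1 + of_int t]"
  moreover from this(1) have "e 0 = 0 \<and> e 1 = 0"
    by (intro units_independent) (simp add: numeral_2_eq_2)
  ultimately show "e i = 0" by (auto simp: less_Suc_eq numeral_2_eq_2)
qed

lemma prod_le_2: "(\<Prod>i\<le>2::nat. f i) = f 0 * f 1 * f 2" by (simp add: numeral_2_eq_2 mult_ac)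

lemma powi_cancel:
  fixes x :: complex
  assumes "x \<noteq> 0" shows "x powi (int m - int n) = x ^ m / x ^ n"
  using assms by (simp add: power_int_diff)

text \<open>Any dependence between x, l and l + t must involve x, as the other two are independent.
  So l and l + t generate a subgroup of the units of K that contains a power of every unit.\<close>

lemma tau_fixed_unit_relation:
  assumes x: "x \<in> UF" "\<tau> x = x"
  shows "\<exists>M. M \<noteq> 0 \<and> (\<exists>A B. x powi M = l1 powi A * (l1 + of_int t) powi B)"
proof -
  define u where "u i = (if i = (0::nat) then x else if i = 1 then l1 else l1 + of_int t)" for i
  have tl: "\<tau> (l1 + of_int t) = l1 + of_int t"
    by (simp add: fhomD(1)[OF fhom_tau F_l1 F.of_int_mem] fhomD(9)[OF fhom_tau] tau_gens)
  have "u i \<in> UF" "\<tau> (u i) = u i" for i using x tl by (simp_all add: u_def UF_l1 UF_l1_t tau_gens)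
  then obtain e e' where e: "(\<Prod>i\<le>2. u i ^ e i) = (\<Prod>i\<le>2. u i ^ e' i)" "\<exists>i\<le>2. e i \<noteq> e' i"
    using tau_fixed_units_dependent[of u] by blast
  note nz = UF_D(2)[OF x(1)] UF_D(2)[OF UF_l1] UF_D(2)[OF UF_l1_t]
  have eq: "x ^ e 0 * l1 ^ e 1 * (l1 + of_int t) ^ e 2 = x ^ e' 0 * l1 ^ e' 1 * (l1 + of_int t) ^ e' 2"
    using e(1) by (simp add: prod_le_2 u_def)
  define M A B where "M = int (e 0) - int (e' 0)" and "A = int (e' 1) - int (e 1)" and "B = int (e' 2) - int (e 2)"
  have r: "x powi M = l1 powi A * (l1 + of_int t) powi B"
    unfolding M_def A_def B_def powi_cancel[OF nz(1)] powi_cancel[OF nz(2)] powi_cancel[OF nz(3)]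
    using eq nz by (simp add: field_simps)
  have "M \<noteq> 0"
  proof
    assume "M = 0"
    then have "A = 0 \<and> B = 0" using units_independent[of A B] r by simp
    then have eq: "e 0 = e' 0" "e 1 = e' 1" "e 2 = e' 2" using \<open>M = 0\<close> by (simp_all add: M_def A_def B_def)
    obtain k where k: "k \<le> 2" "e k \<noteq> e' k" using e(2) by blast
    then have "k = 0 \<or> k = 1 \<or> k = 2" by linarith
    then show False using k(2) eq by blast
  qed
  then show ?thesis using r by blast
qed

lemma UF_torsion: "x \<in> UF \<Longrightarrow> x powi m = 1 \<Longrightarrow> m \<noteq> 0 \<Longrightarrow> x\<^sup>2 = 1"
  using real_root_of_unity F_real UF_D(1) by blast

lemma tau_fixed_units_relations:
  assumes "finite I" "\<And>i. i \<in> I \<Longrightarrow> x i \<in> UF \<and> \<tau> (x i) = x i"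
  shows "\<exists>M A B. M \<noteq> 0 \<and> (\<forall>i\<in>I. x i powi M = l1 powi A i * (l1 + of_int t) powi B i)"
proof -
  define R where "R i M \<longleftrightarrow> (\<exists>A B. x i powi M = l1 powi A * (l1 + of_int t) powi B)" for i M
  have "\<exists>M. M \<noteq> 0 \<and> (\<forall>i\<in>I. R i M)"
  proof (rule common_exponent[OF assms(1)])
    show "\<exists>m. m \<noteq> 0 \<and> R i m" if "i \<in> I" for i unfolding R_def using tau_fixed_unit_relation assms(2)[OF that] by blast
    show "R i (m * k)" if R: "R i m" for i m k
    proof -
      obtain A B where "x i powi m = l1 powi A * (l1 + of_int t) powi B" using R unfolding R_def by blast
      then have "x i powi (m * k) = l1 powi (A * k) * (l1 + of_int t) powi (B * k)"
        by (simp add: power_int_mult power_int_mult_distrib)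
      then show ?thesis unfolding R_def by blast
    qed
  qed
  then show ?thesis unfolding R_def by metis
qed

text \<open>Any non-torsion unit among the x i can serve as \<omega>. If there is none, squares are
  1 and \<omega> = 1 with C = 0 fits; the disjunction in the conclusion covers both cases.\<close>

lemma rho_fixed_units_relations:
  assumes "finite I" and x: "\<And>i. i \<in> I \<Longrightarrow> x i \<in> UF \<and> \<rho> (x i) = x i"
  shows "\<exists>M \<omega> C. M \<noteq> 0 \<and> \<omega> \<in> UF \<and> (\<omega>\<^sup>2 \<noteq> 1 \<or> (\<forall>i\<in>I. C i = 0)) \<and> (\<forall>i\<in>I. x i powi M = \<omega> powi C i)"
proof (cases "\<forall>i\<in>I. (x i)\<^sup>2 = 1")
  case True
  then have "(2::int) \<noteq> 0 \<and> 1 \<in> UF \<and> ((1::complex)\<^sup>2 \<noteq> 1 \<or> (\<forall>i\<in>I. (0::int) = 0)) \<and> (\<forall>i\<in>I. x i powi 2 = 1 powi 0)"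
    by (simp add: UF_1)
  then show ?thesis by (intro exI[of _ 2] exI[of _ 1] exI[of _ "\<lambda>_. 0"])
next
  case False
  then obtain j where j: "j \<in> I" "(x j)\<^sup>2 \<noteq> 1" by blast
  define \<omega> where "\<omega> = x j"
  have w: "\<omega> \<in> UF" "\<rho> \<omega> = \<omega>" "\<omega>\<^sup>2 \<noteq> 1" using x[OF j(1)] j(2) by (simp_all add: \<omega>_def)
  define R where "R i M \<longleftrightarrow> (\<exists>C. x i powi M = \<omega> powi C)" for i M
  have "\<exists>M. M \<noteq> 0 \<and> (\<forall>i\<in>I. R i M)"
  proof (rule common_exponent[OF assms(1)])
    fix i assume i: "i \<in> I"
    define u where "u k = (if k = (0::nat) then x i else \<omega>)" for k
    have "u k \<in> UF" "\<rho> (u k) = u k" for k using x[OF i] w by (simp_all add: u_def)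
    then obtain e e' where e: "(\<Prod>i\<le>1. u i ^ e i) = (\<Prod>i\<le>1. u i ^ e' i)" "\<exists>i\<le>1. e i \<noteq> e' i"
      using rho_fixed_units_dependent[of u] by blast
    note nz = UF_D(2)[OF conjunct1[OF x[OF i]]] UF_D(2)[OF w(1)]
    have eq: "x i ^ e 0 * \<omega> ^ e 1 = x i ^ e' 0 * \<omega> ^ e' 1" using e(1) by (simp add: u_def mult.commute)
    define M C where "M = int (e 0) - int (e' 0)" and "C = int (e' 1) - int (e 1)"
    have r: "x i powi M = \<omega> powi C"
      unfolding M_def C_def powi_cancel[OF nz(1)] powi_cancel[OF nz(2)] using eq nz by (simp add: field_simps)
    have "M \<noteq> 0"
    proof
      assume "M = 0"
      then have "C = 0" using UF_torsion[OF w(1), of C] r w(3) by auto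
      then have eq: "e 0 = e' 0" "e 1 = e' 1" using \<open>M = 0\<close> by (simp_all add: M_def C_def)
      obtain k where k: "k \<le> 1" "e k \<noteq> e' k" using e(2) by blast
      then have "k = 0 \<or> k = 1" by linarith
      then show False using k(2) eq by blast
    qed
    moreover have "R i M" unfolding R_def by (rule exI[of _ C]) (rule r)
    ultimately show "\<exists>m. m \<noteq> 0 \<and> R i m" by (intro exI[of _ M] conjI)
  next
    fix i m k assume "R i m"
    then obtain C where "x i powi m = \<omega> powi C" unfolding R_def by blast
    then have "x i powi (m * k) = \<omega> powi (C * k)" by (simp add: power_int_mult)
    then show "R i (m * k)" unfolding R_def by blast
  qed
  then obtain M where M: "M \<noteq> 0" "\<And>i. i \<in> I \<Longrightarrow> \<exists>C. x i powi M = \<omega> powi C" unfolding R_def by auto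
  from M(2) obtain C where C: "\<And>i. i \<in> I \<Longrightarrow> x i powi M = \<omega> powi C i" by metis
  show ?thesis
    by (rule exI[of _ M], rule exI[of _ \<omega>], rule exI[of _ C]) (simp add: M(1) w C)
qed

end

section \<open>The p-adic estimate\<close>

context valued_field
begin

text \<open>With \<open>x = t\<^sup>2 z\<close> and \<open>1 + y = z (z + t)\<^sup>2\<close>, the sixth power of \<open>z\<^sup>a (z + t)\<^sup>b\<close> is
  \<open>(1 + x)\<^bsup>2a - b\<^esup> (1 + y)\<^bsup>3b\<^esup>\<close>, and \<open>y\<close> is \<open>2 t / z\<close> up to a relative error of size \<open>1 / p\<close>.\<close>

lemma cubic_unit_bound:
  assumes z: "z \<in> E" "w z = 1" "z ^ 3 = (of_int t)\<^sup>2 * z + 1" and pt: "int p dvd t"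
  shows "w (of_int ((2 * a - b) * t\<^sup>2) * z + of_int (6 * b * t) * inverse z) \<le>
    max (w (z powi a * (z + of_int t) powi b - 1))
      (max (w (of_int ((2 * a - b) * t\<^sup>2))) (w (of_int (6 * b * t))) / real p)"
proof -
  define T :: complex where "T = of_int t"
  define m where "m = inverse z"
  have TE: "T \<in> E" by (simp add: T_def)
  have mE: "m \<in> E" unfolding m_def by (rule inverse_mem[OF z(1)])
  have z0: "z \<noteq> 0" using z by auto
  have wm: "w m = 1" by (simp add: m_def abs_inverse z)
  have wT: "0 \<le> w T" "w T \<le> 1 / real p"
  proof -
    obtain k where "t = int p * k" using pt by blast
    then have "w T = 1 / real p * w (of_int k)" by (simp add: T_def abs_mult abs_p)
    also have "\<dots> \<le> 1 / real p * 1" by (rule mult_left_mono[OF abs_of_int_le_1]) simp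
    finally show "w T \<le> 1 / real p" by simp
  qed (simp add: T_def)
  have p_inv: "1 / real p < 1" "1 / real p > 0" using p_gt_1 by simp_all
  have wTm: "w (T * m) \<le> 1 / real p" using wT by (simp add: abs_mult TE mE wm)
  have u: "w (1 - T * m) = 1"
  proof (rule abs_eq_1I)
    show "w (1 - T * m - 1) < 1" using wTm p_inv(1) by (simp add: abs_minus mult_mem TE mE)
  qed (intro mem_intros TE mE one_mem)
  then have u0: "1 - T * m \<noteq> 0" by auto
  define x y where "x = T\<^sup>2 * z" and "y = 2 * T * m / (1 - T * m)"
  have xE: "x \<in> E" and yE: "y \<in> E" unfolding x_def y_def by (intro mem_intros TE mE z numeral_mem one_mem)+
  have wx: "w x = w T * w T" by (simp add: x_def abs_mult abs_power power_mem TE z power2_eq_square mult_mem)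
  have wy: "w y = w 2 * w T"
    by (simp add: y_def abs_divide u mult_mem diff_mem TE mE abs_mult wm)
  have w2: "0 \<le> w 2" "w 2 \<le> 1" "p = 2 \<Longrightarrow> w 2 = 1 / 2"
    using abs_of_nat_le_1[of 2] abs_p by auto
  \<comment> \<open>The square of t gives the value at most 1/p^2, enough for either radius.\<close>
  have xr: "w x \<le> log_radius"
  proof -
    have "w x \<le> 1 / real p * (1 / real p)" unfolding wx by (rule mult_mono) (use wT in auto)
    also have "\<dots> \<le> log_radius" using p_gt_1 by (auto simp: log_radius_def field_simps)
    finally show ?thesis .
  qed
  \<comment> \<open>For p = 2 the divisibility of t gives only 1/2; the factor 2 in y supplies the
    other 1/2.\<close>
  have yr: "w y \<le> log_radius"
  proof (cases "p = 2")
    case True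
    have lr: "log_radius = 1 / 4" unfolding log_radius_def using True by (rule if_P)
    show ?thesis unfolding wy lr w2(3)[OF True] using wT True by simp
  next
    case False
    have "w 2 * w T \<le> 1 * (1 / real p)" by (rule mult_mono) (use w2 wT in auto)
    then show ?thesis using False by (simp add: wy log_radius_def)
  qed
  define \<alpha> \<beta> where "\<alpha> = 2 * a - b" and "\<beta> = 3 * b"
  define P Q where "P = (of_int \<alpha> :: complex) * T\<^sup>2" and "Q = (of_int \<beta> :: complex) * (2 * T)"
  define S where "S = max (w P) (w Q)"
  have PE: "P \<in> E" and QE: "Q \<in> E" unfolding P_def Q_def by (intro mem_intros TE of_int_mem numeral_mem)+
  have S: "0 \<le> S" "w P \<le> S" "w Q \<le> S" using PE QE by (auto simp: S_def le_max_iff_disj)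
  have wP: "w (of_int \<alpha>) * w x = w P" and wQ: "w (of_int \<beta>) * w y = w Q"
    by (simp_all add: P_def Q_def wx wy abs_mult abs_power power_mem TE mult_mem power2_eq_square)
  have z6: "z ^ 6 = (1 + x)\<^sup>2"
  proof -
    have "1 + x = z ^ 3" using z(3) by (simp add: x_def T_def)
    then show ?thesis by (simp flip: power_mult)
  qed
  have z1: "z * ((z + T) * (z - T)) = 1" using z(3) by (simp add: T_def algebra_simps power2_eq_square power3_eq_cube)
  have zT: "z - T \<noteq> 0" "(z + T) * (z - T) = m" "z + T \<noteq> 0"
    using z1 inverse_unique[OF z1] by (auto simp only: m_def mult_zero_left mult_zero_right zero_neq_one)
  have "w T < 1" using wT p_inv by linarith
  then have wzT: "w (z + T) = 1"
    by (intro trans[OF abs_eqI z(2)]) (simp_all add: z TE add_mem)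
  \<comment> \<open>This choice of y gives 1 + y = (z + t)/(z - t). Together with (z + t)(z - t) =
    1/z it yields (z + t)^2 = (1 + y)/z.\<close>
  have e1: "1 + y = (1 + T * m) / (1 - T * m)" using u0 by (simp add: y_def field_simps)
  have e2: "(1 + T * m) / (1 - T * m) = (z + T) / (z - T)"
  proof -
    have "(1 + T * m) * (z - T) = (1 - T * m) * (z + T)" using z0 by (simp add: m_def field_simps)
    then show ?thesis using u0 zT by (simp add: field_simps)
  qed
  have "m * (1 + y) = (z + T) * (z - T) * ((z + T) / (z - T))" by (simp only: e1 e2 zT(2))
  also have "\<dots> = (z + T)\<^sup>2" using zT(1) by (simp add: power2_eq_square)
  finally have m2: "m * (1 + y) = (z + T)\<^sup>2" .
  moreover have "m ^ 3 * (1 + x) = 1"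
  proof -
    have "1 + x = z ^ 3" using z(3) by (simp add: x_def T_def)
    then show ?thesis using z0 by (simp add: m_def power_mult_distrib[symmetric])
  qed
  ultimately have zT6: "(z + T) ^ 6 = inverse (1 + x) * (1 + y) ^ 3"
  proof -
    have "(z + T) ^ 6 = ((z + T)\<^sup>2) ^ 3" by (simp flip: power_mult)
    also have "\<dots> = m ^ 3 * (1 + y) ^ 3" by (simp add: m2[symmetric] power_mult_distrib)
    also have "m ^ 3 = inverse (1 + x)" using \<open>m ^ 3 * (1 + x) = 1\<close> by (metis inverse_unique mult.commute)
    finally show ?thesis .
  qed
  have x1: "1 + x \<noteq> 0" using z(3) z0 by (metis T_def power_eq_0_iff x_def add.commute)
  define g where "g = z powi a * (z + T) powi b"
  have gE: "g \<in> E" and wg: "w g = 1"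
    by (simp_all add: g_def abs_mult powi_mem add_mem mult_mem z TE abs_powi wzT)
  have g6: "g ^ 6 = (1 + x) powi \<alpha> * (1 + y) powi \<beta>"
  proof -
    have sw: "(v powi k) ^ 6 = (v ^ 6) powi k" for v :: complex and k
      by (metis mult.commute power_int_mult power_int_of_nat)
    have "g ^ 6 = ((1 + x)\<^sup>2) powi a * (inverse (1 + x) * (1 + y) ^ 3) powi b"
      by (simp only: g_def power_mult_distrib sw z6 zT6)
    also have "((1 + x)\<^sup>2) powi a = (1 + x) powi (2 * a)" by (simp add: power_int_mult)
    also have "(inverse (1 + x) * (1 + y) ^ 3) powi b = inverse ((1 + x) powi b) * (1 + y) powi (3 * b)"
      by (simp add: power_int_mult_distrib power_int_mult power_int_inverse)
    also have "(1 + x) powi (2 * a) * (inverse ((1 + x) powi b) * (1 + y) powi (3 * b)) = (1 + x) powi \<alpha> * (1 + y) powi \<beta>"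
      using x1 by (simp add: \<alpha>_def \<beta>_def power_int_diff divide_inverse)
    finally show ?thesis .
  qed
  define u v where "u = (1 + x) powi \<alpha> - 1" and "v = (1 + y) powi \<beta> - 1"
  have uE: "u \<in> E" and vE: "v \<in> E" unfolding u_def v_def by (intro mem_intros xE yE one_mem)+
  have "w (g ^ 6 - 1 ^ 6) \<le> w (g - 1)" by (rule abs_power_diff_le) (simp_all add: gE wg)
  then have ge: "w (u + v + u * v) \<le> w (g - 1)" by (simp add: g6 u_def v_def algebra_simps)
  have wu: "w u = w P" and wv: "w v = w Q"
    unfolding u_def v_def using abs_one_plus_powi[OF xE xr] abs_one_plus_powi[OF yE yr] wP wQ by simp_all
  \<comment> \<open>The cross term is negligible: one factor is bounded by S and the other by
    1/p.\<close>
  have uv: "w (u * v) \<le> S / real p"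
  proof -
    have "w v \<le> w y" unfolding wv wQ[symmetric] using abs_of_int_le_1[of \<beta>] yE by (intro mult_left_le_one_le) auto
    then have "w v \<le> 1 / real p" using yr log_radius(3) by linarith
    then have "w u * w v \<le> S * (1 / real p)" using S PE vE by (intro mult_mono) (auto simp: wu)
    then show ?thesis by (simp add: abs_mult uE vE)
  qed
  have ud: "w (u - of_int \<alpha> * x) \<le> S / real p"
    using one_plus_powi[OF xE xr, of \<alpha>] divide_right_mono[OF S(2), of "real p"] by (simp add: u_def wP)
  have vd: "w (v - of_int \<beta> * y) \<le> S / real p"
    using one_plus_powi[OF yE yr, of \<beta>] divide_right_mono[OF S(3), of "real p"] by (simp add: v_def wQ)
  have yd: "w (of_int \<beta> * y - Q * m) \<le> S / real p"
  proof -
    have yy: "y - 2 * T * m = y * (T * m)" using u0 by (simp add: y_def field_simps)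
    have "of_int \<beta> * y - Q * m = of_int \<beta> * (y - 2 * T * m)" by (simp add: Q_def algebra_simps)
    also have "\<dots> = of_int \<beta> * y * (T * m)" unfolding yy by (simp only: mult.assoc)
    also have "w \<dots> = w Q * w (T * m)" by (simp add: abs_mult mult_mem yE TE mE wQ[symmetric])
    also have "\<dots> \<le> S * (1 / real p)" by (rule mult_mono) (use S wTm TE mE in \<open>auto simp: mult_mem\<close>)
    finally show ?thesis by simp
  qed
  define e1 e2 e3 where "e1 = u - of_int \<alpha> * x" and "e2 = v - of_int \<beta> * y" and "e3 = of_int \<beta> * y - Q * m"
  have eE: "e1 \<in> E" "e2 \<in> E" "e3 \<in> E" unfolding e1_def e2_def e3_def
    by (intro mem_intros uE vE xE yE QE mE of_int_mem)+
  have "w (e1 + e2 + e3) \<le> S / real p"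
    using ultrametric[OF add_mem[OF eE(1,2)] eE(3)] ultrametric[OF eE(1,2)] ud vd yd
    by (simp add: e1_def[symmetric] e2_def[symmetric] e3_def[symmetric])
  then have "w (u * v + (e1 + e2 + e3)) \<le> S / real p"
    using uv ultrametric[OF mult_mem[OF uE vE] add_mem[OF add_mem[OF eE(1,2)] eE(3)]] by simp
  moreover have "P * z + Q * m = (u + v + u * v) - (u * v + (e1 + e2 + e3))"
    by (simp add: e1_def e2_def e3_def P_def x_def algebra_simps)
  moreover have "w ((u + v + u * v) - (u * v + (e1 + e2 + e3))) \<le> max (w (u + v + u * v)) (w (u * v + (e1 + e2 + e3)))"
    by (intro abs_diff_le mem_intros uE vE eE)
  ultimately have "w (P * z + Q * m) \<le> max (w (g - 1)) (S / real p)" using ge by simp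
  moreover have "P = of_int ((2 * a - b) * t\<^sup>2)" "Q = of_int (6 * b * t)"
    by (simp_all add: P_def Q_def \<alpha>_def \<beta>_def T_def)
  ultimately show ?thesis by (simp only: g_def S_def m_def T_def)
qed

end

section \<open>Comparison of the estimate at two roots\<close>

context cubic_field
begin

text \<open>Three factors of value at most 1 whose product has value 1 must each have value 1. The
  remaining factor l1 + l2 = -l3 is a unit.\<close>

lemma root_differences_abs:
  assumes v: "valued_field F w p" and p: "p \<noteq> 3" "int p dvd t"
  shows "w (l1\<^sup>2 - l2\<^sup>2) = 1"
proof -
  interpret w: valued_field F w p by fact
  have lU: "l1 \<in> UF" "l2 \<in> UF" "l3 \<in> UF"
    using UF_l1 UF_rho[OF UF_l1] UF_rho[OF UF_rho[OF UF_l1]] by (simp_all add: rho_gens rho_roots)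
  have wl: "w x = 1" if "x \<in> UF" for x using that by (intro w.abs_unit) (auto simp: UF_def)
  have lE: "l1 \<in> F" "l2 \<in> F" "l3 \<in> F" by (simp_all add: F_l1 F_l2 F_l3)
  have d: "w (l1 - l2) \<le> 1" "w (l2 - l3) \<le> 1" "w (l1 - l3) \<le> 1"
    using w.abs_diff_le[OF lE(1,2)] w.abs_diff_le[OF lE(2,3)] w.abs_diff_le[OF lE(1,3)] lU by (simp_all add: wl)
  have "\<not> int p dvd 4 * t ^ 6 - 27"
  proof
    assume *: "int p dvd 4 * t ^ 6 - 27"
    have "int p dvd 4 * t ^ 6" using p(2) by (simp add: dvd_power_same dvd_mult dvd_trans[OF _ dvd_power])
    then have "int p dvd 4 * t ^ 6 - (4 * t ^ 6 - 27)" using * by (rule dvd_diff)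
    then have "int p dvd 3 ^ 3" by simp
    then have "p dvd 3 ^ 3" by (metis int_dvd_int_iff of_nat_numeral of_nat_power)
    then have "p dvd 3" using w.prime_p prime_dvd_power by blast
    then have "p = 2" using p(1) w.p_gt_1 dvd_imp_le[of p 3] by auto
    then show False using \<open>p dvd 3\<close> by simp
  qed
  moreover have "\<delta>\<^sup>2 = of_int (4 * t ^ 6 - 27)"
    by (simp add: delta_square of_rat_D of_rat_T flip: power_mult)
  ultimately have "w (\<delta>\<^sup>2) = 1"
    using w.abs_of_int_less_1_iff[of "4 * t ^ 6 - 27"] w.abs_of_int_le_1[of "4 * t ^ 6 - 27"] by simp
  then have "w \<delta> = 1" using F_delta by (simp add: w.abs_power power2_eq_1_iff) (use w.abs_nonneg[OF F_delta] in linarith)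
  then have *: "w (l1 - l2) * w (l2 - l3) * w (l1 - l3) = 1"
    by (simp add: \<delta>_def w.abs_mult lE F_mult F_diff)
  have "w (l1 - l2) * w (l2 - l3) * w (l1 - l3) \<le> w (l1 - l2) * 1 * 1"
    by (intro mult_mono d order_refl) (simp_all add: lE F_diff)
  then have "w (l1 - l2) = 1" using d(1) * by simp
  moreover have "l1\<^sup>2 - l2\<^sup>2 = (l1 - l2) * (- l3)" using root_sum by Groebner_Basis.algebra
  ultimately show ?thesis using lE lU by (simp add: w.abs_mult F_mult F_diff F_minus w.abs_minus wl)
qed

text \<open>After multiplication by the root, the estimate says that P l^2 + Q is small at l1 and
  l2. Subtracting isolates P, because l1^2 - l2^2 has value 1, and then Q is small too. Since t is
  nonzero, it can be cancelled from P and Q.\<close>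

lemma cubic_units_padic_null:
  assumes v: "valued_field F w p" and p: "p \<noteq> 3" "int p dvd t"
    and lim: "(\<lambda>n. w (l1 powi a n * (l1 + of_int t) powi b n - 1)) \<longlonglongrightarrow> 0"
      "(\<lambda>n. w (l2 powi a n * (l2 + of_int t) powi b n - 1)) \<longlonglongrightarrow> 0"
  shows "padic_null p a \<and> padic_null p b"
proof -
  interpret w: valued_field F w p by fact
  have lU: "l1 \<in> UF" "l2 \<in> UF" using UF_l1 UF_rho[OF UF_l1] by (simp_all add: rho_gens)
  have wl: "w l1 = 1" "w l2 = 1" using lU by (auto intro!: w.abs_unit simp: UF_def)
  note lE = UF_D(1)[OF lU(1)] UF_D(1)[OF lU(2)]
  define P Q where "P n = (2 * a n - b n) * t\<^sup>2" and "Q n = 6 * b n * t" for n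
  define e where "e n = max (w (l1 powi a n * (l1 + of_int t) powi b n - 1))
    (w (l2 powi a n * (l2 + of_int t) powi b n - 1))" for n
  have e: "e \<longlonglongrightarrow> 0" unfolding e_def[abs_def] using tendsto_max[OF lim] by simp
  define S where "S n = max (w (of_int (P n))) (w (of_int (Q n)))" for n
  have S: "S n \<le> e n" for n
  proof -
    define B where "B = max (e n) (S n / real p)"
    have b: "w (of_int (P n) * l\<^sup>2 + of_int (Q n)) \<le> B"
      if l: "l \<in> F" "w l = 1" "l ^ 3 = of_rat T * l + 1"
        "w (l powi a n * (l + of_int t) powi b n - 1) \<le> e n" for l
    proof -
      have "of_int (P n) * l\<^sup>2 + of_int (Q n) = l * (of_int (P n) * l + of_int (Q n) * inverse l)"
        using l(2) by (auto simp: field_simps power2_eq_square)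
      also have "w \<dots> = w (of_int (P n) * l + of_int (Q n) * inverse l)"
        using l by (simp add: w.abs_mult F_add F_mult F_inverse)
      also have "\<dots> \<le> max (w (l powi a n * (l + of_int t) powi b n - 1)) (S n / real p)"
        unfolding P_def Q_def S_def by (rule w.cubic_unit_bound) (use l p in \<open>simp_all add: of_rat_T\<close>)
      also have "\<dots> \<le> B" using l(4) by (auto simp: B_def)
      finally show ?thesis .
    qed
    have b1: "w (of_int (P n) * l1\<^sup>2 + of_int (Q n)) \<le> B"
      by (rule b) (simp_all add: lE wl cubic_root e_def)
    have b2: "w (of_int (P n) * l2\<^sup>2 + of_int (Q n)) \<le> B"
      by (rule b) (simp_all add: lE wl cubic_root2 e_def)
    have E: "of_int (P n) * l1\<^sup>2 + of_int (Q n) \<in> F" "of_int (P n) * l2\<^sup>2 + of_int (Q n) \<in> F" "of_int (P n) * l1\<^sup>2 \<in> F"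
      by (simp_all add: F_add F_mult F_power lE)
    have "w (of_int (P n)) = w (of_int (P n) * (l1\<^sup>2 - l2\<^sup>2))"
      by (simp add: w.abs_mult F_diff F_power lE root_differences_abs[OF v p])
    also have "of_int (P n) * (l1\<^sup>2 - l2\<^sup>2) = (of_int (P n) * l1\<^sup>2 + of_int (Q n)) - (of_int (P n) * l2\<^sup>2 + of_int (Q n))"
      by (simp add: algebra_simps)
    also have "w \<dots> \<le> B" using w.abs_diff_le[OF E(1,2)] b1 b2 by simp
    finally have wP: "w (of_int (P n)) \<le> B" .
    have "w (of_int (P n) * l1\<^sup>2) \<le> B" using wP by (simp add: w.abs_mult F_power lE w.abs_power wl)
    then have "w (of_int (Q n)) \<le> B" using w.abs_diff_le[OF E(1,3)] b1 by simp
    then have "S n \<le> B" using wP by (simp add: S_def)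
    \<comment> \<open>The error S/p in the bound involves S itself and is absorbed: S <= S/p is
      possible only for S = 0.\<close>
    moreover have "S n \<le> 0" if "S n \<le> S n / real p"
    proof (rule ccontr)
      assume "\<not> S n \<le> 0"
      then have "S n / real p < S n / 1" using w.p_gt_1 by (intro divide_strict_left_mono) auto
      then show False using that by simp
    qed
    moreover have "e n \<ge> 0"
      unfolding e_def by (rule max.coboundedI1, rule w.abs_nonneg) (intro F.mem_intros lE F.of_int_mem F.one_mem)
    ultimately show ?thesis by (auto simp: B_def max_def split: if_splits)
  qed
  have "(\<lambda>n. w (of_int (P n))) \<longlonglongrightarrow> 0"
    by (rule w.tendsto_0_squeeze[OF _ _ e]) (use S in \<open>auto simp: S_def\<close>)
  then have nP: "padic_null p (\<lambda>n. t\<^sup>2 * (2 * a n - b n))" by (simp add: w.padic_null_iff P_def mult.commute)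
  have "(\<lambda>n. w (of_int (Q n))) \<longlonglongrightarrow> 0"
    by (rule w.tendsto_0_squeeze[OF _ _ e]) (use S in \<open>auto simp: S_def\<close>)
  then have nQ: "padic_null p (\<lambda>n. (6 * t) * b n)" by (simp add: w.padic_null_iff Q_def mult_ac)
  have b: "padic_null p b" by (rule padic_null_cancel[OF nQ]) (use t_ge_2 w.prime_p in auto)
  have "padic_null p (\<lambda>n. 2 * a n - b n)" by (rule padic_null_cancel[OF nP]) (use t_ge_2 w.prime_p in auto)
  then have "padic_null p (\<lambda>n. 2 * a n)" using padic_null_add[OF _ b] by fastforce
  then have "padic_null p a" by (rule padic_null_cancel) (use w.prime_p in auto)
  then show ?thesis using b by simp
qed

end

section \<open>The Leopoldt condition for the two fields\<close>

context cubic_field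
begin

text \<open>Pulling a place of F back along an automorphism and restricting it yields a place of E.
  This provides enough places of K without classifying them.\<close>

lemma place_restrict:
  assumes w: "w \<in> places_above p F" and s: "fhom s" "\<And>x. x \<in> F \<Longrightarrow> s x \<in> F"
    and E: "complex_subfield E" "E \<subseteq> F"
  shows "restrict (\<lambda>x. w (s x)) E \<in> places_above p E"
proof -
  interpret E: complex_subfield E by fact
  have av: "absolute_value F w" and wr: "\<And>x. x \<in> \<rat> \<Longrightarrow> w x = padic_abs p x"
    using w by (auto simp: places_above_def)
  have "absolute_value E (restrict (\<lambda>x. w (s x)) E)"
    unfolding absolute_value_def
  proof (intro conjI ballI)
    fix x assume x: "x \<in> E"
    then have xF: "x \<in> F" using E(2) by blast
    then show "0 \<le> restrict (\<lambda>x. w (s x)) E x" "restrict (\<lambda>x. w (s x)) E x = 0 \<longleftrightarrow> x = 0"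
      using av s x fhomD(7)[OF s(1)] fhom_nz[OF s(1)] by (auto simp: absolute_value_def)
    fix y assume y: "y \<in> E"
    then have yF: "y \<in> F" using E(2) by blast
    show "restrict (\<lambda>x. w (s x)) E (x * y) = restrict (\<lambda>x. w (s x)) E x * restrict (\<lambda>x. w (s x)) E y"
      "restrict (\<lambda>x. w (s x)) E (x + y) \<le> restrict (\<lambda>x. w (s x)) E x + restrict (\<lambda>x. w (s x)) E y"
      using av s(2) x y by (auto simp: absolute_value_def E.mult_mem E.add_mem fhomD(1,2)[OF s(1) xF yF] xF yF)
  qed
  moreover have "restrict (\<lambda>x. w (s x)) E x = padic_abs p x" if x: "x \<in> \<rat>" for x
  proof -
    obtain q where "x = of_rat q" using x by (auto elim: Rats_cases)
    then show ?thesis using wr[OF x] x E.Rats_subset fhomD(3)[OF s(1)] by auto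
  qed
  ultimately show ?thesis by (auto simp: places_above_def)
qed

lemma place_limit:
  assumes w: "w \<in> places_above p F" and s: "fhom s" "\<And>x. x \<in> F \<Longrightarrow> s x \<in> F"
    and E: "complex_subfield E" "E \<subseteq> F" and V: "\<And>n. V n \<in> E"
    and lim: "\<forall>w\<in>places_above p E. (\<lambda>n. w (V n - 1)) \<longlonglongrightarrow> 0"
  shows "(\<lambda>n. w (s (V n) - 1)) \<longlonglongrightarrow> 0"
proof -
  interpret E: complex_subfield E by fact
  have "restrict (\<lambda>x. w (s x)) E (V n - 1) = w (s (V n) - 1)" for n
    using fhomD(5)[OF s(1), of "V n" 1] fhomD(8)[OF s(1)] V[of n] E(2) by (auto simp: E.diff_mem F_1)
  then show ?thesis using lim place_restrict[OF w s E] by fastforce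
qed

lemma relation_prod:
  assumes "\<And>i. i \<in> I \<Longrightarrow> x i powi M = l1 powi A i * (l1 + of_int t) powi B i"
  shows "(\<Prod>i\<in>I. x i powi c i) powi M = l1 powi (\<Sum>i\<in>I. c i * A i) * (l1 + of_int t) powi (\<Sum>i\<in>I. c i * B i)"
proof -
  have "(\<Prod>i\<in>I. x i powi c i) powi M = (\<Prod>i\<in>I. (l1 powi A i * (l1 + of_int t) powi B i) powi c i)"
    by (rule prod_powi_common) (rule assms)
  then show ?thesis
    by (simp add: power_int_mult_distrib prod.distrib mult.commute[of "c _"] power_int_mult
        powi_sum[symmetric] UF_D(2)[OF UF_l1] UF_D(2)[OF UF_l1_t])
qed

lemma relation_prod_rho:
  fixes \<omega> :: complex
  assumes "\<And>i. i \<in> I \<Longrightarrow> x i powi M = \<omega> powi C i" "\<omega> \<noteq> 0"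
  shows "(\<Prod>i\<in>I. x i powi c i) powi M = \<omega> powi (\<Sum>i\<in>I. c i * C i)"
proof -
  have "(\<Prod>i\<in>I. x i powi c i) powi M = (\<Prod>i\<in>I. (\<omega> powi C i) powi c i)"
    by (rule prod_powi_common) (rule assms)
  then show ?thesis by (simp add: mult.commute[of "c _"] power_int_mult powi_sum[symmetric] assms(2))
qed

lemma unit_abs: "valued_field F w p \<Longrightarrow> x \<in> UF \<Longrightarrow> w x = 1"
  by (rule valued_field.abs_unit) (auto simp: UF_def)

lemma unit_limit_mult:
  assumes v: "valued_field F w p" and U: "\<And>n. x n \<in> UF" "\<And>n. y n \<in> UF"
    and lim: "(\<lambda>n. w (x n - 1)) \<longlonglongrightarrow> 0" "(\<lambda>n. w (y n - 1)) \<longlonglongrightarrow> 0"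
  shows "(\<lambda>n. w (x n * y n - 1)) \<longlonglongrightarrow> 0"
proof -
  interpret w: valued_field F w p by fact
  have m: "(\<lambda>n. max (w (x n - 1)) (w (y n - 1))) \<longlonglongrightarrow> 0" using tendsto_max[OF lim] by simp
  show ?thesis
  proof (rule w.tendsto_0_squeeze[OF _ _ m])
    show "0 \<le> w (x n * y n - 1)" for n by (intro w.abs_nonneg F.mem_intros UF_D(1) U F.one_mem)
    show "w (x n * y n - 1) \<le> max (w (x n - 1)) (w (y n - 1))" for n
      by (intro w.abs_mult_diff_1_le UF_D(1) U unit_abs[OF v])
  qed
qed

lemma unit_limit_powi:
  assumes v: "valued_field F w p" and U: "\<And>n. x n \<in> UF" and lim: "(\<lambda>n. w (x n - 1)) \<longlonglongrightarrow> 0"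
  shows "(\<lambda>n. w (x n powi M - 1)) \<longlonglongrightarrow> 0"
proof -
  interpret w: valued_field F w p by fact
  show ?thesis
  proof (rule w.tendsto_0_squeeze[OF _ _ lim])
    show "0 \<le> w (x n powi M - 1)" for n by (intro w.abs_nonneg F.mem_intros UF_D(1) U F.one_mem)
    show "w (x n powi M - 1) \<le> w (x n - 1)" for n
      using w.abs_powi_diff_le[OF UF_D(1)[OF U] F.one_mem unit_abs[OF v U] w.abs_1, of n M] by simp
  qed
qed

text \<open>The M-th power moves the product into the group generated by l1 and l1 + t, with
  exponents linear in c. Applying \<open>\<rho>\<close> gives the same exponents at l2, the second
  root needed by \<open>cubic_units_padic_null\<close>.\<close>

lemma tau_fixed_block:
  assumes v: "valued_field F w p" and p: "p \<noteq> 3" "int p dvd t"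
    and x: "\<And>i. i \<in> I \<Longrightarrow> x i \<in> UF" "\<And>i. i \<in> I \<Longrightarrow> x i powi M = l1 powi A i * (l1 + of_int t) powi B i"
    and lim: "(\<lambda>n. w ((\<Prod>i\<in>I. x i powi c i n) - 1)) \<longlonglongrightarrow> 0"
      "(\<lambda>n. w (\<rho> (\<Prod>i\<in>I. x i powi c i n) - 1)) \<longlonglongrightarrow> 0"
  shows "padic_null p (\<lambda>n. \<Sum>i\<in>I. c i n * A i) \<and> padic_null p (\<lambda>n. \<Sum>i\<in>I. c i n * B i)"
proof (rule cubic_units_padic_null[OF v p])
  define V where "V n = (\<Prod>i\<in>I. x i powi c i n)" for n
  have V: "V n \<in> UF" for n unfolding V_def by (intro UF_prod UF_powi x)
  have VM: "V n powi M = l1 powi (\<Sum>i\<in>I. c i n * A i) * (l1 + of_int t) powi (\<Sum>i\<in>I. c i n * B i)" for n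
    unfolding V_def by (rule relation_prod) (rule x)
  show "(\<lambda>n. w (l1 powi (\<Sum>i\<in>I. c i n * A i) * (l1 + of_int t) powi (\<Sum>i\<in>I. c i n * B i) - 1)) \<longlonglongrightarrow> 0"
    using unit_limit_powi[OF v V, where M = M] lim(1) by (simp add: VM V_def[symmetric])
  have "\<rho> (V n) powi M = l2 powi (\<Sum>i\<in>I. c i n * A i) * (l2 + of_int t) powi (\<Sum>i\<in>I. c i n * B i)" for n
    using arg_cong[OF VM, of \<rho>] fhomD(1)[OF fhom_rho F_l1 F.of_int_mem[of t]]
    by (simp add: fhom_powi[OF fhom_rho] fhomD(2)[OF fhom_rho] fhomD(9)[OF fhom_rho] UF_D(1) V F.powi_mem F_l1 F_add rho_gens)
  then show "(\<lambda>n. w (l2 powi (\<Sum>i\<in>I. c i n * A i) * (l2 + of_int t) powi (\<Sum>i\<in>I. c i n * B i) - 1)) \<longlonglongrightarrow> 0"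
    using unit_limit_powi[OF v UF_rho[OF V], where M = M] lim(2) by (simp add: V_def[symmetric])
qed

text \<open>In rank at most one there is nothing to compare: one place and one non-torsion unit
  \<omega> already determine the exponent. If \<omega> is torsion, all C i vanish.\<close>

lemma rho_fixed_block:
  assumes v: "valued_field F w p" and \<omega>: "\<omega> \<in> UF" "\<omega>\<^sup>2 \<noteq> 1 \<or> (\<forall>i\<in>I. C i = 0)"
    and x: "\<And>i. i \<in> I \<Longrightarrow> x i \<in> UF" "\<And>i. i \<in> I \<Longrightarrow> x i powi M = \<omega> powi C i"
    and lim: "(\<lambda>n. w ((\<Prod>i\<in>I. x i powi c i n) - 1)) \<longlonglongrightarrow> 0"
  shows "padic_null p (\<lambda>n. \<Sum>i\<in>I. c i n * C i)"
proof (cases "\<omega>\<^sup>2 = 1")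
  case True
  then show ?thesis using \<omega>(2) by simp
next
  case False
  interpret w: valued_field F w p by fact
  define V where "V n = (\<Prod>i\<in>I. x i powi c i n)" for n
  have V: "V n \<in> UF" for n unfolding V_def by (intro UF_prod UF_powi x)
  have VM: "V n powi M = \<omega> powi (\<Sum>i\<in>I. c i n * C i)" for n
    unfolding V_def by (rule relation_prod_rho) (use x UF_D(2)[OF \<omega>(1)] in auto)
  show ?thesis
  proof (rule w.non_torsion_padic_null)
    show "\<omega> \<in> F" "algebraic_int \<omega>" by (rule UF_D[OF \<omega>(1)])+
    show "w \<omega> = 1" by (rule unit_abs[OF v \<omega>(1)])
    show "\<omega> ^ m \<noteq> 1" if "m > 0" for m using UF_torsion[OF \<omega>(1), of "int m"] that False by auto
    show "(\<lambda>n. w (\<omega> powi (\<Sum>i\<in>I. c i n * C i) - 1)) \<longlonglongrightarrow> 0"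
      using unit_limit_powi[OF v V, where M = M] lim by (simp add: VM V_def[symmetric])
  qed
qed

lemma leopoldt_field_subfield:
  assumes E: "complex_subfield E" "E \<subseteq> F" and p: "Factorial_Ring.prime p"
  shows "leopoldt_field E p"
proof -
  interpret E: complex_subfield E by fact
  show ?thesis
  proof (intro leopoldt_field.intro leopoldt_field_axioms.intro padic_rationals.intro)
    show "valued_field \<rat> (padic_abs p) p" by (rule valued_field_Rats[OF p])
    show "places_above p E \<noteq> {}" by (rule places_above_nonempty[OF E(1) _ p]) (use E(2) F_algebraic in blast)
    show "x * y \<in> ring_of_integers E" if "x \<in> ring_of_integers E" "y \<in> ring_of_integers E" for x y
      using that E(2) by (auto simp: ring_of_integers_def E.mult_mem intro!: F_integer_mult)
    fix u and k :: int assume u: "u \<in> carrier (unit_group E)" "k \<noteq> 0" "u powi k = 1"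
    then have "u \<in> F" using E(2) by (auto simp: units_of_def Units_def ring_of_integers_def)
    then show "u = 1 \<or> u = -1" using real_root_of_unity[OF F_real u(3,2)] by (simp add: power2_eq_1_iff)
  qed (rule E)
qed

theorem Leo_K:
  assumes p: "Factorial_Ring.prime p" "p \<noteq> 3" "int p dvd t" shows "Leo K p"
proof -
  interpret L: leopoldt_field K p by (rule leopoldt_field_subfield[OF subfield_K K_subset_F p(1)])
  show ?thesis
  proof (rule L.Leo_criterion)
    fix I :: "nat set" and v c
    assume I: "finite I" and v: "\<forall>i\<in>I. v i \<in> carrier (unit_group K)"
      and ind: "\<forall>e :: nat \<Rightarrow> int. (\<Prod>i\<in>I. v i powi e i) = 1 \<longrightarrow> (\<forall>i\<in>I. e i = 0)"
      and lim: "\<forall>w\<in>places_above p K. (\<lambda>n. w ((\<Prod>i\<in>I. v i powi c i n) - 1)) \<longlonglongrightarrow> 0"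
    have vU: "v i \<in> UF" "\<tau> (v i) = v i" "v i \<in> K" if "i \<in> I" for i
      using v that L.U_iff K_iff by (auto simp: UF_def)
    obtain M A B where M: "M \<noteq> 0" "\<And>i. i \<in> I \<Longrightarrow> v i powi M = l1 powi A i * (l1 + of_int t) powi B i"
      using tau_fixed_units_relations[OF I, of v] vU by blast
    obtain w where w: "w \<in> places_above p F" using places_above_nonempty[OF subfield_F F_algebraic p(1)] by blast
    have vf: "valued_field F w p" by (rule places_above_valued_field[OF p(1) subfield_F w])
    have VK: "(\<Prod>i\<in>I. v i powi c i n) \<in> K" for n by (intro K.prod_mem K.powi_mem vU)
    have null: "padic_null p (\<lambda>n. \<Sum>i\<in>I. c i n * A i) \<and> padic_null p (\<lambda>n. \<Sum>i\<in>I. c i n * B i)"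
      by (rule tau_fixed_block[OF vf p(2,3) vU(1) M(2)])
        (use place_limit[OF w fhom_id _ subfield_K K_subset_F VK lim]
          place_limit[OF w fhom_rho rho_mem subfield_K K_subset_F VK lim] in auto)
    \<comment> \<open>The columns are indexed by \<open>bool\<close>, one for the exponents of l1
      and one for those of l1 + t. A vanishing integer combination makes the M-th power of a product
      of the v i trivial, against their independence.\<close>
    show "\<forall>i\<in>I. padic_null p (c i)"
    proof (rule padic_null_independent[where J = UNIV and e = "\<lambda>i k. if k then A i else B i"])
      show "padic_null p (\<lambda>n. \<Sum>i\<in>I. c i n * (if k then A i else B i))" for k using null by (cases k) auto
      fix z assume z: "\<forall>k\<in>UNIV. (\<Sum>i\<in>I. z i * (if k then A i else B i)) = 0"
      have "(\<Prod>i\<in>I. v i powi z i) powi M = l1 powi (\<Sum>i\<in>I. z i * A i) * (l1 + of_int t) powi (\<Sum>i\<in>I. z i * B i)"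
        by (rule relation_prod) (rule M(2))
      then have "(\<Prod>i\<in>I. v i powi (z i * M)) = 1"
        using z[rule_format, of True] z[rule_format, of False] by (simp add: prod_powi_powi)
      then have "\<forall>i\<in>I. z i * M = 0" by (rule ind[THEN spec, THEN mp])
      then show "\<forall>i\<in>I. z i = 0" using M(1) by simp
    qed (use I p in auto)
  qed
qed

text \<open>The elements \<sigma>(x) \<tau>(\<sigma>(x)) for \<sigma> = 1, \<rho>, \<rho>^2, with
  \<tau> moved to the right by \<tau> \<rho> = \<rho>^2 \<tau>.\<close>

definition colA :: "nat \<Rightarrow> complex \<Rightarrow> complex" where
  "colA k x = (if k = 0 then x * \<tau> x else if k = 1 then \<rho> x * \<rho> (\<rho> (\<tau> x)) else \<rho> (\<rho> x) * \<rho> (\<tau> x))"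

definition colB :: "complex \<Rightarrow> complex" where "colB x = x * \<rho> x * \<rho> (\<rho> x)"

lemma col_UF: assumes "x \<in> UF" shows "colA k x \<in> UF" "colB x \<in> UF"
  using assms by (simp_all add: colA_def colB_def UF_mult UF_rho UF_tau)

lemma col_fixed: assumes "x \<in> F" shows "\<tau> (colA k x) = colA k x" "\<rho> (colB x) = colB x"
  using assms
  by (simp_all add: colA_def colB_def fhomD(2)[OF fhom_tau] fhomD(2)[OF fhom_rho] rho_mem tau_mem F_mult
      tau_rho tau_rho_rho tau2 rho3)

lemma col_prod:
  assumes "\<And>i. i \<in> I \<Longrightarrow> x i \<in> F"
  shows "colA k (\<Prod>i\<in>I. x i powi c i) = (\<Prod>i\<in>I. colA k (x i) powi c i)"
    "colB (\<Prod>i\<in>I. x i powi c i) = (\<Prod>i\<in>I. colB (x i) powi c i)"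
proof -
  have r: "\<rho> (\<Prod>i\<in>I. f i powi c i) = (\<Prod>i\<in>I. \<rho> (f i) powi c i)" if "\<forall>i\<in>I. f i \<in> F" for f
    by (rule fhom_prod_powi[OF fhom_rho]) (use that in blast)
  have t: "\<tau> (\<Prod>i\<in>I. x i powi c i) = (\<Prod>i\<in>I. \<tau> (x i) powi c i)"
    by (rule fhom_prod_powi[OF fhom_tau assms])
  show "colA k (\<Prod>i\<in>I. x i powi c i) = (\<Prod>i\<in>I. colA k (x i) powi c i)"
    "colB (\<Prod>i\<in>I. x i powi c i) = (\<Prod>i\<in>I. colB (x i) powi c i)"
    unfolding colA_def colB_def
    by (simp_all add: r t assms rho_mem tau_mem power_int_mult_distrib prod.distrib)
qed

text \<open>The product of the conjugates \<open>x \<tau>(x)\<close>, \<open>x \<rho>\<tau>(x)\<close>, \<open>x \<rho>\<^sup>2\<tau>(x)\<close> of the values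
  \<open>colA k x\<close> with \<open>colB x\<close> is \<open>x\<^sup>3\<close> times the norm of \<open>x\<close>.\<close>

lemma col_torsion:
  assumes x: "x \<in> UF" and A: "\<And>k. k < 3 \<Longrightarrow> (colA k x)\<^sup>2 = 1" and B: "(colB x)\<^sup>2 = 1"
  shows "x ^ 6 = 1"
proof -
  note F = UF_D(1)[OF x]
  define a b c d e f where "a = x" and "b = \<rho> x" and "c = \<rho> (\<rho> x)" and "d = \<tau> x" and "e = \<rho> (\<tau> x)"
    and "f = \<rho> (\<rho> (\<tau> x))"
  have mem: "y \<in> {a, b, c, d, e, f} \<Longrightarrow> y \<in> F" for y
    using F by (auto simp: a_def b_def c_def d_def e_def f_def rho_mem tau_mem)
  have A0: "(a * d)\<^sup>2 = 1" and A1: "(b * f)\<^sup>2 = 1" and A2: "(c * e)\<^sup>2 = 1"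
    using A[of 0] A[of 1] A[of 2] by (simp_all add: colA_def a_def b_def c_def d_def e_def f_def)
  \<comment> \<open>Powers of \<rho> carry the conjugate of x in the second and third element back
    to x itself; \<rho> has order three.\<close>
  have "\<rho> (\<rho> ((b * f)\<^sup>2)) = (a * e)\<^sup>2" "\<rho> ((c * e)\<^sup>2) = (a * f)\<^sup>2"
    by (simp_all add: fhomD[OF fhom_rho] fhomD[OF fhom_rho_rho] mem F_mult F_power rho_mem)
      (simp_all add: a_def b_def c_def d_def e_def f_def rho3 F rho_mem tau_mem)
  then have A12: "(a * e)\<^sup>2 = 1" "(a * f)\<^sup>2 = 1" using A1 A2 fhomD(8)[OF fhom_rho] by simp_all
  have Bs: "(a * b * c)\<^sup>2 = 1" using B by (simp add: colB_def a_def b_def c_def)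
  have N: "(a * b * c * (d * e * f))\<^sup>2 = 1" using unit_norm[OF x] by (simp add: a_def b_def c_def d_def e_def f_def)
  have "a ^ 6 * (a * b * c * (d * e * f))\<^sup>2 = (a * d)\<^sup>2 * (a * e)\<^sup>2 * (a * f)\<^sup>2 * (a * b * c)\<^sup>2"
    by (simp add: power2_eq_square eval_nat_numeral mult_ac)
  then have "a ^ 6 = 1" by (simp only: A0 A12 Bs N mult_1_right)
  then show ?thesis by (simp add: a_def)
qed

theorem Leo_F:
  assumes p: "Factorial_Ring.prime p" "p \<noteq> 3" "int p dvd t" shows "Leo F p"
proof -
  interpret L: leopoldt_field F p by (rule leopoldt_field_subfield[OF subfield_F order_refl p(1)])
  show ?thesis
  proof (rule L.Leo_criterion)
    fix I :: "nat set" and v c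
    assume I: "finite I" and v: "\<forall>i\<in>I. v i \<in> carrier (unit_group F)"
      and ind: "\<forall>e :: nat \<Rightarrow> int. (\<Prod>i\<in>I. v i powi e i) = 1 \<longrightarrow> (\<forall>i\<in>I. e i = 0)"
      and lim: "\<forall>w\<in>places_above p F. (\<lambda>n. w ((\<Prod>i\<in>I. v i powi c i n) - 1)) \<longlonglongrightarrow> 0"
    have vU: "v i \<in> UF" if "i \<in> I" for i using v that L.U_iff by (auto simp: UF_def)
    note vF = UF_D(1)[OF vU]
    have "\<exists>M A B. M \<noteq> 0 \<and> (\<forall>j\<in>{..<3} \<times> I. colA (fst j) (v (snd j)) powi M = l1 powi A j * (l1 + of_int t) powi B j)"
      by (rule tau_fixed_units_relations) (use I vU vF col_UF col_fixed in auto)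
    then obtain M A B where M: "M \<noteq> 0"
      "\<And>k i. k < 3 \<Longrightarrow> i \<in> I \<Longrightarrow> colA k (v i) powi M = l1 powi A (k, i) * (l1 + of_int t) powi B (k, i)"
      by auto
    have "\<exists>M' \<omega> C. M' \<noteq> 0 \<and> \<omega> \<in> UF \<and> (\<omega>\<^sup>2 \<noteq> 1 \<or> (\<forall>i\<in>I. C i = 0)) \<and> (\<forall>i\<in>I. colB (v i) powi M' = \<omega> powi C i)"
      by (rule rho_fixed_units_relations) (use I vU vF col_UF col_fixed in auto)
    then obtain M' \<omega> C where M': "M' \<noteq> 0" "\<omega> \<in> UF" "\<omega>\<^sup>2 \<noteq> 1 \<or> (\<forall>i\<in>I. C i = 0)"
      "\<And>i. i \<in> I \<Longrightarrow> colB (v i) powi M' = \<omega> powi C i" by auto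
    obtain w where w: "w \<in> places_above p F" using places_above_nonempty[OF subfield_F F_algebraic p(1)] by blast
    have vf: "valued_field F w p" by (rule places_above_valued_field[OF p(1) subfield_F w])
    define V where "V n = (\<Prod>i\<in>I. v i powi c i n)" for n
    have VU: "V n \<in> UF" for n unfolding V_def by (intro UF_prod UF_powi vU)
    note VF = UF_D(1)[OF VU]
    have l: "(\<lambda>n. w (s (V n) - 1)) \<longlonglongrightarrow> 0" if "fhom s" "\<And>x. x \<in> F \<Longrightarrow> s x \<in> F" for s
      by (rule place_limit[OF w that subfield_F order_refl VF]) (use lim in \<open>simp_all add: V_def\<close>)
    have L: "(\<lambda>n. w (V n - 1)) \<longlonglongrightarrow> 0" "(\<lambda>n. w (\<rho> (V n) - 1)) \<longlonglongrightarrow> 0"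
      "(\<lambda>n. w (\<rho> (\<rho> (V n)) - 1)) \<longlonglongrightarrow> 0" "(\<lambda>n. w (\<tau> (V n) - 1)) \<longlonglongrightarrow> 0"
      "(\<lambda>n. w (\<rho> (\<tau> (V n)) - 1)) \<longlonglongrightarrow> 0" "(\<lambda>n. w (\<rho> (\<rho> (\<tau> (V n))) - 1)) \<longlonglongrightarrow> 0"
      using l[OF fhom_id] l[OF fhom_rho rho_mem] l[OF fhom_rho_rho] l[OF fhom_tau tau_mem] l[OF fhom_rho_tau]
        l[OF fhom_rho_rho_tau] rho_mem tau_mem by simp_all
    note lm = unit_limit_mult[OF vf]
    note VUs = VU UF_rho[OF VU] UF_rho[OF UF_rho[OF VU]] UF_tau[OF VU] UF_rho[OF UF_tau[OF VU]]
      UF_rho[OF UF_rho[OF UF_tau[OF VU]]]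
    \<comment> \<open>Each of these elements, and its image under \<rho>, is a product of two of the
      six conjugates of V n, which all tend to 1 at w.\<close>
    have LA: "(\<lambda>n. w (colA k (V n) - 1)) \<longlonglongrightarrow> 0" "(\<lambda>n. w (\<rho> (colA k (V n)) - 1)) \<longlonglongrightarrow> 0" for k
      using lm[OF VUs(1,4) L(1,4)] lm[OF VUs(2,6) L(2,6)] lm[OF VUs(3,5) L(3,5)]
        lm[OF VUs(2,5) L(2,5)] lm[OF VUs(3,4) L(3,4)] lm[OF VUs(1,6) L(1,6)]
      by (cases "k = 0"; cases "k = 1"; simp add: colA_def fhomD(2)[OF fhom_rho] rho_mem tau_mem VF rho3)+
    have LB: "(\<lambda>n. w (colB (V n) - 1)) \<longlonglongrightarrow> 0"
      unfolding colB_def by (rule lm[OF UF_mult[OF VUs(1,2)] VUs(3) lm[OF VUs(1,2) L(1,2)] L(3)])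
    have nA: "padic_null p (\<lambda>n. \<Sum>i\<in>I. c i n * A (k, i)) \<and> padic_null p (\<lambda>n. \<Sum>i\<in>I. c i n * B (k, i))"
      if "k < 3" for k
      by (rule tau_fixed_block[OF vf p(2,3) _ M(2)[OF that]])
        (use LA[of k] vU in \<open>simp_all add: col_UF V_def col_prod[OF vF]\<close>)
    have nC: "padic_null p (\<lambda>n. \<Sum>i\<in>I. c i n * C i)"
      by (rule rho_fixed_block[OF vf M'(2,3) _ M'(4)])
        (use LB vU in \<open>simp_all add: col_UF V_def col_prod[OF vF]\<close>)
    \<comment> \<open>Seven columns: the exponents of l1 and of l1 + t for each of the three
      elements of K, and the exponent of \<omega>.\<close>
    define e where "e i k = (if k < 3 then A (k, i) else if k < 6 then B (k - 3, i) else C i)" for i and k :: nat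
    show "\<forall>i\<in>I. padic_null p (c i)"
    proof (rule padic_null_independent[where J = "{..6}" and e = e])
      show "padic_null p (\<lambda>n. \<Sum>i\<in>I. c i n * e i k)" if "k \<in> {..6}" for k
      proof -
        consider "k < 3" | "3 \<le> k" "k < 6" "k - 3 < 3" | "k \<ge> 6" by linarith
        then show ?thesis
        proof cases
          case 1
          then have "e i k = A (k, i)" for i by (simp add: e_def)
          then show ?thesis using nA[OF 1] by simp
        next
          case 2
          then have "e i k = B (k - 3, i)" for i by (simp add: e_def)
          then show ?thesis using nA[OF 2(3)] by simp
        next
          case 3
          then have "e i k = C i" for i by (simp add: e_def)
          then show ?thesis using nC by simp
        qed
      qed
      fix z assume z: "\<forall>k\<in>{..6}. (\<Sum>i\<in>I. z i * e i k) = 0"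
      have zA: "(\<Sum>i\<in>I. z i * A (k, i)) = 0" "(\<Sum>i\<in>I. z i * B (k, i)) = 0" if "k < 3" for k
        using z[rule_format, of k] z[rule_format, of "k + 3"] that by (simp_all add: e_def)
      have zC: "(\<Sum>i\<in>I. z i * C i) = 0" using z[rule_format, of 6] by (simp add: e_def)
      define W where "W = (\<Prod>i\<in>I. v i powi z i)"
      have W: "W \<in> UF" unfolding W_def by (intro UF_prod UF_powi vU)
      \<comment> \<open>The columns detect W only up to torsion: vanishing columns make nonzero
        powers of \<open>colA k W\<close> and \<open>colB W\<close> trivial, so these are 1 or -1,
        and \<open>col_torsion\<close> applies.\<close>
      have "W ^ 6 = 1"
      proof (rule col_torsion[OF W])
        fix k :: nat assume k: "k < 3"
        have "(\<Prod>i\<in>I. colA k (v i) powi z i) powi M =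
            l1 powi (\<Sum>i\<in>I. z i * A (k, i)) * (l1 + of_int t) powi (\<Sum>i\<in>I. z i * B (k, i))"
          by (rule relation_prod) (rule M(2)[OF k])
        then have "colA k W powi M = 1" using zA[OF k] by (simp add: W_def col_prod vF)
        then show "(colA k W)\<^sup>2 = 1" by (rule UF_torsion[OF col_UF(1)[OF W]]) (rule M(1))
      next
        have "(\<Prod>i\<in>I. colB (v i) powi z i) powi M' = \<omega> powi (\<Sum>i\<in>I. z i * C i)"
          by (rule relation_prod_rho) (rule M'(4) UF_D(2)[OF M'(2)]; assumption?)+
        then have "colB W powi M' = 1" using zC by (simp add: W_def col_prod vF)
        then show "(colB W)\<^sup>2 = 1" by (rule UF_torsion[OF col_UF(2)[OF W]]) (rule M'(1))
      qed
      then have "W powi 6 = 1" by simp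
      then have "(\<Prod>i\<in>I. v i powi (z i * 6)) = 1"
        unfolding W_def prod_powi_powi .
      then have "\<forall>i\<in>I. z i * 6 = 0" by (rule ind[THEN spec, THEN mp])
      then show "\<forall>i\<in>I. z i = 0" by simp
    qed (use I p in auto)
  qed
qed

end

theorem theorem6p5:
  fixes t :: int and l :: complex and K F :: "complex set"
  assumes "t \<ge> 2"
    and "poly (cubic t) l = 0"
    and "K = generate_field complex_ring {l}"
    and "F = galois_closure K"
  shows
    "(Factorial_Ring.irreducible (cubic t :: rat poly) \<and> card {x :: real. poly (cubic t) x = 0} = 3) \<and>
     (galois_extension F \<and> totally_real F \<and> galois_group F \<cong> sym_group 3) \<and>
     (generate_ring complex_ring {l} \<subseteq> ring_of_integers K \<and>
      l \<in> Units (subring_of (generate_ring complex_ring {l})) \<and>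
      l + of_int t \<in> Units (subring_of (generate_ring complex_ring {l})) \<and>
      multiplicatively_independent [l, l + of_int t]) \<and>
     (\<forall>p :: nat. Factorial_Ring.prime p \<and> p \<noteq> 3 \<and> int p dvd t \<longrightarrow> Leo K p \<and> Leo F p)"
proof -
  obtain l2 l3 where "cubic_field t l l2 l3" using cubic_field_exists[OF assms(1,2)] .
  then interpret C: cubic_field t l l2 l3 .
  have K: "K = C.K" using assms(3) C.generate_field_l1 by simp
  have F: "F = C.F" using assms(4) C.galois_closure_K by (simp add: K)
  show ?thesis
    unfolding K F
    using irreducible_cubic[OF assms(1)] card_real_roots[OF assms(1)] C.galois_extension_F C.totally_real_F
      C.galois_group_iso C.generate_ring_integers C.units_generate_ring C.multiplicatively_independent_l1
      C.Leo_K C.Leo_F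
    by blast
qed

end
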